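(* Let $m,N$ be positive integers, $\kappa\in\mathbb{C}$, and let $\ell=\kappa-m$. Let $U$ be any $\mathfrak{sl}_m$-module and let $V$ be the $\widehat{\mathfrak{sl}}_m$-module of level $\ell$ parabolically induced from $U$. Let $\mathfrak{q}=t^{-1}\,\mathfrak{sl}_m[t^{-1}]\subset\widehat{\mathfrak{sl}}_m$ and let $\mathcal{A}_N(V)_{\mathfrak{q}}=\mathcal{A}_N(V)/\mathfrak{q}\,\mathcal{A}_N(V)$ be the space of $\mathfrak{q}$-coinvariants, with its commuting actions of $\mathfrak{sl}_m$ and of the trigonometric Cherednik algebra $\mathfrak{C}_N$ with parameter $\kappa$. Then the bimodule $\mathcal{A}_N(V)_{\mathfrak{q}}$ of $\mathfrak{sl}_m$ and $\mathfrak{C}_N$ is equivalent (isomorphic) to $$\operatorname{Ind}_{\mathfrak{H}_N}^{\mathfrak{C}_N}\mathcal{F}_N(U)\,.$$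
   Context: All algebras and vector spaces are over $\mathbb{C}$. $\mathfrak{S}_N$ is the symmetric group and $\sigma_{pq}$ denotes the transposition of $p$ and $q$. $E_{ab}$ are the standard matrix units, $I=E_{11}+\ldots+E_{mm}$, and $E_{ab}^{(p)}$ is the operator on $(\mathbb{C}^m)^{\otimes N}$ acting as $E_{ab}$ in the $p$-th tensor factor and as the identity in the others. Degenerate affine Hecke algebra: $\mathfrak{H}_N$ is generated by $\mathbb{C}\mathfrak{S}_N$ and elements $z_1,\ldots,z_N$ with the relations $\sigma z_p\sigma^{-1}=z_{\sigma(p)}$ for $\sigma\in\mathfrak{S}_N$ and $[z_p,z_q]=\sigma_{pq}(z_p-z_q)$ for $p\neq q$. Trigonometric Cherednik algebra: $\mathfrak{C}_N$ (depending on $\kappa$) is generated by $\mathfrak{H}_N$ and the Laurent polynomial ring $\mathbb{C}[x_1,x_1^{-1},\ldots,x_N,x_N^{-1}]$ subject to $\sigma x_p\sigma^{-1}=x_{\sigma(p)}$ for $\sigma\in\mathfrak{S}_N$, $[z_p,x_q]=-x_p\sigma_{pq}$ for $q\neq p$, and $[z_p,x_p]=\kappa x_p+\sum_{r\neq p}x_p\sigma_{pr}$. The algebra $\mathfrak{H}_N$ is a subalgebra of $\mathfrak{C}_N$, and multiplication gives a linear bijection $\mathbb{C}[x_1^{\pm1},\ldots,x_N^{\pm1}]\otimes\mathfrak{H}_N\to\mathfrak{C}_N$. $\operatorname{Ind}_{\mathfrak{H}_N}^{\mathfrak{C}_N}$ is the functor $\mathfrak{C}_N\otimes_{\mathfrak{H}_N}(-)$;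 it takes bimodules over $\mathfrak{sl}_m$ and $\mathfrak{H}_N$ to bimodules over $\mathfrak{sl}_m$ and $\mathfrak{C}_N$. Functor $\mathcal{F}_N$: for an $\mathfrak{sl}_m$-module $U$, $\mathcal{F}_N(U)=(\mathbb{C}^m)^{\otimes N}\otimes U$ with the diagonal action of $\mathfrak{sl}_m$, and with the commuting action of $\mathfrak{H}_N$ where $\mathfrak{S}_N$ permutes the $N$ tensor factors $\mathbb{C}^m$ and $z_p$ acts as $\sum_{a,b=1}^m E_{ab}^{(p)}\otimes E_{ba}-\frac1m\,\mathrm{id}^{\otimes N}\otimes I$. This uses only the $\mathfrak{sl}_m$-module structure: it means $\sum_{a,b}E_{ab}^{(p)}\otimes(E_{ba}-\frac1m\delta_{ab}I)$. Affine Lie algebra: $\widehat{\mathfrak{sl}}_m$ is spanned by $\mathfrak{sl}_m[t,t^{-1}]$ and a central element $C$, with $[P\,t^{\,i},Q\,t^{\,j}]=[P,Q]\,t^{\,i+j}+i\,\delta_{i,-j}\operatorname{tr}(PQ)\,C$ for $P,Q\in\mathfrak{sl}_m$. A module has level $\ell$ if $C$ acts as the scalar $\ell$. Let $\mathfrak{p}$ be the subalgebra spanned by $\mathfrak{sl}_m[t]$ and $C$, so $\widehat{\mathfrak{sl}}_m=\mathfrak{p}\oplus\mathfrak{q}$. The level $\ell$ module $V$ parabolically induced from $U$ is obtained by extending the action on $U$ from $\mathfrak{sl}_m$ to $\mathfrak{p}$, letting $t\,\mathfrak{sl}_m[t]$ act as zero and $C$ act as $\ell$, and then inducing from $\mathfrak{p}$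 to $\widehat{\mathfrak{sl}}_m$. For every vector of $V$ there is $i$ such that $t^{\,i}\mathfrak{sl}_m[t]$ annihilates the vector. Functor $\mathcal{A}_N$: for an $\widehat{\mathfrak{sl}}_m$-module $V$ with the latter annihilation property, $\mathcal{A}_N(V)=W=\mathbb{C}[x_1^{\pm1},\ldots,x_N^{\pm1}]\otimes(\mathbb{C}^m)^{\otimes N}\otimes V$. The algebra $\widehat{\mathfrak{sl}}_m$ acts on $W$ by letting $P\,t^{\,j}$ act as $\sum_{q=1}^N x_q^{\,j}\otimes P^{(q)}\otimes\mathrm{id}+\mathrm{id}\otimes\mathrm{id}^{\otimes N}\otimes P\,t^{\,j}$ (with $P^{(q)}$ being $P$ acting in the $q$-th factor $\mathbb{C}^m$) and $C$ act as on $V$. The algebra $\mathfrak{C}_N$ acts on $W$ as follows: $x_p^{\pm1}$ act by multiplication; $\mathfrak{S}_N$ acts by simultaneous permutations of the variables and of the $N$ tensor factors $\mathbb{C}^m$; $z_p$ acts as $$\kappa\,x_p\,\partial_p\otimes\mathrm{id}^{\otimes N}\otimes\mathrm{id}+\sum_{r\neq p}\frac{x_p}{x_p-x_r}(1-\sigma_{pr})\otimes\sigma_{pr}\otimes\mathrm{id}+\sum_{i=0}^\infty x_p^{-i}\otimes\sum_{a,b=1}^m E_{ab}^{(p)}\otimes\bigl(E_{ba}-\tfrac1m\delta_{ab}I\bigr)t^{\,i},$$ where $\partial_p=\partial/\partial x_p$, the left $\sigma_{pr}$ permutes variables and the right $\sigma_{pr}$ permutes tensor factors $\mathbb{C}^m$.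 This action of $\mathfrak{C}_N$ commutes with the action of $\mathfrak{sl}_m\subset\widehat{\mathfrak{sl}}_m$, and when $V$ has level $\kappa-m$ it preserves $\mathfrak{q}W$ (the span of all $Pw$, $P\in\mathfrak{q}$, $w\in W$). The adjoint action of $\mathfrak{sl}_m$ preserves $\mathfrak{q}$, so both $\mathfrak{sl}_m$ and $\mathfrak{C}_N$ act on $W/\mathfrak{q}W$. *)

theory Defs
  imports
    "HOL-Analysis.Analysis"
    "HOL-Library.Poly_Mapping"
    "HOL-Library.Set_Algebras"
    "HOL-Combinatorics.Perm"
begin

unbundle permutation_syntax

section \<open>Free vector spaces, tensor products, quotients\<close>

text \<open>
  A complex vector space is a type of class \<^class>\<open>ab_group_add\<close> with a scaling satisfying
  \<^locale>\<open>vector_space\<close>. The type \<open>'b \<Rightarrow>\<^sub>0 complex\<close> is the space with basis \<open>'b\<close>. If \<open>V\<close> is a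
  vector space with scaling \<open>sc\<close>, then \<open>'b \<Rightarrow>\<^sub>0 'v\<close> with scaling \<open>fscale sc\<close> is the tensor
  product of the space with basis \<open>'b\<close> and \<open>V\<close>: the pure tensor of the basis vector \<open>b\<close> and
  \<open>v\<close> is \<open>Poly_Mapping.single b v\<close>.
\<close>

definition fscale :: "(complex \<Rightarrow> 'v \<Rightarrow> 'v::ab_group_add) \<Rightarrow> complex \<Rightarrow> ('b \<Rightarrow>\<^sub>0 'v) \<Rightarrow> ('b \<Rightarrow>\<^sub>0 'v)"
  where "fscale sc c = Poly_Mapping.map (sc c)"

abbreviation pscale :: "complex \<Rightarrow> ('b \<Rightarrow>\<^sub>0 complex) \<Rightarrow> ('b \<Rightarrow>\<^sub>0 complex)"
  where "pscale \<equiv> fscale (*)"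

abbreviation basis_vec :: "'b \<Rightarrow> ('b \<Rightarrow>\<^sub>0 complex)"
  where "basis_vec b \<equiv> Poly_Mapping.single b 1"

definition lin_ext ::
    "(complex \<Rightarrow> 'v \<Rightarrow> 'v) \<Rightarrow> ('b \<Rightarrow> 'v) \<Rightarrow> ('b \<Rightarrow>\<^sub>0 complex) \<Rightarrow> 'v::ab_group_add"
  where "lin_ext sc h f = (\<Sum>b\<in>Poly_Mapping.keys f. sc (Poly_Mapping.lookup f b) (h b))"

definition pure_tensor ::
    "(complex \<Rightarrow> 'v \<Rightarrow> 'v) \<Rightarrow> ('b \<Rightarrow>\<^sub>0 complex) \<Rightarrow> 'v \<Rightarrow> ('b \<Rightarrow>\<^sub>0 'v::ab_group_add)"
  where "pure_tensor sc y v = lin_ext (fscale sc) (\<lambda>b. Poly_Mapping.single b v) y"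

text \<open>The operator \<open>A \<otimes> D\<close>, where \<open>sc\<close> is the scaling of the second tensor factor:\<close>

definition tensor_op ::
    "(complex \<Rightarrow> 'v \<Rightarrow> 'v) \<Rightarrow> (('b \<Rightarrow>\<^sub>0 complex) \<Rightarrow> ('b \<Rightarrow>\<^sub>0 complex)) \<Rightarrow> ('v \<Rightarrow> 'v)
      \<Rightarrow> ('b \<Rightarrow>\<^sub>0 'v) \<Rightarrow> ('b \<Rightarrow>\<^sub>0 'v::ab_group_add)"
  where "tensor_op sc A D w =
    (\<Sum>b\<in>Poly_Mapping.keys w. pure_tensor sc (A (basis_vec b)) (D (Poly_Mapping.lookup w b)))"

text \<open>
  Let \<open>S\<close>, \<open>T\<close> be subspaces of \<open>X\<close>, \<open>Y\<close>. The elements of \<open>X/S\<close> are the cosets \<open>x +o S\<close>.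
  In \<open>quotient_iso sX S sY T ops\<close> there is a linear bijection \<open>\<phi>\<close> from \<open>X/S\<close> to \<open>Y/T\<close>
  such that for every pair \<open>(A, B)\<close> in \<open>ops\<close> the operators induced by \<open>A\<close> on \<open>X/S\<close> and by
  \<open>B\<close> on \<open>Y/T\<close> correspond to each other. The implication in \<open>intertwines\<close> ranges over all
  representatives, so that it also forces \<open>A\<close> and \<open>B\<close> to be well defined on the quotients.
\<close>

definition intertwines ::
    "('x::ab_group_add set \<Rightarrow> 'y::ab_group_add set) \<Rightarrow> 'x set \<Rightarrow> ('x \<Rightarrow> 'x) \<Rightarrow> 'y set \<Rightarrow> ('y \<Rightarrow> 'y) \<Rightarrow> bool"
  where "intertwines \<phi> S A T B \<longleftrightarrow>
    (\<forall>x y. \<phi> (x +o S) = y +o T \<longrightarrow> \<phi> (A x +o S) = B y +o T)"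

definition quotient_iso ::
    "(complex \<Rightarrow> 'x \<Rightarrow> 'x) \<Rightarrow> 'x set \<Rightarrow> (complex \<Rightarrow> 'y \<Rightarrow> 'y) \<Rightarrow> 'y set \<Rightarrow>
     (('x::ab_group_add \<Rightarrow> 'x) \<times> ('y::ab_group_add \<Rightarrow> 'y)) set \<Rightarrow> bool"
  where "quotient_iso sX S sY T ops \<longleftrightarrow>
    (\<exists>\<phi>. bij_betw \<phi> (range (\<lambda>x. x +o S)) (range (\<lambda>y. y +o T)) \<and>
      (\<forall>x x' y y'. \<phi> (x +o S) = y +o T \<longrightarrow> \<phi> (x' +o S) = y' +o T \<longrightarrow>
         \<phi> ((x + x') +o S) = (y + y') +o T) \<and>
      (\<forall>c. intertwines \<phi> S (sX c) T (sY c)) \<and>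
      (\<forall>(A, B)\<in>ops. intertwines \<phi> S A T B))"


section \<open>Algebras given by generators and relations, induced modules\<close>

datatype 'g word = Word (letters: "'g list")

instantiation word :: (type) monoid_add
begin

definition zero_word :: "'a word" where "0 = Word []"

definition plus_word :: "'a word \<Rightarrow> 'a word \<Rightarrow> 'a word"
  where "v + w = Word (letters v @ letters w)"

instance
  by standard (simp_all add: zero_word_def plus_word_def)

end

text \<open>
  The free associative unital algebra on \<open>'g\<close>: the monoid algebra of the free monoid, with the
  convolution product of \<^theory>\<open>HOL-Library.Poly_Mapping\<close>.
\<close>

type_synonym 'g free_alg = "'g word \<Rightarrow>\<^sub>0 complex"

abbreviation gen :: "'g \<Rightarrow> 'g free_alg"
  where "gen g \<equiv> basis_vec (Word [g])"

definition two_sided_ideal :: "'g free_alg set \<Rightarrow> 'g free_alg set"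
  where "two_sided_ideal R = module.span pscale {a * r * b |a r b. r \<in> R}"

text \<open>The action of the free algebra that extends given operators \<open>act g\<close>:\<close>

definition free_alg_act ::
    "(complex \<Rightarrow> 'u \<Rightarrow> 'u) \<Rightarrow> ('g \<Rightarrow> 'u \<Rightarrow> 'u) \<Rightarrow> 'g free_alg \<Rightarrow> 'u \<Rightarrow> 'u::ab_group_add"
  where "free_alg_act sU act a u = lin_ext sU (\<lambda>w. foldr act (letters w) u) a"

text \<open>
  Let \<open>A\<close> be the free algebra modulo the ideal \<open>I\<close>, and let \<open>B \<rightarrow> A\<close> be a homomorphism of
  algebras where \<open>B\<close> is generated by the letters in \<open>G\<close>. Let \<open>U\<close> be a \<open>B\<close>-module on which these
  letters act by \<open>act\<close>. Then \<open>A \<otimes>\<^sub>B U\<close> is the free vector space on the pairs \<open>(a, u)\<close>, where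
  \<open>a\<close> represents an element of \<open>A\<close>, modulo the following subspace. The elements of \<open>B\<close> are
  represented by the elements \<open>b\<close> of the free algebra that only involve letters from \<open>G\<close>;
  the relations of \<open>B\<close> do not enter, because they hold in \<open>A\<close> and on \<open>U\<close>.
\<close>

definition induced_rels ::
    "'g free_alg set \<Rightarrow> 'g set \<Rightarrow> (complex \<Rightarrow> 'u \<Rightarrow> 'u) \<Rightarrow> ('g \<Rightarrow> 'u \<Rightarrow> 'u) \<Rightarrow>
     ('g free_alg \<times> 'u::ab_group_add \<Rightarrow>\<^sub>0 complex) set"
  where "induced_rels I G sU act = module.span pscale
    ({basis_vec (a, u) - basis_vec (a', u) |a a' u. a - a' \<in> I} \<union>
     {basis_vec (a + a', u) - basis_vec (a, u) - basis_vec (a', u) |a a' u. True} \<union>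
     {basis_vec (a, u + u') - basis_vec (a, u) - basis_vec (a, u') |a u u'. True} \<union>
     {basis_vec (pscale c a, u) - pscale c (basis_vec (a, u)) |c a u. True} \<union>
     {basis_vec (a, sU c u) - pscale c (basis_vec (a, u)) |c a u. True} \<union>
     {basis_vec (a * b, u) - basis_vec (a, free_alg_act sU act b u) |a b u.
        \<forall>w\<in>Poly_Mapping.keys b. set (letters w) \<subseteq> G})"

definition induced_left ::
    "'g free_alg \<Rightarrow> ('g free_alg \<times> 'u \<Rightarrow>\<^sub>0 complex) \<Rightarrow> ('g free_alg \<times> 'u \<Rightarrow>\<^sub>0 complex)"
  where "induced_left a = lin_ext pscale (\<lambda>(a', u). basis_vec (a * a', u))"

definition induced_right ::
    "('u \<Rightarrow> 'u) \<Rightarrow> ('g free_alg \<times> 'u \<Rightarrow>\<^sub>0 complex) \<Rightarrow> ('g free_alg \<times> 'u \<Rightarrow>\<^sub>0 complex)"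
  where "induced_right f = lin_ext pscale (\<lambda>(a', u). basis_vec (a', f u))"


section \<open>The Lie algebra of traceless matrices and its affine version\<close>

typedef (overloaded) 'm sl = "{P :: complex^'m::finite^'m. trace P = 0}"
  morphisms mat_of_sl Abs_sl
  by (rule exI[of _ 0]) (simp add: trace_def)

setup_lifting type_definition_sl

instantiation sl :: (finite) ab_group_add
begin

lift_definition zero_sl :: "'a sl" is 0 by (simp add: trace_def)
lift_definition plus_sl :: "'a sl \<Rightarrow> 'a sl \<Rightarrow> 'a sl" is "(+)" by (simp add: trace_add)
lift_definition uminus_sl :: "'a sl \<Rightarrow> 'a sl" is uminus by (simp add: trace_def sum_negf)
lift_definition minus_sl :: "'a sl \<Rightarrow> 'a sl \<Rightarrow> 'a sl" is "(-)" by (simp add: trace_sub)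

instance by (standard; transfer; simp)

end

lift_definition sl_scale :: "complex \<Rightarrow> 'm::finite sl \<Rightarrow> 'm sl"
  is "\<lambda>c P. \<chi> i j. c * P $ i $ j"
  by (simp add: trace_def flip: sum_distrib_left)

lift_definition sl_bracket :: "'m::finite sl \<Rightarrow> 'm sl \<Rightarrow> 'm sl"
  is "\<lambda>P Q. P ** Q - Q ** P"
  unfolding trace_sub by (metis right_minus_eq trace_mul_sym)

lift_definition sl_trace_form :: "'m::finite sl \<Rightarrow> 'm sl \<Rightarrow> complex"
  is "\<lambda>P Q. trace (P ** Q)" .

definition matrix_unit :: "'m \<Rightarrow> 'm \<Rightarrow> complex^'m::finite^'m"
  where "matrix_unit a b = (\<chi> i j. if i = a \<and> j = b then 1 else 0)"

lemma trace_matrix_unit: "trace (matrix_unit a b) = (if a = b then 1 else 0)"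
  by (auto simp: trace_def matrix_unit_def intro!: sum.neutral)

text \<open>\<open>E\<^sub>a\<^sub>b - \<delta>\<^sub>a\<^sub>b I / m\<close>\<close>

lift_definition sl_unit :: "'m \<Rightarrow> 'm \<Rightarrow> 'm::finite sl"
  is "\<lambda>a b. matrix_unit a b - (if a = b then mat (1 / of_nat CARD('m)) else 0)"
  by (simp add: trace_sub trace_matrix_unit) (simp add: trace_def mat_def)

text \<open>The pair \<open>(f, c)\<close> is the element \<open>\<Sum>\<^sub>i f\<^sub>i t\<^sup>i + c C\<close>.\<close>

type_synonym 'm aff = "(int \<Rightarrow>\<^sub>0 'm sl) \<times> complex"

definition aff_scale :: "complex \<Rightarrow> 'm::finite aff \<Rightarrow> 'm aff"
  where "aff_scale c = (\<lambda>(f, d). (fscale sl_scale c f, c * d))"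

definition aff_bracket :: "'m::finite aff \<Rightarrow> 'm aff \<Rightarrow> 'm aff"
  where "aff_bracket = (\<lambda>(f, c) (g, d).
    (\<Sum>i\<in>Poly_Mapping.keys f. \<Sum>j\<in>Poly_Mapping.keys g.
       Poly_Mapping.single (i + j)
         (sl_bracket (Poly_Mapping.lookup f i) (Poly_Mapping.lookup g j)),
     \<Sum>i\<in>Poly_Mapping.keys f. of_int i *
       sl_trace_form (Poly_Mapping.lookup f i) (Poly_Mapping.lookup g (- i))))"

definition loop :: "'m::finite sl \<Rightarrow> int \<Rightarrow> 'm aff"
  where "loop P i = (Poly_Mapping.single i P, 0)"

definition aff_p :: "'m::finite aff set"
  where "aff_p = {(f, c). \<forall>i<0. Poly_Mapping.lookup f i = 0}"

definition aff_q :: "'m::finite aff set"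
  where "aff_q = {(f, c). c = 0 \<and> (\<forall>i\<ge>0. Poly_Mapping.lookup f i = 0)}"

definition lie_module ::
    "(complex \<Rightarrow> 'l \<Rightarrow> 'l) \<Rightarrow> ('l \<Rightarrow> 'l \<Rightarrow> 'l) \<Rightarrow> (complex \<Rightarrow> 'v \<Rightarrow> 'v) \<Rightarrow>
     ('l::ab_group_add \<Rightarrow> 'v \<Rightarrow> 'v::ab_group_add) \<Rightarrow> bool"
  where "lie_module sL br sV \<rho> \<longleftrightarrow>
    (\<forall>P. Vector_Spaces.linear sV sV (\<rho> P)) \<and>
    (\<forall>v. Vector_Spaces.linear sL sV (\<lambda>P. \<rho> P v)) \<and>
    (\<forall>P Q v. \<rho> (br P Q) v = \<rho> P (\<rho> Q v) - \<rho> Q (\<rho> P v))"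

text \<open>
  The universal enveloping algebra of the affine Lie algebra is the free algebra on the elements
  of the Lie algebra modulo these relations.
\<close>

definition enveloping_rels :: "'m::finite aff free_alg set"
  where "enveloping_rels =
    {gen (\<xi> + \<eta>) - gen \<xi> - gen \<eta> |\<xi> \<eta>. True} \<union>
    {gen (aff_scale c \<xi>) - pscale c (gen \<xi>) |c \<xi>. True} \<union>
    {gen \<xi> * gen \<eta> - gen \<eta> * gen \<xi> - gen (aff_bracket \<xi> \<eta>) |\<xi> \<eta>. True}"

text \<open>The action of \<open>aff_p\<close> on \<open>U\<close>; it is only used on \<open>aff_p\<close>.\<close>

definition parabolic_act ::
    "(complex \<Rightarrow> 'u \<Rightarrow> 'u) \<Rightarrow> ('m::finite sl \<Rightarrow> 'u \<Rightarrow> 'u) \<Rightarrow> complex \<Rightarrow> 'm aff \<Rightarrow> 'u \<Rightarrow> 'u::ab_group_add"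
  where "parabolic_act sU \<rho>U l = (\<lambda>(f, c) u. \<rho>U (Poly_Mapping.lookup f 0) u + sU (l * c) u)"

text \<open>
  The module \<open>V\<close> over the affine Lie algebra is (a model of) the level \<open>l\<close> module parabolically
  induced from \<open>U\<close>. In the quotient isomorphism, \<open>V\<close> is regarded as \<open>V/0\<close>.
\<close>

definition parabolically_induced ::
    "(complex \<Rightarrow> 'u \<Rightarrow> 'u) \<Rightarrow> ('m::finite sl \<Rightarrow> 'u \<Rightarrow> 'u::ab_group_add) \<Rightarrow> complex \<Rightarrow>
     (complex \<Rightarrow> 'v \<Rightarrow> 'v) \<Rightarrow> ('m aff \<Rightarrow> 'v \<Rightarrow> 'v::ab_group_add) \<Rightarrow> bool"
  where "parabolically_induced sU \<rho>U l sV \<rho>V \<longleftrightarrow>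
    lie_module aff_scale aff_bracket sV \<rho>V \<and>
    quotient_iso sV {0} pscale
      (induced_rels (two_sided_ideal enveloping_rels) aff_p sU (parabolic_act sU \<rho>U l))
      {(\<rho>V \<xi>, induced_left (gen \<xi>)) |\<xi>. True}"


section \<open>The degenerate affine Hecke algebra and the trigonometric Cherednik algebra\<close>

text \<open>The index type \<open>'n\<close> is finite, so that \<open>'n perm\<close> is the full symmetric group.\<close>

datatype 'n cher_gen = Sym "'n perm" | Z 'n | X 'n | Xinv 'n

definition hecke_gens :: "'n cher_gen set"
  where "hecke_gens = range Sym \<union> range Z"

definition hecke_rels :: "'n::finite cher_gen free_alg set"
  where "hecke_rels =
    {gen (Sym 1) - 1} \<union>
    {gen (Sym (\<sigma> * \<tau>)) - gen (Sym \<sigma>) * gen (Sym \<tau>) |\<sigma> \<tau>. True} \<union>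
    {gen (Sym \<sigma>) * gen (Z p) * gen (Sym (inverse \<sigma>)) - gen (Z (\<sigma> \<langle>$\<rangle> p)) |\<sigma> p. True} \<union>
    {gen (Z p) * gen (Z q) - gen (Z q) * gen (Z p)
       - gen (Sym \<langle>p \<leftrightarrow> q\<rangle>) * (gen (Z p) - gen (Z q)) |p q. p \<noteq> q}"

definition laurent_rels :: "'n::finite cher_gen free_alg set"
  where "laurent_rels =
    {gen (X p) * gen (Xinv p) - 1 |p. True} \<union>
    {gen (Xinv p) * gen (X p) - 1 |p. True} \<union>
    {gen (X p) * gen (X q) - gen (X q) * gen (X p) |p q. True}"

definition cherednik_rels :: "complex \<Rightarrow> 'n::finite cher_gen free_alg set"
  where "cherednik_rels \<kappa> = hecke_rels \<union> laurent_rels \<union>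
    {gen (Sym \<sigma>) * gen (X p) * gen (Sym (inverse \<sigma>)) - gen (X (\<sigma> \<langle>$\<rangle> p)) |\<sigma> p. True} \<union>
    {gen (Z p) * gen (X q) - gen (X q) * gen (Z p)
       + gen (X p) * gen (Sym \<langle>p \<leftrightarrow> q\<rangle>) |p q. q \<noteq> p} \<union>
    {gen (Z p) * gen (X p) - gen (X p) * gen (Z p)
       - pscale \<kappa> (gen (X p))
       - (\<Sum>r\<in>UNIV - {p}. gen (X p) * gen (Sym \<langle>p \<leftrightarrow> r\<rangle>)) |p. True}"


section \<open>The functor \<open>\<F>\<^sub>N\<close>\<close>

text \<open>
  The basis vector of \<open>(\<complex>\<^sup>m)\<^sup>\<otimes>\<^sup>N\<close> indexed by \<open>e\<close> has the \<open>e q\<close>-th standard basis vector of \<open>\<complex>\<^sup>m\<close> in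
  the tensor factor \<open>q\<close>.
\<close>

type_synonym ('n, 'm) tpow = "('n \<Rightarrow> 'm) \<Rightarrow>\<^sub>0 complex"
type_synonym ('n, 'm, 'u) FN = "('n \<Rightarrow> 'm) \<Rightarrow>\<^sub>0 'u"

definition site_op :: "complex^'m::finite^'m \<Rightarrow> 'n \<Rightarrow> ('n, 'm) tpow \<Rightarrow> ('n, 'm) tpow"
  where "site_op P q = lin_ext pscale (\<lambda>e.
    \<Sum>a\<in>UNIV. pscale (P $ a $ e q) (basis_vec (e(q := a))))"

text \<open>A permutation \<open>\<sigma>\<close> moves the tensor factor \<open>q\<close> to the position \<open>\<sigma> q\<close>.\<close>

definition perm_tpow :: "'n perm \<Rightarrow> ('n, 'm) tpow \<Rightarrow> ('n, 'm) tpow"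
  where "perm_tpow \<sigma> = lin_ext pscale (\<lambda>e. basis_vec (\<lambda>q. e (inverse \<sigma> \<langle>$\<rangle> q)))"

definition FN_sl ::
    "(complex \<Rightarrow> 'u \<Rightarrow> 'u) \<Rightarrow> ('m::finite sl \<Rightarrow> 'u \<Rightarrow> 'u) \<Rightarrow> 'm sl
      \<Rightarrow> ('n::finite, 'm, 'u::ab_group_add) FN \<Rightarrow> ('n, 'm, 'u) FN"
  where "FN_sl sU \<rho>U P w =
    (\<Sum>q\<in>UNIV. tensor_op sU (site_op (mat_of_sl P) q) id w) + tensor_op sU id (\<rho>U P) w"

text \<open>The remaining letters \<open>X\<close> and \<open>Xinv\<close> are not in \<^const>\<open>hecke_gens\<close>.\<close>

fun FN_hecke ::
    "(complex \<Rightarrow> 'u \<Rightarrow> 'u) \<Rightarrow> ('m::finite sl \<Rightarrow> 'u \<Rightarrow> 'u) \<Rightarrow> 'n cher_gen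
      \<Rightarrow> ('n::finite, 'm, 'u::ab_group_add) FN \<Rightarrow> ('n, 'm, 'u) FN"
  where
    "FN_hecke sU \<rho>U (Sym \<sigma>) w = tensor_op sU (perm_tpow \<sigma>) id w"
  | "FN_hecke sU \<rho>U (Z p) w =
      (\<Sum>a\<in>UNIV. \<Sum>b\<in>UNIV. tensor_op sU (site_op (matrix_unit a b) p) (\<rho>U (sl_unit b a)) w)"
  | "FN_hecke sU \<rho>U _ w = undefined"


section \<open>The functor \<open>\<A>\<^sub>N\<close>\<close>

text \<open>Laurent polynomials form the group algebra of \<open>\<int>\<^sup>N\<close>.\<close>

type_synonym 'n laurent = "(int^'n) \<Rightarrow>\<^sub>0 complex"
type_synonym ('n, 'm, 'v) AN = "(int^'n) \<Rightarrow>\<^sub>0 (('n \<Rightarrow> 'm) \<Rightarrow>\<^sub>0 'v)"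

definition xpow :: "'n \<Rightarrow> int \<Rightarrow> 'n::finite laurent"
  where "xpow p j = basis_vec (axis p j)"

definition perm_laurent :: "'n perm \<Rightarrow> 'n::finite laurent \<Rightarrow> 'n laurent"
  where "perm_laurent \<sigma> = lin_ext pscale (\<lambda>a. basis_vec (\<chi> q. a $ (inverse \<sigma> \<langle>$\<rangle> q)))"

definition partial :: "'n \<Rightarrow> 'n::finite laurent \<Rightarrow> 'n laurent"
  where "partial p = lin_ext pscale (\<lambda>a. pscale (of_int (a $ p)) (basis_vec (a - axis p 1)))"

text \<open>The operator \<open>x\<^sub>p / (x\<^sub>p - x\<^sub>r) (1 - \<sigma>\<^sub>p\<^sub>r)\<close> on Laurent polynomials, for \<open>r \<noteq> p\<close>:\<close>

definition divided_diff :: "'n \<Rightarrow> 'n \<Rightarrow> 'n::finite laurent \<Rightarrow> 'n laurent"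
  where "divided_diff p r f =
    (THE g. (xpow p 1 - xpow r 1) * g = xpow p 1 * (f - perm_laurent \<langle>p \<leftrightarrow> r\<rangle> f))"

abbreviation tensor3_op ::
    "(complex \<Rightarrow> 'v \<Rightarrow> 'v) \<Rightarrow> ('n laurent \<Rightarrow> 'n laurent) \<Rightarrow> (('n, 'm) tpow \<Rightarrow> ('n, 'm) tpow)
      \<Rightarrow> ('v \<Rightarrow> 'v) \<Rightarrow> ('n::finite, 'm, 'v::ab_group_add) AN \<Rightarrow> ('n, 'm, 'v) AN"
  where "tensor3_op sV A B D \<equiv> tensor_op (fscale sV) A (tensor_op sV B D)"

definition AN_aff ::
    "(complex \<Rightarrow> 'v \<Rightarrow> 'v) \<Rightarrow> ('m::finite aff \<Rightarrow> 'v \<Rightarrow> 'v) \<Rightarrow> 'm aff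
      \<Rightarrow> ('n::finite, 'm, 'v::ab_group_add) AN \<Rightarrow> ('n, 'm, 'v) AN"
  where "AN_aff sV \<rho>V \<xi> w =
    (\<Sum>j\<in>Poly_Mapping.keys (fst \<xi>). \<Sum>q\<in>UNIV.
       tensor3_op sV ((*) (xpow q j)) (site_op (mat_of_sl (Poly_Mapping.lookup (fst \<xi>) j)) q) id w)
    + tensor3_op sV id id (\<rho>V \<xi>) w"

text \<open>The sum over \<open>i\<close> has finitely many nonzero terms for every \<open>w\<close>.\<close>

fun AN_cherednik ::
    "complex \<Rightarrow> (complex \<Rightarrow> 'v \<Rightarrow> 'v) \<Rightarrow> ('m::finite aff \<Rightarrow> 'v \<Rightarrow> 'v) \<Rightarrow> 'n cher_gen
      \<Rightarrow> ('n::finite, 'm, 'v::ab_group_add) AN \<Rightarrow> ('n, 'm, 'v) AN"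
  where
    "AN_cherednik \<kappa> sV \<rho>V (Sym \<sigma>) w = tensor3_op sV (perm_laurent \<sigma>) (perm_tpow \<sigma>) id w"
  | "AN_cherednik \<kappa> sV \<rho>V (X p) w = tensor3_op sV ((*) (xpow p 1)) id id w"
  | "AN_cherednik \<kappa> sV \<rho>V (Xinv p) w = tensor3_op sV ((*) (xpow p (- 1))) id id w"
  | "AN_cherednik \<kappa> sV \<rho>V (Z p) w =
      tensor3_op sV (\<lambda>f. pscale \<kappa> (xpow p 1 * partial p f)) id id w
      + (\<Sum>r\<in>UNIV - {p}. tensor3_op sV (divided_diff p r) (perm_tpow \<langle>p \<leftrightarrow> r\<rangle>) id w)
      + Sum_any (\<lambda>i::nat. \<Sum>a\<in>UNIV. \<Sum>b\<in>UNIV.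
          tensor3_op sV ((*) (xpow p (- int i))) (site_op (matrix_unit a b) p)
            (\<rho>V (loop (sl_unit b a) (int i))) w)"

definition AN_qW ::
    "(complex \<Rightarrow> 'v \<Rightarrow> 'v) \<Rightarrow> ('m::finite aff \<Rightarrow> 'v \<Rightarrow> 'v)
      \<Rightarrow> ('n::finite, 'm, 'v::ab_group_add) AN set"
  where "AN_qW sV \<rho>V = module.span (fscale (fscale sV)) {AN_aff sV \<rho>V \<xi> w |\<xi> w. \<xi> \<in> aff_q}"

end

theory Submission
  imports Defs
begin

text \<open>
  Let \<open>L\<close> be the ring of Laurent polynomials, \<open>T = (\<complex>\<^sup>m)\<^sup>\<otimes>\<^sup>N\<close> and \<open>W = L \<otimes> T \<otimes> V\<close>. As \<open>V\<close> is spanned by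
  the vectors \<open>\<xi>\<^sub>1 \<dots> \<xi>\<^sub>k u\<close> with \<open>\<xi>\<^sub>i \<in> \<qq>\<close>, \<open>u \<in> U\<close>, and modulo \<open>\<qq>W\<close> the action of \<open>\<qq>\<close> on \<open>V\<close> can be moved to
  \<open>L \<otimes> T\<close>, every element of \<open>W\<close> is congruent to one of \<open>L \<otimes> T \<otimes> U\<close>. The Cherednik algebra acts
  on \<open>W/\<qq>W\<close>, and on \<open>1 \<otimes> T \<otimes> U\<close> its Hecke subalgebra acts as on \<open>\<F>\<^sub>N(U)\<close>. Hence \<open>a \<otimes> f \<mapsto> a f\<close> is a
  surjection from the induced module to \<open>W/\<qq>W\<close>. The induced module is spanned by Laurent
  monomials times elements of \<open>\<F>\<^sub>N(U)\<close>, so injectivity follows from a projection of \<open>W\<close> onto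
  \<open>L \<otimes> T \<otimes> U\<close> that kills \<open>\<qq>W\<close>. It is obtained without the Poincare-Birkhoff-Witt theorem: the
  functionals on \<open>U(\<qq>) \<otimes> U\<close> are given a right action of the affine Lie algebra by an explicit
  recursion, and the universal property of \<open>V\<close> turns a functional into a map on \<open>V\<close>.
\<close>

section \<open>Additive maps on finitely supported functions\<close>

text \<open>The hard direction is an upper bound for \<open>\<qq>W\<close> while \<open>V\<close> is
  known only by generators and relations. A projection of \<open>W\<close> onto
  \<open>Z = L \<otimes> T \<otimes> U\<close> that kills \<open>\<qq>W\<close> must send
  \<open>f \<otimes> \<xi>v\<close> and \<open>- (\<xi>f) \<otimes> v\<close> to the same element
  for \<open>\<xi> \<in> \<qq>\<close>. So each linear map from \<open>U\<close> to \<open>Z\<close>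
  has to extend to \<open>V\<close> in such a way that a letter \<open>\<xi>\<close> on
  \<open>V\<close> is traded for \<open>- \<xi>\<close> on \<open>Z\<close>. On words from
  \<open>\<qq>\<close> this prescribes the value; the work is to show that it respects the relations
  of the whole affine algebra and of \<open>\<pp>\<close>. This is why functionals rather than
  vectors carry the action: multilinearity and commutation relations of a functional on words can be
  checked directly, whereas independence of vectors in \<open>U(\<qq>)\<close> cannot. The
  projection also supplies the independence of Laurent monomials in the induced module, so that for
  the Cherednik algebra only a spanning statement has to be derived from its relations. These
  relations have to hold on \<open>W\<close> only modulo \<open>\<qq>W\<close>; this is used for
  \<open>[z\<^sub>p, z\<^sub>q]\<close>.\<close>

abbreviation additive :: "('a::ab_group_add \<Rightarrow> 'b::ab_group_add) \<Rightarrow> bool"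
  where "additive \<equiv> Modules.additive"

lemma additiveI: "(\<And>x y. f (x + y) = f x + f y) \<Longrightarrow> additive f"
  by (simp add: Modules.additive_def)

lemma additive_id [intro, simp]: "additive id" "additive (\<lambda>x. x)"
  by (simp_all add: Modules.additive_def)

lemma additive_comp: "additive f \<Longrightarrow> additive g \<Longrightarrow> additive (\<lambda>x. f (g x))"
  by (simp add: Modules.additive_def)

lemma additive_plus: "additive f \<Longrightarrow> additive g \<Longrightarrow> additive (\<lambda>x. f x + g x)"
  by (simp add: Modules.additive_def)

lemma additive_minus: "additive f \<Longrightarrow> additive g \<Longrightarrow> additive (\<lambda>x. f x - g x)"
  by (simp add: Modules.additive_def)

lemma additive_sum: "(\<And>i. i \<in> I \<Longrightarrow> additive (F i)) \<Longrightarrow> additive (\<lambda>x. \<Sum>i\<in>I. F i x)"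
  by (simp add: Modules.additive_def sum.distrib)

lemma additive_zero [simp]: "additive (\<lambda>x. 0)"
  by (simp add: Modules.additive_def)

lemma additive_linear: "Vector_Spaces.linear s t f \<Longrightarrow> additive f"
  by (simp add: Modules.additive_def Vector_Spaces.linear_iff)

lemma linear_scale': "Vector_Spaces.linear s t f \<Longrightarrow> f (s c x) = t c (f x)"
  by (simp add: Vector_Spaces.linear_iff)

lemma linearI':
  assumes "vector_space s" "vector_space t" "additive f" "\<And>c x. f (s c x) = t c (f x)"
  shows "Vector_Spaces.linear s t f"
  using assms by (simp add: Modules.additive_def Vector_Spaces.linear_iff)

lemma additive_scale: "vector_space sc \<Longrightarrow> additive (sc c)"
  by (simp add: Modules.additive_def vector_space_def)

lemma additive_scale_left: "vector_space sc \<Longrightarrow> additive (\<lambda>c. sc c x)"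
  by (simp add: Modules.additive_def vector_space_def)

lemma additive_single: "additive (Poly_Mapping.single b)"
  by (simp add: Modules.additive_def single_add)

lemma pm_induct [case_names single add]:
  assumes "\<And>b v. P (Poly_Mapping.single b v)" "\<And>f g. P f \<Longrightarrow> P g \<Longrightarrow> P (f + g)"
  shows "P (f :: 'b \<Rightarrow>\<^sub>0 'v::ab_group_add)"
proof (induction f rule: update_induct)
  case const
  have "P (Poly_Mapping.single undefined 0)" by (rule assms(1))
  then show ?case by simp
next
  case (update f a b)
  have "Poly_Mapping.update a b f = Poly_Mapping.single a b + f"
    using update(1) by (intro poly_mapping_eqI) (auto simp: lookup_update lookup_add lookup_single
        in_keys_iff when_def)
  then show ?case using assms update by simp
qed

lemma additive_eqI:
  fixes f g :: "('b \<Rightarrow>\<^sub>0 'v::ab_group_add) \<Rightarrow> 'w::ab_group_add"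
  assumes "additive f" "additive g" "\<And>b v. f (Poly_Mapping.single b v) = g (Poly_Mapping.single b v)"
  shows "f x = g x"
  by (induction x rule: pm_induct) (simp_all add: assms(3) additive.add[OF assms(1)] additive.add[OF assms(2)])

text \<open>For additive \<open>h b\<close> this is the map out of a direct sum of copies of
  \<open>'v\<close> that is \<open>h b\<close> on the copy \<open>b\<close>. \<open>lin_ext\<close>
  and \<open>tensor_op\<close> are instances, and in this form their additivity is no longer hidden
  by sums over supports.\<close>

definition pm_ext :: "('b \<Rightarrow> 'v \<Rightarrow> 'w) \<Rightarrow> ('b \<Rightarrow>\<^sub>0 'v::ab_group_add) \<Rightarrow> 'w::ab_group_add"
  where "pm_ext h w = (\<Sum>b\<in>Poly_Mapping.keys w. h b (Poly_Mapping.lookup w b))"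

lemma pm_ext_superset:
  assumes "\<And>b. additive (h b)" "finite K" "Poly_Mapping.keys w \<subseteq> K"
  shows "pm_ext h w = (\<Sum>b\<in>K. h b (Poly_Mapping.lookup w b))"
  unfolding pm_ext_def using assms
  by (intro sum.mono_neutral_left) (auto simp: in_keys_iff additive.zero)

lemma additive_pm_ext:
  assumes "\<And>b. additive (h b)"
  shows "additive (pm_ext h)"
proof (rule additiveI)
  fix x y :: "'a \<Rightarrow>\<^sub>0 'b"
  let ?K = "Poly_Mapping.keys x \<union> Poly_Mapping.keys y"
  have "pm_ext h z = (\<Sum>b\<in>?K. h b (Poly_Mapping.lookup z b))" if "z \<in> {x, y, x + y}" for z
    using that keys_add[of x y] by (intro pm_ext_superset assms) auto
  then show "pm_ext h (x + y) = pm_ext h x + pm_ext h y"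
    by (simp add: lookup_add additive.add[OF assms] sum.distrib)
qed

lemma pm_ext_single [simp]: "additive (h b) \<Longrightarrow> pm_ext h (Poly_Mapping.single b v) = h b v"
  by (cases "v = 0") (simp_all add: pm_ext_def additive.zero)

lemma pm_ext_single_id: "pm_ext Poly_Mapping.single w = w"
  by (rule additive_eqI[where g = "\<lambda>w. w"]) (simp_all add: additive_pm_ext additive_single)

lemma lookup_fscale: "vector_space sc \<Longrightarrow> Poly_Mapping.lookup (fscale sc c f) b = sc c (Poly_Mapping.lookup f b)"
  by (simp add: fscale_def map.rep_eq when_def additive.zero[OF additive_scale])

lemma fscale_single [simp]: "vector_space sc \<Longrightarrow> fscale sc c (Poly_Mapping.single b v) = Poly_Mapping.single b (sc c v)"
  by (rule poly_mapping_eqI) (simp add: lookup_fscale lookup_single when_def additive.zero[OF additive_scale])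

lemma vector_space_fscale [intro, simp]: "vector_space sc \<Longrightarrow> vector_space (fscale sc)"
  by (unfold_locales)
    (auto intro!: poly_mapping_eqI simp: lookup_fscale lookup_add vector_space_def)

lemma vector_space_mult [intro, simp]: "vector_space ((*) :: complex \<Rightarrow> complex \<Rightarrow> complex)"
  by unfold_locales (auto simp: algebra_simps)

lemma lin_ext_eq: "lin_ext sc h = pm_ext (\<lambda>b c. sc c (h b))"
  by (simp add: fun_eq_iff lin_ext_def pm_ext_def)

lemma additive_lin_ext: "vector_space sc \<Longrightarrow> additive (lin_ext sc h)"
  by (simp add: lin_ext_eq additive_pm_ext additive_scale_left)

lemma lin_ext_single: "vector_space sc \<Longrightarrow> lin_ext sc h (Poly_Mapping.single b c) = sc c (h b)"
  by (simp add: lin_ext_eq additive_scale_left)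

lemma lin_ext_basis [simp]: "vector_space sc \<Longrightarrow> lin_ext sc h (basis_vec b) = h b"
  by (simp add: lin_ext_single vector_space_def)

lemma linear_lin_ext:
  assumes "vector_space sc" shows "Vector_Spaces.linear pscale sc (lin_ext sc h)"
proof (rule linearI')
  show "lin_ext sc h (pscale c x) = sc c (lin_ext sc h x)" for c x
    by (rule additive_eqI[where f = "\<lambda>x. lin_ext sc h (pscale c x)" and g = "\<lambda>x. sc c (lin_ext sc h x)"])
      (use assms in \<open>auto intro!: additive_comp[of "lin_ext sc h"] additive_comp[of "sc c"] additive_lin_ext
        additive_scale simp: lin_ext_single vector_space.vector_space_assms(3)\<close>)
qed (auto simp: assms additive_lin_ext)

lemma linear_eq_on_basis:
  fixes f g :: "('a \<Rightarrow>\<^sub>0 complex) \<Rightarrow> 'v::ab_group_add"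
  assumes "Vector_Spaces.linear pscale s f" "Vector_Spaces.linear pscale s g"
    "\<And>b. f (basis_vec b) = g (basis_vec b)"
  shows "f x = g x"
proof (rule additive_eqI)
  fix b :: 'a and c :: complex
  have "Poly_Mapping.single b c = pscale c (basis_vec b)" by simp
  then show "f (Poly_Mapping.single b c) = g (Poly_Mapping.single b c)"
    by (metis assms linear_scale')
qed (use assms in \<open>auto intro: additive_linear\<close>)

lemma pure_tensor_eq: "vector_space sc \<Longrightarrow> pure_tensor sc y v = pm_ext (\<lambda>b c. Poly_Mapping.single b (sc c v)) y"
  by (simp add: pure_tensor_def lin_ext_eq)

lemma additive_pure_tensor_left: "vector_space sc \<Longrightarrow> additive (\<lambda>y. pure_tensor sc y v)"
  by (simp add: pure_tensor_eq additive_pm_ext additive_comp[OF additive_single] additive_scale_left)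

lemma pure_tensor_single: "vector_space sc \<Longrightarrow> pure_tensor sc (Poly_Mapping.single b c) v = Poly_Mapping.single b (sc c v)"
  by (simp add: pure_tensor_eq additive_comp[OF additive_single] additive_scale_left)

lemma pure_tensor_basis [simp]: "vector_space sc \<Longrightarrow> pure_tensor sc (basis_vec b) v = Poly_Mapping.single b v"
  by (simp add: pure_tensor_single vector_space_def)

lemma additive_pure_tensor_right: "vector_space sc \<Longrightarrow> additive (pure_tensor sc y)"
  by (rule additiveI) (simp add: pure_tensor_eq pm_ext_def additive.add[OF additive_scale] single_add sum.distrib)

lemma tensor_op_eq: "tensor_op sc A D = pm_ext (\<lambda>b v. pure_tensor sc (A (basis_vec b)) (D v))"
  by (simp add: fun_eq_iff tensor_op_def pm_ext_def)

lemma additive_tensor_op: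
  assumes "vector_space sc" "additive D" shows "additive (tensor_op sc A D)"
  by (simp add: tensor_op_eq assms additive_pm_ext additive_comp[OF additive_pure_tensor_right])

lemma tensor_op_single:
  "vector_space sc \<Longrightarrow> additive D \<Longrightarrow>
    tensor_op sc A D (Poly_Mapping.single b v) = pure_tensor sc (A (basis_vec b)) (D v)"
  by (simp add: tensor_op_eq additive_comp[OF additive_pure_tensor_right])


section \<open>Isomorphisms of quotients\<close>

definition add_subgroup :: "'a::ab_group_add set \<Rightarrow> bool"
  where "add_subgroup S \<longleftrightarrow> 0 \<in> S \<and> (\<forall>x\<in>S. \<forall>y\<in>S. x - y \<in> S)"

lemma add_subgroupD:
  assumes "add_subgroup S"
  shows "0 \<in> S" "x \<in> S \<Longrightarrow> y \<in> S \<Longrightarrow> x - y \<in> S" "x \<in> S \<Longrightarrow> - x \<in> S" "x \<in> S \<Longrightarrow> y \<in> S \<Longrightarrow> x + y \<in> S"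
proof -
  show 0: "0 \<in> S" and d: "x \<in> S \<Longrightarrow> y \<in> S \<Longrightarrow> x - y \<in> S" for x y
    using assms by (auto simp: add_subgroup_def)
  show n: "x \<in> S \<Longrightarrow> - x \<in> S" for x using d[OF 0, of x] by simp
  show "x \<in> S \<Longrightarrow> y \<in> S \<Longrightarrow> x + y \<in> S" using d[OF _ n[of y], of x] by simp
qed

lemma vector_space_module: "vector_space s \<Longrightarrow> module s"
  by (simp add: vector_space_def module_def)

lemma add_subgroup_span: "vector_space s \<Longrightarrow> add_subgroup (module.span s B)"
  by (simp add: add_subgroup_def module.span_zero module.span_diff vector_space_module)

lemma coset_eq_iff: "add_subgroup T \<Longrightarrow> y +o T = y' +o T \<longleftrightarrow> y - y' \<in> T"
proof
  assume T: "add_subgroup T" and eq: "y +o T = y' +o T"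
  have "y \<in> y +o T" using add_subgroupD(1)[OF T] by (force simp: elt_set_plus_def)
  then show "y - y' \<in> T" unfolding eq by (auto simp: elt_set_plus_def)
next
  assume T: "add_subgroup T" and d: "y - y' \<in> T"
  have "\<exists>b'\<in>T. y + b = y' + b'" if "b \<in> T" for b
    using add_subgroupD(4)[OF T d that] by (intro bexI[of _ "y - y' + b"]) (simp_all add: algebra_simps)
  moreover have "\<exists>b'\<in>T. y' + b = y + b'" if "b \<in> T" for b
    using add_subgroupD(2)[OF T that d] by (intro bexI[of _ "b - (y - y')"]) (simp_all add: algebra_simps)
  ultimately show "y +o T = y' +o T" by (auto simp: elt_set_plus_def)
qed

text \<open>\<open>\<Theta>\<close> induces a map from \<open>Y/T\<close> to \<open>X/S\<close>, but
  the bijection has to go the other way. On cosets, viewed as sets, it is the preimage under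
  \<open>\<Theta>\<close>, so no representatives are chosen.\<close>

lemma quotient_isoI:
  fixes sX :: "complex \<Rightarrow> 'x::ab_group_add \<Rightarrow> 'x" and sY :: "complex \<Rightarrow> 'y::ab_group_add \<Rightarrow> 'y"
  assumes \<Theta>: "Vector_Spaces.linear sY sX \<Theta>"
    and S: "add_subgroup S" "\<And>c x. x \<in> S \<Longrightarrow> sX c x \<in> S"
    and T: "\<And>y. \<Theta> y \<in> S \<longleftrightarrow> y \<in> T"
    and surj: "\<And>x. \<exists>y. x - \<Theta> y \<in> S"
    and ops: "\<And>A B. (A, B) \<in> ops \<Longrightarrow> additive A"
      "\<And>A B x. (A, B) \<in> ops \<Longrightarrow> x \<in> S \<Longrightarrow> A x \<in> S"
      "\<And>A B y. (A, B) \<in> ops \<Longrightarrow> A (\<Theta> y) - \<Theta> (B y) \<in> S"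
  shows "quotient_iso sX S sY T ops"
proof -
  note addT = additive_linear[OF \<Theta>]
  have subT: "add_subgroup T"
    by (auto simp: add_subgroup_def T[symmetric] additive.zero[OF addT] additive.diff[OF addT] add_subgroupD[OF S(1)])
  have mem: "z \<in> x +o S \<longleftrightarrow> z - x \<in> S" for z x
    by (force simp: elt_set_plus_def)
  have swap: "a - b \<in> S \<longleftrightarrow> b - a \<in> S" for a b
    using add_subgroupD(3)[OF S(1), of "a - b"] add_subgroupD(3)[OF S(1), of "b - a"] by auto
  have trans: "a - b \<in> S \<Longrightarrow> b - c \<in> S \<Longrightarrow> a - c \<in> S" for a b c
    using add_subgroupD(4)[OF S(1), of "a - b" "b - c"] by simp
  have memT: "z \<in> y +o T \<longleftrightarrow> \<Theta> z - \<Theta> y \<in> S" for z y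
    by (simp add: additive.diff[OF addT, symmetric] T) (force simp: elt_set_plus_def)
  define \<phi> where "\<phi> C = \<Theta> -` C" for C
  \<comment> \<open>All conditions on \<open>\<phi>\<close> become statements about membership in
    \<open>S\<close> through this equivalence.\<close>
  have key: "\<phi> (x +o S) = y +o T \<longleftrightarrow> x - \<Theta> y \<in> S" for x y
  proof
    assume *: "\<phi> (x +o S) = y +o T"
    have "y \<in> y +o T" by (simp add: memT add_subgroupD(1)[OF S(1)])
    then show "x - \<Theta> y \<in> S" unfolding *[symmetric] \<phi>_def by (simp add: mem swap)
  next
    assume "x - \<Theta> y \<in> S"
    then have "z - x \<in> S \<longleftrightarrow> z - \<Theta> y \<in> S" for z
      using trans[of z x "\<Theta> y"] trans[of z "\<Theta> y" x] swap[of x "\<Theta> y"] by blast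
    then show "\<phi> (x +o S) = y +o T"
      by (simp add: set_eq_iff \<phi>_def mem memT)
  qed
  have ex: "\<exists>y. \<phi> (x +o S) = y +o T" for x
    using surj[of x] by (simp add: key)
  have "bij_betw \<phi> (range (\<lambda>x. x +o S)) (range (\<lambda>y. y +o T))"
  proof (rule bij_betwI')
    fix C C' assume "C \<in> range (\<lambda>x. x +o S)" "C' \<in> range (\<lambda>x. x +o S)"
    then obtain x x' where C: "C = x +o S" "C' = x' +o S" by auto
    obtain y where y: "\<phi> C = y +o T" using ex C by blast
    show "\<phi> C = \<phi> C' \<longleftrightarrow> C = C'"
    proof
      assume "\<phi> C = \<phi> C'"
      then have "x - \<Theta> y \<in> S" "x' - \<Theta> y \<in> S" using y by (simp_all add: C key[symmetric])
      then show "C = C'" unfolding C coset_eq_iff[OF S(1)] using swap trans by blast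
    qed simp
  next
    fix C assume "C \<in> range (\<lambda>x. x +o S)"
    then obtain x where C: "C = x +o S" by auto
    obtain y where "\<phi> C = y +o T" using ex C by blast
    then show "\<phi> C \<in> range (\<lambda>y. y +o T)" by simp
  next
    fix D assume "D \<in> range (\<lambda>y. y +o T)"
    then obtain y where "D = y +o T" by auto
    then have "D = \<phi> (\<Theta> y +o S)" using key[of "\<Theta> y" y] add_subgroupD(1)[OF S(1)] by simp
    then show "\<exists>C\<in>range (\<lambda>x. x +o S). D = \<phi> C" by blast
  qed
  moreover have "x + x' - \<Theta> (y + y') \<in> S" if "x - \<Theta> y \<in> S" "x' - \<Theta> y' \<in> S" for x x' y y'
    using add_subgroupD(4)[OF S(1) that] by (simp add: additive.add[OF addT] algebra_simps)
  moreover have "sX c x - \<Theta> (sY c y) \<in> S" if "x - \<Theta> y \<in> S" for c x y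
  proof -
    have "additive (sX c)" using \<Theta> by (simp add: Vector_Spaces.linear_iff additive_scale)
    then show ?thesis using S(2)[OF that, of c] by (simp add: linear_scale'[OF \<Theta>] additive.diff)
  qed
  moreover have "A x - \<Theta> (B y) \<in> S" if "(A, B) \<in> ops" "x - \<Theta> y \<in> S" for A B x y
    using ops(2)[OF that] ops(3)[OF that(1), of y] additive.diff[OF ops(1)[OF that(1)]] trans by metis
  ultimately show ?thesis
    unfolding quotient_iso_def intertwines_def
    by (intro exI[of _ \<phi>]) (auto simp: key)
qed

text \<open>With \<open>V\<close> regarded as \<open>V/0\<close>, an isomorphism onto
  \<open>Y/T\<close> is the same as a linear surjection from \<open>Y\<close> to \<open>V\<close>
  with kernel \<open>T\<close>.\<close>

lemma quotient_isoE:
  fixes sV :: "complex \<Rightarrow> 'v::ab_group_add \<Rightarrow> 'v" and sY :: "complex \<Rightarrow> 'y::ab_group_add \<Rightarrow> 'y"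
  assumes "quotient_iso sV {0} sY T ops" "vector_space sV" "vector_space sY" "add_subgroup T"
  obtains \<psi> where "Vector_Spaces.linear sY sV \<psi>" "surj \<psi>" "\<And>y. \<psi> y = 0 \<longleftrightarrow> y \<in> T"
    "\<And>A B y. (A, B) \<in> ops \<Longrightarrow> \<psi> (B y) = A (\<psi> y)"
proof -
  have co_word: "v +o {0} = {v}" for v :: 'v by (auto simp: elt_set_plus_def)
  from assms(1) obtain \<phi> where
    bij: "bij_betw \<phi> (range (\<lambda>x. {x})) (range (\<lambda>y. y +o T))" and
    add': "\<forall>x x' y y'. \<phi> {x} = y +o T \<longrightarrow> \<phi> {x'} = y' +o T \<longrightarrow> \<phi> {x + x'} = (y + y') +o T" and
    scl': "\<forall>c x y. \<phi> {x} = y +o T \<longrightarrow> \<phi> {sV c x} = sY c y +o T" and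
    op': "\<forall>(A, B)\<in>ops. \<forall>x y. \<phi> {x} = y +o T \<longrightarrow> \<phi> {A x} = B y +o T"
    unfolding quotient_iso_def intertwines_def co_word by (elim exE conjE)
  note add = add'[rule_format] and scl = scl'[rule_format]
  have op: "\<phi> {A x} = B y +o T" if "(A, B) \<in> ops" "\<phi> {x} = y +o T" for A B x y
    using op' that by auto
  have inj: "x = x'" if "\<phi> {x} = \<phi> {x'}" for x x'
    using bij that by (auto simp: bij_betw_def inj_on_def)
  have ex: "\<exists>x. \<phi> {x} = y +o T" for y
  proof -
    have "y +o T \<in> \<phi> ` range (\<lambda>x. {x})" using bij by (simp add: bij_betw_def)
    then show ?thesis by auto
  qed
  \<comment> \<open>The inverse of \<open>\<phi>\<close>, composed with the passage from a vector to
    its coset; the choice is unique by \<open>inj\<close>.\<close>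
  define \<psi> where "\<psi> y = (SOME x. \<phi> {x} = y +o T)" for y
  have \<psi>: "\<phi> {\<psi> y} = y +o T" for y
    unfolding \<psi>_def by (rule someI_ex[OF ex])
  have \<psi>I: "\<psi> y = x" if "\<phi> {x} = y +o T" for x y
    by (rule inj) (simp only: that \<psi>)
  have \<psi>_eq: "\<psi> y = \<psi> y' \<longleftrightarrow> y - y' \<in> T" for y y'
  proof
    assume "\<psi> y = \<psi> y'"
    then have "y +o T = y' +o T" by (simp only: \<psi>[symmetric])
    then show "y - y' \<in> T" by (simp only: coset_eq_iff[OF assms(4)])
  next
    assume "y - y' \<in> T"
    then have "y +o T = y' +o T" by (simp only: coset_eq_iff[OF assms(4)])
    then show "\<psi> y = \<psi> y'" by (intro \<psi>I) (simp only: \<psi>)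
  qed
  have "surj \<psi>"
  proof (rule surjI)
    fix x
    have "\<phi> {x} \<in> \<phi> ` range (\<lambda>x. {x})" by simp
    then have "\<phi> {x} \<in> range (\<lambda>y. y +o T)" using bij by (simp only: bij_betw_def)
    then have "\<phi> {x} = (SOME y. \<phi> {x} = y +o T) +o T" by (intro someI_ex[of "\<lambda>y. \<phi> {x} = y +o T"]) auto
    then show "\<psi> (SOME y. \<phi> {x} = y +o T) = x" by (rule \<psi>I)
  qed
  moreover have addp: "additive \<psi>"
    by (rule additiveI, rule \<psi>I) (rule add[OF \<psi> \<psi>])
  moreover have "\<psi> (sY c y) = sV c (\<psi> y)" for c y
    by (rule \<psi>I) (rule scl[OF \<psi>])
  moreover have "\<psi> y = 0 \<longleftrightarrow> y \<in> T" for y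
    using \<psi>_eq[of y 0] additive.zero[OF addp] by simp
  moreover have "\<psi> (B y) = A (\<psi> y)" if "(A, B) \<in> ops" for A B y
    by (rule \<psi>I) (rule op[OF that \<psi>])
  ultimately show ?thesis
    by (intro that[of \<psi>] linearI' assms(2,3)) auto
qed


section \<open>The ring of additive endomorphisms\<close>

text \<open>A ring type turns commutator computations into ring algebra. The maps are additive
  rather than linear so that the type depends on no scaling: scalars become the ring elements
  \<open>S c\<close>, and linearity becomes commutation with them.\<close>

typedef (overloaded) 'w endo = "{f :: 'w::ab_group_add \<Rightarrow> 'w. additive f}"
  morphisms app Abs_endo by auto

setup_lifting type_definition_endo

lemma additive_app [intro, simp]: "additive (app A)"
  using app[of A] by simp

lemmas app_add = additive.add[OF additive_app]
  and app_diff = additive.diff[OF additive_app]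
  and app_zero [simp] = additive.zero[OF additive_app]
  and app_minus = additive.minus[OF additive_app]
  and app_sum = additive.sum[OF additive_app]

lemma app_Abs: "additive f \<Longrightarrow> app (Abs_endo f) = f"
  by (simp add: Abs_endo_inverse)

lemma endo_eqI: "(\<And>w. app A w = app B w) \<Longrightarrow> A = B"
  by (metis app_inject ext)

instantiation endo :: (ab_group_add) "{ring, monoid_mult}"
begin

lift_definition zero_endo :: "'a endo" is "\<lambda>x. 0" by simp
lift_definition one_endo :: "'a endo" is "\<lambda>x. x" by simp
lift_definition plus_endo :: "'a endo \<Rightarrow> 'a endo \<Rightarrow> 'a endo" is "\<lambda>f g x. f x + g x" by (rule additive_plus)
lift_definition minus_endo :: "'a endo \<Rightarrow> 'a endo \<Rightarrow> 'a endo" is "\<lambda>f g x. f x - g x" by (rule additive_minus)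
lift_definition uminus_endo :: "'a endo \<Rightarrow> 'a endo" is "\<lambda>f x. - f x" by (simp add: Modules.additive_def)
lift_definition times_endo :: "'a endo \<Rightarrow> 'a endo \<Rightarrow> 'a endo" is "\<lambda>f g x. f (g x)" by (rule additive_comp)

instance
  by standard (transfer, simp add: fun_eq_iff additive.add algebra_simps)+

end

lemma app_simps [simp]:
  "app 0 w = 0" "app 1 w = w" "app (A + B) w = app A w + app B w"
  "app (A - B) w = app A w - app B w" "app (- A) w = - app A w" "app (A * B) w = app A (app B w)"
  by (transfer, simp)+

lemma app_sum_left: "app (sum F I) w = (\<Sum>i\<in>I. app (F i) w)"
  by (induction I rule: infinite_finite_induct) simp_all


section \<open>Modules over free algebras\<close>

lemma linear_comp': "Vector_Spaces.linear s t f \<Longrightarrow> Vector_Spaces.linear t r g \<Longrightarrow> Vector_Spaces.linear s r (\<lambda>x. g (f x))"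
  by (simp add: Vector_Spaces.linear_iff)

lemma linear_plus':
  "Vector_Spaces.linear s t f \<Longrightarrow> Vector_Spaces.linear s t g \<Longrightarrow> Vector_Spaces.linear s t (\<lambda>x. f x + g x)"
  by (auto simp: Vector_Spaces.linear_iff vector_space_def algebra_simps)

lemma linear_sum':
  assumes "vector_space s" "vector_space t" "\<And>i. i \<in> I \<Longrightarrow> Vector_Spaces.linear s t (F i)"
  shows "Vector_Spaces.linear s t (\<lambda>x. \<Sum>i\<in>I. F i x)"
proof (rule linearI')
  show "(\<Sum>i\<in>I. F i (s c x)) = t c (\<Sum>i\<in>I. F i x)" for c x
    by (simp add: linear_scale'[OF assms(3)] additive.sum[OF additive_scale[OF assms(2)]] cong: sum.cong)
qed (use assms in \<open>auto intro!: additive_sum intro: additive_linear\<close>)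

lemma linear_ident: "vector_space s \<Longrightarrow> Vector_Spaces.linear s s (\<lambda>x. x)"
  by (simp add: Vector_Spaces.linear_iff)

lemma linear_add': "Vector_Spaces.linear s t f \<Longrightarrow> f (x + y) = f x + f y"
  by (simp add: Vector_Spaces.linear_iff)

lemma linear_diff': "Vector_Spaces.linear s t f \<Longrightarrow> f (x - y) = f x - f y"
  by (simp add: additive.diff[OF additive_linear])

lemma linear_zero': "Vector_Spaces.linear s t f \<Longrightarrow> f 0 = 0"
  by (simp add: additive.zero[OF additive_linear])

lemma linear_vs: "Vector_Spaces.linear s t f \<Longrightarrow> vector_space s" "Vector_Spaces.linear s t f \<Longrightarrow> vector_space t"
  by (simp_all add: Vector_Spaces.linear_iff)

lemma linear_on_span:
  assumes "Vector_Spaces.linear s t f" "\<And>b. b \<in> B \<Longrightarrow> f b \<in> S" "add_subgroup S" "\<And>c y. y \<in> S \<Longrightarrow> t c y \<in> S"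
    and "x \<in> module.span s B"
  shows "f x \<in> S"
proof -
  note m = vector_space_module[OF linear_vs(1)[OF assms(1)]]
  from m assms(5) show ?thesis
  proof (rule module.span_induct)
    show "module.subspace s {x. f x \<in> S}"
      by (auto simp: module.subspace_def[OF m] linear_zero'[OF assms(1)] linear_add'[OF assms(1)]
        linear_scale'[OF assms(1)] add_subgroupD[OF assms(3)] assms(4))
  qed (use assms(2) in auto)
qed

lemma linear_span_zero:
  assumes "Vector_Spaces.linear s t f" "\<And>b. b \<in> B \<Longrightarrow> f b = 0" "x \<in> module.span s B"
  shows "f x = 0"
  using linear_on_span[OF assms(1), of B "{0}" x] assms(2,3) linear_vs(2)[OF assms(1)]
  by (simp add: add_subgroup_def additive.zero[OF additive_scale])

lemma linear_free_alg_act_left: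
  "vector_space s \<Longrightarrow> Vector_Spaces.linear pscale s (\<lambda>a. free_alg_act s act a u)"
  unfolding free_alg_act_def by (rule linear_lin_ext)

lemma free_alg_act_single:
  "vector_space s \<Longrightarrow> free_alg_act s act (Poly_Mapping.single w c) u = s c (foldr act (letters w) u)"
  by (simp add: free_alg_act_def lin_ext_single)

lemma free_alg_act_basis [simp]:
  "vector_space s \<Longrightarrow> free_alg_act s act (basis_vec w) u = foldr act (letters w) u"
  by (simp add: free_alg_act_def)

lemma basis_vec_one: "1 = basis_vec (Word [])"
  by (simp add: zero_word_def[symmetric])

lemma free_alg_act_one [simp]: "vector_space s \<Longrightarrow> free_alg_act s act 1 u = u"
  by (simp add: basis_vec_one)

lemma word_plus: "Word xs + Word ys = Word (xs @ ys)"
  by (simp add: plus_word_def)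

lemma letters_plus [simp]: "letters (v + w) = letters v @ letters w"
  by (simp add: plus_word_def)

locale free_action =
  fixes s :: "complex \<Rightarrow> 'v \<Rightarrow> 'v::ab_group_add" and act :: "'g \<Rightarrow> 'v \<Rightarrow> 'v"
  assumes linear_act: "Vector_Spaces.linear s s (act g)"
begin

lemma vs: "vector_space s"
  using linear_act by (rule linear_vs)

lemma linear_foldr: "Vector_Spaces.linear s s (foldr act xs)"
proof (induction xs)
  case Nil
  then show ?case using linear_ident[OF vs] by (simp add: id_def)
next
  case (Cons a xs)
  then show ?case using linear_comp'[OF Cons linear_act[of a]] by (simp add: comp_def)
qed

lemma linear_free_alg_act: "Vector_Spaces.linear s s (free_alg_act s act a)"
proof (rule linearI'[OF vs vs])
  note vs[simp]
  have *: "free_alg_act s act a u = (\<Sum>w\<in>Poly_Mapping.keys a. s (Poly_Mapping.lookup a w) (foldr act (letters w) u))" for u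
    by (simp add: free_alg_act_def lin_ext_def)
  show "additive (free_alg_act s act a)"
    unfolding * by (rule additive_sum, rule additive_comp[OF additive_scale[OF vs] additive_linear[OF linear_foldr]])
  show "free_alg_act s act a (s c x) = s c (free_alg_act s act a x)" for c x
    unfolding * by (simp add: linear_scale'[OF linear_foldr] additive.sum[OF additive_scale]
       vector_space.vector_space_assms(3) mult.commute)
qed

lemma free_alg_act_mult: "free_alg_act s act (a * b) u = free_alg_act s act a (free_alg_act s act b u)"
proof (rule additive_eqI[where f = "\<lambda>a. free_alg_act s act (a * b) u" and g = "\<lambda>a. free_alg_act s act a (free_alg_act s act b u)"])
  note vs[simp] note addl = additive_linear[OF linear_free_alg_act_left[OF vs]]
  show "additive (\<lambda>a. free_alg_act s act (a * b) u)"
    by (rule additiveI) (simp add: distrib_right additive.add[OF addl])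
  fix w c
  show "free_alg_act s act (Poly_Mapping.single w c * b) u =
    free_alg_act s act (Poly_Mapping.single w c) (free_alg_act s act b u)"
  proof (rule additive_eqI[where x = b])
    show "additive (\<lambda>b. free_alg_act s act (Poly_Mapping.single w c * b) u)"
      by (rule additiveI) (simp add: distrib_left additive.add[OF addl])
    show "additive (\<lambda>b. free_alg_act s act (Poly_Mapping.single w c) (free_alg_act s act b u))"
      by (rule additiveI) (simp add: linear_add'[OF linear_free_alg_act] additive.add[OF addl])
  qed (simp add: mult_single free_alg_act_single linear_scale'[OF linear_foldr]
      vector_space.vector_space_assms(3))
qed (simp_all add: additive_linear[OF linear_free_alg_act_left[OF vs]])

lemma free_alg_act_invariant:
  assumes "add_subgroup S" "\<And>c y. y \<in> S \<Longrightarrow> s c y \<in> S" "\<And>g y. y \<in> S \<Longrightarrow> act g y \<in> S" "u \<in> S"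
  shows "free_alg_act s act a u \<in> S"
proof (induction a rule: pm_induct)
  case (single w c)
  have "foldr act xs u \<in> S" for xs by (induction xs) (auto simp: assms)
  then show ?case by (simp add: free_alg_act_single vs assms(2))
qed (simp add: linear_add'[OF linear_free_alg_act_left[OF vs]] add_subgroupD[OF assms(1)])

text \<open>In \<open>b * r * b'\<close> the factor \<open>b'\<close> acts on an arbitrary vector,
  \<open>r\<close> takes the result into \<open>S\<close>, and \<open>b\<close> keeps it there.
  Hence relations that hold only modulo \<open>S\<close> suffice.\<close>

lemma free_alg_act_ideal:
  assumes S: "add_subgroup S" "\<And>c y. y \<in> S \<Longrightarrow> s c y \<in> S" "\<And>g y. y \<in> S \<Longrightarrow> act g y \<in> S"
    and R: "\<And>r v. r \<in> R \<Longrightarrow> free_alg_act s act r v \<in> S"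
    and a: "a \<in> two_sided_ideal R"
  shows "free_alg_act s act a u \<in> S"
  using linear_free_alg_act_left[OF vs] _ S(1,2) a[unfolded two_sided_ideal_def]
proof (rule linear_on_span, safe)
  fix b r b' assume "r \<in> R"
  then show "free_alg_act s act (b * r * b') u \<in> S"
    unfolding free_alg_act_mult by (intro free_alg_act_invariant[OF S] R)
qed

text \<open>Applied with the Hecke letters to the inclusion of \<open>\<F>\<^sub>N(U)\<close>, since
  the letters \<open>X\<close> and \<open>Xinv\<close> lead out of its image, and with
  \<open>G = UNIV\<close> to the action of \<open>sl\<close>.\<close>

lemma free_alg_act_intertwine:
  assumes s': "vector_space s'" and \<iota>: "Vector_Spaces.linear s' s \<iota>"
    and g: "\<And>g u. g \<in> G \<Longrightarrow> act g (\<iota> u) = \<iota> (act' g u)"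
    and b: "\<forall>w\<in>Poly_Mapping.keys b. set (letters w) \<subseteq> G"
  shows "free_alg_act s act b (\<iota> u) = \<iota> (free_alg_act s' act' b u)"
proof -
  have "foldr act xs (\<iota> u) = \<iota> (foldr act' xs u)" if "set xs \<subseteq> G" for xs
    using that by (induction xs) (auto simp: g)
  then show ?thesis using b
    by (simp add: free_alg_act_def lin_ext_def additive.sum[OF additive_linear[OF \<iota>]] linear_scale'[OF \<iota>])
qed

end

lemma linear_mult_left: "Vector_Spaces.linear pscale pscale (\<lambda>x. a * x :: 'g free_alg)"
  and linear_mult_right: "Vector_Spaces.linear pscale pscale (\<lambda>x. x * a :: 'g free_alg)"
proof -
  have sc: "pscale c x = Poly_Mapping.single 0 c * x" for c and x :: "'g free_alg"
    by (simp add: fscale_def mult_map_scale_conv_mult)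
  have sc': "pscale c x = x * Poly_Mapping.single 0 c" for c and x :: "'g free_alg"
  proof (rule additive_eqI[where x = x])
    show "additive (pscale c)" by (rule additive_scale) simp
    show "additive (\<lambda>x :: 'g free_alg. x * Poly_Mapping.single 0 c)" by (rule additiveI) (rule distrib_right)
  qed (simp add: mult_single mult.commute)
  have "a * pscale c x = pscale c (a * x)" for c and x :: "'g free_alg"
    unfolding sc'[of c x] sc'[of c "a * x"] by (rule mult.assoc[symmetric])
  then show "Vector_Spaces.linear pscale pscale (\<lambda>x. a * x :: 'g free_alg)"
    by (intro linearI' additiveI) (auto simp: distrib_left)
  have "pscale c x * a = pscale c (x * a)" for c and x :: "'g free_alg"
    unfolding sc[of c x] sc[of c "x * a"] by (rule mult.assoc)
  then show "Vector_Spaces.linear pscale pscale (\<lambda>x. x * a :: 'g free_alg)"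
    by (intro linearI' additiveI) (auto simp: distrib_right)
qed

lemma vs_pscale: "vector_space pscale"
  by simp

lemma two_sided_ideal_subgroup: "add_subgroup (two_sided_ideal R)"
  unfolding two_sided_ideal_def by (rule add_subgroup_span) simp

lemma two_sided_ideal_scale: "x \<in> two_sided_ideal R \<Longrightarrow> pscale c x \<in> two_sided_ideal R"
  unfolding two_sided_ideal_def by (intro module.span_scale vector_space_module) simp_all

lemma two_sided_ideal_base: "r \<in> R \<Longrightarrow> r \<in> two_sided_ideal R"
  unfolding two_sided_ideal_def
  by (rule module.span_base[OF vector_space_module[OF vs_pscale]], rule CollectI)
    (rule exI[of _ 1], rule exI[of _ r], rule exI[of _ 1], simp)

lemma two_sided_ideal_left: "x \<in> two_sided_ideal R \<Longrightarrow> a * x \<in> two_sided_ideal R"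
  and two_sided_ideal_right: "x \<in> two_sided_ideal R \<Longrightarrow> x * a \<in> two_sided_ideal R"
proof -
  have b: "b * r * c \<in> two_sided_ideal R" if "r \<in> R" for b r c
    unfolding two_sided_ideal_def using that
    by (intro module.span_base[OF vector_space_module[OF vs_pscale]]) auto
  assume x: "x \<in> two_sided_ideal R"
  have "a * (b * r * c) \<in> two_sided_ideal R" if "r \<in> R" for b r c
    using b[OF that, of "a * b" c] by (simp add: mult.assoc)
  then show "a * x \<in> two_sided_ideal R"
    by (rule_tac linear_on_span[OF linear_mult_left _ two_sided_ideal_subgroup two_sided_ideal_scale
          x[unfolded two_sided_ideal_def]]) auto
  have "b * r * c * a \<in> two_sided_ideal R" if "r \<in> R" for b r c
    using b[OF that, of b "c * a"] by (simp add: mult.assoc)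
  then show "x * a \<in> two_sided_ideal R"
    by (rule_tac linear_on_span[OF linear_mult_right _ two_sided_ideal_subgroup two_sided_ideal_scale
          x[unfolded two_sided_ideal_def]]) auto
qed

section \<open>Functionals on induced modules of a split Lie algebra\<close>

text \<open>The decomposition into two subalgebras is encoded by one idempotent:
  \<open>\<qq>\<close> consists of the fixed vectors of \<open>proj_q\<close> and
  \<open>\<pp>\<close> is its kernel. \<open>pact\<close> is a total linear map, but it satisfies
  the module law only on \<open>\<pp>\<close>.\<close>

locale split_lie =
  fixes sL :: "complex \<Rightarrow> 'l \<Rightarrow> 'l::ab_group_add" and br :: "'l \<Rightarrow> 'l \<Rightarrow> 'l" and proj_q :: "'l \<Rightarrow> 'l"
    and sU :: "complex \<Rightarrow> 'u \<Rightarrow> 'u::ab_group_add" and pact :: "'l \<Rightarrow> 'u \<Rightarrow> 'u"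
    and sZ :: "complex \<Rightarrow> 'z \<Rightarrow> 'z::ab_group_add"
  assumes vsL: "vector_space sL" and vsU: "vector_space sU" and vsZ: "vector_space sZ"
    and br_left: "Vector_Spaces.linear sL sL (\<lambda>x. br x y)"
    and br_right: "Vector_Spaces.linear sL sL (br x)"
    and br_anti: "br x y = - br y x"
    and jacobi: "br x (br y z) = br (br x y) z + br y (br x z)"
    and proj_q_linear: "Vector_Spaces.linear sL sL proj_q"
    and proj_q_idem: "proj_q (proj_q x) = proj_q x"
    and proj_q_q: "proj_q x = x \<Longrightarrow> proj_q y = y \<Longrightarrow> proj_q (br x y) = br x y"
    and proj_q_p: "proj_q x = 0 \<Longrightarrow> proj_q y = 0 \<Longrightarrow> proj_q (br x y) = 0"
    and pact_linear: "Vector_Spaces.linear sU sU (pact x)"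
    and pact_linear_left: "Vector_Spaces.linear sL sU (\<lambda>x. pact x u)"
    and pact_br: "proj_q x = 0 \<Longrightarrow> proj_q y = 0 \<Longrightarrow> pact (br x y) u = pact x (pact y u) - pact y (pact x u)"
begin

text \<open>These are the linear maps from \<open>U(l) \<otimes> U\<close> to \<open>Z\<close>,
  where \<open>l\<close> is the whole Lie algebra, written as functions on words. Allowing all
  letters avoids a side condition in every induction; by \<open>coact_cong\<close> only the values
  on words from \<open>\<qq>\<close> matter in the end.\<close>

definition good :: "('l list \<Rightarrow> 'u \<Rightarrow> 'z) \<Rightarrow> bool"
  where "good \<Phi> \<longleftrightarrow> (\<forall>v w x. Vector_Spaces.linear sL sZ (\<lambda>\<xi>. \<Phi> (v @ \<xi> # w) x)) \<and>
    (\<forall>w. Vector_Spaces.linear sU sZ (\<Phi> w)) \<and>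
    (\<forall>v w \<xi> \<eta> x. \<Phi> (v @ \<xi> # \<eta> # w) x - \<Phi> (v @ \<eta> # \<xi> # w) x = \<Phi> (v @ br \<xi> \<eta> # w) x)"

text \<open>The value of \<open>\<Phi>\<close> at \<open>y w x\<close>, where \<open>y\<close> is moved to the right through the word \<open>w\<close> and its component outside \<open>\<qq>\<close>
  then acts on \<open>x\<close>. So \<open>coact\<close> needs no basis of the enveloping algebra.\<close>

primrec co_word :: "'l list \<Rightarrow> ('l list \<Rightarrow> 'u \<Rightarrow> 'z) \<Rightarrow> 'l \<Rightarrow> 'u \<Rightarrow> 'z"
  where
    "co_word [] \<Phi> y x = \<Phi> [proj_q y] x + \<Phi> [] (pact (y - proj_q y) x)"
  | "co_word (\<xi> # w) \<Phi> y x = co_word w (\<lambda>w. \<Phi> (\<xi> # w)) y x + co_word w \<Phi> (br y \<xi>) x"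

text \<open>The argument order of \<open>co_word\<close> serves the recursion, this one the right
  action on functionals: \<open>coact \<Phi> y\<close> is \<open>\<Phi>\<close> composed with the
  action of \<open>y\<close>, and \<open>foldl coact \<Phi> ys\<close> is \<open>\<Phi>\<close>
  composed with the action of the product of \<open>ys\<close>.\<close>

definition coact :: "('l list \<Rightarrow> 'u \<Rightarrow> 'z) \<Rightarrow> 'l \<Rightarrow> 'l list \<Rightarrow> 'u \<Rightarrow> 'z"
  where "coact \<Phi> y w = co_word w \<Phi> y"

lemma good_letter: "good \<Phi> \<Longrightarrow> Vector_Spaces.linear sL sZ (\<lambda>\<xi>. \<Phi> (v @ \<xi> # w) x)"
  and good_arg: "good \<Phi> \<Longrightarrow> Vector_Spaces.linear sU sZ (\<Phi> w)"
  and good_rel: "good \<Phi> \<Longrightarrow> \<Phi> (v @ \<xi> # \<eta> # w) x - \<Phi> (v @ \<eta> # \<xi> # w) x = \<Phi> (v @ br \<xi> \<eta> # w) x"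
  by (simp_all add: good_def)

lemma good_shift: "good \<Phi> \<Longrightarrow> good (\<lambda>w. \<Phi> (\<xi> # w))"
proof -
  assume g: "good \<Phi>"
  show ?thesis unfolding good_def
    using good_letter[OF g, of "\<xi> # _"] good_arg[OF g] good_rel[OF g, of "\<xi> # _"] by simp
qed

lemma co_word_add: "co_word w (\<lambda>w x. \<Phi> w x + \<Psi> w x) y x = co_word w \<Phi> y x + co_word w \<Psi> y x"
  by (induction w arbitrary: \<Phi> \<Psi> y) (simp_all add: algebra_simps)

lemma co_word_hom: "additive F \<Longrightarrow> co_word w (\<lambda>w x. F (\<Phi> w x)) y x = F (co_word w \<Phi> y x)"
  by (induction w arbitrary: \<Phi> y) (simp_all add: additive.add)

lemma co_word_minus: "co_word w (\<lambda>w x. \<Phi> w x - \<Psi> w x) y x = co_word w \<Phi> y x - co_word w \<Psi> y x"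
  by (induction w arbitrary: \<Phi> \<Psi> y) (simp_all add: algebra_simps)

lemma co_word_linear: "good \<Phi> \<Longrightarrow> Vector_Spaces.linear sL sZ (\<lambda>y. co_word w \<Phi> y x)"
proof (induction w arbitrary: \<Phi>)
  case Nil
  have 1: "Vector_Spaces.linear sL sL (\<lambda>y. y - proj_q y)"
    using proj_q_linear by (auto simp: Vector_Spaces.linear_iff module.scale_right_diff_distrib vector_space_module)
  show ?case
    using linear_comp'[OF proj_q_linear good_letter[OF Nil, of "[]" "[]"]]
      linear_comp'[OF linear_comp'[OF 1 pact_linear_left] good_arg[OF Nil, of "[]"]]
    by (simp add: linear_plus')
next
  case (Cons \<xi> w)
  show ?case
    using Cons.IH[OF good_shift[OF Cons.prems, of \<xi>]] linear_comp'[OF br_left[of \<xi>] Cons.IH[OF Cons.prems]]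
    by (simp add: linear_plus')
qed

lemma co_word_linear_param:
  "(\<And>w x. Vector_Spaces.linear sL sZ (\<lambda>\<xi>. \<Phi> \<xi> w x)) \<Longrightarrow> Vector_Spaces.linear sL sZ (\<lambda>\<xi>. co_word w (\<Phi> \<xi>) y x)"
  by (induction w arbitrary: \<Phi> y) (simp_all add: linear_plus')

lemma co_word_linear_arg: "good \<Phi> \<Longrightarrow> Vector_Spaces.linear sU sZ (co_word w \<Phi> y)"
proof (induction w arbitrary: \<Phi> y)
  case Nil
  have "co_word [] \<Phi> y = (\<lambda>x. \<Phi> [proj_q y] x + \<Phi> [] (pact (y - proj_q y) x))" by (simp add: fun_eq_iff)
  then show ?case
    using linear_plus'[OF good_arg[OF Nil, of "[proj_q y]"] linear_comp'[OF pact_linear[of "y - proj_q y"] good_arg[OF Nil, of "[]"]]]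
    by simp
next
  case (Cons \<xi> w)
  have "co_word (\<xi> # w) \<Phi> y = (\<lambda>x. co_word w (\<lambda>w. \<Phi> (\<xi> # w)) y x + co_word w \<Phi> (br y \<xi>) x)" by (simp add: fun_eq_iff)
  then show ?case
    using linear_plus'[OF Cons.IH[OF good_shift[OF Cons.prems, of \<xi>], of y] Cons.IH[OF Cons.prems, of "br y \<xi>"]]
    by simp
qed

lemma co_word_letter: "good \<Phi> \<Longrightarrow> Vector_Spaces.linear sL sZ (\<lambda>\<xi>. co_word (v @ \<xi> # w) \<Phi> y x)"
proof (induction v arbitrary: \<Phi> y)
  case Nil
  have "Vector_Spaces.linear sL sZ (\<lambda>\<xi>. \<Phi> (\<xi> # w) x)" for w x
    using good_letter[OF Nil, of "[]"] by simp
  then show ?case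
    using linear_comp'[OF br_right[of y] co_word_linear[OF Nil]]
    by (simp add: linear_plus' co_word_linear_param)
next
  case (Cons a v)
  then show ?case by (simp add: linear_plus' good_shift)
qed

lemma jacobi': "br (br y \<xi>) \<eta> - br (br y \<eta>) \<xi> = br y (br \<xi> \<eta>)"
  using jacobi[of y \<xi> \<eta>] br_anti[of "br y \<eta>" \<xi>] by simp

text \<open>In the base case, when \<open>y\<close> has passed both letters, the terms with a single
  bracket are symmetric in \<open>\<xi>\<close> and \<open>\<eta>\<close>. The terms without bracket
  differ by the relation for \<open>\<Phi>\<close>, and those with two brackets by the Jacobi
  identity.\<close>

lemma co_word_rel:
  "good \<Phi> \<Longrightarrow> co_word (v @ \<xi> # \<eta> # w) \<Phi> y x - co_word (v @ \<eta> # \<xi> # w) \<Phi> y x = co_word (v @ br \<xi> \<eta> # w) \<Phi> y x"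
proof (induction v arbitrary: \<Phi> y)
  case Nil
  have "(\<lambda>w x. \<Phi> (\<xi> # \<eta> # w) x - \<Phi> (\<eta> # \<xi> # w) x) = (\<lambda>w. \<Phi> (br \<xi> \<eta> # w))"
    using good_rel[OF Nil, of "[]"] by (simp add: fun_eq_iff)
  then have "co_word w (\<lambda>w. \<Phi> (\<xi> # \<eta> # w)) y x - co_word w (\<lambda>w. \<Phi> (\<eta> # \<xi> # w)) y x = co_word w (\<lambda>w. \<Phi> (br \<xi> \<eta> # w)) y x"
    by (simp add: co_word_minus[symmetric])
  moreover have "co_word w \<Phi> (br (br y \<xi>) \<eta>) x - co_word w \<Phi> (br (br y \<eta>) \<xi>) x = co_word w \<Phi> (br y (br \<xi> \<eta>)) x"
    by (simp add: linear_diff'[OF co_word_linear[OF Nil], symmetric] jacobi')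
  ultimately show ?case by (simp add: algebra_simps)
next
  case (Cons a v)
  show ?case
    using Cons.IH[OF good_shift[OF Cons.prems, of a], of y] Cons.IH[OF Cons.prems, of "br y a"]
    by (simp add: algebra_simps)
qed

lemma good_coact: "good \<Phi> \<Longrightarrow> good (coact \<Phi> y)"
  unfolding good_def[of "coact _ _"] coact_def by (simp add: co_word_linear_arg co_word_letter co_word_rel)

lemma coact_shift: "(\<lambda>w. coact \<Phi> y (\<xi> # w)) = (\<lambda>w x. coact (\<lambda>w. \<Phi> (\<xi> # w)) y w x + coact \<Phi> (br y \<xi>) w x)"
  by (simp add: coact_def fun_eq_iff)

lemma coact_add: "coact (\<lambda>w x. \<Phi> w x + \<Psi> w x) y w x = coact \<Phi> y w x + coact \<Psi> y w x"
  by (simp add: coact_def co_word_add)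

text \<open>This makes \<open>coact\<close> a right action of the Lie algebra. Past a letter, the
  induction hypotheses combine by the Jacobi identity; the splitting matters only at the empty word,
  where closure of \<open>\<qq>\<close> and \<open>\<pp>\<close> under brackets and the module law
  for \<open>\<pp>\<close> are used.\<close>

lemma coact_br:
  "good \<Phi> \<Longrightarrow> coact (coact \<Phi> y) z w x - coact (coact \<Phi> z) y w x = coact \<Phi> (br y z) w x"
proof (induction w arbitrary: \<Phi> y z)
  case Nil
  let ?p = "\<lambda>y. y - proj_q y"
  note l = linear_diff'[OF co_word_linear[OF Nil, of "[]" x]] linear_add'[OF co_word_linear[OF Nil, of "[]" x]]
  have p: "proj_q (?p y) = 0" for y by (simp add: linear_diff'[OF proj_q_linear] proj_q_idem)
  have P: "co_word [] \<Phi> (br (?p y) (?p z)) x = \<Phi> [] (pact (?p y) (pact (?p z) x)) - \<Phi> [] (pact (?p z) (pact (?p y) x))"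
    using linear_zero'[OF good_letter[OF Nil, of "[]" "[]"]]
    by (simp add: proj_q_p p pact_br linear_diff'[OF good_arg[OF Nil]])
  have Q: "co_word [] \<Phi> (br (proj_q y) (proj_q z)) x = \<Phi> [proj_q y, proj_q z] x - \<Phi> [proj_q z, proj_q y] x"
    using good_rel[OF Nil, of "[]" _ _ "[]"] linear_zero'[OF pact_linear_left] linear_zero'[OF good_arg[OF Nil]]
    by (simp add: proj_q_q proj_q_idem)
  \<comment> \<open>Expansion by components: the first two terms both contain the bracket of the two
    \<open>\<qq>\<close> components, so it is subtracted once.\<close>
  have "br y z = br y (proj_q z) - br z (proj_q y) - br (proj_q y) (proj_q z) + br (?p y) (?p z)"
    using br_anti[of z "proj_q y"] by (simp add: linear_diff'[OF br_left] linear_diff'[OF br_right])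
  then have "co_word [] \<Phi> (br y z) x = co_word [] \<Phi> (br y (proj_q z)) x - co_word [] \<Phi> (br z (proj_q y)) x
      - co_word [] \<Phi> (br (proj_q y) (proj_q z)) x + co_word [] \<Phi> (br (?p y) (?p z)) x"
    by (simp only: l)
  then show ?case unfolding P Q
    by (simp add: coact_def linear_add'[OF good_arg[OF Nil]] linear_zero'[OF pact_linear_left] proj_q_idem
       linear_zero'[OF good_arg[OF Nil]] linear_diff'[OF pact_linear_left] linear_diff'[OF good_arg[OF Nil]])
next
  case (Cons \<xi> w)
  have "br (br y z) \<xi> = br (br y \<xi>) z + br y (br z \<xi>)"
    using jacobi'[of y z \<xi>] br_anti[of "br y \<xi>" z] by (simp add: algebra_simps)
  then have j: "coact \<Phi> (br (br y z) \<xi>) w x = coact \<Phi> (br (br y \<xi>) z) w x + coact \<Phi> (br y (br z \<xi>)) w x"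
    by (simp add: coact_def linear_add'[OF co_word_linear[OF Cons.prems]])
  have step: "coact (coact \<Phi> y) z (\<xi> # w) x = coact (coact (\<lambda>w. \<Phi> (\<xi> # w)) y) z w x
      + coact (coact \<Phi> (br y \<xi>)) z w x + coact (coact \<Phi> y) (br z \<xi>) w x" for y z
    by (simp add: fun_cong[OF fun_cong[OF coact_shift[of "coact \<Phi> y" z \<xi>]]] coact_shift coact_add)
  show ?case
    unfolding step
    using Cons.IH[OF good_shift[OF Cons.prems, of \<xi>], of y z] Cons.IH[OF Cons.prems, of "br y \<xi>" z]
      Cons.IH[OF Cons.prems, of y "br z \<xi>"] j
    by (simp add: fun_cong[OF fun_cong[OF coact_shift[of \<Phi> _ \<xi>]]] algebra_simps)
qed

text \<open>If \<open>y\<close> and the word come from \<open>\<qq>\<close>, then \<open>y\<close>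
  arrives unchanged at the end of the word, and the commutation relations bring it back to the
  front. So \<open>y\<close> acts by left multiplication, as in the induced module.\<close>

lemma coact_q:
  "good \<Phi> \<Longrightarrow> proj_q y = y \<Longrightarrow> \<forall>\<xi>\<in>set w. proj_q \<xi> = \<xi> \<Longrightarrow> coact \<Phi> y w x = \<Phi> (y # w) x"
proof (induction w arbitrary: \<Phi> y)
  case Nil
  then show ?case using linear_zero'[OF pact_linear_left] linear_zero'[OF good_arg[OF Nil(1)]] by (simp add: coact_def)
next
  case (Cons \<xi> w)
  have "coact \<Phi> y (\<xi> # w) x = \<Phi> (\<xi> # y # w) x + \<Phi> (br y \<xi> # w) x"
    using Cons.IH[OF good_shift[OF Cons.prems(1), of \<xi>], of y] Cons.IH[OF Cons.prems(1), of "br y \<xi>"] Cons.prems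
    by (simp add: fun_cong[OF fun_cong[OF coact_shift[of \<Phi> _ \<xi>]]] proj_q_q)
  also have "\<dots> = \<Phi> (y # \<xi> # w) x" using good_rel[OF Cons.prems(1), of "[]" y \<xi>] by (simp add: algebra_simps)
  finally show ?case .
qed

lemma coact_p: "good \<Phi> \<Longrightarrow> proj_q y = 0 \<Longrightarrow> coact \<Phi> y [] x = \<Phi> [] (pact y x)"
  using linear_zero'[OF good_letter[of \<Phi> "[]" "[]" x]] by (simp add: coact_def)

text \<open>The recursion only removes letters from a word and appends some \<open>proj_q y\<close>,
  so words from \<open>\<qq>\<close> lead to words from \<open>\<qq>\<close>.\<close>

lemma coact_cong:
  assumes "\<And>w x. \<forall>\<xi>\<in>set w. proj_q \<xi> = \<xi> \<Longrightarrow> \<Phi> w x = \<Psi> w x" "\<forall>\<xi>\<in>set w. proj_q \<xi> = \<xi>"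
  shows "coact \<Phi> y w x = coact \<Psi> y w x"
  using assms
proof (induction w arbitrary: \<Phi> \<Psi> y)
  case Nil
  then show ?case by (simp add: coact_def proj_q_idem)
next
  case (Cons \<xi> w)
  have "coact (\<lambda>w. \<Phi> (\<xi> # w)) y w x = coact (\<lambda>w. \<Psi> (\<xi> # w)) y w x"
    using Cons.prems by (intro Cons.IH) auto
  moreover have "coact \<Phi> (br y \<xi>) w x = coact \<Psi> (br y \<xi>) w x"
    using Cons.prems by (intro Cons.IH) auto
  ultimately show ?case by (simp add: fun_cong[OF fun_cong[OF coact_shift]])
qed

lemma foldl_coact_cong:
  assumes "\<And>w x. \<forall>\<xi>\<in>set w. proj_q \<xi> = \<xi> \<Longrightarrow> \<Phi> w x = \<Psi> w x"
  shows "foldl coact \<Phi> ys [] x = foldl coact \<Psi> ys [] x"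
  using assms
proof (induction ys arbitrary: \<Phi> \<Psi>)
  case (Cons y ys)
  have "coact \<Phi> y w x = coact \<Psi> y w x" if "\<forall>\<xi>\<in>set w. proj_q \<xi> = \<xi>" for w x
    using Cons.prems that by (rule coact_cong)
  then show ?case unfolding foldl_Cons by (rule Cons.IH)
qed (simp add: assms)

lemma foldl_coact_add:
  "foldl coact (\<lambda>w x. \<Phi> w x + \<Psi> w x) ys w x = foldl coact \<Phi> ys w x + foldl coact \<Psi> ys w x"
proof (induction ys arbitrary: \<Phi> \<Psi>)
  case (Cons y ys)
  have "coact (\<lambda>w x. \<Phi> w x + \<Psi> w x) y = (\<lambda>w x. coact \<Phi> y w x + coact \<Psi> y w x)"
    by (simp add: fun_eq_iff coact_add)
  then show ?case by (simp add: Cons.IH)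
qed simp

lemma foldl_coact_hom:
  assumes "additive F" shows "foldl coact (\<lambda>w x. F (\<Phi> w x)) ys w x = F (foldl coact \<Phi> ys w x)"
proof (induction ys arbitrary: \<Phi>)
  case (Cons y ys)
  have "coact (\<lambda>w x. F (\<Phi> w x)) y = (\<lambda>w x. F (coact \<Phi> y w x))"
    by (simp add: fun_eq_iff coact_def co_word_hom[OF assms])
  then show ?case by (simp add: Cons.IH)
qed simp

lemma good_foldl: "good \<Phi> \<Longrightarrow> good (foldl coact \<Phi> ys)"
  by (induction ys arbitrary: \<Phi>) (simp_all add: good_coact)

text \<open>The value of \<open>\<Phi>\<close> at \<open>a (1 \<otimes> u)\<close>, where the empty
  word stands for the unit of \<open>U(\<qq>)\<close>.\<close>

definition coact_alg :: "('l list \<Rightarrow> 'u \<Rightarrow> 'z) \<Rightarrow> 'l free_alg \<Rightarrow> 'u \<Rightarrow> 'z"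
  where "coact_alg \<Phi> a u = lin_ext sZ (\<lambda>w. foldl coact \<Phi> (letters w) [] u) a"

lemma coact_alg_linear: "Vector_Spaces.linear pscale sZ (\<lambda>a. coact_alg \<Phi> a u)"
  unfolding coact_alg_def by (rule linear_lin_ext[OF vsZ])

lemma coact_alg_single: "coact_alg \<Phi> (Poly_Mapping.single w c) u = sZ c (foldl coact \<Phi> (letters w) [] u)"
  by (simp add: coact_alg_def lin_ext_single vsZ)

lemma coact_alg_word_mult: "coact_alg \<Phi> (Poly_Mapping.single w c * b) u = sZ c (coact_alg (foldl coact \<Phi> (letters w)) b u)"
proof (rule additive_eqI[where x = b])
  show "additive (\<lambda>b. coact_alg \<Phi> (Poly_Mapping.single w c * b) u)"
    by (rule additiveI) (simp add: distrib_left linear_add'[OF coact_alg_linear])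
  show "additive (\<lambda>b. sZ c (coact_alg (foldl coact \<Phi> (letters w)) b u))"
    by (rule additive_comp[OF additive_scale[OF vsZ] additive_linear[OF coact_alg_linear]])
qed (simp add: coact_alg_single mult_single vector_space.vector_space_assms(3)[OF vsZ])

lemma coact_alg_gen_mult: "coact_alg \<Phi> (gen \<xi> * b) u = coact_alg (coact \<Phi> \<xi>) b u"
  by (simp add: coact_alg_word_mult vector_space.vector_space_assms(4)[OF vsZ])

lemma coact_alg_add: "coact_alg (\<lambda>w x. \<Phi> w x + \<Psi> w x) a u = coact_alg \<Phi> a u + coact_alg \<Psi> a u"
  by (simp add: coact_alg_def lin_ext_def foldl_coact_add additive.add[OF additive_scale[OF vsZ]] sum.distrib)

lemma coact_alg_scale: "coact_alg (\<lambda>w x. sZ c (\<Phi> w x)) a u = sZ c (coact_alg \<Phi> a u)"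
  by (simp add: coact_alg_def lin_ext_def foldl_coact_hom additive_scale vsZ additive.sum[OF additive_scale[OF vsZ]]
     vector_space.vector_space_assms(3)[OF vsZ] mult.commute)

lemma coact_alg_minus: "coact_alg (\<lambda>w x. - \<Phi> w x) a u = - coact_alg \<Phi> a u"
  using coact_alg_scale[of "-1" \<Phi> a u] by (simp add: module.scale_minus_left vector_space_module vsZ
      vector_space.vector_space_assms(4))

lemma coact_alg_diff: "coact_alg (\<lambda>w x. \<Phi> w x - \<Psi> w x) a u = coact_alg \<Phi> a u - coact_alg \<Psi> a u"
  using coact_alg_add[of \<Phi> "\<lambda>w x. - \<Psi> w x" a u] by (simp add: coact_alg_minus)

lemma coact_alg_cong:
  "(\<And>w x. \<forall>\<xi>\<in>set w. proj_q \<xi> = \<xi> \<Longrightarrow> \<Phi> w x = \<Psi> w x) \<Longrightarrow> coact_alg \<Phi> a u = coact_alg \<Psi> a u"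
  unfolding coact_alg_def by (rule arg_cong[where f = "\<lambda>h. lin_ext sZ h a"], rule ext, rule foldl_coact_cong)

lemma coact_alg_linear_arg: "good \<Phi> \<Longrightarrow> Vector_Spaces.linear sU sZ (coact_alg \<Phi> a)"
  unfolding coact_alg_def lin_ext_def
proof (rule linear_sum'[OF vsU vsZ])
  fix w assume g: "good \<Phi>"
  have "Vector_Spaces.linear sZ sZ (sZ c)" for c
    by (rule linearI') (simp_all add: additive_scale vsZ vector_space.vector_space_assms(3) mult.commute)
  with good_arg[OF good_foldl[OF g]]
  show "Vector_Spaces.linear sU sZ (\<lambda>u. sZ (Poly_Mapping.lookup a w) (foldl coact \<Phi> (letters w) [] u))"
    by (rule linear_comp')
qed

definition env_rels :: "'l free_alg set"
  where "env_rels =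
    {gen (\<xi> + \<eta>) - gen \<xi> - gen \<eta> |\<xi> \<eta>. True} \<union>
    {gen (sL c \<xi>) - pscale c (gen \<xi>) |c \<xi>. True} \<union>
    {gen \<xi> * gen \<eta> - gen \<eta> * gen \<xi> - gen (br \<xi> \<eta>) |\<xi> \<eta>. True}"

lemma coact_alg_rel_mult:
  assumes "good \<Phi>" "r \<in> env_rels" shows "coact_alg \<Phi> (r * b) u = 0"
proof -
  note lin = linear_diff'[OF coact_alg_linear] linear_scale'[OF coact_alg_linear] coact_alg_gen_mult mult.assoc
    left_diff_distrib linear_scale'[OF linear_mult_right]
  have "coact \<Phi> (\<xi> + \<eta>) = (\<lambda>w x. coact \<Phi> \<xi> w x + coact \<Phi> \<eta> w x)" for \<xi> \<eta>
    by (simp add: fun_eq_iff coact_def linear_add'[OF co_word_linear[OF assms(1)]])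
  then have 1: "coact_alg (coact \<Phi> (\<xi> + \<eta>)) b u = coact_alg (coact \<Phi> \<xi>) b u + coact_alg (coact \<Phi> \<eta>) b u" for \<xi> \<eta>
    by (simp add: coact_alg_add)
  have "coact \<Phi> (sL c \<xi>) = (\<lambda>w x. sZ c (coact \<Phi> \<xi> w x))" for c \<xi>
    by (simp add: fun_eq_iff coact_def linear_scale'[OF co_word_linear[OF assms(1)]])
  then have 2: "coact_alg (coact \<Phi> (sL c \<xi>)) b u = sZ c (coact_alg (coact \<Phi> \<xi>) b u)" for c \<xi>
    by (simp add: coact_alg_scale)
  have "coact \<Phi> (br \<xi> \<eta>) = (\<lambda>w x. coact (coact \<Phi> \<xi>) \<eta> w x - coact (coact \<Phi> \<eta>) \<xi> w x)" for \<xi> \<eta>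
    by (simp add: fun_eq_iff coact_br[OF assms(1)])
  then have 3: "coact_alg (coact \<Phi> (br \<xi> \<eta>)) b u = coact_alg (coact (coact \<Phi> \<xi>) \<eta>) b u - coact_alg (coact (coact \<Phi> \<eta>) \<xi>) b u" for \<xi> \<eta>
    by (simp add: coact_alg_diff)
  show ?thesis using assms(2) unfolding env_rels_def by (auto simp: lin 1 2 3 coact_alg_word_mult vector_space.vector_space_assms(4)[OF vsZ])
qed

lemma coact_alg_ideal:
  assumes "good \<Phi>" "a \<in> two_sided_ideal env_rels" shows "coact_alg \<Phi> a u = 0"
  using coact_alg_linear _ assms(2)[unfolded two_sided_ideal_def]
proof (rule linear_span_zero, safe)
  fix a r b assume r: "r \<in> env_rels"
  show "coact_alg \<Phi> (a * r * b) u = 0"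
  proof (induction a rule: pm_induct)
    case (single w c)
    show ?case by (simp add: mult.assoc coact_alg_word_mult coact_alg_rel_mult[OF good_foldl[OF assms(1)] r]
       additive.zero[OF additive_scale[OF vsZ]])
  qed (simp add: distrib_right linear_add'[OF coact_alg_linear])
qed

text \<open>At the empty word an element of \<open>\<pp>\<close> has no letter to pass and no
  component to append, so it acts on \<open>u\<close> through \<open>pact\<close> alone. A trailing
  factor is the first one to act.\<close>

lemma coact_alg_mult_p:
  assumes "good \<Phi>" "\<forall>w\<in>Poly_Mapping.keys b. set (letters w) \<subseteq> {\<xi>. proj_q \<xi> = 0}"
  shows "coact_alg \<Phi> (a * b) u = coact_alg \<Phi> a (free_alg_act sU pact b u)"
proof (induction a rule: pm_induct)
  case (single w c)
  define \<Psi> where "\<Psi> = foldl coact \<Phi> (letters w)"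
  have \<Psi>: "good \<Psi>" by (simp add: \<Psi>_def good_foldl assms(1))
  have *: "foldl coact \<Psi> ys [] u = \<Psi> [] (foldr pact ys u)" if "set ys \<subseteq> {\<xi>. proj_q \<xi> = 0}" for ys
    using that \<Psi>
  proof (induction ys arbitrary: \<Psi>)
    case (Cons y ys)
    then show ?case by (simp add: good_coact coact_p)
  qed simp
  have "coact_alg \<Psi> b u = \<Psi> [] (free_alg_act sU pact b u)"
    using assms(2) by (simp add: coact_alg_def lin_ext_def free_alg_act_def * 
      additive.sum[OF additive_linear[OF good_arg[OF \<Psi>]]] linear_scale'[OF good_arg[OF \<Psi>]])
  then show ?case by (simp add: coact_alg_word_mult coact_alg_single \<Psi>_def)
qed (simp add: distrib_right linear_add'[OF coact_alg_linear])

text \<open>Every good functional therefore defines a linear map on the induced module. This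
  universal property replaces a basis of \<open>U(\<qq>)\<close>.\<close>

lemma coact_alg_induced_rels:
  assumes "good \<Phi>" "f \<in> induced_rels (two_sided_ideal env_rels) {\<xi>. proj_q \<xi> = 0} sU pact"
  shows "lin_ext sZ (\<lambda>(a, u). coact_alg \<Phi> a u) f = 0"
proof -
  note lin = linear_lin_ext[OF vsZ, of "\<lambda>(a, u). coact_alg \<Phi> a u"]
  have "coact_alg \<Phi> a u = coact_alg \<Phi> a' u" if "a - a' \<in> two_sided_ideal env_rels" for a a' u
    using coact_alg_ideal[OF assms(1) that, of u] by (simp add: linear_diff'[OF coact_alg_linear])
  then show ?thesis
    by (rule_tac linear_span_zero[OF lin _ assms(2)[unfolded induced_rels_def]])
      (auto simp: linear_diff'[OF lin] lin_ext_single vsZ linear_add'[OF coact_alg_linear] linear_scale'[OF coact_alg_linear]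
        vector_space.vector_space_assms(4)[OF vsZ]
        linear_add'[OF coact_alg_linear_arg[OF assms(1)]] linear_scale'[OF coact_alg_linear_arg[OF assms(1)]] coact_alg_mult_p[OF assms(1)])
qed

end


section \<open>Operators on Laurent polynomials with tensor coefficients\<close>

lemma commute_mult:
  fixes a :: "'a::semigroup_mult"
  assumes "a * b = b * a" "a * c = c * a" shows "a * (b * c) = b * c * a"
proof -
  have "a * (b * c) = b * a * c" by (simp only: mult.assoc[symmetric] assms(1))
  also have "\<dots> = b * c * a" by (simp only: mult.assoc assms(2))
  finally show ?thesis .
qed

lemma commute_sum:
  fixes a :: "'a::ring"
  assumes "\<And>i. i \<in> I \<Longrightarrow> a * f i = f i * a" shows "a * sum f I = sum f I * a"
  using assms by (simp add: sum_distrib_left sum_distrib_right)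

abbreviation tmono :: "'a \<Rightarrow> 'b \<Rightarrow> 'v::zero \<Rightarrow> ('a \<Rightarrow>\<^sub>0 ('b \<Rightarrow>\<^sub>0 'v))"
  where "tmono a e v \<equiv> Poly_Mapping.single a (Poly_Mapping.single e v)"

lemma additive_mono: "additive (tmono a e)"
  by (rule additiveI) (simp add: single_add)

lemma additive_mono_app [simp]: "additive (\<lambda>v. tmono a e (app D v))"
  by (rule additive_comp[OF additive_mono additive_app])

lemma additive_mono_scale: "vector_space s \<Longrightarrow> additive (\<lambda>v. tmono a e (s c v))"
  by (rule additive_comp[OF additive_mono additive_scale])

lemma mono_induct [case_names mono add]:
  assumes "\<And>a e v. P (tmono a e v)" "\<And>f g. P f \<Longrightarrow> P g \<Longrightarrow> P (f + g)"
  shows "P (w :: 'a \<Rightarrow>\<^sub>0 ('b \<Rightarrow>\<^sub>0 'v::ab_group_add))"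
proof (induction w rule: pm_induct)
  case (single a y)
  then show ?case by (induction y rule: pm_induct) (simp_all add: assms single_add)
qed (rule assms(2))

lemma additive_mono_eqI:
  assumes "additive f" "additive g" "\<And>a e v. f (tmono a e v) = g (tmono a e v)"
  shows "f w = g (w :: 'a \<Rightarrow>\<^sub>0 ('b \<Rightarrow>\<^sub>0 'v::ab_group_add))"
  by (induction w rule: mono_induct) (simp_all add: assms(3) additive.add[OF assms(1)] additive.add[OF assms(2)])

lemma endo_mono_eqI: "(\<And>a e v. app A (tmono a e v) = app B (tmono a e v)) \<Longrightarrow> A = B"
  by (rule endo_eqI, rule additive_mono_eqI) auto

definition monomial_op :: "('a \<Rightarrow> 'b \<Rightarrow> 'v \<Rightarrow> ('a \<Rightarrow>\<^sub>0 ('b \<Rightarrow>\<^sub>0 'v))) \<Rightarrow> ('a \<Rightarrow>\<^sub>0 ('b \<Rightarrow>\<^sub>0 'v::ab_group_add)) endo"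
  where "monomial_op h = Abs_endo (pm_ext (\<lambda>a. pm_ext (h a)))"

lemma app_monomial_op:
  assumes "\<And>a e. additive (h a e)"
  shows "app (monomial_op h) (tmono a e v) = h a e v"
  by (simp add: monomial_op_def app_Abs additive_pm_ext assms)

text \<open>Multiplication by the Laurent monomial with exponent vector \<open>c\<close>. Below,
  \<open>E p x y\<close> is the matrix unit \<open>E\<^sub>x\<^sub>y\<close> in the tensor factor
  \<open>p\<close>, and a permutation is split into \<open>perm_vars\<close> and
  \<open>perm_sites\<close> because \<open>z\<^sub>p\<close> uses the second without the
  first.\<close>

definition shift_op :: "int^'n \<Rightarrow> ('n::finite, 'm, 'v::ab_group_add) AN endo"
  where "shift_op c = monomial_op (\<lambda>a e. tmono (a + c) e)"

definition E :: "'n \<Rightarrow> 'm \<Rightarrow> 'm \<Rightarrow> ('n::finite, 'm, 'v::ab_group_add) AN endo"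
  where "E p x y = monomial_op (\<lambda>a e v. if e p = y then tmono a (e(p := x)) v else 0)"

definition coeff_op :: "'v endo \<Rightarrow> ('n::finite, 'm, 'v::ab_group_add) AN endo"
  where "coeff_op D = monomial_op (\<lambda>a e v. tmono a e (app D v))"

definition perm_vec :: "'n perm \<Rightarrow> int^'n \<Rightarrow> int^'n::finite"
  where "perm_vec \<sigma> a = (\<chi> q. a $ (inverse \<sigma> \<langle>$\<rangle> q))"

definition perm_idx :: "'n perm \<Rightarrow> ('n \<Rightarrow> 'm) \<Rightarrow> 'n \<Rightarrow> 'm"
  where "perm_idx \<sigma> e = (\<lambda>q. e (inverse \<sigma> \<langle>$\<rangle> q))"

definition perm_vars :: "'n perm \<Rightarrow> ('n::finite, 'm, 'v::ab_group_add) AN endo"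
  where "perm_vars \<sigma> = monomial_op (\<lambda>a e. tmono (perm_vec \<sigma> a) e)"

definition perm_sites :: "'n perm \<Rightarrow> ('n::finite, 'm, 'v::ab_group_add) AN endo"
  where "perm_sites \<sigma> = monomial_op (\<lambda>a e. tmono a (perm_idx \<sigma> e))"

lemma app_shift_op [simp]: "app (shift_op c) (tmono a e v) = tmono (a + c) e v"
  by (simp add: shift_op_def app_monomial_op additive_mono)

lemma app_E: "app (E p x y) (tmono a e v) = (if e p = y then tmono a (e(p := x)) v else 0)"
proof -
  have "additive (\<lambda>v. if e p = y then tmono a (e(p := x)) v else 0)" for a :: "int^'n" and e
    by (cases "e p = y") (simp_all add: additive_mono)
  then show ?thesis unfolding E_def by (rule app_monomial_op)
qed

lemma app_coeff_op [simp]: "app (coeff_op D) (tmono a e v) = tmono a e (app D v)"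
  by (simp add: coeff_op_def app_monomial_op)

lemma app_perm_vars [simp]: "app (perm_vars \<sigma>) (tmono a e v) = tmono (perm_vec \<sigma> a) e v"
  by (simp add: perm_vars_def app_monomial_op additive_mono)

lemma app_perm_sites [simp]: "app (perm_sites \<sigma>) (tmono a e v) = tmono a (perm_idx \<sigma> e) v"
  by (simp add: perm_sites_def app_monomial_op additive_mono)

lemma perm_inverse_apply [simp]: "inverse \<sigma> \<langle>$\<rangle> (\<sigma> \<langle>$\<rangle> p) = p" "\<sigma> \<langle>$\<rangle> (inverse \<sigma> \<langle>$\<rangle> p) = p"
  by (simp_all add: apply_inverse bij_is_inj bij_is_surj surj_f_inv_f)

lemma perm_inverse_mult: "inverse (\<sigma> * \<tau>) = inverse \<tau> * inverse (\<sigma> :: 'a perm)"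
  by (rule perm_eqI) (metis apply_inj apply_sequence comp_apply perm_inverse_apply(2))

lemma perm_inverse_one [simp]: "inverse (1 :: 'a perm) = 1"
  by (metis apply_inj apply_one id_apply perm_eqI perm_inverse_apply(1))

lemma apply_mult: "(\<sigma> * \<tau>) \<langle>$\<rangle> p = \<sigma> \<langle>$\<rangle> (\<tau> \<langle>$\<rangle> p)"
  by (simp add: apply_times)

lemma perm_vec_simps [simp]: "perm_vec 1 a = a" "perm_vec \<sigma> (perm_vec \<tau> a) = perm_vec (\<sigma> * \<tau>) a"
  "perm_vec \<sigma> (a + b) = perm_vec \<sigma> a + perm_vec \<sigma> b" "perm_vec \<sigma> 0 = 0" "perm_vec \<sigma> (axis p j) = axis (\<sigma> \<langle>$\<rangle> p) j"
  by (auto simp: perm_vec_def vec_eq_iff perm_inverse_mult apply_mult axis_def)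

lemma perm_idx_simps [simp]: "perm_idx 1 e = e" "perm_idx \<sigma> (perm_idx \<tau> e) = perm_idx (\<sigma> * \<tau>) e"
  "perm_idx \<sigma> (e(p := x)) = (perm_idx \<sigma> e)(\<sigma> \<langle>$\<rangle> p := x)" "perm_idx \<sigma> e (\<sigma> \<langle>$\<rangle> p) = e p"
  by (auto simp: perm_idx_def fun_eq_iff perm_inverse_mult apply_mult)

lemma shift_op_mult: "shift_op c * shift_op d = shift_op (c + d)"
  by (rule endo_mono_eqI) (simp add: ac_simps)

lemma shift_op_zero: "shift_op 0 = 1"
  by (rule endo_mono_eqI) simp

lemma shift_op_comm: "shift_op c * shift_op d = shift_op d * shift_op c"
  by (simp add: shift_op_mult add.commute)

lemma E_shift_op: "E p x y * shift_op c = shift_op c * E p x y"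
  by (rule endo_mono_eqI) (simp add: app_E)

lemma coeff_op_shift_op: "coeff_op D * shift_op c = shift_op c * coeff_op D"
  by (rule endo_mono_eqI) simp

lemma E_coeff_op: "E p x y * coeff_op D = coeff_op D * E p x y"
  by (rule endo_mono_eqI) (simp add: app_E)

lemma E_mult: "E p x y * E p z w = (if y = z then E p x w else 0)"
  by (rule endo_mono_eqI) (auto simp: app_E)

lemma E_comm: "p \<noteq> q \<Longrightarrow> E p x y * E q z w = E q z w * E p x y"
  by (rule endo_mono_eqI) (auto simp: app_E fun_upd_twist)

lemma E_sum: "(\<Sum>x\<in>UNIV. E p x x) = (1 :: ('n::finite, 'm::finite, 'v::ab_group_add) AN endo)"
  by (rule endo_mono_eqI) (simp add: app_sum_left app_E sum.delta')

lemma perm_vars_mult: "perm_vars \<sigma> * perm_vars \<tau> = perm_vars (\<sigma> * \<tau>)"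
  by (rule endo_mono_eqI) simp

lemma perm_sites_mult: "perm_sites \<sigma> * perm_sites \<tau> = perm_sites (\<sigma> * \<tau>)"
  by (rule endo_mono_eqI) simp

lemma perm_vars_one: "perm_vars 1 = 1"
  by (rule endo_mono_eqI) simp

lemma perm_sites_one: "perm_sites 1 = 1"
  by (rule endo_mono_eqI) simp

lemma perm_vars_shift_op: "perm_vars \<sigma> * shift_op c = shift_op (perm_vec \<sigma> c) * perm_vars \<sigma>"
  by (rule endo_mono_eqI) simp

lemma perm_vars_E: "perm_vars \<sigma> * E p x y = E p x y * perm_vars \<sigma>"
  by (rule endo_mono_eqI) (simp add: app_E)

lemma perm_vars_coeff_op: "coeff_op D * perm_vars \<sigma> = perm_vars \<sigma> * coeff_op D"
  by (rule endo_mono_eqI) simp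

lemma perm_vars_perm_sites: "perm_vars \<sigma> * perm_sites \<tau> = perm_sites \<tau> * perm_vars \<sigma>"
  by (rule endo_mono_eqI) simp

lemma perm_sites_shift_op: "perm_sites \<sigma> * shift_op c = shift_op c * perm_sites \<sigma>"
  by (rule endo_mono_eqI) simp

lemma perm_sites_E: "perm_sites \<sigma> * E p x y = E (\<sigma> \<langle>$\<rangle> p) x y * perm_sites \<sigma>"
  by (rule endo_mono_eqI) (simp add: app_E)

lemma perm_sites_coeff_op: "coeff_op D * perm_sites \<sigma> = perm_sites \<sigma> * coeff_op D"
  by (rule endo_mono_eqI) simp

lemma perm_idx_swap: "p \<noteq> q \<Longrightarrow> perm_idx \<langle>p \<leftrightarrow> q\<rangle> e = e(p := e q, q := e p)"
  by (auto simp: perm_idx_def fun_eq_iff)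

text \<open>On a basis vector only the pair \<open>x = e q\<close>, \<open>y = e p\<close> survives,
  and it exchanges the two indices. Through this identity Casimir sums give rise to
  transpositions.\<close>

lemma perm_sites_swap:
  assumes "p \<noteq> q"
  shows "(\<Sum>x\<in>UNIV. \<Sum>y\<in>UNIV. E p x y * E q y x) = (perm_sites \<langle>p \<leftrightarrow> q\<rangle> :: ('n::finite, 'm::finite, 'v::ab_group_add) AN endo)"
proof (rule endo_mono_eqI)
  fix a :: "int^'n" and e :: "'n \<Rightarrow> 'm" and v :: 'v
  have "app (E p x y * E q y x) (tmono a e v) = (if x = e q then if y = e p then tmono a (perm_idx \<langle>p \<leftrightarrow> q\<rangle> e) v else 0 else 0)" for x y
    using assms by (auto simp: app_E perm_idx_swap fun_upd_twist)
  then have "(\<Sum>y\<in>UNIV. app (E p x y * E q y x) (tmono a e v)) = (if x = e q then tmono a (perm_idx \<langle>p \<leftrightarrow> q\<rangle> e) v else 0)" for x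
    by (cases "x = e q") (simp_all del: app_simps)
  then show "app (\<Sum>x\<in>UNIV. \<Sum>y\<in>UNIV. E p x y * E q y x) (tmono a e v) = app (perm_sites \<langle>p \<leftrightarrow> q\<rangle>) (tmono a e v)"
    by (simp add: app_sum_left del: app_simps)
qed

text \<open>Multiplication by \<open>x\<^sub>p - x\<^sub>r\<close> is injective: a polynomial that it annihilates has a support
  invariant under the shift by \<open>e\<^sub>p - e\<^sub>r\<close>.\<close>

lemma shift_invariant_zero:
  fixes f :: "int^'n::finite \<Rightarrow>\<^sub>0 'x::zero"
  assumes "p \<noteq> r" "\<And>a. Poly_Mapping.lookup f (a - axis p 1) = Poly_Mapping.lookup f (a - axis r 1)"
  shows "f = 0"
proof (rule ccontr)
  assume "f \<noteq> 0"
  then obtain a where a: "Poly_Mapping.lookup f a \<noteq> 0" by (metis lookup_zero poly_mapping_eqI)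
  let ?d = "axis p 1 - axis r 1 :: int^'n"
  have step: "Poly_Mapping.lookup f (b + ?d) = Poly_Mapping.lookup f b" for b
    using assms(2)[of "b + axis p 1"] by (simp add: algebra_simps)
  define g where "g k = a + of_nat k *s ?d" for k
  have "Poly_Mapping.lookup f (g k) = Poly_Mapping.lookup f a" for k
  proof (induction k)
    case (Suc k)
    have "g (Suc k) = g k + ?d" by (simp add: g_def vec_eq_iff algebra_simps)
    then show ?case using step Suc by metis
  qed (simp add: g_def vec_eq_iff)
  then have "range g \<subseteq> Poly_Mapping.keys f" using a by (auto simp: in_keys_iff)
  then have "finite (range g)" using finite_subset finite_keys by blast
  moreover have "inj g"
  proof (rule injI)
    fix k l assume "g k = g l"
    then have "g k $ p = g l $ p" by simp
    then show "k = l" using assms(1) by (simp add: g_def axis_def)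
  qed
  ultimately show False using finite_imageD infinite_UNIV_nat by blast
qed

lemma lookup_shift_op: "Poly_Mapping.lookup (app (shift_op c) w) a = Poly_Mapping.lookup w (a - c)"
proof (rule additive_mono_eqI[where w = w])
  show "additive (\<lambda>w. Poly_Mapping.lookup (app (shift_op c) w) a)" "additive (\<lambda>w. Poly_Mapping.lookup w (a - c))"
    by (auto intro!: additiveI simp: lookup_add app_add)
qed (auto simp: lookup_single when_def)

definition xdiff :: "'n \<Rightarrow> 'n \<Rightarrow> ('n::finite, 'm, 'v::ab_group_add) AN endo"
  where "xdiff p r = shift_op (axis p 1) - shift_op (axis r 1)"

lemma xdiff_inj: "p \<noteq> r \<Longrightarrow> app (xdiff p r) w = 0 \<Longrightarrow> w = 0"
  by (rule shift_invariant_zero[of p r]) (simp_all add: xdiff_def poly_mapping_eq_iff fun_eq_iff lookup_minus lookup_shift_op)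

text \<open>The method for all identities about divided differences: after multiplication by
  \<open>x\<^sub>p - x\<^sub>r\<close> their defining equation applies, and the factor can be
  cancelled.\<close>

lemma xdiff_cancel: "p \<noteq> r \<Longrightarrow> xdiff p r * A = xdiff p r * B \<Longrightarrow> A = B"
proof (rule endo_eqI)
  fix w assume "p \<noteq> r" "xdiff p r * A = xdiff p r * B"
  then have "app (xdiff p r * A) w - app (xdiff p r * B) w = 0" by simp
  then have "app (xdiff p r) (app A w - app B w) = 0" by (simp add: app_diff)
  from xdiff_inj[OF \<open>p \<noteq> r\<close> this] show "app A w = app B w" by simp
qed

lemma xpow_mult: "xpow p i * xpow p j = xpow p (i + j)"
proof -
  have "axis p i + axis p j = axis p (i + j)" by (simp add: axis_def vec_eq_iff)
  then show ?thesis by (simp add: xpow_def mult_single)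
qed

lemma perm_laurent_basis: "perm_laurent \<sigma> (basis_vec a) = basis_vec (perm_vec \<sigma> a)"
  by (simp add: perm_laurent_def perm_vec_def)

lemma lookup_xpow_mult: "Poly_Mapping.lookup (xpow p j * f) a = Poly_Mapping.lookup f (a - axis p j)"
proof (rule additive_eqI[where x = f])
  show "additive (\<lambda>f. Poly_Mapping.lookup (xpow p j * f) a)" "additive (\<lambda>f. Poly_Mapping.lookup f (a - axis p j))"
    by (auto intro!: additiveI simp: lookup_add distrib_left)
qed (auto simp: xpow_def mult_single lookup_single when_def algebra_simps)

lemma xpow_diff_cancel:
  assumes "p \<noteq> r" "(xpow p 1 - xpow r 1) * g = (xpow p 1 - xpow r 1) * h" shows "g = h"
proof -
  have "(xpow p 1 - xpow r 1) * (g - h) = 0" using assms(2) by (simp add: right_diff_distrib)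
  then have "Poly_Mapping.lookup (xpow p 1 * (g - h) - xpow r 1 * (g - h)) a = 0" for a
    by (simp add: left_diff_distrib)
  then have "g - h = 0" using assms(1)
    by (intro shift_invariant_zero[of p r]) (simp_all only: lookup_minus lookup_xpow_mult right_minus_eq, simp)
  then show ?thesis by simp
qed

lemma xpow_zero: "xpow p 0 = 1"
proof -
  have "axis p (0 :: int) = 0" by (simp add: axis_def vec_eq_iff)
  then show ?thesis unfolding xpow_def by (simp only: single_one)
qed

lemma xpow_nat: "xpow p 1 ^ k = xpow p (int k)"
  by (induction k) (simp_all add: xpow_mult xpow_zero)

text \<open>Dividing by \<open>x\<^sub>p\<close> to the power \<open>k = a $ p - a $ r\<close>
  leaves a monomial with equal exponents at \<open>p\<close> and \<open>r\<close>, which the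
  transposition fixes. So a monomial and its image differ only in a factor
  \<open>x\<^sub>p\<^sup>k\<close> or \<open>x\<^sub>r\<^sup>k\<close>.\<close>

lemma perm_vec_swap_diff:
  assumes "p \<noteq> r"
  shows "a = (a - axis p (a $ p - a $ r)) + axis p (a $ p - a $ r)"
    "perm_vec \<langle>p \<leftrightarrow> r\<rangle> a = (a - axis p (a $ p - a $ r)) + axis r (a $ p - a $ r)"
  using assms
  by (auto simp: vec_eq_iff axis_def perm_vec_def)

text \<open>For a monomial the difference is a common factor times
  \<open>x\<^sub>p\<^sup>k - x\<^sub>r\<^sup>k\<close>, which for \<open>k \<ge> 0\<close> is
  divisible by the usual factorization of a difference of powers.\<close>

lemma xpow_diff_dvd:
  assumes "p \<noteq> r" shows "xpow p 1 - xpow r 1 dvd f - perm_laurent \<langle>p \<leftrightarrow> r\<rangle> f"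
proof (induction f rule: pm_induct)
  case (single a c)
  have basis: "xpow p 1 - xpow r 1 dvd basis_vec a - basis_vec (perm_vec \<langle>p \<leftrightarrow> r\<rangle> a)"
    if "a $ p \<ge> a $ r" for a
  proof -
    let ?k = "nat (a $ p - a $ r)" and ?b = "a - axis p (a $ p - a $ r)"
    have "xpow p 1 - xpow r 1 dvd xpow p 1 ^ ?k - xpow r 1 ^ ?k"
      by (simp add: power_diff_sumr2)
    then have "xpow p 1 - xpow r 1 dvd basis_vec ?b * (xpow p 1 ^ ?k - xpow r 1 ^ ?k)" by simp
    moreover have "basis_vec ?b * (xpow p 1 ^ ?k - xpow r 1 ^ ?k) = basis_vec a - basis_vec (perm_vec \<langle>p \<leftrightarrow> r\<rangle> a)"
      using that perm_vec_swap_diff[OF assms, of a]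
      by (simp only: xpow_nat right_diff_distrib) (simp add: xpow_def mult_single)
    ultimately show ?thesis by simp
  qed
  have "xpow p 1 - xpow r 1 dvd basis_vec a - basis_vec (perm_vec \<langle>p \<leftrightarrow> r\<rangle> a)" for a
  proof (cases "a $ p \<ge> a $ r")
    case False
    \<comment> \<open>If \<open>k\<close> is negative, the monomial and its image exchange roles and
      the difference only changes sign.\<close>
    then have *: "perm_vec \<langle>p \<leftrightarrow> r\<rangle> a $ p \<ge> perm_vec \<langle>p \<leftrightarrow> r\<rangle> a $ r" by (simp add: perm_vec_def)
    have "\<langle>p \<leftrightarrow> r\<rangle> * \<langle>p \<leftrightarrow> r\<rangle> = 1" by (metis inverse_swap mult_1 perm_eq_iff perm_inverse_apply(1) apply_mult apply_one id_apply)
    then show ?thesis using basis[OF *] by simp (metis dvd_minus_iff minus_diff_eq)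
  qed (rule basis)
  moreover have "Poly_Mapping.single a c - perm_laurent \<langle>p \<leftrightarrow> r\<rangle> (Poly_Mapping.single a c)
      = Poly_Mapping.single 0 c * (basis_vec a - basis_vec (perm_vec \<langle>p \<leftrightarrow> r\<rangle> a))"
    by (simp add: perm_laurent_def perm_vec_def lin_ext_single right_diff_distrib mult_single)
  ultimately show ?case by simp
next
  case (add f g)
  have "additive (perm_laurent \<langle>p \<leftrightarrow> r\<rangle>)" by (simp add: perm_laurent_def additive_lin_ext)
  then have "(f + g) - perm_laurent \<langle>p \<leftrightarrow> r\<rangle> (f + g) = (f - perm_laurent \<langle>p \<leftrightarrow> r\<rangle> f) + (g - perm_laurent \<langle>p \<leftrightarrow> r\<rangle> g)"
    by (simp add: additive.add)
  then show ?case using add by (metis dvd_add)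
qed

text \<open>The definite description is justified: divisibility provides a solution, and
  cancellation of \<open>x\<^sub>p - x\<^sub>r\<close> makes it unique.\<close>

lemma divided_diff:
  assumes "p \<noteq> r"
  shows "(xpow p 1 - xpow r 1) * divided_diff p r f = xpow p 1 * (f - perm_laurent \<langle>p \<leftrightarrow> r\<rangle> f)"
proof -
  obtain g where g: "f - perm_laurent \<langle>p \<leftrightarrow> r\<rangle> f = (xpow p 1 - xpow r 1) * g"
    using xpow_diff_dvd[OF assms] by (rule dvdE)
  show ?thesis unfolding divided_diff_def
  proof (rule theI)
    show "(xpow p 1 - xpow r 1) * (xpow p 1 * g) = xpow p 1 * (f - perm_laurent \<langle>p \<leftrightarrow> r\<rangle> f)"
      unfolding g by (rule mult.left_commute)
    fix h assume "(xpow p 1 - xpow r 1) * h = xpow p 1 * (f - perm_laurent \<langle>p \<leftrightarrow> r\<rangle> f)"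
    then have "(xpow p 1 - xpow r 1) * h = (xpow p 1 - xpow r 1) * (xpow p 1 * g)"
      unfolding g by (simp only: mult.left_commute)
    then show "h = xpow p 1 * g" by (rule xpow_diff_cancel[OF assms])
  qed
qed

section \<open>Scalars, matrices at one site, and Casimir sums\<close>

lemma unit_mult_right: "(matrix_unit y x ** Q) $ i $ j = (if i = y then Q $ x $ j else (0::complex))"
  by (simp add: matrix_matrix_mult_def matrix_unit_def if_distrib[of "\<lambda>c. c * _"] sum.delta cong: if_cong)

lemma unit_mult_left: "(Q ** matrix_unit y x) $ i $ j = (if j = x then Q $ i $ y else (0::complex))"
  by (simp add: matrix_matrix_mult_def matrix_unit_def if_distrib[of "(*) _"] sum.delta cong: if_cong)

locale scaled =
  fixes s :: "complex \<Rightarrow> 'v \<Rightarrow> 'v::ab_group_add"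
  assumes vs: "vector_space s"
begin

text \<open>Scalars act through the innermost coefficient space, so that their commutation rules are
  instances of those for \<open>coeff_op\<close>.\<close>

definition S :: "complex \<Rightarrow> ('n::finite, 'm::finite, 'v) AN endo"
  where "S c = coeff_op (Abs_endo (s c))"

lemma app_scale [simp]: "app (Abs_endo (s c)) v = s c v"
  by (simp add: app_Abs additive_scale[OF vs])

lemma app_S [simp]: "app (S c) (tmono a e v) = tmono a e (s c v)"
  by (simp add: S_def)

lemma S_scale: "fscale (fscale s) c w = app (S c) w"
  by (rule additive_mono_eqI) (simp_all add: additive_scale vs)

lemma S_mult: "S c * S d = S (c * d)"
  by (rule endo_mono_eqI) (simp add: vector_space.vector_space_assms(3)[OF vs])

lemma S_add: "S c + S d = S (c + d)"
  by (rule endo_mono_eqI) (simp add: vector_space.vector_space_assms(2)[OF vs] single_add)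

lemma S_one: "S 1 = 1"
  by (rule endo_mono_eqI) (simp add: vector_space.vector_space_assms(4)[OF vs])

lemma S_zero: "S 0 = 0"
  by (rule endo_mono_eqI) (simp add: additive.zero[OF additive_scale_left[OF vs]])

lemma S_sum: "S (sum f I) = (\<Sum>i\<in>I. S (f i))"
  by (induction I rule: infinite_finite_induct) (simp_all add: S_zero S_add[symmetric])

lemma S_shift_op: "S c * shift_op d = shift_op d * S c"
  and S_E: "S c * E p x y = E p x y * S c"
  and S_perm_vars: "S c * perm_vars \<sigma> = perm_vars \<sigma> * S c"
  and S_perm_sites: "S c * perm_sites \<sigma> = perm_sites \<sigma> * S c"
  unfolding S_def by (rule coeff_op_shift_op, rule E_coeff_op[symmetric], rule perm_vars_coeff_op, rule perm_sites_coeff_op)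

lemma S_comm: "S c * S d = S d * S c"
  by (simp add: S_mult mult.commute)

definition M :: "'n \<Rightarrow> complex^'m^'m \<Rightarrow> ('n::finite, 'm::finite, 'v) AN endo"
  where "M p P = (\<Sum>x\<in>UNIV. \<Sum>y\<in>UNIV. S (P $ x $ y) * E p x y)"

lemma app_M: "app (M p P) (tmono a e v) = (\<Sum>x\<in>UNIV. tmono a (e(p := x)) (s (P $ x $ e p) v))"
proof -
  have "app (S (P $ x $ y) * E p x y) (tmono a e v) = (if e p = y then tmono a (e(p := x)) (s (P $ x $ y) v) else 0)" for x y
    by (simp add: app_E)
  then show ?thesis by (simp add: M_def app_sum_left)
qed

lemma M_shift_op: "M p P * shift_op c = shift_op c * M p P"
  by (simp add: M_def sum_distrib_left sum_distrib_right mult.assoc E_shift_op)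
    (simp add: mult.assoc[symmetric] S_shift_op)

lemma M_S: "M p P * S c = S c * M p P"
  by (simp add: M_def sum_distrib_left sum_distrib_right mult.assoc S_E[symmetric])
    (simp add: mult.assoc[symmetric] S_comm)

lemma M_perm_vars: "M p P * perm_vars \<sigma> = perm_vars \<sigma> * M p P"
  by (simp add: M_def sum_distrib_left sum_distrib_right mult.assoc perm_vars_E[symmetric])
    (simp add: mult.assoc[symmetric] S_perm_vars)

lemma perm_sites_M: "perm_sites \<sigma> * M p P = M (\<sigma> \<langle>$\<rangle> p) P * perm_sites \<sigma>"
  by (simp add: M_def sum_distrib_left sum_distrib_right mult.assoc perm_sites_E[symmetric])
    (simp add: mult.assoc[symmetric] S_perm_sites)

lemma M_coeff_op: "(\<And>c v. app D (s c v) = s c (app D v)) \<Longrightarrow> M p P * coeff_op D = coeff_op D * M p P"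
  by (rule endo_mono_eqI) (simp add: app_M app_sum)

lemma M_add: "M p (P + Q) = M p P + M p Q"
  by (simp add: M_def S_add[symmetric] distrib_right sum.distrib)

lemma M_zero: "M p 0 = 0"
  by (simp add: M_def S_zero)

lemma M_diff: "M p (P - Q) = M p P - M p Q"
  using M_add[of p "P - Q" Q] by (simp add: algebra_simps)

lemma M_scale: "M p (\<chi> i j. c * P $ i $ j) = S c * M p P"
  by (simp add: M_def sum_distrib_left S_mult[symmetric] mult.assoc)

lemma M_comm: "p \<noteq> q \<Longrightarrow> M p P * M q Q = M q Q * M p P"
proof -
  assume "p \<noteq> q"
  then have "E q x y * (S c * E p a b) = S c * E p a b * E q x y" for a b c x y
    by (rule_tac commute_mult) (simp_all add: S_E E_comm)
  then have "M p P * E q x y = E q x y * M p P" for x y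
    unfolding M_def by (rule_tac commute_sum[symmetric], rule_tac commute_sum)
  then show ?thesis unfolding M_def[of q]
    by (simp add: sum_distrib_left sum_distrib_right mult.assoc[symmetric] M_S) (simp add: mult.assoc)
qed

lemma M_mult: "M p (P ** Q) = M p P * M p Q"
proof (rule endo_mono_eqI)
  fix a :: "int^'a" and e and v
  show "app (M p (P ** Q)) (tmono a e v) = app (M p P * M p Q) (tmono a e v)"
    by (simp add: app_M app_sum matrix_matrix_mult_def additive.sum[OF additive_scale_left[OF vs]]
        additive.sum[OF additive_mono] vector_space.vector_space_assms(3)[OF vs]) (rule sum.swap)
qed

lemma M_unit: "M p (matrix_unit x y) = E p x y"
  by (rule endo_mono_eqI) (auto simp: app_M app_E matrix_unit_def if_distrib[of "\<lambda>c. s c _"] additive.zero[OF additive_scale_left[OF vs]]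
     vector_space.vector_space_assms(4)[OF vs] if_distrib[of "tmono _ _"] cong: if_cong)

lemma M_one: "M p (mat 1) = (1 :: ('n::finite, 'm::finite, 'v) AN endo)"
proof -
  have "(\<Sum>x\<in>UNIV. if i = x \<and> j = x then 1 else 0) = (if i = j then 1 else (0 :: complex))" for i j :: 'm
  proof (cases "i = j")
    case True
    then show ?thesis using sum.delta'[of UNIV j "\<lambda>_. 1 :: complex"] by simp
  qed (auto intro!: sum.neutral)
  then have "mat 1 = (\<Sum>x\<in>UNIV. matrix_unit x x :: complex^'m^'m)"
    by (simp add: vec_eq_iff mat_def matrix_unit_def)
  then have "M p (mat 1) = (M p (\<Sum>x\<in>UNIV. matrix_unit x x) :: ('n, 'm, 'v) AN endo)" by (rule arg_cong)
  also have "\<dots> = (\<Sum>x\<in>UNIV. M p (matrix_unit x x))"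
    by (rule additive.sum[OF additiveI]) (rule M_add)
  finally have "M p (mat 1) = (\<Sum>x\<in>UNIV. M p (matrix_unit x x) :: ('n, 'm, 'v) AN endo)" .
  then show ?thesis by (simp add: M_unit E_sum)
qed

text \<open>The tensor \<open>\<Sum> E\<^sub>x\<^sub>y \<otimes> E\<^sub>y\<^sub>x\<close> with its
  first leg at the site \<open>p\<close> and its second leg represented by \<open>L\<close>. The
  coefficients in the infinite sum of \<open>z\<^sub>p\<close> have this form.\<close>

definition casimir :: "'n \<Rightarrow> (complex^'m^'m \<Rightarrow> ('n::finite, 'm::finite, 'v) AN endo) \<Rightarrow> ('n, 'm, 'v) AN endo"
  where "casimir p L = (\<Sum>x\<in>UNIV. \<Sum>y\<in>UNIV. E p x y * L (matrix_unit y x))"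

definition mlin :: "(complex^'m^'m \<Rightarrow> ('n::finite, 'm::finite, 'v) AN endo) \<Rightarrow> bool"
  where "mlin L \<longleftrightarrow> additive L \<and> (\<forall>c P. L (\<chi> i j. c * P $ i $ j) = S c * L P)"

lemma mlin_M: "mlin (M p)"
  by (simp add: mlin_def additiveI M_add M_scale)

lemma mlin_expand: "mlin L \<Longrightarrow> L P = (\<Sum>x\<in>UNIV. \<Sum>y\<in>UNIV. S (P $ x $ y) * L (matrix_unit x y))"
proof -
  assume L: "mlin L"
  have "(\<Sum>x\<in>UNIV. \<Sum>y\<in>UNIV. P $ x $ y * (if i = x \<and> j = y then 1 else 0)) = P $ i $ j" for i j
  proof -
    have "(\<Sum>y\<in>UNIV. P $ x $ y * (if i = x \<and> j = y then 1 else 0)) = (if x = i then P $ i $ j else 0)" for x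
      by (cases "x = i") (simp_all add: sum.delta' if_distrib[of "(*) _"] cong: if_cong)
    then show ?thesis by simp
  qed
  then have "P = (\<Sum>x\<in>UNIV. \<Sum>y\<in>UNIV. (\<chi> i j. P $ x $ y * matrix_unit x y $ i $ j))"
    by (simp add: vec_eq_iff matrix_unit_def)
  then have "L P = L (\<Sum>x\<in>UNIV. \<Sum>y\<in>UNIV. (\<chi> i j. P $ x $ y * matrix_unit x y $ i $ j))" by simp
  also have "\<dots> = (\<Sum>x\<in>UNIV. \<Sum>y\<in>UNIV. S (P $ x $ y) * L (matrix_unit x y))"
    using L by (simp add: mlin_def additive.sum)
  finally show ?thesis .
qed

lemma mlin_unit_mult_right:
  assumes "mlin L" shows "L (matrix_unit y x ** Q) = (\<Sum>z\<in>UNIV. S (Q $ x $ z) * L (matrix_unit y z))"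
proof -
  have "(\<Sum>j\<in>UNIV. S (if i = y then Q $ x $ j else 0) * L (matrix_unit i j)) =
    (if i = y then (\<Sum>z\<in>UNIV. S (Q $ x $ z) * L (matrix_unit y z)) else 0)" for i
    by (simp add: S_zero)
  then show ?thesis by (subst mlin_expand[OF assms]) (simp add: unit_mult_right)
qed

lemma mlin_unit_mult_left:
  assumes "mlin L" shows "L (Q ** matrix_unit y x) = (\<Sum>z\<in>UNIV. S (Q $ z $ y) * L (matrix_unit z x))"
proof -
  have "(\<Sum>j\<in>UNIV. S (if j = x then Q $ i $ y else 0) * L (matrix_unit i j)) = S (Q $ i $ y) * L (matrix_unit i x)" for i
    by (simp add: S_zero if_distrib[of S] if_distrib[of "\<lambda>c. c * _"] sum.delta cong: if_cong)
  then show ?thesis by (subst mlin_expand[OF assms]) (simp add: unit_mult_left)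
qed

lemma E_expand_left: "M p Q * E p x y = (\<Sum>z\<in>UNIV. S (Q $ z $ x) * E p z y)"
  using mlin_unit_mult_left[OF mlin_M, of p Q x y] by (simp add: M_mult M_unit)

lemma E_expand_right: "E p x y * M p Q = (\<Sum>z\<in>UNIV. S (Q $ y $ z) * E p x z)"
  using mlin_unit_mult_right[OF mlin_M, of p x y Q] by (simp add: M_mult M_unit)

text \<open>Invariance of the Casimir tensor:
  \<open>Q E\<^sub>x\<^sub>y \<otimes> E\<^sub>y\<^sub>x\<close> and
  \<open>E\<^sub>x\<^sub>y \<otimes> E\<^sub>y\<^sub>x Q\<close> have the same sum. Expanded in the
  entries of \<open>Q\<close>, the two sides differ by a renaming of the summation indices.\<close>

lemma casimir_left:
  assumes "mlin L"
  shows "M p Q * casimir p L = (\<Sum>x\<in>UNIV. \<Sum>y\<in>UNIV. E p x y * L (matrix_unit y x ** Q))"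
proof -
  have "M p Q * casimir p L = (\<Sum>x\<in>UNIV. \<Sum>y\<in>UNIV. \<Sum>z\<in>UNIV. S (Q $ z $ x) * E p z y * L (matrix_unit y x))"
    by (simp add: casimir_def sum_distrib_left sum_distrib_right mult.assoc[symmetric] E_expand_left)
  also have "\<dots> = (\<Sum>y\<in>UNIV. \<Sum>x\<in>UNIV. \<Sum>z\<in>UNIV. S (Q $ z $ x) * E p z y * L (matrix_unit y x))"
    by (rule sum.swap)
  also have "\<dots> = (\<Sum>y\<in>UNIV. \<Sum>z\<in>UNIV. \<Sum>x\<in>UNIV. S (Q $ z $ x) * E p z y * L (matrix_unit y x))"
    by (rule sum.cong[OF refl], rule sum.swap)
  also have "\<dots> = (\<Sum>z\<in>UNIV. \<Sum>y\<in>UNIV. \<Sum>x\<in>UNIV. S (Q $ z $ x) * E p z y * L (matrix_unit y x))"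
    by (rule sum.swap)
  also have "\<dots> = (\<Sum>x\<in>UNIV. \<Sum>y\<in>UNIV. E p x y * L (matrix_unit y x ** Q))"
    by (simp add: mlin_unit_mult_right[OF assms] sum_distrib_left S_E mult.assoc[symmetric])
  finally show ?thesis .
qed

text \<open>The mirror image of \<open>casimir_left\<close>. Here \<open>M p Q\<close> has to be
  moved past the second leg first, hence the commutation hypotheses on \<open>L\<close>.\<close>

lemma casimir_right:
  assumes "mlin L" "\<And>P x y. L P * E p x y = E p x y * L P" "\<And>P c. L P * S c = S c * L P"
  shows "casimir p L * M p Q = (\<Sum>x\<in>UNIV. \<Sum>y\<in>UNIV. E p x y * L (Q ** matrix_unit y x))"
proof -
  have "L P * M p Q = M p Q * L P" for P
  proof -
    have "L P * (S c * E p x y) = S c * E p x y * L P" for c x y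
      by (rule commute_mult) (rule assms(3), rule assms(2))
    then show ?thesis unfolding M_def by (intro commute_sum)
  qed
  then have "casimir p L * M p Q = (\<Sum>x\<in>UNIV. \<Sum>y\<in>UNIV. E p x y * M p Q * L (matrix_unit y x))"
    by (simp add: casimir_def sum_distrib_right mult.assoc)
  also have "\<dots> = (\<Sum>x\<in>UNIV. \<Sum>y\<in>UNIV. \<Sum>z\<in>UNIV. S (Q $ y $ z) * E p x z * L (matrix_unit y x))"
    by (simp add: E_expand_right sum_distrib_right)
  also have "\<dots> = (\<Sum>x\<in>UNIV. \<Sum>z\<in>UNIV. \<Sum>y\<in>UNIV. S (Q $ y $ z) * E p x z * L (matrix_unit y x))"
    by (rule sum.cong[OF refl], rule sum.swap)
  also have "\<dots> = (\<Sum>x\<in>UNIV. \<Sum>y\<in>UNIV. E p x y * L (Q ** matrix_unit y x))"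
    by (simp add: mlin_unit_mult_left[OF assms(1)] sum_distrib_left S_E mult.assoc[symmetric])
  finally show ?thesis .
qed

definition ddiff_op :: "'n \<Rightarrow> 'n \<Rightarrow> ('n::finite, 'm::finite, 'v) AN endo"
  where "ddiff_op p r = Abs_endo (tensor3_op s (divided_diff p r) id id)"

lemma additive_tensor3: "additive D \<Longrightarrow> additive (tensor3_op s A B D)"
  by (intro additive_tensor_op vector_space_fscale vs)

lemma tensor3_mono:
  "additive D \<Longrightarrow> tensor3_op s A B D (tmono a e v)
    = pure_tensor (fscale s) (A (basis_vec a)) (pure_tensor s (B (basis_vec e)) (D v))"
  by (simp add: tensor_op_single vs additive_tensor_op)

lemma app_ddiff_op: "app (ddiff_op p r) (tmono a e v) = pure_tensor (fscale s) (divided_diff p r (basis_vec a)) (Poly_Mapping.single e v)"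
  by (simp add: ddiff_op_def app_Abs additive_tensor3 tensor3_mono vs)

lemma shift_op_pure_tensor:
  fixes p :: "'n::finite" and y :: "('n \<Rightarrow> 'm) \<Rightarrow>\<^sub>0 'v"
  shows "app (shift_op (axis p j)) (pure_tensor (fscale s) f y) = pure_tensor (fscale s) (xpow p j * f) y"
proof (rule additive_eqI[where x = f])
  show "additive (\<lambda>f. app (shift_op (axis p j)) (pure_tensor (fscale s) f y))"
    by (rule additive_comp[OF additive_app]) (simp add: additive_pure_tensor_left vs)
  show "additive (\<lambda>f. pure_tensor (fscale s) (xpow p j * f) y)"
    by (rule additiveI) (simp add: distrib_left additive.add[OF additive_pure_tensor_left] vs)
  fix b :: "int^'n" and c
  have "app (shift_op (axis p j)) (Poly_Mapping.single b y) = Poly_Mapping.single (b + axis p j) y" for y :: "('n \<Rightarrow> 'm) \<Rightarrow>\<^sub>0 'v"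
    by (rule additive_eqI[where x = y]) (auto intro!: additiveI simp: app_add single_add)
  then show "app (shift_op (axis p j)) (pure_tensor (fscale s) (Poly_Mapping.single b c) y)
      = pure_tensor (fscale s) (xpow p j * Poly_Mapping.single b c) y"
    by (simp add: pure_tensor_single vs xpow_def mult_single add.commute)
qed

lemma xdiff_ddiff_op:
  assumes "p \<noteq> r"
  shows "xdiff p r * ddiff_op p r = shift_op (axis p 1) * (1 - perm_vars \<langle>p \<leftrightarrow> r\<rangle>)"
proof (rule endo_mono_eqI)
  fix a e v
  note add = additive.diff[OF additive_pure_tensor_left[OF vector_space_fscale[OF vs]]]
  have "app (xdiff p r * ddiff_op p r) (tmono a e v)
      = pure_tensor (fscale s) ((xpow p 1 - xpow r 1) * divided_diff p r (basis_vec a)) (Poly_Mapping.single e v)"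
    by (simp add: app_ddiff_op xdiff_def shift_op_pure_tensor left_diff_distrib add)
  also have "\<dots> = app (shift_op (axis p 1) * (1 - perm_vars \<langle>p \<leftrightarrow> r\<rangle>)) (tmono a e v)"
    unfolding divided_diff[OF assms]
    by (simp add: perm_laurent_basis right_diff_distrib add vs app_diff xpow_def mult_single add.commute)
  finally show "app (xdiff p r * ddiff_op p r) (tmono a e v) = app (shift_op (axis p 1) * (1 - perm_vars \<langle>p \<leftrightarrow> r\<rangle>)) (tmono a e v)" .
qed

text \<open>The operator \<open>x\<^sub>p \<partial>\<^sub>p\<close>, which is diagonal on
  monomials; \<open>AN_euler\<close> connects it with \<open>partial\<close>.\<close>

definition euler_op :: "'n \<Rightarrow> ('n::finite, 'm::finite, 'v) AN endo"
  where "euler_op p = monomial_op (\<lambda>a e v. tmono a e (s (of_int (a $ p)) v))"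

lemma app_euler_op [simp]: "app (euler_op p) (tmono a e v) = tmono a e (s (of_int (a $ p)) v)"
  by (simp add: euler_op_def app_monomial_op additive_mono_scale[OF vs])

lemma euler_op_shift_op: "euler_op p * shift_op c = shift_op c * (euler_op p + S (of_int (c $ p)))"
  by (rule endo_mono_eqI) (simp add: vector_space.vector_space_assms(2)[OF vs] single_add app_add)

lemma euler_op_M: "euler_op p * M q P = M q P * euler_op p"
  by (rule endo_mono_eqI) (simp add: app_M app_sum vector_space.vector_space_assms(3)[OF vs] mult.commute)

lemma euler_op_coeff_op: "(\<And>c v. app D (s c v) = s c (app D v)) \<Longrightarrow> euler_op p * coeff_op D = coeff_op D * euler_op p"
  by (rule endo_mono_eqI) simp

lemma euler_op_S: "euler_op p * S c = S c * euler_op p"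
  unfolding S_def by (rule euler_op_coeff_op) (simp add: vector_space.vector_space_assms(3)[OF vs] mult.commute)

lemma euler_op_perm_sites: "euler_op p * perm_sites \<sigma> = perm_sites \<sigma> * euler_op p"
  by (rule endo_mono_eqI) simp

lemma perm_vars_euler_op: "perm_vars \<sigma> * euler_op p = euler_op (\<sigma> \<langle>$\<rangle> p) * perm_vars \<sigma>"
  by (rule endo_mono_eqI) (simp add: perm_vec_def)

end


section \<open>The affine Lie algebra\<close>

lemma matrix_diff_rdistrib: "(A - B) ** C = A ** C - B ** (C :: complex^'n^'n::finite)"
  and matrix_diff_ldistrib: "C ** (A - B) = C ** A - C ** (B :: complex^'n^'n::finite)"
  by (simp_all add: matrix_matrix_mult_def vec_eq_iff sum_subtractf algebra_simps)

lemma vector_space_sl [simp]: "vector_space (sl_scale :: complex \<Rightarrow> 'm::finite sl \<Rightarrow> 'm sl)"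
  by (unfold_locales; transfer) (auto simp: vec_eq_iff algebra_simps)

lemma vector_space_aff [simp]: "vector_space (aff_scale :: complex \<Rightarrow> 'm::finite aff \<Rightarrow> 'm aff)"
  by unfold_locales
    (auto simp: aff_scale_def algebra_simps vector_space.vector_space_assms[OF vector_space_fscale[OF vector_space_sl]])

lemma sl_bracket_linear: "Vector_Spaces.linear sl_scale sl_scale (sl_bracket P)"
  "Vector_Spaces.linear sl_scale sl_scale (\<lambda>P. sl_bracket P Q)"
  by (auto intro!: linearI' additiveI vector_space_sl; transfer;
      auto simp: vec_eq_iff matrix_matrix_mult_def algebra_simps sum.distrib sum_distrib_left)+

lemma sl_bracket_anti: "sl_bracket P Q = - sl_bracket Q P"
  by transfer simp

lemma sl_jacobi: "sl_bracket P (sl_bracket Q R) = sl_bracket (sl_bracket P Q) R + sl_bracket Q (sl_bracket P R)"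
  by transfer (simp add: matrix_diff_rdistrib matrix_diff_ldistrib matrix_mul_assoc)

lemma trace_form_linear: "Vector_Spaces.linear sl_scale (*) (sl_trace_form P)"
  "Vector_Spaces.linear sl_scale (*) (\<lambda>P. sl_trace_form P Q)"
  by (auto intro!: linearI' additiveI vector_space_sl; transfer;
      auto simp: trace_def matrix_matrix_mult_def algebra_simps sum.distrib sum_distrib_left)+

lemma trace_form_sym: "sl_trace_form P Q = sl_trace_form Q P"
  by transfer (rule trace_mul_sym)

lemma trace_form_inv: "sl_trace_form (sl_bracket P Q) R = sl_trace_form P (sl_bracket Q R)"
  by transfer (simp add: matrix_diff_rdistrib matrix_diff_ldistrib matrix_mul_assoc trace_sub,
      metis matrix_mul_assoc trace_mul_sym)

lemma trace_form_inv': "sl_trace_form Q (sl_bracket P R) = - sl_trace_form (sl_bracket P Q) R"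
  using trace_form_inv[of Q P R] sl_bracket_anti[of Q P]
  by (simp add: additive.minus[OF additive_linear[OF trace_form_linear(2)]])

lemma loop_add: "loop (P + Q) i = loop P i + loop Q i"
  by (simp add: loop_def single_add)

lemma loop_scale: "loop (sl_scale c P) i = aff_scale c (loop P i)"
  by (simp add: loop_def aff_scale_def)

lemma loop_zero [simp]: "loop 0 i = 0"
  by (simp add: loop_def zero_prod_def)

lemma aff_induct [case_names loop central add]:
  assumes "\<And>P i. A (loop P i)" "\<And>c. A (0, c)" "\<And>\<xi> \<eta>. A \<xi> \<Longrightarrow> A \<eta> \<Longrightarrow> A (\<xi> + \<eta>)"
  shows "A (\<xi> :: 'm::finite aff)"
proof -
  have "A (f, 0)" for f
  proof (induction f rule: pm_induct)
    case (single i P)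
    then show ?case using assms(1)[of P i] by (simp add: loop_def)
  next
    case (add f g)
    then show ?case using assms(3)[of "(f, 0)" "(g, 0)"] by simp
  qed
  then show ?thesis using assms(3)[of "(fst \<xi>, 0)" "(0, snd \<xi>)"] assms(2) by simp
qed

text \<open>This and \<open>bracket_cocycle\<close> are the two components of
  \<open>aff_bracket\<close>, rewritten as extensions from single terms. In this form additivity in
  each argument is visible.\<close>

definition bracket_loop :: "(int \<Rightarrow>\<^sub>0 'm sl) \<Rightarrow> (int \<Rightarrow>\<^sub>0 'm sl) \<Rightarrow> (int \<Rightarrow>\<^sub>0 'm::finite sl)"
  where "bracket_loop f g = pm_ext (\<lambda>i P. pm_ext (\<lambda>j Q. Poly_Mapping.single (i + j) (sl_bracket P Q)) g) f"

definition bracket_cocycle :: "(int \<Rightarrow>\<^sub>0 'm sl) \<Rightarrow> (int \<Rightarrow>\<^sub>0 'm::finite sl) \<Rightarrow> complex"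
  where "bracket_cocycle f g = pm_ext (\<lambda>i P. of_int i * sl_trace_form P (Poly_Mapping.lookup g (- i))) f"

lemma aff_bracket_eq: "aff_bracket (f, c) (g, d) = (bracket_loop f g, bracket_cocycle f g)"
  by (simp add: aff_bracket_def bracket_loop_def bracket_cocycle_def pm_ext_def)

lemma additive_single_bracket:
  "additive (\<lambda>Q. Poly_Mapping.single k (sl_bracket P Q))" "additive (\<lambda>P. Poly_Mapping.single k (sl_bracket P Q))"
  by (rule additive_comp[OF additive_single additive_linear], rule sl_bracket_linear)+

lemma additive_bracket_inner:
  "additive (\<lambda>P. pm_ext (\<lambda>j Q. Poly_Mapping.single (i + j) (sl_bracket P Q)) g)"
  unfolding pm_ext_def by (rule additive_sum) (rule additive_single_bracket)

lemma additive_cocycle_inner: "additive (\<lambda>P. of_int i * sl_trace_form P R)"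
  by (rule additiveI) (simp add: linear_add'[OF trace_form_linear(2)] algebra_simps)

lemma bracket_loop_single [simp]:
  "bracket_loop (Poly_Mapping.single i P) (Poly_Mapping.single j Q) = Poly_Mapping.single (i + j) (sl_bracket P Q)"
  by (simp add: bracket_loop_def additive_bracket_inner additive_single_bracket)

lemma bracket_cocycle_single [simp]:
  "bracket_cocycle (Poly_Mapping.single i P) g = of_int i * sl_trace_form P (Poly_Mapping.lookup g (- i))"
  unfolding bracket_cocycle_def by (rule pm_ext_single) (rule additive_cocycle_inner)

lemma additive_bracket_loop: "additive (bracket_loop f)" "additive (\<lambda>f. bracket_loop f g)"
proof -
  have "additive (\<lambda>g. pm_ext (\<lambda>j Q. Poly_Mapping.single (i + j) (sl_bracket P Q)) g)" for i and P :: "'a sl"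
    by (rule additive_pm_ext) (rule additive_single_bracket)
  then show "additive (bracket_loop f)"
    unfolding bracket_loop_def pm_ext_def[of _ f] by (rule additive_sum)
  show "additive (\<lambda>f. bracket_loop f g)"
    unfolding bracket_loop_def by (rule additive_pm_ext) (rule additive_bracket_inner)
qed

lemma additive_bracket_cocycle: "additive (bracket_cocycle f)" "additive (\<lambda>f. bracket_cocycle f g)"
proof -
  show "additive (bracket_cocycle f)"
    by (rule additiveI) (simp add: bracket_cocycle_def pm_ext_def lookup_add linear_add'[OF trace_form_linear(1)]
        algebra_simps sum.distrib)
  show "additive (\<lambda>f. bracket_cocycle f g)"
    unfolding bracket_cocycle_def by (rule additive_pm_ext) (rule additive_cocycle_inner)
qed

lemma aff_bracket_add_left: "aff_bracket (\<xi> + \<xi>') \<eta> = aff_bracket \<xi> \<eta> + aff_bracket \<xi>' \<eta>"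
  and aff_bracket_add_right: "aff_bracket \<eta> (\<xi> + \<xi>') = aff_bracket \<eta> \<xi> + aff_bracket \<eta> \<xi>'"
  by (cases \<xi>; cases \<xi>'; cases \<eta>;
      simp add: aff_bracket_eq additive.add[OF additive_bracket_loop(1)] additive.add[OF additive_bracket_loop(2)]
        additive.add[OF additive_bracket_cocycle(1)] additive.add[OF additive_bracket_cocycle(2)])+

lemma aff_bracket_central [simp]: "aff_bracket (0, c) \<eta> = 0" "aff_bracket \<eta> (0, c) = 0"
  by (cases \<eta>; simp add: aff_bracket_eq additive.zero[OF additive_bracket_loop(1)] additive.zero[OF additive_bracket_loop(2)]
        additive.zero[OF additive_bracket_cocycle(1)] additive.zero[OF additive_bracket_cocycle(2)] zero_prod_def)+

lemma aff_bracket_loop: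
  "aff_bracket (loop P i) (loop Q j) =
    loop (sl_bracket P Q) (i + j) + (0, if i + j = 0 then of_int i * sl_trace_form P Q else 0)"
proof -
  have "sl_trace_form P (Poly_Mapping.lookup (Poly_Mapping.single j Q) (- i)) = (if i + j = 0 then sl_trace_form P Q else 0)"
    using linear_zero'[OF trace_form_linear(1)] by (auto simp: lookup_single when_def)
  then show ?thesis by (auto simp: loop_def aff_bracket_eq)
qed

lemma aff_scale_central: "aff_scale c (0, d) = (0, c * d)"
  using additive.zero[OF additive_scale[OF vector_space_fscale[OF vector_space_sl]]] by (simp add: aff_scale_def)

lemma additive_aff_bracket: "additive (aff_bracket \<xi>)" "additive (\<lambda>\<xi>. aff_bracket \<xi> \<eta>)"
  by (rule additiveI, rule aff_bracket_add_right) (rule additiveI, rule aff_bracket_add_left)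

lemmas aff_bracket_zero [simp] = additive.zero[OF additive_aff_bracket(1)] additive.zero[OF additive_aff_bracket(2)]

lemma aff_scale_add: "aff_scale c (x + y) = aff_scale c x + aff_scale c y"
  by (rule additive.add[OF additive_scale[OF vector_space_aff]])

lemma aff_scale_zero [simp]: "aff_scale c 0 = 0"
  by (rule additive.zero[OF additive_scale[OF vector_space_aff]])

lemma aff_bracket_anti: "aff_bracket \<xi> \<eta> = - aff_bracket \<eta> \<xi>"
proof (induction \<xi> arbitrary: \<eta> rule: aff_induct)
  case (loop P i \<eta>)
  show ?case
  proof (induction \<eta> rule: aff_induct)
    case (loop Q j)
    have "loop (- sl_bracket Q P) (j + i) = - loop (sl_bracket Q P) (j + i)"
      by (rule additive.minus, rule additiveI) (rule loop_add)
    moreover have "of_int i * sl_trace_form P Q = - (of_int j * sl_trace_form P Q)" if "i + j = 0"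
      using that by (simp add: add_eq_0_iff)
    ultimately show ?case
      using sl_bracket_anti[of P Q] trace_form_sym[of P Q] by (simp add: aff_bracket_loop add.commute)
  qed (simp_all add: aff_bracket_add_left aff_bracket_add_right)
qed (simp_all add: aff_bracket_add_left aff_bracket_add_right)

lemma aff_bracket_linear:
  fixes \<xi> \<eta> :: "'m::finite aff"
  shows "Vector_Spaces.linear aff_scale aff_scale (aff_bracket \<xi>)"
    and "Vector_Spaces.linear aff_scale aff_scale (\<lambda>\<xi>. aff_bracket \<xi> \<eta>)"
proof -
  have sc: "aff_bracket \<xi> (aff_scale c \<eta>) = aff_scale c (aff_bracket \<xi> \<eta>)" for \<xi> \<eta> :: "'m aff" and c
  proof (induction \<xi> rule: aff_induct)
    case (loop P i)
    show ?case
      by (induction \<eta> rule: aff_induct)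
        (auto simp: aff_bracket_loop aff_scale_add aff_bracket_add_right loop_scale[symmetric] aff_scale_central
         linear_scale'[OF sl_bracket_linear(1)] linear_scale'[OF trace_form_linear(1)])
  qed (simp_all add: aff_bracket_add_left aff_scale_add)
  then show "Vector_Spaces.linear aff_scale aff_scale (aff_bracket \<xi>)"
    by (intro linearI' vector_space_aff additive_aff_bracket) auto
  have "aff_bracket (aff_scale c \<xi>) \<eta> = aff_scale c (aff_bracket \<xi> \<eta>)" for c \<xi>
    using sc[of \<eta> c \<xi>] by (simp only: aff_bracket_anti[of _ \<eta>] additive.minus[OF additive_scale[OF vector_space_aff]])
  then show "Vector_Spaces.linear aff_scale aff_scale (\<lambda>\<xi>. aff_bracket \<xi> \<eta>)"
    by (intro linearI' vector_space_aff additive_aff_bracket) auto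
qed

text \<open>On three loops the loop component is the Jacobi identity of \<open>sl\<close>. The
  central component, present only if the degrees add up to 0, is the invariance of the trace
  form.\<close>

lemma aff_jacobi: "aff_bracket x (aff_bracket y z) = aff_bracket (aff_bracket x y) z + aff_bracket y (aff_bracket x z)"
proof (induction x rule: aff_induct)
  case (loop P i)
  show ?case
  proof (induction y rule: aff_induct)
    case (loop Q j)
    show ?case
    proof (induction z rule: aff_induct)
      case (loop R k)
      have "of_int i * sl_trace_form P (sl_bracket Q R) = of_int (i + j) * sl_trace_form (sl_bracket P Q) R
          + of_int j * sl_trace_form Q (sl_bracket P R)"
        by (simp add: trace_form_inv trace_form_inv'[of Q P R] algebra_simps)
      then show ?case
        by (auto simp: aff_bracket_loop aff_bracket_add_left aff_bracket_add_right sl_jacobi[of P Q R] loop_add add_ac)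
    qed (simp_all add: aff_bracket_add_right)
  qed (simp_all add: aff_bracket_add_left aff_bracket_add_right)
qed (simp_all add: aff_bracket_add_left aff_bracket_add_right)

text \<open>This will be \<open>proj_q\<close> for the affine algebra, hence it also discards the
  central component, which belongs to \<open>\<pp>\<close>.\<close>

definition aff_neg :: "'m aff \<Rightarrow> 'm::finite aff"
  where "aff_neg \<xi> = (pm_ext (\<lambda>i P. if i < 0 then Poly_Mapping.single i P else 0) (fst \<xi>), 0)"

lemma additive_neg_part: "additive (\<lambda>P. if i < 0 then Poly_Mapping.single i P else 0)" for i :: int
  by (cases "i < 0") (simp_all add: additive_single)

lemma additive_aff_neg: "additive aff_neg"
  by (rule additiveI) (simp add: aff_neg_def additive.add[OF additive_pm_ext[OF additive_neg_part]])

lemma aff_neg_loop: "aff_neg (loop P i) = (if i < 0 then loop P i else 0)"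
  by (simp add: aff_neg_def loop_def additive_neg_part zero_prod_def)

lemma aff_neg_central [simp]: "aff_neg (0, c) = 0"
  by (simp add: aff_neg_def additive.zero[OF additive_pm_ext[OF additive_neg_part]] zero_prod_def)

lemmas aff_neg_add = additive.add[OF additive_aff_neg]

lemma lookup_aff_neg: "Poly_Mapping.lookup (fst (aff_neg \<xi>)) i = (if i < 0 then Poly_Mapping.lookup (fst \<xi>) i else 0)"
proof (induction \<xi> rule: aff_induct)
  case (loop P j)
  then show ?case by (cases "j < 0") (simp_all add: aff_neg_loop, auto simp: loop_def lookup_single when_def)
qed (simp_all add: aff_neg_add lookup_add)

lemma aff_q_iff: "\<xi> \<in> aff_q \<longleftrightarrow> aff_neg \<xi> = \<xi>"
proof -
  have "snd (aff_neg \<xi>) = 0" by (simp add: aff_neg_def)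
  then show ?thesis
    by (auto simp: aff_q_def prod_eq_iff poly_mapping_eq_iff fun_eq_iff lookup_aff_neg)
qed

lemma aff_p_iff: "\<xi> \<in> aff_p \<longleftrightarrow> aff_neg \<xi> = 0"
proof -
  have "snd (aff_neg \<xi>) = 0" by (simp add: aff_neg_def)
  then show ?thesis
    by (auto simp: aff_p_def prod_eq_iff poly_mapping_eq_iff fun_eq_iff lookup_aff_neg)
qed

lemma aff_neg_idem: "aff_neg (aff_neg \<xi>) = aff_neg \<xi>"
  by (induction \<xi> rule: aff_induct) (simp_all add: aff_neg_loop aff_neg_add additive.zero[OF additive_aff_neg])

lemma aff_neg_linear: "Vector_Spaces.linear aff_scale aff_scale aff_neg"
proof (rule linearI'[OF vector_space_aff vector_space_aff additive_aff_neg])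
  show "aff_neg (aff_scale c \<xi>) = aff_scale c (aff_neg \<xi>)" for c and \<xi> :: "'a aff"
    by (induction \<xi> rule: aff_induct)
      (simp_all add: aff_neg_loop aff_neg_add loop_scale[symmetric] aff_scale_central aff_scale_add)
qed

lemma aff_q_induct [consumes 1, case_names loop add]:
  assumes "\<xi> \<in> aff_q" "\<And>P i. i < 0 \<Longrightarrow> A (loop P i)" "\<And>\<xi> \<eta>. A \<xi> \<Longrightarrow> A \<eta> \<Longrightarrow> A (\<xi> + \<eta>)"
  shows "A \<xi>"
proof -
  have "A 0" using assms(2)[of "-1" 0] by simp
  then have "A (aff_neg \<xi>)" for \<xi>
    by (induction \<xi> rule: aff_induct) (simp_all add: aff_neg_loop aff_neg_add assms(2,3))
  then show ?thesis using assms(1) unfolding aff_q_iff by metis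
qed

lemma aff_neg_bracket_q: "aff_neg (aff_bracket (aff_neg x) (aff_neg y)) = aff_bracket (aff_neg x) (aff_neg y)"
proof (induction x rule: aff_induct)
  case (loop P i)
  show ?case
    by (induction y rule: aff_induct)
      (simp_all add: aff_neg_loop aff_neg_add aff_bracket_add_right aff_bracket_loop additive.zero[OF additive_aff_neg]
        zero_prod_def[symmetric])
qed (simp_all add: aff_neg_add aff_bracket_add_left additive.zero[OF additive_aff_neg])

lemma aff_p_induct [consumes 1, case_names loop central add]:
  assumes "aff_neg \<xi> = 0" "\<And>P i. i \<ge> 0 \<Longrightarrow> A (loop P i)" "\<And>c. A (0, c)" "\<And>\<xi> \<eta>. A \<xi> \<Longrightarrow> A \<eta> \<Longrightarrow> A (\<xi> + \<eta>)"
  shows "A \<xi>"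
proof -
  have "A 0" using assms(2)[of 0 0] by simp
  have "A (\<xi> - aff_neg \<xi>)" for \<xi>
  proof (induction \<xi> rule: aff_induct)
    case (add \<xi> \<eta>)
    have "\<xi> + \<eta> - aff_neg (\<xi> + \<eta>) = (\<xi> - aff_neg \<xi>) + (\<eta> - aff_neg \<eta>)" by (simp add: aff_neg_add)
    then show ?case using add assms(4) by metis
  qed (use \<open>A 0\<close> in \<open>simp_all add: aff_neg_loop assms(2,3)\<close>)
  from this[of \<xi>] show ?thesis by (simp add: assms(1))
qed

lemma aff_neg_bracket_p:
  assumes "aff_neg x = 0" "aff_neg y = 0" shows "aff_neg (aff_bracket x y) = 0"
  using assms(1)
proof (induction rule: aff_p_induct)
  case (loop P i)
  from assms(2) loop show ?case
    by (induction rule: aff_p_induct) (simp_all add: aff_bracket_loop aff_neg_add aff_neg_loop aff_bracket_add_right additive.zero[OF additive_aff_neg])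
qed (simp_all add: aff_bracket_add_left aff_neg_add additive.zero[OF additive_aff_neg])

section \<open>Parabolically induced modules\<close>

lemma induced_rels_base:
  assumes "x \<in> {basis_vec (a, u) - basis_vec (a', u) |a a' u. a - a' \<in> I} \<union>
     {basis_vec (a + a', u) - basis_vec (a, u) - basis_vec (a', u) |a a' u. True} \<union>
     {basis_vec (a, u + u') - basis_vec (a, u) - basis_vec (a, u') |a u u'. True} \<union>
     {basis_vec (pscale c a, u) - pscale c (basis_vec (a, u)) |c a u. True} \<union>
     {basis_vec (a, sU c u) - pscale c (basis_vec (a, u)) |c a u. True} \<union>
     {basis_vec (a * b, u) - basis_vec (a, free_alg_act sU act b u) |a b u.
        \<forall>w\<in>Poly_Mapping.keys b. set (letters w) \<subseteq> G}"
  shows "x \<in> induced_rels I G sU act"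
  unfolding induced_rels_def by (rule module.span_base[OF vector_space_module[OF vs_pscale] assms])

lemma induced_rels_cong: "a - a' \<in> I \<Longrightarrow> basis_vec (a, u) - basis_vec (a', u) \<in> induced_rels I G sU act"
  by (rule induced_rels_base) blast

lemma induced_rels_add_left: "basis_vec (a + a', u) - basis_vec (a, u) - basis_vec (a', u) \<in> induced_rels I G sU act"
  by (rule induced_rels_base) blast

lemma induced_rels_add_right: "basis_vec (a, u + u') - basis_vec (a, u) - basis_vec (a, u') \<in> induced_rels I G sU act"
  by (rule induced_rels_base) blast

lemma induced_rels_scale_left: "basis_vec (pscale c a, u) - pscale c (basis_vec (a, u)) \<in> induced_rels I G sU act"
  by (rule induced_rels_base) blast

lemma induced_rels_scale_right: "basis_vec (a, sU c u) - pscale c (basis_vec (a, u)) \<in> induced_rels I G sU act"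
  by (rule induced_rels_base) blast

lemma induced_rels_act:
  "\<forall>w\<in>Poly_Mapping.keys b. set (letters w) \<subseteq> G \<Longrightarrow>
    basis_vec (a * b, u) - basis_vec (a, free_alg_act sU act b u) \<in> induced_rels I G sU act"
  by (rule induced_rels_base) blast

lemma induced_rels_subgroup: "add_subgroup (induced_rels I G sU act)"
  unfolding induced_rels_def by (rule add_subgroup_span) simp

lemma induced_rels_scale: "x \<in> induced_rels I G sU act \<Longrightarrow> pscale c x \<in> induced_rels I G sU act"
  unfolding induced_rels_def by (rule module.span_scale[OF vector_space_module[OF vs_pscale]])

lemma linear_induced_left: "Vector_Spaces.linear pscale pscale (induced_left a)"
  unfolding induced_left_def by (rule linear_lin_ext) simp

lemma linear_induced_right: "Vector_Spaces.linear pscale pscale (induced_right f)"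
  unfolding induced_right_def by (rule linear_lin_ext) simp

lemma induced_left_basis [simp]: "induced_left a (basis_vec (b, u)) = basis_vec (a * b, u)"
  by (simp add: induced_left_def)

lemma induced_right_basis [simp]: "induced_right f (basis_vec (b, u)) = basis_vec (b, f u)"
  by (simp add: induced_right_def)

lemma lie_moduleD:
  assumes "lie_module sG br sV \<rho>"
  shows "Vector_Spaces.linear sV sV (\<rho> P)" "Vector_Spaces.linear sG sV (\<lambda>P. \<rho> P v)"
    "\<rho> (br P Q) v = \<rho> P (\<rho> Q v) - \<rho> Q (\<rho> P v)"
  using assms unfolding lie_module_def by blast+

text \<open>The hypothesis on \<open>V\<close> in usable form: instead of an isomorphism of
  quotients, a surjection \<open>\<psi>\<close> from formal combinations of pairs
  \<open>(a, u)\<close> whose kernel is exactly the space of relations.\<close>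

locale par_ind =
  fixes sU :: "complex \<Rightarrow> 'u::ab_group_add \<Rightarrow> 'u" and \<rho>U :: "'m::finite sl \<Rightarrow> 'u \<Rightarrow> 'u" and l :: complex
    and sV :: "complex \<Rightarrow> 'v::ab_group_add \<Rightarrow> 'v" and \<rho>V :: "'m aff \<Rightarrow> 'v \<Rightarrow> 'v"
    and \<psi> :: "('m aff free_alg \<times> 'u \<Rightarrow>\<^sub>0 complex) \<Rightarrow> 'v"
  assumes vsU: "vector_space sU" and modU: "lie_module sl_scale sl_bracket sU \<rho>U"
    and vsV: "vector_space sV" and modV: "lie_module aff_scale aff_bracket sV \<rho>V"
    and \<psi>_linear: "Vector_Spaces.linear pscale sV \<psi>" and \<psi>_surj: "surj \<psi>"
    and \<psi>_kernel: "\<psi> y = 0 \<longleftrightarrow> y \<in> induced_rels (two_sided_ideal enveloping_rels) aff_p sU (parabolic_act sU \<rho>U l)"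
    and \<psi>_left: "\<psi> (induced_left (gen \<xi>) y) = \<rho>V \<xi> (\<psi> y)"

lemma par_indI:
  assumes "vector_space sU" "lie_module sl_scale sl_bracket sU \<rho>U" "vector_space sV"
    "parabolically_induced sU \<rho>U l sV \<rho>V"
  obtains \<psi> where "par_ind sU \<rho>U l sV \<rho>V \<psi>"
proof -
  let ?R = "induced_rels (two_sided_ideal enveloping_rels) aff_p sU (parabolic_act sU \<rho>U l)"
  have V: "lie_module aff_scale aff_bracket sV \<rho>V"
    "quotient_iso sV {0} pscale ?R {(\<rho>V \<xi>, induced_left (gen \<xi>)) |\<xi>. True}"
    using assms(4) by (simp_all only: parabolically_induced_def)
  show ?thesis
  proof (rule quotient_isoE[OF V(2) assms(3) vs_pscale induced_rels_subgroup])
    fix \<psi> assume \<psi>: "Vector_Spaces.linear pscale sV \<psi>" "surj \<psi>" "\<And>y. \<psi> y = 0 \<longleftrightarrow> y \<in> ?R"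
      "\<And>A B y. (A, B) \<in> {(\<rho>V \<xi>, induced_left (gen \<xi>)) |\<xi>. True} \<Longrightarrow> \<psi> (B y) = A (\<psi> y)"
    have "\<psi> (induced_left (gen \<xi>) y) = \<rho>V \<xi> (\<psi> y)" for \<xi> y
      by (rule \<psi>(4)) blast
    from par_ind.intro[OF assms(1-3) V(1) \<psi>(1-3) this] show ?thesis by (rule that)
  qed
qed

context par_ind
begin

abbreviation pact :: "'m aff \<Rightarrow> 'u \<Rightarrow> 'u"
  where "pact \<equiv> parabolic_act sU \<rho>U l"

abbreviation relV :: "('m aff free_alg \<times> 'u \<Rightarrow>\<^sub>0 complex) set"
  where "relV \<equiv> induced_rels (two_sided_ideal enveloping_rels) aff_p sU pact"

lemma pact_linear: "Vector_Spaces.linear sU sU (pact \<xi>)"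
proof (cases \<xi>)
  case (Pair f c)
  have "Vector_Spaces.linear sU sU (sU (l * c))"
    by (rule linearI') (simp_all add: vsU additive_scale vector_space.vector_space_assms(3)[OF vsU] mult.commute)
  then show ?thesis
    using linear_plus'[OF lie_moduleD(1)[OF modU, of "Poly_Mapping.lookup f 0"]]
    by (simp add: Pair parabolic_act_def)
qed

lemma pact_loop: "pact (loop P i) u = (if i = 0 then \<rho>U P u else 0)"
  using linear_zero'[OF lie_moduleD(2)[OF modU]] additive.zero[OF additive_scale_left[OF vsU]]
  by (simp add: parabolic_act_def loop_def lookup_single when_def)

lemma pact_central: "pact (0, c) u = sU (l * c) u"
  using linear_zero'[OF lie_moduleD(2)[OF modU]] by (simp add: parabolic_act_def)

lemma pact_add: "pact (\<xi> + \<eta>) u = pact \<xi> u + pact \<eta> u"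
  by (cases \<xi>; cases \<eta>) (simp add: parabolic_act_def lookup_add linear_add'[OF lie_moduleD(2)[OF modU]]
      algebra_simps additive.add[OF additive_scale_left[OF vsU]])

lemma pact_linear_left: "Vector_Spaces.linear aff_scale sU (\<lambda>\<xi>. pact \<xi> u)"
proof (rule linearI'[OF vector_space_aff vsU])
  show "additive (\<lambda>\<xi>. pact \<xi> u)" by (rule additiveI) (rule pact_add)
  show "pact (aff_scale c \<xi>) u = sU c (pact \<xi> u)" for c \<xi>
    by (cases \<xi>) (simp add: parabolic_act_def aff_scale_def lookup_fscale linear_scale'[OF lie_moduleD(2)[OF modU]]
      additive.add[OF additive_scale[OF vsU]] vector_space.vector_space_assms(3)[OF vsU] mult_ac)
qed

text \<open>The cocycle vanishes on \<open>\<pp>\<close>: two nonnegative degrees with sum 0 are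
  both 0, and the degree is a factor of the cocycle. Hence every level is possible on
  \<open>U\<close>.\<close>

lemma pact_bracket:
  assumes "aff_neg x = 0" "aff_neg y = 0"
  shows "pact (aff_bracket x y) u = pact x (pact y u) - pact y (pact x u)"
  using assms(1)
proof (induction rule: aff_p_induct)
  case (loop P i)
  from assms(2) loop show ?case
  proof (induction rule: aff_p_induct)
    case (loop Q j)
    then show ?case
      by (auto simp: aff_bracket_loop pact_add pact_loop pact_central lie_moduleD(3)[OF modU] linear_zero'[OF pact_linear]
        linear_zero'[OF lie_moduleD(1)[OF modU]] additive.zero[OF additive_scale_left[OF vsU]])
  qed (simp_all add: aff_bracket_add_right pact_add pact_central linear_scale'[OF pact_linear] linear_add'[OF pact_linear]
     linear_zero'[OF pact_linear_left])
qed (simp_all add: aff_bracket_add_left pact_add pact_central linear_scale'[OF pact_linear] linear_add'[OF pact_linear]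
     linear_zero'[OF pact_linear_left])

lemma split_lie:
  assumes "vector_space sZ"
  shows "split_lie aff_scale aff_bracket aff_neg sU pact sZ"
proof -
  have "aff_neg (aff_bracket x y) = aff_bracket x y" if "aff_neg x = x" "aff_neg y = y" for x y
    using aff_neg_bracket_q[of x y] that by simp
  then show ?thesis
    by (intro split_lie.intro[OF vector_space_aff vsU assms aff_bracket_linear(2) aff_bracket_linear(1)
      aff_bracket_anti aff_jacobi aff_neg_linear aff_neg_idem _ aff_neg_bracket_p pact_linear pact_linear_left pact_bracket])
qed

lemma env_rels: "split_lie.env_rels aff_scale aff_bracket = (enveloping_rels :: 'm aff free_alg set)"
  unfolding enveloping_rels_def by (rule split_lie.env_rels_def[OF split_lie[OF vsU]])

definition j :: "'u \<Rightarrow> 'v"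
  where "j u = \<psi> (basis_vec (1, u))"

lemma \<psi>_relD: "x \<in> relV \<Longrightarrow> \<psi> x = 0"
  by (simp add: \<psi>_kernel)

lemma \<psi>_basis_linear: "Vector_Spaces.linear pscale sV (\<lambda>a. \<psi> (basis_vec (a, u)))"
proof (rule linearI')
  show "additive (\<lambda>a. \<psi> (basis_vec (a, u)))"
    using \<psi>_relD[OF induced_rels_add_left] unfolding linear_diff'[OF \<psi>_linear]
    by (intro additiveI) (simp only: diff_diff_eq right_minus_eq)
  show "\<psi> (basis_vec (pscale c a, u)) = sV c (\<psi> (basis_vec (a, u)))" for c a
    using \<psi>_relD[OF induced_rels_scale_left]
    by (simp add: linear_diff'[OF \<psi>_linear] linear_scale'[OF \<psi>_linear, symmetric])
qed (simp_all add: vsV)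

lemma j_linear: "Vector_Spaces.linear sU sV j"
proof (rule linearI'[OF vsU vsV])
  show "additive j" unfolding j_def
    using \<psi>_relD[OF induced_rels_add_right] unfolding linear_diff'[OF \<psi>_linear]
    by (intro additiveI) (simp only: diff_diff_eq right_minus_eq)
  show "j (sU c u) = sV c (j u)" for c u unfolding j_def
    using \<psi>_relD[OF induced_rels_scale_right]
    by (simp add: linear_diff'[OF \<psi>_linear] linear_scale'[OF \<psi>_linear, symmetric])
qed

sublocale V: free_action sV \<rho>V
  by (rule free_action.intro) (rule lie_moduleD(1)[OF modV])

lemmas \<rho>_linear = lie_moduleD(1)[OF modV] and \<rho>_linear_left = lie_moduleD(2)[OF modV]
  and \<rho>_bracket = lie_moduleD(3)[OF modV]

lemma \<rho>_add_left: "\<rho>V (\<xi> + \<eta>) v = \<rho>V \<xi> v + \<rho>V \<eta> v"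
  by (rule linear_add'[OF \<rho>_linear_left])

lemma j_p: "aff_neg \<xi> = 0 \<Longrightarrow> \<rho>V \<xi> (j u) = j (pact \<xi> u)"
proof -
  assume "aff_neg \<xi> = 0"
  then have "basis_vec (1 * gen \<xi>, u) - basis_vec (1, free_alg_act sU pact (gen \<xi>) u) \<in> relV"
    by (intro induced_rels_act) (simp add: aff_p_iff)
  then show ?thesis
    using \<psi>_left[of \<xi> "basis_vec (1, u)"] \<psi>_relD by (fastforce simp: linear_diff'[OF \<psi>_linear] vsU j_def)
qed

lemma \<psi>_basis: "\<psi> (basis_vec (a, u)) = free_alg_act sV \<rho>V a (j u)"
proof (rule linear_eq_on_basis[OF \<psi>_basis_linear linear_free_alg_act_left[OF vsV]])
  fix w :: "'m aff word"
  have "\<psi> (basis_vec (basis_vec (Word xs), u)) = foldr \<rho>V xs (j u)" for xs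
  proof (induction xs)
    case Nil
    then show ?case by (simp add: j_def basis_vec_one)
  next
    case (Cons \<xi> xs)
    have "basis_vec (Word (\<xi> # xs)) = gen \<xi> * basis_vec (Word xs)"
      by (simp add: mult_single word_plus)
    then show ?case using \<psi>_left[of \<xi> "basis_vec (basis_vec (Word xs), u)"] Cons by simp
  qed
  from this[of "letters w"] show "\<psi> (basis_vec (basis_vec w, u)) = free_alg_act sV \<rho>V (basis_vec w) (j u)"
    by (simp add: vsV)
qed

lemma V_induct [case_names j add act]:
  assumes "\<And>u. A (j u)" "\<And>v w. A v \<Longrightarrow> A w \<Longrightarrow> A (v + w)" "\<And>\<xi> v. A v \<Longrightarrow> A (\<rho>V \<xi> v)"
  shows "A v"
proof -
  have words: "A (foldr \<rho>V xs (j u))" for xs u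
    by (induction xs) (simp_all add: assms)
  have act: "A (free_alg_act sV \<rho>V a (j u))" for a u
  proof (induction a rule: pm_induct)
    case (single w c)
    have "free_alg_act sV \<rho>V (Poly_Mapping.single w c) (j u) = foldr \<rho>V (letters w) (j (sU c u))"
      by (simp add: free_alg_act_single vsV linear_scale'[OF j_linear] linear_scale'[OF V.linear_foldr])
    then show ?case by (simp add: words)
  qed (simp add: assms linear_add'[OF linear_free_alg_act_left[OF vsV]])
  have "A (\<psi> y)" for y
  proof (induction y rule: pm_induct)
    case (single au c)
    obtain a u where [simp]: "au = (a, u)" by (cases au)
    have "\<psi> (Poly_Mapping.single au c) = sV c (\<psi> (basis_vec (a, u)))"
      by (simp add: linear_scale'[OF \<psi>_linear, symmetric])
    also have "\<dots> = free_alg_act sV \<rho>V a (j (sU c u))"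
      by (simp add: \<psi>_basis linear_scale'[OF j_linear] linear_scale'[OF V.linear_free_alg_act])
    finally show ?case by (simp add: act)
  qed (simp add: assms linear_add'[OF \<psi>_linear])
  then show ?thesis using \<psi>_surj by (metis surjD)
qed

inductive qgen :: "'v \<Rightarrow> bool" where
  "qgen (j u)"
| "qgen v \<Longrightarrow> qgen w \<Longrightarrow> qgen (v + w)"
| "\<xi> \<in> aff_q \<Longrightarrow> qgen v \<Longrightarrow> qgen (\<rho>V \<xi> v)"

text \<open>On \<open>j u\<close>, the component of \<open>\<xi>\<close> in \<open>\<pp>\<close>
  acts within \<open>U\<close>. Past a letter \<open>\<eta>\<close> from \<open>\<qq>\<close>,
  \<open>\<xi>\<close> moves at the cost of the bracket of \<open>\<xi>\<close> and
  \<open>\<eta>\<close>, which the induction covers because \<open>\<xi>\<close> is arbitrary in it.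
  So the vectors generated from \<open>U\<close> by \<open>\<qq>\<close> fill
  \<open>V\<close>.\<close>

lemma qgen_act: "qgen v \<Longrightarrow> qgen (\<rho>V \<xi> v)"
proof (induction arbitrary: \<xi> rule: qgen.induct)
  case (1 u)
  have "\<rho>V \<xi> (j u) = \<rho>V (aff_neg \<xi>) (j u) + \<rho>V (\<xi> - aff_neg \<xi>) (j u)"
    by (simp add: \<rho>_add_left[symmetric])
  also have "\<rho>V (\<xi> - aff_neg \<xi>) (j u) = j (pact (\<xi> - aff_neg \<xi>) u)"
    by (rule j_p) (simp add: additive.diff[OF additive_aff_neg] aff_neg_idem)
  finally show ?case
    by (simp add: qgen.intros aff_q_iff aff_neg_idem)
next
  case (3 \<eta> v)
  have "\<rho>V \<xi> (\<rho>V \<eta> v) = \<rho>V \<eta> (\<rho>V \<xi> v) + \<rho>V (aff_bracket \<xi> \<eta>) v"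
    by (simp add: \<rho>_bracket)
  then show ?case using 3 by (simp add: qgen.intros)
qed (simp add: linear_add'[OF \<rho>_linear] qgen.intros)

lemma V_induct_q [case_names j add act]:
  assumes "\<And>u. A (j u)" "\<And>v w. A v \<Longrightarrow> A w \<Longrightarrow> A (v + w)" "\<And>\<xi> v. \<xi> \<in> aff_q \<Longrightarrow> A v \<Longrightarrow> A (\<rho>V \<xi> v)"
  shows "A v"
proof -
  have "qgen v" by (induction v rule: V_induct) (auto intro: qgen.intros qgen_act)
  then show ?thesis by (induction rule: qgen.induct) (auto intro: assms)
qed

lemma level: "\<rho>V (0, c) v = sV (l * c) v"
proof (induction v rule: V_induct)
  case (j u)
  then show ?case by (simp add: j_p pact_central linear_scale'[OF j_linear])
next
  case (act \<xi> v)
  have "\<rho>V (0, c) (\<rho>V \<xi> v) = \<rho>V \<xi> (\<rho>V (0, c) v)"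
    using \<rho>_bracket[of "(0, c)" \<xi> v] linear_zero'[OF \<rho>_linear_left] by simp
  then show ?case using act by (simp add: linear_scale'[OF \<rho>_linear])
qed (simp add: linear_add'[OF \<rho>_linear] additive.add[OF additive_scale[OF vsV]])

text \<open>This makes the infinite sum in \<open>z\<^sub>p\<close> finite on each vector. For
  \<open>\<xi> v\<close> the only new contribution is the commutator of the loop with
  \<open>\<xi>\<close>, whose degrees grow with \<open>i\<close>.\<close>

lemma annihilated: "\<exists>n. \<forall>i\<ge>n. \<forall>P. \<rho>V (loop P (int i)) v = 0"
proof (induction v rule: V_induct)
  case (j u)
  have "\<rho>V (loop P (int i)) (j u) = 0" if "i \<ge> 1" for i P
    using that by (simp add: j_p aff_neg_loop pact_loop linear_zero'[OF j_linear])
  then show ?case by blast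
next
  case (add v w)
  then obtain m n where "\<forall>i\<ge>m. \<forall>P. \<rho>V (loop P (int i)) v = 0" "\<forall>i\<ge>n. \<forall>P. \<rho>V (loop P (int i)) w = 0" by blast
  then show ?case by (intro exI[of _ "max m n"]) (simp add: linear_add'[OF \<rho>_linear])
next
  case (act \<xi> v)
  then obtain n where n: "\<forall>i\<ge>n. \<forall>P. \<rho>V (loop P (int i)) v = 0" by blast
  have "\<exists>k. \<forall>i\<ge>k. \<forall>P. \<rho>V (aff_bracket (loop P (int i)) \<xi>) v = 0"
  proof (induction \<xi> rule: aff_induct)
    case (loop Q j)
    \<comment> \<open>The margin \<open>nat (- j) + 1\<close> makes the degree \<open>i + j\<close>
      larger than \<open>n\<close> and nonzero, so that the bracket has no central term.\<close>
    have "\<rho>V (aff_bracket (loop P (int i)) (loop Q j)) v = 0" if i: "i \<ge> n + nat (- j) + 1" for i P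
    proof -
      obtain k where k: "int i + j = int k" "k \<ge> n" "int k \<noteq> 0"
        using i by (intro that[of "nat (int i + j)"]) auto
      then show ?thesis
        using n by (simp add: aff_bracket_loop \<rho>_add_left level additive.zero[OF additive_scale_left[OF vsV]])
    qed
    then show ?case by blast
  next
    case (add \<xi> \<eta>)
    then obtain k k' where "\<forall>i\<ge>k. \<forall>P. \<rho>V (aff_bracket (loop P (int i)) \<xi>) v = 0"
      "\<forall>i\<ge>k'. \<forall>P. \<rho>V (aff_bracket (loop P (int i)) \<eta>) v = 0" by blast
    then show ?case by (intro exI[of _ "max k k'"]) (simp add: aff_bracket_add_right \<rho>_add_left)
  qed (simp add: linear_zero'[OF \<rho>_linear_left])
  then obtain k where k: "\<forall>i\<ge>k. \<forall>P. \<rho>V (aff_bracket (loop P (int i)) \<xi>) v = 0" by blast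
  have "\<rho>V (loop P (int i)) (\<rho>V \<xi> v) = 0" if "i \<ge> max n k" for i P
    using \<rho>_bracket[of "loop P (int i)" \<xi> v] n k that by (simp add: linear_zero'[OF \<rho>_linear])
  then show ?case by blast
qed

text \<open>\<open>\<Psi> h\<close> extends \<open>h\<close> from \<open>U\<close> to
  \<open>V\<close> in such a way that a letter from \<open>\<qq>\<close> on \<open>V\<close> becomes
  its negative on the values; this sign later makes the two parts of the action on \<open>W\<close>
  cancel. Linearity in \<open>h\<close> allows finite sums to be carried through
  \<open>\<Psi>\<close>.\<close>

lemma functional:
  fixes sZ :: "complex \<Rightarrow> 'z \<Rightarrow> 'z::ab_group_add" and loop_act :: "'m aff \<Rightarrow> 'z \<Rightarrow> 'z"
  assumes loop_act: "lie_module aff_scale aff_bracket sZ loop_act"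
  obtains \<Psi> :: "('u \<Rightarrow> 'z) \<Rightarrow> 'v \<Rightarrow> 'z" where
    "\<And>h. Vector_Spaces.linear sU sZ h \<Longrightarrow> Vector_Spaces.linear sV sZ (\<Psi> h)"
    "\<And>h u. Vector_Spaces.linear sU sZ h \<Longrightarrow> \<Psi> h (j u) = h u"
    "\<And>h \<xi> v. Vector_Spaces.linear sU sZ h \<Longrightarrow> \<xi> \<in> aff_q \<Longrightarrow> \<Psi> h (\<rho>V \<xi> v) = \<Psi> (\<lambda>u. - loop_act \<xi> (h u)) v"
    "\<And>h h' v. \<Psi> (\<lambda>u. h u + h' u) v = \<Psi> h v + \<Psi> h' v"
    "\<And>h c v. \<Psi> (\<lambda>u. sZ c (h u)) v = sZ c (\<Psi> h v)"
proof -
  note lam1 = lie_moduleD(1)[OF loop_act] and lam2 = lie_moduleD(2)[OF loop_act] and lam3 = lie_moduleD(3)[OF loop_act]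
  have vsZ: "vector_space sZ" using lam1 by (rule linear_vs)
  interpret L: split_lie aff_scale aff_bracket aff_neg sU pact sZ by (rule split_lie[OF vsZ])
  \<comment> \<open>The first letter of the word has to act first, as the rule for
    \<open>\<xi> v\<close> demands. The signs compensate this reversal of the order, as in the
    antipode of an enveloping algebra, so that the commutation relations hold.\<close>
  define T where "T w z = foldl (\<lambda>z \<xi>. - loop_act \<xi> z) z w" for w z
  define \<Phi> where "\<Phi> h w u = T w (h u)" for h :: "'u \<Rightarrow> 'z" and w u
  have neg: "Vector_Spaces.linear s sZ f \<Longrightarrow> Vector_Spaces.linear s sZ (\<lambda>x. - f x)" for s and f :: "'a::ab_group_add \<Rightarrow> 'z"
    by (auto simp: Vector_Spaces.linear_iff module.scale_minus_right vector_space_module)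
  have T_linear: "Vector_Spaces.linear sZ sZ (T w)" for w
  proof (induction w)
    case (Cons \<xi> w)
    have "T (\<xi> # w) = (\<lambda>z. T w (- loop_act \<xi> z))" by (simp add: T_def fun_eq_iff)
    then show ?case using linear_comp'[OF neg[OF lam1] Cons, of \<xi>] by simp
  qed (use linear_ident[OF vsZ] in \<open>simp add: T_def\<close>)
  have T_app: "T (v @ w) z = T w (T v z)" "T (\<xi> # w) z = T w (- loop_act \<xi> z)" for v w z \<xi>
    by (simp_all add: T_def)
  have good: "L.good (\<Phi> h)" if h: "Vector_Spaces.linear sU sZ h" for h
    unfolding L.good_def
  proof (intro conjI allI)
    show "Vector_Spaces.linear aff_scale sZ (\<lambda>\<xi>. \<Phi> h (v @ \<xi> # w) x)" for v w x
      using linear_comp'[OF neg[OF lam2] T_linear] by (simp add: \<Phi>_def T_app)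
    show "Vector_Spaces.linear sU sZ (\<Phi> h w)" for w
      using linear_comp'[OF h T_linear] by (simp add: \<Phi>_def[abs_def])
    show "\<Phi> h (v @ \<xi> # \<eta> # w) x - \<Phi> h (v @ \<eta> # \<xi> # w) x = \<Phi> h (v @ aff_bracket \<xi> \<eta> # w) x" for v w \<xi> \<eta> x
      by (simp add: \<Phi>_def T_app linear_diff'[OF T_linear, symmetric] lam3 additive.minus[OF additive_linear[OF lam1]])
  qed
  define G where "G h = lin_ext sZ (\<lambda>(a, u). L.coact_alg (\<Phi> h) a u)" for h
  define \<Psi> where "\<Psi> h v = G h (SOME y. \<psi> y = v)" for h v
  have G_linear: "Vector_Spaces.linear pscale sZ (G h)" for h
    unfolding G_def by (rule linear_lin_ext[OF vsZ])
  have G_basis: "G h (basis_vec (a, u)) = L.coact_alg (\<Phi> h) a u" for h a u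
    by (simp add: G_def vsZ)
  have P_eq: "{\<xi>. aff_neg \<xi> = 0} = aff_p" by (auto simp: aff_p_iff)
  \<comment> \<open>The choice of a preimage does not affect the value, since \<open>G h\<close>
    vanishes on the kernel of \<open>\<psi>\<close>.\<close>
  have \<Psi>: "\<Psi> h (\<psi> y) = G h y" if h: "Vector_Spaces.linear sU sZ h" for h y
  proof -
    have "\<psi> (SOME y'. \<psi> y' = \<psi> y) = \<psi> y" by (rule someI) simp
    then have "(SOME y'. \<psi> y' = \<psi> y) - y \<in> relV" by (simp add: \<psi>_kernel[symmetric] linear_diff'[OF \<psi>_linear])
    then have "G h ((SOME y'. \<psi> y' = \<psi> y) - y) = 0"
      unfolding G_def using L.coact_alg_induced_rels[OF good[OF h]] by (simp add: env_rels P_eq)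
    then show ?thesis by (simp add: \<Psi>_def linear_diff'[OF G_linear])
  qed
  show ?thesis
  proof (rule that[of \<Psi>])
    fix h :: "'u \<Rightarrow> 'z" assume h: "Vector_Spaces.linear sU sZ h"
    show "Vector_Spaces.linear sV sZ (\<Psi> h)"
    proof (rule linearI'[OF vsV vsZ])
      have "\<Psi> h (v + w) = \<Psi> h v + \<Psi> h w" for v w
      proof -
        obtain y z where "v = \<psi> y" "w = \<psi> z" using \<psi>_surj by (metis surjD)
        then show ?thesis by (simp add: linear_add'[OF \<psi>_linear, symmetric] \<Psi>[OF h] linear_add'[OF G_linear])
      qed
      then show "additive (\<Psi> h)" by (rule additiveI)
      fix c v
      obtain y where "v = \<psi> y" using \<psi>_surj by (metis surjD)
      then show "\<Psi> h (sV c v) = sZ c (\<Psi> h v)"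
        by (simp add: linear_scale'[OF \<psi>_linear, symmetric] \<Psi>[OF h] linear_scale'[OF G_linear])
    qed
    show "\<Psi> h (j u) = h u" for u
      by (simp add: j_def \<Psi>[OF h] G_basis basis_vec_one L.coact_alg_single \<Phi>_def T_def
          vector_space.vector_space_assms(4)[OF vsZ])
    fix \<xi> :: "'m aff" and v assume \<xi>: "\<xi> \<in> aff_q"
    have h': "Vector_Spaces.linear sU sZ (\<lambda>u. - loop_act \<xi> (h u))"
      by (rule neg[OF linear_comp'[OF h lam1]])
    obtain y where y: "v = \<psi> y" using \<psi>_surj by (metis surjD)
    have "G h (induced_left (gen \<xi>) y) = G (\<lambda>u. - loop_act \<xi> (h u)) y"
    proof (rule linear_eq_on_basis[of sZ "\<lambda>y. G h (induced_left (gen \<xi>) y)"])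
      show "Vector_Spaces.linear pscale sZ (\<lambda>y. G h (induced_left (gen \<xi>) y))"
        unfolding induced_left_def by (rule linear_comp'[OF linear_lin_ext[OF vs_pscale] G_linear])
      show "Vector_Spaces.linear pscale sZ (G (\<lambda>u. - loop_act \<xi> (h u)))" by (rule G_linear)
      fix au :: "'m aff free_alg \<times> 'u"
      obtain a u where au: "au = (a, u)" by (cases au)
      \<comment> \<open>The identity between the two functionals is available only on words from
        \<open>\<qq>\<close>, where \<open>\<xi>\<close> acts by left multiplication; by
        \<open>coact_alg_cong\<close> this is enough.\<close>
      have "L.coact_alg (coact (\<Phi> h) \<xi>) a u = L.coact_alg (\<Phi> (\<lambda>u. - loop_act \<xi> (h u))) a u" if "coact = L.coact" for coact
        unfolding that
      proof (rule L.coact_alg_cong)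
        fix w :: "'m aff list" and x assume "\<forall>\<xi>\<in>set w. aff_neg \<xi> = \<xi>"
        then show "L.coact (\<Phi> h) \<xi> w x = \<Phi> (\<lambda>u. - loop_act \<xi> (h u)) w x"
          using L.coact_q[OF good[OF h], of \<xi> w x] \<xi> by (simp add: aff_q_iff \<Phi>_def T_app)
      qed
      then show "G h (induced_left (gen \<xi>) (basis_vec au)) = G (\<lambda>u. - loop_act \<xi> (h u)) (basis_vec au)"
        by (simp add: au G_basis L.coact_alg_gen_mult)
    qed
    then show "\<Psi> h (\<rho>V \<xi> v) = \<Psi> (\<lambda>u. - loop_act \<xi> (h u)) v"
      by (simp add: y \<psi>_left[symmetric] \<Psi>[OF h] \<Psi>[OF h'])
  next
    fix h h' :: "'u \<Rightarrow> 'z" and v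
    have "\<Phi> (\<lambda>u. h u + h' u) = (\<lambda>w x. \<Phi> h w x + \<Phi> h' w x)"
      by (simp add: \<Phi>_def[abs_def] linear_add'[OF T_linear])
    then have "G (\<lambda>u. h u + h' u) y = G h y + G h' y" for y
      by (simp add: G_def lin_ext_def L.coact_alg_add split_def additive.add[OF additive_scale[OF vsZ]] sum.distrib)
    then show "\<Psi> (\<lambda>u. h u + h' u) v = \<Psi> h v + \<Psi> h' v" by (simp add: \<Psi>_def)
  next
    fix h :: "'u \<Rightarrow> 'z" and c v
    have "\<Phi> (\<lambda>u. sZ c (h u)) = (\<lambda>w x. sZ c (\<Phi> h w x))"
      by (simp add: \<Phi>_def[abs_def] linear_scale'[OF T_linear])
    then have "G (\<lambda>u. sZ c (h u)) y = sZ c (G h y)" for y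
      by (simp add: G_def lin_ext_def L.coact_alg_scale split_def additive.sum[OF additive_scale[OF vsZ]]
        vector_space.vector_space_assms(3)[OF vsZ] mult.commute)
    then show "\<Psi> (\<lambda>u. sZ c (h u)) v = sZ c (\<Psi> h v)" by (simp add: \<Psi>_def)
  qed
qed

end


section \<open>The action of the affine Lie algebra\<close>

text \<open>Extends operators on \<open>V\<close> that are indexed by traceless matrices to all
  matrices, so that products with matrix units can occur as indices in the Casimir
  computations.\<close>

lift_definition sl_proj :: "complex^'m^'m \<Rightarrow> 'm::finite sl" is "\<lambda>P. P - mat (trace P / of_nat CARD('m))"
proof -
  fix P :: "complex^'m^'m"
  have "trace (mat c :: complex^'m^'m) = of_nat CARD('m) * c" for c
    by (simp add: trace_def mat_def)
  then show "trace (P - mat (trace P / of_nat CARD('m))) = 0"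
    by (simp add: trace_sub)
qed

lemma sl_proj_unit: "sl_proj (matrix_unit x y) = sl_unit x y"
  by (transfer) (simp add: trace_matrix_unit mat_def vec_eq_iff)

lemma trace_mat_of_sl [simp]: "trace (mat_of_sl P) = 0"
  by transfer

lemma sl_proj_mat_of_sl [simp]: "sl_proj (mat_of_sl P) = P"
  by transfer (simp add: mat_def vec_eq_iff)

lemma mat_of_sl_add: "mat_of_sl (P + Q) = mat_of_sl P + mat_of_sl Q"
  by transfer simp

lemma mat_of_sl_scale: "mat_of_sl (sl_scale c P) = (\<chi> i j. c * mat_of_sl P $ i $ j)"
  by transfer simp

lemma mat_of_sl_bracket: "mat_of_sl (sl_bracket P Q) = mat_of_sl P ** mat_of_sl Q - mat_of_sl Q ** mat_of_sl P"
  by transfer simp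

lemma sl_proj_add: "sl_proj (P + Q) = sl_proj P + sl_proj Q"
  by transfer (simp add: trace_add mat_def vec_eq_iff add_divide_distrib)

lemma sl_proj_scale: "sl_proj (\<chi> i j. c * P $ i $ j) = sl_scale c (sl_proj P)"
  by transfer (simp add: trace_def mat_def vec_eq_iff sum_distrib_left algebra_simps flip: sum_divide_distrib)

text \<open>Scalar matrices are central and commutators are traceless, so the trace part disappears
  on both sides.\<close>

lemma sl_proj_bracket: "sl_bracket (sl_proj P) Q = sl_proj (P ** mat_of_sl Q - mat_of_sl Q ** P)"
proof transfer
  fix P Q :: "complex^'m^'m"
  have "mat c ** Q = Q ** mat c" for c
    by (simp add: matrix_matrix_mult_def mat_def vec_eq_iff if_distrib[of "\<lambda>x. x * _"] if_distrib[of "(*) _"] cong: if_cong)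
  then show "(P - mat (trace P / of_nat CARD('m))) ** Q - Q ** (P - mat (trace P / of_nat CARD('m))) =
    P ** Q - Q ** P - mat (trace (P ** Q - Q ** P) / of_nat CARD('m))"
    by (simp add: matrix_diff_rdistrib matrix_diff_ldistrib trace_sub trace_mul_sym[of P Q])
qed

text \<open>Because \<open>Q\<close> is traceless, the scalar correction in \<open>sl_unit\<close>
  contributes nothing.\<close>

lemma trace_form_unit: "sl_trace_form (sl_unit y x) Q = mat_of_sl Q $ x $ y"
proof transfer
  fix y x and Q :: "complex^'m^'m" assume Q: "trace Q = 0"
  have "mat c ** Q = (\<chi> i j. c * Q $ i $ j)" for c
    by (simp add: matrix_matrix_mult_def mat_def vec_eq_iff if_distrib[of "\<lambda>x. x * _"] cong: if_cong)
  then have 1: "trace (mat c ** Q) = 0" for c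
    using Q by (simp add: trace_def flip: sum_distrib_left)
  have "trace (matrix_unit y x ** Q) = Q $ x $ y"
    by (simp add: trace_def unit_mult_right)
  then show "trace ((matrix_unit y x - (if y = x then mat (1 / of_nat CARD('m)) else 0)) ** Q) = Q $ x $ y"
    using 1 by (simp add: matrix_diff_rdistrib trace_sub) (simp add: trace_def matrix_matrix_mult_def)
qed

context scaled
begin

definition loop_sites :: "int \<Rightarrow> complex^'m^'m \<Rightarrow> ('n::finite, 'm::finite, 'v) AN endo"
  where "loop_sites i P = (\<Sum>q\<in>UNIV. shift_op (axis q i) * M q P)"

text \<open>The action on the variables and sites alone. It has level 0, so the central component is
  dropped. Over \<open>U\<close> instead of \<open>V\<close> it is the action on the target of the
  projection.\<close>

definition loop_act :: "'m aff \<Rightarrow> ('n::finite, 'm::finite, 'v) AN endo"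
  where "loop_act \<xi> = pm_ext (\<lambda>i P. loop_sites i (mat_of_sl P)) (fst \<xi>)"

lemma loop_sites_add: "loop_sites i (P + Q) = loop_sites i P + loop_sites i Q"
  by (simp add: loop_sites_def M_add distrib_left sum.distrib)

lemma loop_sites_scale: "loop_sites i (\<chi> j k. c * P $ j $ k) = S c * loop_sites i P"
  by (simp add: loop_sites_def M_scale sum_distrib_left mult.assoc[symmetric] S_shift_op)

lemma shift_op_M_comm: "p \<noteq> q \<Longrightarrow> (shift_op c * M p P) * (shift_op d * M q Q) = (shift_op d * M q Q) * (shift_op c * M p P)"
  by (rule commute_mult; rule commute_mult[symmetric]) (simp_all add: shift_op_comm M_shift_op M_comm)

text \<open>Operators at different sites commute. At one site the powers of the variable multiply
  and the matrices give their commutator, so no cocycle appears.\<close>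

lemma loop_sites_bracket: "loop_sites i P * loop_sites j Q - loop_sites j Q * loop_sites i P = loop_sites (i + j) (P ** Q - Q ** P)"
proof -
  let ?a = "\<lambda>p. shift_op (axis p i) * M p P" and ?b = "\<lambda>p. shift_op (axis p j) * M p Q"
  have ax: "axis p (i + j) = axis p i + axis p j" for p by (simp add: axis_def vec_eq_iff)
  have proj_q: "?a p * ?b q - ?b q * ?a p = (if q = p then shift_op (axis p (i + j)) * M p (P ** Q - Q ** P) else 0)" for p q
  proof (cases "p = q")
    case True
    have "?a p * ?b p = shift_op (axis p i) * (M p P * shift_op (axis p j)) * M p Q" by (simp only: mult.assoc)
    also have "\<dots> = shift_op (axis p i) * shift_op (axis p j) * (M p P * M p Q)" by (simp only: M_shift_op mult.assoc)
    finally have 1: "?a p * ?b p = shift_op (axis p i) * shift_op (axis p j) * (M p P * M p Q)" .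
    have "?b p * ?a p = shift_op (axis p j) * (M p Q * shift_op (axis p i)) * M p P" by (simp only: mult.assoc)
    also have "\<dots> = shift_op (axis p j) * shift_op (axis p i) * (M p Q * M p P)" by (simp only: M_shift_op mult.assoc)
    finally have 2: "?b p * ?a p = shift_op (axis p i) * shift_op (axis p j) * (M p Q * M p P)" by (simp only: shift_op_comm)
    show ?thesis unfolding True[symmetric] 1 2
      by (simp add: M_diff M_mult right_diff_distrib ax shift_op_mult[symmetric])
  qed (simp add: shift_op_M_comm)
  have "loop_sites i P * loop_sites j Q - loop_sites j Q * loop_sites i P = (\<Sum>p\<in>UNIV. \<Sum>q\<in>UNIV. ?a p * ?b q) - (\<Sum>q\<in>UNIV. \<Sum>p\<in>UNIV. ?b q * ?a p)"
    by (simp only: loop_sites_def sum_product)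
  also have "(\<Sum>q\<in>UNIV. \<Sum>p\<in>UNIV. ?b q * ?a p) = (\<Sum>p\<in>UNIV. \<Sum>q\<in>UNIV. ?b q * ?a p)"
    by (rule sum.swap)
  also have "(\<Sum>p\<in>UNIV. \<Sum>q\<in>UNIV. ?a p * ?b q) - (\<Sum>p\<in>UNIV. \<Sum>q\<in>UNIV. ?b q * ?a p)
    = (\<Sum>p\<in>UNIV. \<Sum>q\<in>UNIV. (if q = p then shift_op (axis p (i + j)) * M p (P ** Q - Q ** P) else 0))"
    by (simp only: sum_subtractf[symmetric] proj_q)
  also have "\<dots> = loop_sites (i + j) (P ** Q - Q ** P)" by (simp add: loop_sites_def)
  finally show ?thesis .
qed

lemma additive_loop_sites: "additive (\<lambda>P. loop_sites i (mat_of_sl P))"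
  by (rule additiveI) (simp add: mat_of_sl_add loop_sites_add)

lemma loop_act_add: "loop_act (\<xi> + \<eta>) = loop_act \<xi> + loop_act \<eta>"
  by (simp add: loop_act_def additive.add[OF additive_pm_ext[OF additive_loop_sites]])

lemma loop_act_loop: "loop_act (loop P i) = loop_sites i (mat_of_sl P)"
  unfolding loop_act_def loop_def by (simp add: additive_loop_sites)

lemma loop_act_central [simp]: "loop_act (0, c) = 0"
  by (simp add: loop_act_def additive.zero[OF additive_pm_ext[OF additive_loop_sites]])

lemma loop_act_zero [simp]: "loop_act 0 = 0"
  by (simp add: zero_prod_def)

lemma loop_act_scale: "loop_act (aff_scale c \<xi>) = S c * loop_act \<xi>"
  by (induction \<xi> rule: aff_induct)
    (simp_all add: loop_scale[symmetric] loop_act_loop mat_of_sl_scale loop_sites_scale aff_scale_central aff_scale_add loop_act_add distrib_left)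

lemma loop_act_bracket: "loop_act (aff_bracket \<xi> \<eta>) = loop_act \<xi> * loop_act \<eta> - loop_act \<eta> * loop_act \<xi>"
proof (induction \<xi> rule: aff_induct)
  case (loop P i)
  show ?case
    by (induction \<eta> rule: aff_induct)
      (simp_all add: aff_bracket_loop loop_act_add loop_act_loop mat_of_sl_bracket loop_sites_bracket aff_bracket_add_right algebra_simps)
qed (simp_all add: aff_bracket_add_left loop_act_add algebra_simps)

lemma vsW: "vector_space (fscale (fscale s))"
  by (simp add: vs)

lemma loop_act_S:
  fixes \<xi> :: "'m::finite aff"
  shows "loop_act \<xi> * S c = (S c * loop_act \<xi> :: ('n::finite, 'm, 'v) AN endo)"
proof -
  have "S c * (shift_op d * M q P) = (shift_op d * M q P * S c :: ('n, 'm, 'v) AN endo)" for d q P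
    by (rule commute_mult) (simp_all add: S_shift_op M_S)
  then have "S c * loop_sites i P = (loop_sites i P * S c :: ('n, 'm, 'v) AN endo)" for i P
    unfolding loop_sites_def by (rule_tac commute_sum)
  then show ?thesis
    by (induction \<xi> rule: aff_induct) (simp_all add: loop_act_loop loop_act_add distrib_left distrib_right)
qed

lemma lie_module_loop_act: "lie_module aff_scale aff_bracket (fscale (fscale s)) (\<lambda>\<xi>. app (loop_act \<xi>))"
  unfolding lie_module_def
proof (intro conjI allI)
  show "Vector_Spaces.linear (fscale (fscale s)) (fscale (fscale s)) (app (loop_act \<xi>))" for \<xi>
    using vsW vsW additive_app
  proof (rule linearI')
    fix c w
    have "app (loop_act \<xi> * S c) w = app (S c * loop_act \<xi>) w" by (simp only: loop_act_S)
    then show "app (loop_act \<xi>) (fscale (fscale s) c w) = fscale (fscale s) c (app (loop_act \<xi>) w)" by (simp add: S_scale)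
  qed
  show "Vector_Spaces.linear aff_scale (fscale (fscale s)) (\<lambda>\<xi>. app (loop_act \<xi>) v)" for v
    using vector_space_aff vsW by (rule linearI') (rule additiveI, simp_all add: loop_act_add loop_act_scale S_scale)
qed (simp add: loop_act_bracket)

section \<open>The defining operators of \<open>\<A>\<^sub>N\<close> as elements of the endomorphism
  ring\<close>

lemma site_op_basis: "site_op P q (basis_vec e) = (\<Sum>a\<in>UNIV. Poly_Mapping.single (e(q := a)) (P $ a $ e q))"
  by (simp add: site_op_def)

lemma tensor3_site:
  fixes q :: "'n::finite" and P :: "complex^'m^'m::finite"
  assumes "additive D"
  shows "tensor3_op s ((*) (xpow q j)) (site_op P q) D w = app (shift_op (axis q j) * M q P * coeff_op (Abs_endo D)) w"
proof (rule additive_mono_eqI[where w = w])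
  fix a :: "int^'n" and e :: "'n \<Rightarrow> 'm" and v
  have "pure_tensor s (site_op P q (basis_vec e)) (D v) = (\<Sum>x\<in>UNIV. Poly_Mapping.single (e(q := x)) (s (P $ x $ e q) (D v)))"
    by (simp add: site_op_basis additive.sum[OF additive_pure_tensor_left[OF vs]] pure_tensor_single vs)
  then show "tensor3_op s ((*) (xpow q j)) (site_op P q) D (tmono a e v) = app (shift_op (axis q j) * M q P * coeff_op (Abs_endo D)) (tmono a e v)"
    using assms by (simp add: tensor3_mono xpow_def mult_single vs app_M app_sum app_Abs add.commute additive.sum[OF additive_single])
qed (rule additive_tensor3[OF assms], rule additive_app)

lemma tensor3_id_id:
  assumes "additive D"
  shows "tensor3_op s id id D w = app (coeff_op (Abs_endo D)) w"
  by (rule additive_mono_eqI[where w = w], rule additive_tensor3[OF assms], rule additive_app)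
    (simp add: tensor3_mono vs app_Abs assms)

lemma coeff_op_Abs_id: "coeff_op (Abs_endo id) = 1"
  by (rule endo_mono_eqI) (simp add: app_Abs)

lemma AN_aff_eq:
  assumes "additive (\<rho> \<xi>)"
  shows "AN_aff s \<rho> \<xi> w = app (loop_act \<xi> + coeff_op (Abs_endo (\<rho> \<xi>))) w"
  unfolding AN_aff_def tensor3_id_id[OF assms] tensor3_site[OF additive_id(1)] coeff_op_Abs_id
  by (simp add: loop_act_def pm_ext_def loop_sites_def app_sum_left)

definition Xop :: "'n \<Rightarrow> int \<Rightarrow> ('n::finite, 'm::finite, 'v) AN endo"
  where "Xop p j = shift_op (axis p j)"

definition sym_op :: "'n perm \<Rightarrow> ('n::finite, 'm::finite, 'v) AN endo"
  where "sym_op \<sigma> = perm_vars \<sigma> * perm_sites \<sigma>"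

lemma AN_Sym: "AN_cherednik \<kappa> s \<rho> (Sym \<sigma>) w = app (sym_op \<sigma>) w"
  unfolding AN_cherednik.simps
  by (rule additive_mono_eqI[where w = w], rule additive_tensor3, simp, rule additive_app)
    (subst tensor3_mono[OF additive_id(1)], simp add: vs sym_op_def perm_laurent_basis perm_tpow_def perm_idx_def)

lemma AN_shift: "tensor3_op s ((*) (xpow p j)) id id w = app (Xop p j) w"
  by (rule additive_mono_eqI[where w = w], rule additive_tensor3, simp, rule additive_app)
    (subst tensor3_mono[OF additive_id(1)], simp add: vs Xop_def xpow_def mult_single add.commute)

lemma AN_X: "AN_cherednik \<kappa> s \<rho> (X p) w = app (Xop p 1) w" "AN_cherednik \<kappa> s \<rho> (Xinv p) w = app (Xop p (- 1)) w"
  by (simp_all add: AN_shift)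

lemma AN_euler: "tensor3_op s (\<lambda>f. pscale \<kappa> (xpow p 1 * partial p f)) id id w = app (S \<kappa> * euler_op p) w"
  by (rule additive_mono_eqI[where w = w], rule additive_tensor3, simp, rule additive_app)
    (subst tensor3_mono[OF additive_id(1)], simp add: vs partial_def xpow_def mult_single pure_tensor_single
      vector_space.vector_space_assms(3)[OF vs])

lemma AN_ddiff_op: "tensor3_op s (divided_diff p r) (perm_tpow \<sigma>) id w = app (ddiff_op p r * perm_sites \<sigma>) w"
  by (rule additive_mono_eqI[where w = w], rule additive_tensor3, simp, rule additive_app)
    (subst tensor3_mono[OF additive_id(1)], simp add: vs app_ddiff_op perm_tpow_def perm_idx_def)

text \<open>Multiplied by \<open>x\<^sub>p - x\<^sub>r\<close>, the divided difference is an
  expression in \<open>x\<^sub>p\<close> and the transposition of variables; an operator that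
  commutes with these and with \<open>x\<^sub>r\<close> commutes with it.\<close>

lemma ddiff_op_comm:
  assumes "p \<noteq> r" "B * shift_op (axis p 1) = shift_op (axis p 1) * B" "B * shift_op (axis r 1) = shift_op (axis r 1) * B"
    "B * perm_vars \<langle>p \<leftrightarrow> r\<rangle> = perm_vars \<langle>p \<leftrightarrow> r\<rangle> * B"
  shows "ddiff_op p r * B = B * ddiff_op p r"
proof (rule xdiff_cancel[OF assms(1)])
  have B: "B * xdiff p r = xdiff p r * B"
    by (simp add: xdiff_def left_diff_distrib right_diff_distrib assms(2,3))
  have "shift_op (axis p 1) * (1 - perm_vars \<langle>p \<leftrightarrow> r\<rangle>) * B = B * (shift_op (axis p 1) * (1 - perm_vars \<langle>p \<leftrightarrow> r\<rangle>))"
    by (rule commute_mult[symmetric]) (simp_all add: assms(2,4) left_diff_distrib right_diff_distrib)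
  then have "xdiff p r * ddiff_op p r * B = B * (xdiff p r * ddiff_op p r)" by (simp only: xdiff_ddiff_op[OF assms(1)])
  also have "\<dots> = xdiff p r * (B * ddiff_op p r)" by (simp only: mult.assoc[symmetric] B)
  finally show "xdiff p r * (ddiff_op p r * B) = xdiff p r * (B * ddiff_op p r)" by (simp only: mult.assoc)
qed

lemma axis_split: "axis p (i + j :: int) = axis p i + axis p j"
  by (simp add: axis_def vec_eq_iff)

lemma perm_vars_swap_shift_op: "perm_vars \<langle>p \<leftrightarrow> r\<rangle> * shift_op (axis p j) = shift_op (axis r j) * perm_vars \<langle>p \<leftrightarrow> r\<rangle>"
  "perm_vars \<langle>p \<leftrightarrow> r\<rangle> * shift_op (axis r j) = shift_op (axis p j) * perm_vars \<langle>p \<leftrightarrow> r\<rangle>"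
  by (simp_all add: perm_vars_shift_op)

text \<open>A twisted Leibniz rule. Combined with the permutation of sites, its extra term becomes
  \<open>x\<^sub>p \<sigma>\<^sub>p\<^sub>r\<close> in \<open>[z\<^sub>p, x\<^sub>p]\<close>;
  \<open>ddiff_op_X_right\<close> supplies the one in \<open>[z\<^sub>p, x\<^sub>r]\<close>.\<close>

lemma ddiff_op_X_left:
  fixes p r :: "'n::finite"
  assumes "p \<noteq> r"
  shows "(ddiff_op p r :: ('n, 'm::finite, 'v) AN endo) * shift_op (axis p 1) = shift_op (axis p 1) * ddiff_op p r + shift_op (axis p 1) * perm_vars \<langle>p \<leftrightarrow> r\<rangle>"
proof (rule xdiff_cancel[OF assms])
  let ?p = "shift_op (axis p 1) :: ('n, 'm, 'v) AN endo" and ?r = "shift_op (axis r 1) :: ('n, 'm, 'v) AN endo" and ?s = "perm_vars \<langle>p \<leftrightarrow> r\<rangle>"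
  have "xdiff p r * (ddiff_op p r * ?p) = ?p * (1 - ?s) * ?p" by (simp only: mult.assoc[symmetric] xdiff_ddiff_op[OF assms])
  also have "\<dots> = ?p * ?p - ?p * ?r * ?s" by (simp add: left_diff_distrib right_diff_distrib mult.assoc perm_vars_swap_shift_op)
  finally have 1: "xdiff p r * (ddiff_op p r * ?p) = ?p * ?p - ?p * ?r * ?s" .
  have "xdiff p r * ?p = ?p * xdiff p r" by (simp add: xdiff_def left_diff_distrib right_diff_distrib shift_op_comm)
  then have "xdiff p r * (?p * ddiff_op p r) = ?p * (xdiff p r * ddiff_op p r)" by (simp only: mult.assoc[symmetric])
  also have "\<dots> = ?p * ?p - ?p * ?p * ?s" by (simp add: xdiff_ddiff_op[OF assms] right_diff_distrib mult.assoc)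
  finally have 2: "xdiff p r * (?p * ddiff_op p r) = ?p * ?p - ?p * ?p * ?s" .
  have 3: "xdiff p r * (?p * ?s) = ?p * ?p * ?s - ?p * ?r * ?s"
    by (simp add: xdiff_def left_diff_distrib mult.assoc[symmetric] shift_op_comm[of "axis r 1"])
  show "xdiff p r * (ddiff_op p r * ?p) = xdiff p r * (?p * ddiff_op p r + ?p * ?s)"
    unfolding distrib_left 1 2 3 by simp
qed

lemma ddiff_op_X_right:
  fixes p r :: "'n::finite"
  assumes "p \<noteq> r"
  shows "(ddiff_op p r :: ('n, 'm::finite, 'v) AN endo) * shift_op (axis r 1) = shift_op (axis r 1) * ddiff_op p r - shift_op (axis p 1) * perm_vars \<langle>p \<leftrightarrow> r\<rangle>"
proof (rule xdiff_cancel[OF assms])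
  let ?p = "shift_op (axis p 1) :: ('n, 'm, 'v) AN endo" and ?r = "shift_op (axis r 1) :: ('n, 'm, 'v) AN endo" and ?s = "perm_vars \<langle>p \<leftrightarrow> r\<rangle>"
  have "xdiff p r * (ddiff_op p r * ?r) = ?p * (1 - ?s) * ?r" by (simp only: mult.assoc[symmetric] xdiff_ddiff_op[OF assms])
  also have "\<dots> = ?p * ?r - ?p * ?p * ?s" by (simp add: left_diff_distrib right_diff_distrib mult.assoc perm_vars_swap_shift_op)
  finally have 1: "xdiff p r * (ddiff_op p r * ?r) = ?p * ?r - ?p * ?p * ?s" .
  have "xdiff p r * ?r = ?r * xdiff p r" by (simp add: xdiff_def left_diff_distrib right_diff_distrib shift_op_comm)
  then have "xdiff p r * (?r * ddiff_op p r) = ?r * (xdiff p r * ddiff_op p r)" by (simp only: mult.assoc[symmetric])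
  also have "\<dots> = ?p * ?r - ?p * ?r * ?s"
    by (simp add: xdiff_ddiff_op[OF assms] right_diff_distrib mult.assoc[symmetric] shift_op_comm[of "axis r 1"])
  finally have 2: "xdiff p r * (?r * ddiff_op p r) = ?p * ?r - ?p * ?r * ?s" .
  have 3: "xdiff p r * (?p * ?s) = ?p * ?p * ?s - ?p * ?r * ?s"
    by (simp add: xdiff_def left_diff_distrib mult.assoc[symmetric] shift_op_comm[of "axis r 1"])
  show "xdiff p r * (ddiff_op p r * ?r) = xdiff p r * (?r * ddiff_op p r - ?p * ?s)"
    unfolding right_diff_distrib 1 2 3 by simp
qed

lemma apply_eq_iff: "\<sigma> \<langle>$\<rangle> p = \<sigma> \<langle>$\<rangle> r \<longleftrightarrow> p = r"
  by (metis perm_inverse_apply(1))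

lemma swap_conj: "\<sigma> * \<langle>p \<leftrightarrow> r\<rangle> = \<langle>\<sigma> \<langle>$\<rangle> p \<leftrightarrow> \<sigma> \<langle>$\<rangle> r\<rangle> * \<sigma>"
proof (rule perm_eqI)
  fix q
  show "(\<sigma> * \<langle>p \<leftrightarrow> r\<rangle>) \<langle>$\<rangle> q = (\<langle>\<sigma> \<langle>$\<rangle> p \<leftrightarrow> \<sigma> \<langle>$\<rangle> r\<rangle> * \<sigma>) \<langle>$\<rangle> q"
    by (cases "q = p"; cases "q = r") (simp_all add: apply_mult apply_eq_iff)
qed

lemma perm_vars_ddiff_op:
  fixes p r :: "'n::finite"
  assumes "p \<noteq> r"
  shows "perm_vars \<sigma> * ddiff_op p r = (ddiff_op (\<sigma> \<langle>$\<rangle> p) (\<sigma> \<langle>$\<rangle> r) * perm_vars \<sigma> :: ('n, 'm::finite, 'v) AN endo)"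
proof (rule xdiff_cancel)
  let ?p = "\<sigma> \<langle>$\<rangle> p" and ?r = "\<sigma> \<langle>$\<rangle> r"
  show n: "?p \<noteq> ?r" using assms by (simp add: apply_eq_iff)
  have "xdiff ?p ?r * perm_vars \<sigma> = (perm_vars \<sigma> * xdiff p r :: ('n, 'm, 'v) AN endo)"
    by (simp add: xdiff_def left_diff_distrib right_diff_distrib perm_vars_shift_op)
  then have "xdiff ?p ?r * (perm_vars \<sigma> * ddiff_op p r) = (perm_vars \<sigma> * (xdiff p r * ddiff_op p r) :: ('n, 'm, 'v) AN endo)" by (simp only: mult.assoc[symmetric])
  also have "\<dots> = shift_op (axis ?p 1) * (1 - perm_vars \<langle>?p \<leftrightarrow> ?r\<rangle>) * perm_vars \<sigma>"
    unfolding xdiff_ddiff_op[OF assms]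
    by (simp add: left_diff_distrib right_diff_distrib mult.assoc[symmetric] perm_vars_shift_op)
      (simp only: mult.assoc perm_vars_mult swap_conj)
  also have "\<dots> = xdiff ?p ?r * (ddiff_op ?p ?r * perm_vars \<sigma>)" by (simp only: mult.assoc[symmetric] xdiff_ddiff_op[OF n])
  finally show "xdiff ?p ?r * (perm_vars \<sigma> * ddiff_op p r) = (xdiff ?p ?r * (ddiff_op ?p ?r * perm_vars \<sigma>) :: ('n, 'm, 'v) AN endo)" .
qed

lemma ddiff_op_perm_sites: "p \<noteq> r \<Longrightarrow> ddiff_op p r * perm_sites \<sigma> = perm_sites \<sigma> * ddiff_op p r"
  by (rule ddiff_op_comm) (simp_all add: perm_sites_shift_op perm_vars_perm_sites)

lemma ddiff_op_coeff_op: "p \<noteq> r \<Longrightarrow> ddiff_op p r * coeff_op D = coeff_op D * ddiff_op p r"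
  by (rule ddiff_op_comm) (simp_all add: coeff_op_shift_op perm_vars_coeff_op)

lemma ddiff_op_X_other: "p \<noteq> r \<Longrightarrow> q \<noteq> p \<Longrightarrow> q \<noteq> r \<Longrightarrow> ddiff_op p r * shift_op (axis q j) = shift_op (axis q j) * ddiff_op p r"
  by (rule ddiff_op_comm) (simp_all add: shift_op_comm perm_vars_shift_op)

text \<open>The full transposition of \<open>p\<close> and \<open>r\<close> commutes with the loop
  action, so after multiplication by \<open>x\<^sub>p - x\<^sub>r\<close> only the commutator with
  the flip of sites alone remains. It carries the difference of the \<open>- k\<close>-th powers of
  \<open>x\<^sub>p\<close> and \<open>x\<^sub>r\<close>, and division by
  \<open>x\<^sub>p - x\<^sub>r\<close> leaves a finite geometric sum.\<close>

lemma ddiff_op_loop_sites: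
  fixes p r :: "'n::finite" and Q :: "complex^'m^'m::finite"
  assumes "p \<noteq> r"
  shows "ddiff_op p r * perm_sites \<langle>p \<leftrightarrow> r\<rangle> * loop_sites (- int k) Q - loop_sites (- int k) Q * (ddiff_op p r * perm_sites \<langle>p \<leftrightarrow> r\<rangle>)
    = - (\<Sum>i<k. shift_op (axis p (- int i)) * shift_op (axis r (int i - int k)) * ((M r Q - M p Q) * perm_sites \<langle>p \<leftrightarrow> r\<rangle>))"
proof (rule xdiff_cancel[OF assms])
  let ?s = "\<langle>p \<leftrightarrow> r\<rangle>" and ?L = "loop_sites (- int k) Q :: ('n, 'm, 'v) AN endo" and ?x = "shift_op (axis p 1) :: ('n, 'm, 'v) AN endo" and ?k = "- int k"
  have Lsh: "?L * shift_op c = shift_op c * ?L" for c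
    unfolding loop_sites_def by (intro commute_sum[symmetric] commute_mult) (simp_all add: shift_op_comm M_shift_op)
  have eq: "(\<Sum>q\<in>UNIV. f q) = f p + f r + (\<Sum>q\<in>UNIV - {p, r}. f q)" for f :: "'n \<Rightarrow> ('n, 'm, 'v) AN endo"
    using sum.subset_diff[of "{p, r}" UNIV f] assms by (simp add: add.commute)
  let ?rest = "\<Sum>q\<in>UNIV - {p, r}. shift_op (axis q ?k) * M q Q :: ('n, 'm, 'v) AN endo"
  have L: "?L = shift_op (axis p ?k) * M p Q + shift_op (axis r ?k) * M r Q + ?rest"
    unfolding loop_sites_def by (rule eq)
  have rest_L: "perm_vars ?s * ?rest = ?rest * perm_vars ?s"
    by (rule commute_sum) (auto simp: mult.assoc[symmetric] perm_vars_shift_op M_perm_vars, simp add: mult.assoc M_perm_vars)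
  have rest_T: "perm_sites ?s * ?rest = ?rest * perm_sites ?s"
    by (rule commute_sum) (auto simp: mult.assoc[symmetric] perm_sites_shift_op, simp add: mult.assoc perm_sites_M)
  have T: "perm_sites ?s * ?L = (shift_op (axis p ?k) * M r Q + shift_op (axis r ?k) * M p Q + ?rest) * perm_sites ?s"
    unfolding L distrib_left distrib_right rest_T
    by (simp add: mult.assoc[symmetric] perm_sites_shift_op) (simp add: mult.assoc perm_sites_M)
  have LL: "perm_vars ?s * (shift_op (axis p ?k) * M r Q + shift_op (axis r ?k) * M p Q + ?rest) = ?L * perm_vars ?s"
    unfolding L distrib_left distrib_right rest_L
    by (simp add: mult.assoc[symmetric] perm_vars_shift_op) (simp add: mult.assoc M_perm_vars add.commute)
  \<comment> \<open>Exchanging variables and sites together only permutes the summands of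
    \<open>?L\<close>.\<close>
  have ST: "perm_vars ?s * perm_sites ?s * ?L = ?L * (perm_vars ?s * perm_sites ?s)"
    by (simp only: mult.assoc T) (simp only: mult.assoc[symmetric] LL)
  have diff: "perm_sites ?s * ?L - ?L * perm_sites ?s = (shift_op (axis p ?k) - shift_op (axis r ?k)) * ((M r Q - M p Q) * perm_sites ?s)"
    unfolding T by (subst L) (simp add: algebra_simps)
  have "xdiff p r * (ddiff_op p r * perm_sites ?s * ?L - ?L * (ddiff_op p r * perm_sites ?s))
      = xdiff p r * ddiff_op p r * (perm_sites ?s * ?L) - xdiff p r * ?L * (ddiff_op p r * perm_sites ?s)"
    by (simp add: right_diff_distrib mult.assoc)
  also have "xdiff p r * ?L = ?L * xdiff p r"
    by (simp add: xdiff_def left_diff_distrib right_diff_distrib Lsh)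
  also have "?L * xdiff p r * (ddiff_op p r * perm_sites ?s) = ?L * (xdiff p r * ddiff_op p r) * perm_sites ?s" by (simp only: mult.assoc)
  also have "\<dots> = ?x * (?L * (perm_sites ?s - perm_vars ?s * perm_sites ?s))"
    by (simp add: xdiff_ddiff_op[OF assms] right_diff_distrib left_diff_distrib mult.assoc[symmetric] Lsh)
  also have "xdiff p r * ddiff_op p r * (perm_sites ?s * ?L) = ?x * (perm_sites ?s * ?L - perm_vars ?s * perm_sites ?s * ?L)"
    by (simp add: xdiff_ddiff_op[OF assms] right_diff_distrib left_diff_distrib mult.assoc)
  also have "?x * (perm_sites ?s * ?L - perm_vars ?s * perm_sites ?s * ?L) - ?x * (?L * (perm_sites ?s - perm_vars ?s * perm_sites ?s)) = ?x * (perm_sites ?s * ?L - ?L * perm_sites ?s)"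
    unfolding ST by (simp add: right_diff_distrib)
  also have "\<dots> = ?x * (shift_op (axis p ?k) - shift_op (axis r ?k)) * ((M r Q - M p Q) * perm_sites ?s)"
    unfolding diff by (simp only: mult.assoc)
  also have "?x * (shift_op (axis p ?k) - shift_op (axis r ?k)) =
      - (xdiff p r * (\<Sum>i<k. shift_op (axis p (- int i)) * shift_op (axis r (int i - int k))))"
  proof -
    \<comment> \<open>Multiplying the \<open>i\<close>-th summand by
      \<open>x\<^sub>p - x\<^sub>r\<close> gives \<open>g i - g (Suc i)\<close>; the sum telescopes
      to the two end terms, which are \<open>x\<^sub>p\<close> times the \<open>- k\<close>-th power
      of \<open>x\<^sub>r\<close> and of \<open>x\<^sub>p\<close>.\<close>
    define g where "g i = (shift_op (axis p (1 - int i)) * shift_op (axis r (int i - int k)) :: ('n, 'm, 'v) AN endo)" for i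
    have "xdiff p r * (shift_op (axis p (- int i)) * shift_op (axis r (int i - int k))) = g i - g (Suc i)" for i
    proof -
      have "axis p 1 + (axis p (- int i) + axis r (int i - int k)) = axis p (1 - int i) + axis r (int i - int k)"
        "axis r 1 + (axis p (- int i) + axis r (int i - int k)) = axis p (1 - int (Suc i)) + axis r (int (Suc i) - int k)"
        by (simp_all add: vec_eq_iff axis_def)
      then show ?thesis unfolding g_def xdiff_def left_diff_distrib shift_op_mult by metis
    qed
    then have "xdiff p r * (\<Sum>i<k. shift_op (axis p (- int i)) * shift_op (axis r (int i - int k))) = g 0 - g k"
      by (simp add: sum_distrib_left sum_lessThan_telescope')
    moreover have "g 0 = ?x * shift_op (axis r ?k)" by (simp add: g_def)
    moreover have "g k = ?x * shift_op (axis p ?k)"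
    proof -
      have "axis p (1 - int k) + axis r (int k - int k) = axis p 1 + axis p ?k"
        by (simp add: vec_eq_iff axis_def)
      then show ?thesis unfolding g_def shift_op_mult by simp
    qed
    ultimately have "xdiff p r * (\<Sum>i<k. shift_op (axis p (- int i)) * shift_op (axis r (int i - int k))) =
      ?x * shift_op (axis r ?k) - ?x * shift_op (axis p ?k)" by simp
    then show ?thesis by (simp add: right_diff_distrib)
  qed
  finally show "xdiff p r * (ddiff_op p r * perm_sites ?s * ?L - ?L * (ddiff_op p r * perm_sites ?s)) =
    xdiff p r * - (\<Sum>i<k. shift_op (axis p (- int i)) * shift_op (axis r (int i - int k)) * ((M r Q - M p Q) * perm_sites ?s))"
    by (simp add: sum_distrib_right mult.assoc sum_distrib_left)
qed

lemma euler_op_loop_sites: "euler_op p * loop_sites j Q - loop_sites j Q * euler_op p = S (of_int j) * (shift_op (axis p j) * M p Q)"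
proof -
  have "euler_op p * (shift_op (axis q j) * M q Q) - shift_op (axis q j) * M q Q * euler_op p
      = (if q = p then S (of_int j) * (shift_op (axis q j) * M q Q) else 0)" for q
  proof -
    have "euler_op p * (shift_op (axis q j) * M q Q) = shift_op (axis q j) * (euler_op p + S (of_int (axis q j $ p))) * M q Q"
      by (simp only: mult.assoc[symmetric] euler_op_shift_op)
    also have "\<dots> = shift_op (axis q j) * M q Q * euler_op p + S (of_int (axis q j $ p)) * (shift_op (axis q j) * M q Q)"
      by (simp add: distrib_left distrib_right mult.assoc euler_op_M) (simp only: mult.assoc[symmetric] S_shift_op)
    finally show ?thesis by (simp add: axis_def S_zero)
  qed
  then have "euler_op p * loop_sites j Q - loop_sites j Q * euler_op p = (\<Sum>q\<in>UNIV. if q = p then S (of_int j) * (shift_op (axis q j) * M q Q) else 0)"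
    by (simp add: loop_sites_def sum_distrib_left sum_distrib_right sum_subtractf[symmetric])
  then show ?thesis by simp
qed

end


section \<open>The actions on W and the commutator formula\<close>

lemma assoc_rule: "a * b = d \<Longrightarrow> a * (b * c) = d * (c :: 'a::semigroup_mult)"
  by (simp add: mult.assoc[symmetric])

text \<open>The two windows of length \<open>n\<close> are shifted by \<open>k\<close>, so they
  differ only in \<open>k\<close> terms at each end. When \<open>H\<close> vanishes at large
  arguments, the terms at the negative arguments are what remains.\<close>

lemma telescope_shift:
  fixes H :: "int \<Rightarrow> 'a::ab_group_add"
  shows "(\<Sum>i<n. H (int i) - H (int i - int k)) = (\<Sum>i<k. H (int n - int k + int i) - H (int i - int k))"
proof (induction n)
  case (Suc n)
  have "(\<Sum>i<k. H (int (Suc n) - int k + int i) - H (int i - int k)) - (\<Sum>i<k. H (int n - int k + int i) - H (int i - int k))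
    = (\<Sum>i<k. H (int n - int k + int (Suc i)) - H (int n - int k + int i))"
    by (simp add: sum_subtractf[symmetric] algebra_simps)
  also have "\<dots> = H (int n) - H (int n - int k)"
    by (subst sum_lessThan_telescope) simp
  finally show ?case using Suc by (simp add: algebra_simps)
qed simp

context par_ind
begin

sublocale W: scaled sV by (rule scaled.intro[OF vsV])
sublocale Z: scaled sU by (rule scaled.intro[OF vsU])

text \<open>The locale fixes the level; this is the parameter \<open>\<kappa>\<close> with
  \<open>l = \<kappa> - m\<close>.\<close>

definition kap :: complex where "kap = l + of_nat CARD('m)"

lemma additive_\<rho>: "additive (\<rho>V \<xi>)"
  by (rule additive_linear[OF \<rho>_linear])

definition R :: "'m aff \<Rightarrow> ('n::finite, 'm, 'v) AN endo"
  where "R \<xi> = coeff_op (Abs_endo (\<rho>V \<xi>))"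

lemma app_R [simp]: "app (R \<xi>) (tmono a e v) = tmono a e (\<rho>V \<xi> v)"
  by (simp add: R_def app_Abs additive_\<rho>)

lemma R_add: "R (\<xi> + \<eta>) = R \<xi> + R \<eta>"
  by (rule endo_mono_eqI) (simp add: \<rho>_add_left single_add)

lemma R_scale: "R (aff_scale c \<xi>) = W.S c * R \<xi>"
  by (rule endo_mono_eqI) (simp add: linear_scale'[OF \<rho>_linear_left])

lemma R_bracket: "R (aff_bracket \<xi> \<eta>) = R \<xi> * R \<eta> - R \<eta> * R \<xi>"
  by (rule endo_mono_eqI) (simp add: \<rho>_bracket single_diff)

lemma R_central: "R (0, c) = W.S (l * c)"
  by (rule endo_mono_eqI) (simp add: level)

lemma R_shift_op: "R \<xi> * shift_op c = shift_op c * R \<xi>"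
  and R_E: "E p x y * R \<xi> = R \<xi> * E p x y"
  and R_perm_vars: "R \<xi> * perm_vars \<sigma> = perm_vars \<sigma> * R \<xi>"
  and R_perm_sites: "R \<xi> * perm_sites \<sigma> = perm_sites \<sigma> * R \<xi>"
  unfolding R_def by (rule coeff_op_shift_op E_coeff_op perm_vars_coeff_op perm_sites_coeff_op)+

lemma \<rho>_S: "app (Abs_endo (\<rho>V \<xi>)) (sV c v) = sV c (app (Abs_endo (\<rho>V \<xi>)) v)"
  by (simp add: app_Abs additive_\<rho> linear_scale'[OF \<rho>_linear])

lemma R_M: "W.M p P * R \<xi> = R \<xi> * W.M p P"
  unfolding R_def by (rule W.M_coeff_op) (rule \<rho>_S)

lemma euler_op_R: "W.euler_op p * R \<xi> = R \<xi> * W.euler_op p"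
  unfolding R_def by (rule W.euler_op_coeff_op) (rule \<rho>_S)

lemma R_S: "R \<xi> * W.S c = W.S c * R \<xi>"
  by (rule endo_mono_eqI) (simp add: linear_scale'[OF \<rho>_linear])

lemma ddiff_op_R: "p \<noteq> r \<Longrightarrow> W.ddiff_op p r * R \<xi> = R \<xi> * W.ddiff_op p r"
  unfolding R_def by (rule W.ddiff_op_coeff_op)

definition LR :: "int \<Rightarrow> complex^'m^'m \<Rightarrow> ('n::finite, 'm, 'v) AN endo"
  where "LR i P = R (loop (sl_proj P) i)"

lemma LR_mlin: "W.mlin (LR i)"
  by (simp add: W.mlin_def additiveI LR_def sl_proj_add sl_proj_scale loop_add loop_scale R_add R_scale)

lemma LR_diff: "LR i (P - Q) = LR i P - LR i Q"
  by (rule additive.diff, rule additiveI) (simp add: LR_def sl_proj_add loop_add R_add)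

lemma LR_E: "LR i P * E p x y = E p x y * LR i P"
  by (simp add: LR_def R_E)

lemma LR_S: "LR i P * W.S c = W.S c * LR i P"
  by (simp add: LR_def R_S)

lemma LR_unit: "LR i (matrix_unit y x) = R (loop (sl_unit y x) i)"
  by (simp add: LR_def sl_proj_unit)

text \<open>For \<open>i \<ge> 0\<close> this is the part of the \<open>i\<close>-th summand of
  \<open>z\<^sub>p\<close> without the power of the variable. Negative degrees arise in commutators
  with \<open>\<qq>\<close>.\<close>

definition casimir_V :: "'n \<Rightarrow> int \<Rightarrow> ('n::finite, 'm, 'v) AN endo"
  where "casimir_V p i = W.casimir p (LR i)"

lemma casimir_V_eq: "casimir_V p i = (\<Sum>x\<in>UNIV. \<Sum>y\<in>UNIV. E p x y * R (loop (sl_unit y x) i))"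
  by (simp add: casimir_V_def W.casimir_def LR_unit)

lemma casimir_V_commute:
  assumes "\<And>x y. B * E p x y = E p x y * B" "\<And>P. B * R (loop P i) = R (loop P i) * B"
  shows "B * casimir_V p i = casimir_V p i * B"
  unfolding casimir_V_eq using assms by (intro commute_sum commute_mult)

lemma casimir_V_shift_op: "shift_op c * casimir_V p i = casimir_V p i * shift_op c"
  by (rule casimir_V_commute) (simp_all add: E_shift_op R_shift_op)

lemma E_M: "p \<noteq> q \<Longrightarrow> W.M q P * E p x y = E p x y * W.M q P"
  by (metis W.M_comm W.M_unit)

lemma casimir_V_M: "p \<noteq> q \<Longrightarrow> W.M q P * casimir_V p i = casimir_V p i * W.M q P"
  by (rule casimir_V_commute) (simp_all add: E_M R_M)

lemma casimir_V_S: "W.S c * casimir_V p i = casimir_V p i * W.S c"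
  by (rule casimir_V_commute) (simp_all add: W.S_E R_S)

lemma casimir_V_perm_sites: "perm_sites \<sigma> * casimir_V p i = casimir_V (\<sigma> \<langle>$\<rangle> p) i * perm_sites \<sigma>"
  by (simp add: casimir_V_eq sum_distrib_left sum_distrib_right mult.assoc R_perm_sites) (simp add: mult.assoc[symmetric] perm_sites_E)

lemma casimir_V_perm_vars: "perm_vars \<sigma> * casimir_V p i = casimir_V p i * perm_vars \<sigma>"
  by (rule casimir_V_commute) (simp_all add: perm_vars_E R_perm_vars)

definition G :: "'n \<Rightarrow> int \<Rightarrow> 'm sl \<Rightarrow> ('n::finite, 'm, 'v) AN endo"
  where "G p i Q = casimir_V p i * W.M p (mat_of_sl Q) - W.M p (mat_of_sl Q) * casimir_V p i"

text \<open>By invariance of the Casimir tensor, commuting with \<open>Q\<close> on \<open>V\<close>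
  amounts to commuting with \<open>Q\<close> at the site \<open>p\<close> with the opposite sign,
  while the degree rises by \<open>k\<close>. The cocycle contracts with the matrix units to
  \<open>Q\<close> at the site \<open>p\<close>, with the level as a factor.\<close>

lemma casimir_V_R:
  fixes p :: "'n::finite"
  shows "casimir_V p i * R (loop Q k) - R (loop Q k) * casimir_V p i =
    (if i + k = 0 then W.S (of_int i * l) * W.M p (mat_of_sl Q) else 0) - (G p (i + k) Q :: ('n, 'm, 'v) AN endo)"
proof -
  let ?Q = "mat_of_sl Q"
  have *: "E p x y * R (loop (sl_unit y x) i) * R (loop Q k) - R (loop Q k) * (E p x y * R (loop (sl_unit y x) i)) =
     (E p x y * LR (i + k) (matrix_unit y x ** ?Q) - E p x y * LR (i + k) (?Q ** matrix_unit y x)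
      + (if i + k = 0 then W.S (of_int i * l) * (W.S (?Q $ x $ y) * E p x y) else 0) :: ('n, 'm, 'v) AN endo)" for x y
  proof -
    have "E p x y * R (loop (sl_unit y x) i) * R (loop Q k) - R (loop Q k) * (E p x y * R (loop (sl_unit y x) i)) =
      (E p x y * R (aff_bracket (loop (sl_unit y x) i) (loop Q k)) :: ('n, 'm, 'v) AN endo)"
    proof -
      have "R (loop Q k) * (E p x y * R (loop (sl_unit y x) i)) = (E p x y * (R (loop Q k) * R (loop (sl_unit y x) i)) :: ('n, 'm, 'v) AN endo)"
        by (simp only: mult.assoc[symmetric] R_E[symmetric])
      then show ?thesis by (simp add: R_bracket right_diff_distrib mult.assoc)
    qed
    also have "aff_bracket (loop (sl_unit y x) i) (loop Q k) =
        loop (sl_proj (matrix_unit y x ** ?Q - ?Q ** matrix_unit y x)) (i + k) + (0, if i + k = 0 then of_int i * ?Q $ x $ y else 0)"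
      by (simp add: aff_bracket_loop trace_form_unit sl_proj_bracket[symmetric] sl_proj_unit)
    also have "R \<dots> = (LR (i + k) (matrix_unit y x ** ?Q) - LR (i + k) (?Q ** matrix_unit y x)
       + (if i + k = 0 then W.S (of_int i * l) * W.S (?Q $ x $ y) else 0) :: ('n, 'm, 'v) AN endo)"
      by (simp add: R_add R_central LR_def[symmetric] LR_diff W.S_mult W.S_zero mult_ac)
    finally show ?thesis
      by (simp add: distrib_left right_diff_distrib W.S_E) (simp add: mult.assoc[symmetric] W.S_E)
  qed
  have "casimir_V p i * R (loop Q k) - R (loop Q k) * casimir_V p i =
     ((\<Sum>x\<in>UNIV. \<Sum>y\<in>UNIV. E p x y * LR (i + k) (matrix_unit y x ** ?Q))
     - (\<Sum>x\<in>UNIV. \<Sum>y\<in>UNIV. E p x y * LR (i + k) (?Q ** matrix_unit y x))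
     + (\<Sum>x\<in>UNIV. \<Sum>y\<in>UNIV. if i + k = 0 then W.S (of_int i * l) * (W.S (?Q $ x $ y) * E p x y) else 0) :: ('n, 'm, 'v) AN endo)"
    unfolding casimir_V_eq sum_distrib_left sum_distrib_right sum_subtractf[symmetric] *
    by (simp only: sum.distrib sum_subtractf)
  also have "(\<Sum>x\<in>UNIV. \<Sum>y\<in>UNIV. if i + k = 0 then W.S (of_int i * l) * (W.S (?Q $ x $ y) * E p x y) else 0) =
     (if i + k = 0 then W.S (of_int i * l) * W.M p ?Q else 0 :: ('n, 'm, 'v) AN endo)"
    by (simp add: W.M_def sum_distrib_left)
  finally show ?thesis
    unfolding W.casimir_left[OF LR_mlin, symmetric] W.casimir_right[OF LR_mlin LR_E LR_S, symmetric]
    by (simp add: G_def casimir_V_def)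
qed

lemma casimir_V_loop_sites:
  fixes p :: "'n::finite"
  shows "casimir_V p i * W.loop_sites k (mat_of_sl Q) - W.loop_sites k (mat_of_sl Q) * casimir_V p i = (shift_op (axis p k) * G p i Q :: ('n, 'm, 'v) AN endo)"
proof -
  let ?Q = "mat_of_sl Q"
  have "casimir_V p i * (shift_op (axis q k) * W.M q ?Q) - shift_op (axis q k) * W.M q ?Q * casimir_V p i =
     (if q = p then shift_op (axis p k) * G p i Q else 0 :: ('n, 'm, 'v) AN endo)" for q
  proof (cases "q = p")
    case True
    have "casimir_V p i * (shift_op (axis q k) * W.M q ?Q) = (shift_op (axis q k) * (casimir_V p i * W.M q ?Q) :: ('n, 'm, 'v) AN endo)"
      by (simp only: mult.assoc[symmetric] casimir_V_shift_op)
    then show ?thesis using True by (simp add: G_def right_diff_distrib mult.assoc)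
  next
    case False
    then have "shift_op (axis q k) * W.M q ?Q * casimir_V p i = (casimir_V p i * (shift_op (axis q k) * W.M q ?Q) :: ('n, 'm, 'v) AN endo)"
      by (rule_tac commute_mult[symmetric]) (simp_all add: casimir_V_shift_op casimir_V_M)
    then show ?thesis using False by simp
  qed
  then show ?thesis
    by (simp add: W.loop_sites_def sum_distrib_left sum_distrib_right sum_subtractf[symmetric])
qed

definition A :: "'m aff \<Rightarrow> ('n::finite, 'm, 'v) AN endo"
  where "A \<xi> = W.loop_act \<xi> + R \<xi>"

lemma AN_aff_A: "AN_aff sV \<rho>V \<xi> w = app (A \<xi>) w"
  by (simp only: W.AN_aff_eq[OF additive_\<rho>] A_def R_def)

lemma A_add: "A (\<xi> + \<eta>) = A \<xi> + A \<eta>"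
  by (simp add: A_def W.loop_act_add R_add)

lemma A_loop: "A (loop P i) = W.loop_sites i (mat_of_sl P) + R (loop P i)"
  by (simp add: A_def W.loop_act_loop)

lemma loop_sites_shift_op: "shift_op c * W.loop_sites i P = W.loop_sites i P * shift_op c"
  unfolding W.loop_sites_def by (intro commute_sum commute_mult) (simp_all add: shift_op_comm W.M_shift_op)

lemma loop_sites_sym_op: "W.sym_op \<sigma> * W.loop_sites i P = W.loop_sites i P * W.sym_op \<sigma>"
proof -
  have "W.sym_op \<sigma> * W.loop_sites i P = (\<Sum>q\<in>UNIV. shift_op (axis (\<sigma> \<langle>$\<rangle> q) i) * W.M (\<sigma> \<langle>$\<rangle> q) P * W.sym_op \<sigma>)"
    unfolding W.loop_sites_def W.sym_op_def sum_distrib_left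
  proof (rule sum.cong[OF refl])
    fix q
    have "perm_vars \<sigma> * perm_sites \<sigma> * (shift_op (axis q i) * W.M q P) = perm_vars \<sigma> * (perm_sites \<sigma> * shift_op (axis q i)) * W.M q P" by (simp only: mult.assoc)
    also have "\<dots> = perm_vars \<sigma> * shift_op (axis q i) * (perm_sites \<sigma> * W.M q P)" by (simp only: perm_sites_shift_op mult.assoc)
    also have "\<dots> = shift_op (axis (\<sigma> \<langle>$\<rangle> q) i) * (perm_vars \<sigma> * W.M (\<sigma> \<langle>$\<rangle> q) P) * perm_sites \<sigma>" by (simp add: perm_vars_shift_op W.perm_sites_M mult.assoc)
    finally show "perm_vars \<sigma> * perm_sites \<sigma> * (shift_op (axis q i) * W.M q P) = shift_op (axis (\<sigma> \<langle>$\<rangle> q) i) * W.M (\<sigma> \<langle>$\<rangle> q) P * (perm_vars \<sigma> * perm_sites \<sigma>)"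
      by (simp only: W.M_perm_vars[symmetric] mult.assoc)
  qed
  also have "\<dots> = (\<Sum>q\<in>UNIV. shift_op (axis q i) * W.M q P * W.sym_op \<sigma>)"
    by (rule sum.reindex_bij_witness[of _ "\<lambda>q. inverse \<sigma> \<langle>$\<rangle> q" "\<lambda>q. \<sigma> \<langle>$\<rangle> q"]) simp_all
  finally show ?thesis by (simp add: W.loop_sites_def sum_distrib_right)
qed

lemma A_shift_op: "shift_op c * A \<xi> = A \<xi> * shift_op c"
  by (induction \<xi> rule: aff_induct)
    (simp_all add: A_add A_loop distrib_left distrib_right loop_sites_shift_op R_shift_op, simp add: A_def R_shift_op)

lemma A_sym_op: "W.sym_op \<sigma> * A \<xi> = A \<xi> * W.sym_op \<sigma>"
proof -
  have "R \<xi> * W.sym_op \<sigma> = W.sym_op \<sigma> * R \<xi>" for \<xi>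
    unfolding W.sym_op_def by (rule commute_mult) (simp_all add: R_perm_vars R_perm_sites)
  then show ?thesis
    by (induction \<xi> rule: aff_induct)
      (simp_all add: A_add A_loop distrib_left distrib_right loop_sites_sym_op, simp add: A_def)
qed

lemma A_S: "W.S c * A \<xi> = A \<xi> * W.S c"
  by (simp add: A_def distrib_left distrib_right W.loop_act_S R_S)

lemma A_bracket: "A (aff_bracket \<xi> \<eta>) = (A \<xi> * A \<eta> - A \<eta> * A \<xi> :: ('n::finite, 'm, 'v) AN endo)"
proof -
  have "W.loop_act \<xi> * R \<eta> = (R \<eta> * W.loop_act \<xi> :: ('n, 'm, 'v) AN endo)" for \<xi> \<eta>
  proof (induction \<xi> rule: aff_induct)
    case (loop P i)
    show ?case unfolding W.loop_act_loop W.loop_sites_def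
      by (rule commute_sum[symmetric], rule commute_mult) (simp_all add: R_shift_op R_M)
  qed (simp_all add: W.loop_act_add distrib_left distrib_right)
  then show ?thesis by (simp add: A_def W.loop_act_bracket R_bracket algebra_simps)
qed

section \<open>The infinite sum in \<open>z\<^sub>p\<close>\<close>

definition z_term :: "'n \<Rightarrow> nat \<Rightarrow> ('n::finite, 'm, 'v) AN endo"
  where "z_term p i = shift_op (axis p (- int i)) * casimir_V p (int i)"

text \<open>The exponent is chosen so that the commutator of the \<open>i\<close>-th term with a
  loop of degree \<open>- k\<close> contains \<open>H i - H (i - k)\<close>, a difference that
  telescopes in \<open>i\<close>.\<close>

definition H :: "'n \<Rightarrow> nat \<Rightarrow> 'm sl \<Rightarrow> int \<Rightarrow> ('n::finite, 'm, 'v) AN endo"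
  where "H p k Q i = shift_op (axis p (- (i + int k))) * G p i Q"

text \<open>The action outside \<open>V\<close> contributes \<open>H i\<close>, since only the site
  \<open>p\<close> fails to commute. The action on \<open>V\<close> contributes
  \<open>- H (i - k)\<close> by \<open>casimir_V_R\<close>, with a central term exactly when the
  degrees \<open>i\<close> and \<open>- k\<close> cancel.\<close>

lemma z_term_A:
  fixes p :: "'n::finite"
  shows "z_term p i * A (loop Q (- int k)) - A (loop Q (- int k)) * z_term p i =
    (H p k Q (int i) - H p k Q (int i - int k)
     + (if i = k then W.S (of_nat k * l) * (shift_op (axis p (- int k)) * W.M p (mat_of_sl Q)) else 0) :: ('n, 'm, 'v) AN endo)"
proof -
  let ?A = "A (loop Q (- int k)) :: ('n, 'm, 'v) AN endo" and ?O = "casimir_V p (int i) :: ('n, 'm, 'v) AN endo"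
    and ?s = "shift_op (axis p (- int i)) :: ('n, 'm, 'v) AN endo" and ?Q = "mat_of_sl Q"
  have "?A * (?s * ?O) = ?s * (?A * ?O)" by (simp only: mult.assoc[symmetric] A_shift_op)
  then have "z_term p i * ?A - ?A * z_term p i = ?s * (?O * ?A - ?A * ?O)"
    by (simp add: z_term_def right_diff_distrib mult.assoc)
  also have "?O * ?A - ?A * ?O = (?O * W.loop_sites (- int k) ?Q - W.loop_sites (- int k) ?Q * ?O) + (?O * R (loop Q (- int k)) - R (loop Q (- int k)) * ?O)"
    by (simp add: A_loop algebra_simps)
  also have "\<dots> = shift_op (axis p (- int k)) * G p (int i) Q +
     ((if i = k then W.S (of_nat k * l) * W.M p ?Q else 0) - G p (int i - int k) Q)"
    unfolding casimir_V_loop_sites casimir_V_R by simp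
  finally have "z_term p i * ?A - ?A * z_term p i = ?s * shift_op (axis p (- int k)) * G p (int i) Q +
     (if i = k then ?s * W.S (of_nat k * l) * W.M p ?Q else 0) - ?s * G p (int i - int k) Q"
    by (simp add: algebra_simps)
  moreover have "?s * shift_op (axis p (- int k)) = shift_op (axis p (- (int i + int k)))"
    by (simp add: shift_op_mult W.axis_split[symmetric])
  ultimately show ?thesis by (simp add: H_def W.S_shift_op[symmetric] mult.assoc)
qed

lemma R_fin: "\<exists>n. \<forall>i\<ge>n. \<forall>P. app (R (loop P (int i))) w = 0"
proof (induction w rule: mono_induct)
  case (mono a e v)
  obtain n where "\<forall>i\<ge>n. \<forall>P. \<rho>V (loop P (int i)) v = 0" using annihilated by blast
  then show ?case by (intro exI[of _ n]) simp
next
  case (add f g)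
  then obtain m n where "\<forall>i\<ge>m. \<forall>P. app (R (loop P (int i))) f = 0" "\<forall>i\<ge>n. \<forall>P. app (R (loop P (int i))) g = 0" by blast
  then show ?case by (intro exI[of _ "max m n"]) (simp add: app_add)
qed

lemma casimir_V_vanish: "\<forall>P. app (R (loop P i)) w = 0 \<Longrightarrow> app (casimir_V p i) w = 0"
  by (simp add: casimir_V_eq app_sum_left)

lemma G_vanish:
  assumes "\<forall>P. app (R (loop P i)) w = 0" shows "app (G p i Q) w = 0"
proof -
  have "app (R (loop P i)) (app (W.M p (mat_of_sl Q)) w) = 0" for P
  proof -
    have "app (R (loop P i) * W.M p (mat_of_sl Q)) w = app (W.M p (mat_of_sl Q) * R (loop P i)) w" by (simp only: R_M)
    then show ?thesis using assms by simp
  qed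
  then show ?thesis using assms by (simp add: G_def casimir_V_vanish)
qed

lemma H_vanish: "\<forall>P. app (R (loop P i)) w = 0 \<Longrightarrow> app (H p k Q i) w = 0"
  by (simp add: H_def G_vanish)

lemma z_term_vanish: "\<forall>P. app (R (loop P (int i))) w = 0 \<Longrightarrow> app (z_term p i) w = 0"
  by (simp add: z_term_def casimir_V_vanish)

lemma Sum_any_z_term:
  assumes "\<forall>i\<ge>n. \<forall>P. app (R (loop P (int i))) w = 0"
  shows "Sum_any (\<lambda>i. app (z_term p i) w) = (\<Sum>i<n. app (z_term p i) w)"
proof (rule Sum_any.expand_superset)
  show "{i. app (z_term p i) w \<noteq> 0} \<subseteq> {..<n}"
  proof (rule subsetI)
    fix i assume "i \<in> {i. app (z_term p i) w \<noteq> 0}"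
    then have "\<not> (\<forall>P. app (R (loop P (int i))) w = 0)" using z_term_vanish[of i w p] by auto
    then show "i \<in> {..<n}" using assms by (cases "n \<le> i") auto
  qed
qed simp

definition z_sum :: "'n \<Rightarrow> ('n::finite, 'm, 'v) AN endo"
  where "z_sum p = Abs_endo (\<lambda>w. Sum_any (\<lambda>i. app (z_term p i) w))"

lemma additive_Sum_z_term:
  fixes p :: "'n::finite"
  shows "additive (\<lambda>w. Sum_any (\<lambda>i. app (z_term p i) w))"
proof (rule additiveI)
  fix x y :: "('n, 'm, 'v) AN"
  obtain m n where "\<forall>i\<ge>m. \<forall>P. app (R (loop P (int i))) x = 0" "\<forall>i\<ge>n. \<forall>P. app (R (loop P (int i))) y = 0"
    using R_fin[of x] R_fin[of y] by blast
  then have eq: "Sum_any (\<lambda>i. app (z_term p i) w) = (\<Sum>i<max m n. app (z_term p i) w)" if "w \<in> {x, y, x + y}" for w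
    using that by (intro Sum_any_z_term) (auto simp: app_add)
  then show "Sum_any (\<lambda>i. app (z_term p i) (x + y)) = Sum_any (\<lambda>i. app (z_term p i) x) + Sum_any (\<lambda>i. app (z_term p i) y)"
    by (subst (1 2 3) eq) (simp_all add: app_add sum.distrib)
qed

lemma app_z_sum: "\<forall>i\<ge>n. \<forall>P. app (R (loop P (int i))) w = 0 \<Longrightarrow> app (z_sum p) w = (\<Sum>i<n. app (z_term p i) w)"
  by (simp add: z_sum_def app_Abs additive_Sum_z_term Sum_any_z_term)

text \<open>Termwise intertwining suffices, but the truncation must be valid both for
  \<open>w\<close> and for its image under \<open>B\<close>.\<close>

lemma z_sum_intertwine:
  assumes "\<And>i. B * z_term p i = z_term p' i * B" shows "B * z_sum p = z_sum p' * B"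
proof (rule endo_eqI)
  fix w
  obtain m n where m: "\<forall>i\<ge>m. \<forall>P. app (R (loop P (int i))) w = 0" and n: "\<forall>i\<ge>n. \<forall>P. app (R (loop P (int i))) (app B w) = 0"
    using R_fin[of w] R_fin[of "app B w"] by blast
  have "app B (app (z_term p i) w) = app (z_term p' i) (app B w)" for i
    using assms[of i] by (metis app_simps(6))
  moreover have "app (z_sum p) w = (\<Sum>i<max m n. app (z_term p i) w)"
    by (rule app_z_sum) (use m in simp)
  moreover have "app (z_sum p') (app B w) = (\<Sum>i<max m n. app (z_term p' i) (app B w))"
    by (rule app_z_sum) (use n in simp)
  ultimately show "app (B * z_sum p) w = app (z_sum p' * B) w" by (simp add: app_sum)
qed

text \<open>After telescoping, the terms of large degree annihilate \<open>w\<close>. The terms of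
  degrees \<open>- k, ..., - 1\<close> and the central term remain.\<close>

lemma z_sum_A:
  fixes p :: "'n::finite" and w :: "('n, 'm, 'v) AN"
  shows "app (z_sum p * A (loop Q (- int k)) - A (loop Q (- int k)) * z_sum p) w =
    app (W.S (of_nat k * l) * (shift_op (axis p (- int k)) * W.M p (mat_of_sl Q))) w - (\<Sum>i<k. app (H p k Q (int i - int k)) w)"
proof -
  let ?A = "A (loop Q (- int k)) :: ('n, 'm, 'v) AN endo"
  let ?C = "W.S (of_nat k * l) * (shift_op (axis p (- int k)) * W.M p (mat_of_sl Q)) :: ('n, 'm, 'v) AN endo"
  obtain m m' where m: "\<forall>i\<ge>m. \<forall>P. app (R (loop P (int i))) w = 0" and m': "\<forall>i\<ge>m'. \<forall>P. app (R (loop P (int i))) (app ?A w) = 0"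
    using R_fin[of w] R_fin[of "app ?A w"] by blast
  \<comment> \<open>Large enough that the truncation is valid for \<open>w\<close> and for its
    image, that the index \<open>k\<close> of the central term occurs, and that even the boundary
    degrees \<open>n - k + i\<close> exceed \<open>m\<close>.\<close>
  define n where "n = Suc (m + m' + k)"
  have "app (z_sum p * ?A - ?A * z_sum p) w = (\<Sum>i<n. app (z_term p i) (app ?A w)) - app ?A (\<Sum>i<n. app (z_term p i) w)"
    using m m' by (simp add: n_def app_z_sum[of n])
  also have "\<dots> = (\<Sum>i<n. app (z_term p i * ?A - ?A * z_term p i) w)"
    by (simp add: app_sum sum_subtractf)
  also have "\<dots> = (\<Sum>i<n. app (H p k Q (int i)) w - app (H p k Q (int i - int k)) w) + (\<Sum>i<n. if i = k then app ?C w else 0)"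
    unfolding z_term_A sum.distrib[symmetric] by (rule sum.cong[OF refl]) simp
  also have "(\<Sum>i<n. if i = k then app ?C w else 0) = app ?C w" by (simp add: n_def)
  also have "(\<Sum>i<n. app (H p k Q (int i)) w - app (H p k Q (int i - int k)) w)
      = (\<Sum>i<k. app (H p k Q (int n - int k + int i)) w - app (H p k Q (int i - int k)) w)"
    by (rule telescope_shift)
  also have "\<dots> = (\<Sum>i<k. - app (H p k Q (int i - int k)) w)"
  proof (rule sum.cong[OF refl])
    fix i
    have "int n - int k + int i = int (Suc (m + m' + i))" by (simp add: n_def)
    moreover have "\<forall>P. app (R (loop P (int (Suc (m + m' + i))))) w = 0"
      using m[rule_format, of "Suc (m + m' + i)"] by simp
    ultimately have "app (H p k Q (int n - int k + int i)) w = 0" using H_vanish by metis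
    then show "app (H p k Q (int n - int k + int i)) w - app (H p k Q (int i - int k)) w = - app (H p k Q (int i - int k)) w" by simp
  qed
  finally show ?thesis by (simp add: sum_negf)
qed

section \<open>The commutator of \<open>z\<^sub>p\<close> with \<open>\<qq>\<close>\<close>

definition z_op :: "'n \<Rightarrow> ('n::finite, 'm, 'v) AN endo"
  where "z_op p = W.S kap * W.euler_op p + (\<Sum>r\<in>UNIV - {p}. W.ddiff_op p r * perm_sites \<langle>p \<leftrightarrow> r\<rangle>) + z_sum p"

lemma AN_Z: "AN_cherednik kap sV \<rho>V (Z p) w = app (z_op p) w"
proof -
  have "(\<Sum>a\<in>UNIV. \<Sum>b\<in>UNIV. tensor3_op sV ((*) (xpow p (- int i))) (site_op (matrix_unit a b) p) (\<rho>V (loop (sl_unit b a) (int i))) w)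
     = app (z_term p i) w" for i
    by (simp add: W.tensor3_site[OF additive_\<rho>] z_term_def casimir_V_eq app_sum_left app_sum W.M_unit R_def)
  then show ?thesis
    by (simp add: z_op_def W.AN_euler W.AN_ddiff_op app_sum_left z_sum_def app_Abs additive_Sum_z_term del: app_simps(6))
qed

text \<open>In \<open>H p k Q (i - k)\<close> matrices of the negative degree \<open>i - k\<close>
  act on \<open>V\<close>. Here the same matrices act on the variables and sites instead, so that
  the two expressions add up to an element of \<open>\<qq>W\<close>.\<close>

definition K :: "'n \<Rightarrow> nat \<Rightarrow> 'm sl \<Rightarrow> nat \<Rightarrow> ('n::finite, 'm, 'v) AN endo"
  where "K p k Q i = (\<Sum>x\<in>UNIV. \<Sum>y\<in>UNIV. W.loop_sites (int i - int k) (mat_of_sl (sl_unit y x)) *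
    (shift_op (axis p (- int i)) * (E p x y * W.M p (mat_of_sl Q) - W.M p (mat_of_sl Q) * E p x y)))"

lemma qW_subgroup: "add_subgroup (AN_qW sV \<rho>V)"
  unfolding AN_qW_def by (rule add_subgroup_span) (rule W.vsW)

lemma qW_scale: "x \<in> AN_qW sV \<rho>V \<Longrightarrow> fscale (fscale sV) c x \<in> AN_qW sV \<rho>V"
  unfolding AN_qW_def by (rule module.span_scale[OF vector_space_module[OF W.vsW]])

lemma qW_A: "\<xi> \<in> aff_q \<Longrightarrow> app (A \<xi>) w \<in> AN_qW sV \<rho>V"
  unfolding AN_qW_def AN_aff_A by (rule module.span_base[OF vector_space_module[OF W.vsW]]) blast

lemma qW_sum: "(\<And>i. i \<in> I \<Longrightarrow> f i \<in> AN_qW sV \<rho>V) \<Longrightarrow> sum f I \<in> AN_qW sV \<rho>V"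
  by (induction I rule: infinite_finite_induct) (auto simp: add_subgroupD[OF qW_subgroup])

text \<open>The operators on \<open>V\<close> commute with the other factors and can be pulled to
  the left, where they combine with \<open>loop_sites\<close> to the full action \<open>A\<close>.
  The hypothesis \<open>i < k\<close> makes its degree negative.\<close>

lemma HK_qW:
  fixes p :: "'n::finite" and w :: "('n, 'm, 'v) AN"
  assumes "i < k"
  shows "app (H p k Q (int i - int k) + K p k Q i) w \<in> AN_qW sV \<rho>V"
proof -
  let ?M = "W.M p (mat_of_sl Q) :: ('n, 'm, 'v) AN endo" and ?s = "shift_op (axis p (- int i)) :: ('n, 'm, 'v) AN endo"
  let ?R = "\<lambda>x y. R (loop (sl_unit y x) (int i - int k)) :: ('n, 'm, 'v) AN endo"
  let ?B = "\<lambda>x y. ?s * (E p x y * ?M - ?M * E p x y)"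
  have "?R x y * ?B x y = ?s * (E p x y * ?R x y * ?M - ?M * (E p x y * ?R x y))" for x y
  proof -
    have "?R x y * ?B x y = ?B x y * ?R x y"
      by (rule commute_mult) (simp_all add: R_shift_op left_diff_distrib right_diff_distrib commute_mult R_E R_M)
    then show ?thesis by (simp add: right_diff_distrib left_diff_distrib mult.assoc R_M)
  qed
  then have "H p k Q (int i - int k) = (\<Sum>x\<in>UNIV. \<Sum>y\<in>UNIV. ?R x y * ?B x y)"
    by (simp add: H_def G_def casimir_V_eq sum_distrib_left sum_distrib_right sum_subtractf[symmetric])
  then have "H p k Q (int i - int k) + K p k Q i = (\<Sum>x\<in>UNIV. \<Sum>y\<in>UNIV. A (loop (sl_unit y x) (int i - int k)) * ?B x y)"
    by (simp add: K_def A_loop distrib_right sum.distrib add.commute)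
  then show ?thesis
    using assms by (simp only: app_sum_left app_simps(6)) (intro qW_sum qW_A, simp add: aff_q_iff aff_neg_loop)
qed

text \<open>The matrix unit at \<open>r\<close> commutes with everything at \<open>p\<close>, so the
  sum is the commutator of the flip with \<open>P\<close> at the site \<open>p\<close>, and the flip
  moves \<open>P\<close> to the site \<open>r\<close>.\<close>

lemma K_inner_other:
  fixes p r :: "'n::finite"
  assumes "r \<noteq> p"
  shows "(\<Sum>x\<in>UNIV. \<Sum>y\<in>UNIV. E r y x * (E p x y * W.M p P - W.M p P * E p x y)) =
    ((W.M r P - W.M p P) * perm_sites \<langle>p \<leftrightarrow> r\<rangle> :: ('n, 'm, 'v) AN endo)"
proof -
  have 1: "E r y x * (E p x y * W.M p P) = (E p x y * E r y x * W.M p P :: ('n, 'm, 'v) AN endo)" for x y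
    using assms by (simp add: mult.assoc[symmetric] E_comm)
  have 2: "E r y x * (W.M p P * E p x y) = (W.M p P * (E p x y * E r y x) :: ('n, 'm, 'v) AN endo)" for x y
  proof -
    have "E r y x * (W.M p P * E p x y) = (W.M p P * E p x y * E r y x :: ('n, 'm, 'v) AN endo)"
      using assms by (intro commute_mult) (simp_all add: E_M E_comm)
    then show ?thesis by (simp only: mult.assoc)
  qed
  have "(\<Sum>x\<in>UNIV. \<Sum>y\<in>UNIV. E r y x * (E p x y * W.M p P - W.M p P * E p x y)) =
    (\<Sum>x\<in>UNIV. \<Sum>y\<in>UNIV. E p x y * E r y x) * W.M p P - W.M p P * (\<Sum>x\<in>UNIV. \<Sum>y\<in>UNIV. E p x y * E r y x :: ('n, 'm, 'v) AN endo)"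
    by (simp add: right_diff_distrib 1 2 sum_subtractf sum_distrib_left sum_distrib_right)
  also have "(\<Sum>x\<in>UNIV. \<Sum>y\<in>UNIV. E p x y * E r y x :: ('n, 'm, 'v) AN endo) = perm_sites \<langle>p \<leftrightarrow> r\<rangle>"
    using assms by (simp add: perm_sites_swap)
  finally show ?thesis by (simp add: W.perm_sites_M left_diff_distrib)
qed

text \<open>The origin of \<open>m\<close> in \<open>\<kappa> = l + m\<close>: the first products
  sum to \<open>m P\<close>, the second ones to the trace of \<open>P\<close>, which is
  zero.\<close>

lemma K_inner_same:
  fixes p :: "'n::finite" and P :: "complex^'m^'m"
  assumes "trace P = 0"
  shows "(\<Sum>x\<in>UNIV. \<Sum>y\<in>UNIV. E p y x * (E p x y * W.M p P - W.M p P * E p x y)) =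
    (W.S (of_nat CARD('m)) * W.M p P :: ('n, 'm, 'v) AN endo)"
proof -
  have 1: "(\<Sum>y\<in>UNIV. E p y x * (E p x y * W.M p P)) = (W.M p P :: ('n, 'm, 'v) AN endo)" for x
    by (simp add: mult.assoc[symmetric] E_mult sum_distrib_right[symmetric] E_sum)
  have "E p y x * (W.M p P * E p x y) = (W.S (P $ x $ x) * E p y y :: ('n, 'm, 'v) AN endo)" for x y
  proof -
    have "E p y x * (W.M p P * E p x y) = (\<Sum>z\<in>UNIV. W.S (P $ x $ z) * (E p y z * E p x y) :: ('n, 'm, 'v) AN endo)"
      by (simp only: mult.assoc[symmetric] W.E_expand_right sum_distrib_right)
    also have "\<dots> = (\<Sum>z\<in>UNIV. if z = x then W.S (P $ x $ z) * E p y y else 0)"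
      by (rule sum.cong) (auto simp: E_mult)
    finally show ?thesis by simp
  qed
  then have 2: "(\<Sum>y\<in>UNIV. E p y x * (W.M p P * E p x y)) = (W.S (P $ x $ x) :: ('n, 'm, 'v) AN endo)" for x
    by (simp add: sum_distrib_left[symmetric] E_sum)
  have "(\<Sum>x\<in>UNIV. W.S (P $ x $ x)) = (0 :: ('n, 'm, 'v) AN endo)"
    using assms by (simp add: W.S_sum[symmetric] trace_def W.S_zero)
  moreover have "(\<Sum>x\<in>(UNIV :: 'm set). B) = W.S (of_nat CARD('m)) * (B :: ('n, 'm, 'v) AN endo)" for B
  proof -
    have "(\<Sum>x\<in>(UNIV :: 'm set). B) = (\<Sum>x\<in>(UNIV :: 'm set). W.S 1 * B)" by (simp add: W.S_one)
    also have "\<dots> = W.S (\<Sum>x\<in>(UNIV :: 'm set). 1) * B" by (simp only: W.S_sum sum_distrib_right)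
    finally show ?thesis by simp
  qed
  ultimately show ?thesis by (simp add: right_diff_distrib sum_subtractf 1 2)
qed

lemma M_sl_unit:
  "W.M r (mat_of_sl (sl_unit y x)) =
    (E r y x - (if y = x then W.S (1 / of_nat CARD('m)) else 0) :: ('n::finite, 'm, 'v) AN endo)"
proof -
  have mat: "mat c = (\<chi> i j. c * (mat 1 :: complex^'m^'m) $ i $ j)" for c :: complex
    by (simp add: vec_eq_iff mat_def)
  have "W.M r (mat c :: complex^'m^'m) = (W.S c :: ('n, 'm, 'v) AN endo)" for c
    unfolding mat[of c] W.M_scale W.M_one by simp
  then show ?thesis by (simp add: sl_unit.rep_eq W.M_diff W.M_unit W.M_zero)
qed

text \<open>The terms with \<open>r \<noteq> p\<close> are those that occur, with the opposite sign,
  in the commutator with the divided differences in \<open>ddiff_op_loop_sites\<close>. The term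
  \<open>r = p\<close> shifts the coefficient of the central contribution by
  \<open>m\<close>.\<close>

lemma K_eq:
  fixes p :: "'n::finite"
  shows "K p k Q i = ((\<Sum>r\<in>UNIV - {p}. shift_op (axis p (- int i)) * shift_op (axis r (int i - int k)) *
      ((W.M r (mat_of_sl Q) - W.M p (mat_of_sl Q)) * perm_sites \<langle>p \<leftrightarrow> r\<rangle>))
    + W.S (of_nat CARD('m)) * (shift_op (axis p (- int k)) * W.M p (mat_of_sl Q)) :: ('n, 'm, 'v) AN endo)"
proof -
  let ?M = "W.M p (mat_of_sl Q) :: ('n, 'm, 'v) AN endo" and ?s = "shift_op (axis p (- int i)) :: ('n, 'm, 'v) AN endo"
  let ?d = "int i - int k" and ?c = "W.S (1 / of_nat CARD('m)) :: ('n, 'm, 'v) AN endo"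
  let ?B = "\<lambda>x y. E p x y * ?M - ?M * E p x y"
  \<comment> \<open>The scalar part of \<open>sl_unit\<close> contributes a multiple of the
    commutator of \<open>\<Sum> E\<^sub>x\<^sub>x = 1\<close> with \<open>?M\<close>.\<close>
  have diag: "(\<Sum>x\<in>UNIV. \<Sum>y\<in>UNIV. (if y = x then ?c else 0) * ?B x y) = 0"
  proof -
    have "(\<Sum>y\<in>UNIV. (if y = x then ?c else 0) * ?B x y) = ?c * ?B x x" for x
      by (simp add: if_distrib[of "\<lambda>z. z * _"] cong: if_cong)
    then have "(\<Sum>x\<in>UNIV. \<Sum>y\<in>UNIV. (if y = x then ?c else 0) * ?B x y) = ?c * ((\<Sum>x\<in>UNIV. E p x x) * ?M - ?M * (\<Sum>x\<in>UNIV. E p x x))"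
      by (simp only: sum_distrib_left sum_distrib_right sum_subtractf right_diff_distrib)
    then show ?thesis by (simp add: E_sum)
  qed
  have inner: "(\<Sum>x\<in>UNIV. \<Sum>y\<in>UNIV. W.M r (mat_of_sl (sl_unit y x)) * ?B x y) = (\<Sum>x\<in>UNIV. \<Sum>y\<in>UNIV. E r y x * ?B x y)" for r
    unfolding M_sl_unit left_diff_distrib[of "E r _ _"] sum_subtractf diag by simp
  have "W.loop_sites ?d P * (?s * B) = (\<Sum>r\<in>UNIV. ?s * shift_op (axis r ?d) * (W.M r P * B))" for P and B :: "('n, 'm, 'v) AN endo"
  proof -
    have "W.loop_sites ?d P * (?s * B) = ?s * W.loop_sites ?d P * B" by (simp only: mult.assoc[symmetric] loop_sites_shift_op)
    then show ?thesis by (simp add: W.loop_sites_def sum_distrib_left sum_distrib_right mult.assoc)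
  qed
  then have "K p k Q i = (\<Sum>x\<in>UNIV. \<Sum>y\<in>UNIV. \<Sum>r\<in>UNIV. ?s * shift_op (axis r ?d) * (W.M r (mat_of_sl (sl_unit y x)) * ?B x y))"
    by (simp add: K_def)
  also have "\<dots> = (\<Sum>x\<in>UNIV. \<Sum>r\<in>UNIV. \<Sum>y\<in>UNIV. ?s * shift_op (axis r ?d) * (W.M r (mat_of_sl (sl_unit y x)) * ?B x y))"
    by (rule sum.cong[OF refl], rule sum.swap)
  also have "\<dots> = (\<Sum>r\<in>UNIV. \<Sum>x\<in>UNIV. \<Sum>y\<in>UNIV. ?s * shift_op (axis r ?d) * (W.M r (mat_of_sl (sl_unit y x)) * ?B x y))"
    by (rule sum.swap)
  also have "\<dots> = (\<Sum>r\<in>UNIV. ?s * shift_op (axis r ?d) * (\<Sum>x\<in>UNIV. \<Sum>y\<in>UNIV. E r y x * ?B x y))"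
    by (simp only: sum_distrib_left[symmetric] inner)
  also have "\<dots> = (\<Sum>r\<in>UNIV - {p}. ?s * shift_op (axis r ?d) * (\<Sum>x\<in>UNIV. \<Sum>y\<in>UNIV. E r y x * ?B x y))
      + ?s * shift_op (axis p ?d) * (\<Sum>x\<in>UNIV. \<Sum>y\<in>UNIV. E p y x * ?B x y)"
    by (subst sum.remove[of UNIV p]) (simp_all add: add.commute)
  also have "?s * shift_op (axis p ?d) = shift_op (axis p (- int k))"
    by (simp add: shift_op_mult W.axis_split[symmetric])
  also have "(\<Sum>x\<in>UNIV. \<Sum>y\<in>UNIV. E p y x * ?B x y) = W.S (of_nat CARD('m)) * ?M"
    by (rule K_inner_same) simp
  also have "shift_op (axis p (- int k)) * (W.S (of_nat CARD('m)) * ?M) = W.S (of_nat CARD('m)) * (shift_op (axis p (- int k)) * ?M)"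
    by (simp only: mult.assoc[symmetric] W.S_shift_op)
  also have "(\<Sum>r\<in>UNIV - {p}. ?s * shift_op (axis r ?d) * (\<Sum>x\<in>UNIV. \<Sum>y\<in>UNIV. E r y x * ?B x y))
      = (\<Sum>r\<in>UNIV - {p}. ?s * shift_op (axis r ?d) * ((W.M r (mat_of_sl Q) - ?M) * perm_sites \<langle>p \<leftrightarrow> r\<rangle>))"
    by (rule sum.cong[OF refl]) (simp add: K_inner_other)
  finally show ?thesis .
qed

text \<open>The level enters only here: the contributions \<open>- k \<kappa>\<close> of the Euler operator, \<open>k l\<close> of the central
  element and \<open>k m\<close> of the Casimir-type contraction cancel.\<close>

lemma z_op_A:
  fixes p :: "'n::finite" and w :: "('n, 'm, 'v) AN"
  shows "app (z_op p * A (loop Q (- int k)) - A (loop Q (- int k)) * z_op p) w =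
    - (\<Sum>i<k. app (H p k Q (int i - int k) + K p k Q i) w)"
proof -
  let ?A = "A (loop Q (- int k)) :: ('n, 'm, 'v) AN endo" and ?L = "W.loop_sites (- int k) (mat_of_sl Q) :: ('n, 'm, 'v) AN endo"
  let ?R = "R (loop Q (- int k)) :: ('n, 'm, 'v) AN endo"
  let ?C = "shift_op (axis p (- int k)) * W.M p (mat_of_sl Q) :: ('n, 'm, 'v) AN endo"
  let ?D = "\<lambda>r i. shift_op (axis p (- int i)) * shift_op (axis r (int i - int k)) *
      ((W.M r (mat_of_sl Q) - W.M p (mat_of_sl Q)) * perm_sites \<langle>p \<leftrightarrow> r\<rangle>) :: ('n, 'm, 'v) AN endo"
  have A: "?A = ?L + ?R" by (rule A_loop)
  have 1: "W.S kap * W.euler_op p * ?A - ?A * (W.S kap * W.euler_op p) = W.S (- of_nat k * kap) * ?C"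
  proof -
    have "?A * (W.S kap * W.euler_op p) = W.S kap * (?A * W.euler_op p)"
      by (simp only: mult.assoc[symmetric] A_S)
    then have "W.S kap * W.euler_op p * ?A - ?A * (W.S kap * W.euler_op p) = W.S kap * (W.euler_op p * ?A - ?A * W.euler_op p)"
      by (simp add: right_diff_distrib mult.assoc)
    also have "W.euler_op p * ?A - ?A * W.euler_op p = W.euler_op p * ?L - ?L * W.euler_op p"
      unfolding A by (simp add: distrib_left distrib_right euler_op_R)
    finally show ?thesis by (simp add: W.euler_op_loop_sites W.S_mult mult.assoc[symmetric] mult.commute)
  qed
  have 2: "W.ddiff_op p r * perm_sites \<langle>p \<leftrightarrow> r\<rangle> * ?A - ?A * (W.ddiff_op p r * perm_sites \<langle>p \<leftrightarrow> r\<rangle>) = - (\<Sum>i<k. ?D r i)" if "r \<noteq> p" for r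
  proof -
    have "?R * (W.ddiff_op p r * perm_sites \<langle>p \<leftrightarrow> r\<rangle>) = W.ddiff_op p r * perm_sites \<langle>p \<leftrightarrow> r\<rangle> * ?R"
      using that by (intro commute_mult) (simp_all add: ddiff_op_R R_perm_sites)
    then have "W.ddiff_op p r * perm_sites \<langle>p \<leftrightarrow> r\<rangle> * ?A - ?A * (W.ddiff_op p r * perm_sites \<langle>p \<leftrightarrow> r\<rangle>)
       = W.ddiff_op p r * perm_sites \<langle>p \<leftrightarrow> r\<rangle> * ?L - ?L * (W.ddiff_op p r * perm_sites \<langle>p \<leftrightarrow> r\<rangle>)"
      unfolding A by (simp add: distrib_left distrib_right)
    then show ?thesis using W.ddiff_op_loop_sites[of p r k "mat_of_sl Q"] that by simp
  qed
  have "z_op p * ?A - ?A * z_op p = (W.S kap * W.euler_op p * ?A - ?A * (W.S kap * W.euler_op p)) +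
     (\<Sum>r\<in>UNIV - {p}. W.ddiff_op p r * perm_sites \<langle>p \<leftrightarrow> r\<rangle> * ?A - ?A * (W.ddiff_op p r * perm_sites \<langle>p \<leftrightarrow> r\<rangle>)) + (z_sum p * ?A - ?A * z_sum p)"
    by (simp add: z_op_def distrib_left distrib_right sum_distrib_left sum_distrib_right sum_subtractf)
  also have "(\<Sum>r\<in>UNIV - {p}. W.ddiff_op p r * perm_sites \<langle>p \<leftrightarrow> r\<rangle> * ?A - ?A * (W.ddiff_op p r * perm_sites \<langle>p \<leftrightarrow> r\<rangle>)) =
     (\<Sum>r\<in>UNIV - {p}. - (\<Sum>i<k. ?D r i))"
    by (rule sum.cong[OF refl]) (use 2 in simp)
  also have "\<dots> = - (\<Sum>i<k. \<Sum>r\<in>UNIV - {p}. ?D r i)"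
    by (simp only: sum_negf) (subst sum.swap, simp)
  also have "(\<Sum>i<k. \<Sum>r\<in>UNIV - {p}. ?D r i) = (\<Sum>i<k. K p k Q i) - W.S (of_nat k * of_nat CARD('m)) * ?C"
  proof -
    have "(\<Sum>i<k. K p k Q i) = (\<Sum>i<k. \<Sum>r\<in>UNIV - {p}. ?D r i) + (\<Sum>i<k. W.S (of_nat CARD('m)) * ?C)"
      by (simp only: K_eq sum.distrib)
    moreover have "(\<Sum>i<k. W.S (of_nat CARD('m)) * ?C) = W.S (of_nat k * of_nat CARD('m)) * ?C"
      by (simp only: sum_distrib_right[symmetric] W.S_sum[symmetric]) simp
    ultimately show ?thesis by simp
  qed
  finally have "app (z_op p * ?A - ?A * z_op p) w = app (W.S (- of_nat k * kap) * ?C) w - app (\<Sum>i<k. K p k Q i) w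
     + app (W.S (of_nat k * of_nat CARD('m)) * ?C) w + app (z_sum p * ?A - ?A * z_sum p) w"
    unfolding 1 by simp
  also have "\<dots> = app (W.S (- of_nat k * kap) * ?C + W.S (of_nat k * of_nat CARD('m)) * ?C + W.S (of_nat k * l) * ?C) w
     - (\<Sum>i<k. app (K p k Q i) w) - (\<Sum>i<k. app (H p k Q (int i - int k)) w)"
    unfolding z_sum_A by (simp add: app_sum_left)
  also have "W.S (- of_nat k * kap) * ?C + W.S (of_nat k * of_nat CARD('m)) * ?C + W.S (of_nat k * l) * ?C = 0"
  proof -
    have "W.S (- of_nat k * kap) * ?C + W.S (of_nat k * of_nat CARD('m)) * ?C + W.S (of_nat k * l) * ?C =
      W.S (- of_nat k * kap + of_nat k * of_nat CARD('m) + of_nat k * l) * ?C"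
      by (simp only: W.S_add[symmetric] distrib_right)
    also have "- of_nat k * kap + of_nat k * of_nat CARD('m) + of_nat k * l = 0"
      by (simp add: kap_def algebra_simps)
    finally show ?thesis by (simp add: W.S_zero)
  qed
  finally show ?thesis by (simp add: sum.distrib)
qed

lemma z_op_S: "W.S c * z_op p = (z_op p * W.S c :: ('n::finite, 'm, 'v) AN endo)"
proof -
  have 1: "W.S c * (W.S kap * W.euler_op p) = (W.S kap * W.euler_op p * W.S c :: ('n, 'm, 'v) AN endo)"
    by (rule commute_mult) (rule W.S_comm, rule W.euler_op_S[symmetric])
  have "W.S c * (W.ddiff_op p r * perm_sites \<langle>p \<leftrightarrow> r\<rangle>) = (W.ddiff_op p r * perm_sites \<langle>p \<leftrightarrow> r\<rangle> * W.S c :: ('n, 'm, 'v) AN endo)" if "p \<noteq> r" for r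
    unfolding W.S_def by (rule commute_mult) (rule W.ddiff_op_coeff_op[OF that, symmetric], rule perm_sites_coeff_op)
  then have 2: "W.S c * (\<Sum>r\<in>UNIV - {p}. W.ddiff_op p r * perm_sites \<langle>p \<leftrightarrow> r\<rangle>) =
      ((\<Sum>r\<in>UNIV - {p}. W.ddiff_op p r * perm_sites \<langle>p \<leftrightarrow> r\<rangle>) * W.S c :: ('n, 'm, 'v) AN endo)"
    by (rule_tac commute_sum) auto
  have 3: "W.S c * z_sum p = (z_sum p * W.S c :: ('n, 'm, 'v) AN endo)"
    by (rule z_sum_intertwine) (unfold z_term_def, rule commute_mult, rule W.S_shift_op, rule casimir_V_S)
  show ?thesis unfolding z_op_def distrib_left distrib_right 1 2 3 ..
qed

lemma app_linear:
  assumes "\<And>c. W.S c * B = B * W.S c"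
  shows "Vector_Spaces.linear (fscale (fscale sV)) (fscale (fscale sV)) (app B)"
proof (rule linearI'[OF W.vsW W.vsW additive_app])
  fix c w
  have "app (W.S c * B) w = app (B * W.S c) w" by (simp only: assms)
  then show "app B (fscale (fscale sV) c w) = fscale (fscale sV) c (app B w)" by (simp add: W.S_scale)
qed

text \<open>Single loops of negative degree generate \<open>\<qq>\<close> additively, so one degree
  at a time can be treated.\<close>

lemma qW_preserve:
  assumes "\<And>c. W.S c * B = B * W.S c"
    and "\<And>Q k w. k \<ge> 1 \<Longrightarrow> app B (app (A (loop Q (- int k))) w) \<in> AN_qW sV \<rho>V"
    and "x \<in> AN_qW sV \<rho>V"
  shows "app B x \<in> AN_qW sV \<rho>V"
  using app_linear[OF assms(1)] _ qW_subgroup qW_scale assms(3)[unfolded AN_qW_def]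
proof (rule linear_on_span, safe)
  fix \<xi> :: "'m aff" and w assume "\<xi> \<in> aff_q"
  then have "app B (app (A \<xi>) w) \<in> AN_qW sV \<rho>V"
  proof (induction rule: aff_q_induct)
    case (loop P i)
    then have "i = - int (nat (- i))" "nat (- i) \<ge> 1" by simp_all
    then show ?case using assms(2)[of "nat (- i)" P w] by simp
  next
    case (add \<xi> \<eta>)
    then show ?case by (simp add: A_add app_add add_subgroupD[OF qW_subgroup])
  qed
  then show "app B (AN_aff sV \<rho>V \<xi> w) \<in> AN_qW sV \<rho>V" by (simp only: AN_aff_A)
qed

lemma loop_neg_q: "k \<ge> 1 \<Longrightarrow> loop Q (- int k) \<in> aff_q"
  by (simp add: aff_q_iff aff_neg_loop)

lemma qW_commute:
  assumes "\<And>c. W.S c * B = B * W.S c" "\<And>\<xi>. B * A \<xi> = A \<xi> * B" "x \<in> AN_qW sV \<rho>V"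
  shows "app B x \<in> AN_qW sV \<rho>V"
  using assms(1) _ assms(3)
proof (rule qW_preserve)
  fix Q :: "'m sl" and k :: nat and w assume "k \<ge> 1"
  moreover have "app (B * A (loop Q (- int k))) w = app (A (loop Q (- int k)) * B) w" by (simp only: assms(2))
  ultimately show "app B (app (A (loop Q (- int k))) w) \<in> AN_qW sV \<rho>V" by (simp add: qW_A loop_neg_q)
qed

text \<open>The commutator of \<open>z_op p\<close> with a loop of negative degree maps into
  \<open>\<qq>W\<close> by \<open>z_op_A\<close> and \<open>HK_qW\<close>, and the loop does so when
  it acts after \<open>z_op p\<close>.\<close>

lemma qW_z_op: "x \<in> AN_qW sV \<rho>V \<Longrightarrow> app (z_op p) x \<in> AN_qW sV \<rho>V"
proof (rule qW_preserve)
  fix Q :: "'m sl" and k :: nat and w assume k: "k \<ge> 1"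
  have "app (z_op p * A (loop Q (- int k)) - A (loop Q (- int k)) * z_op p) w \<in> AN_qW sV \<rho>V"
    unfolding z_op_A by (intro add_subgroupD(3)[OF qW_subgroup] qW_sum HK_qW) simp
  from add_subgroupD(4)[OF qW_subgroup this qW_A[OF loop_neg_q[OF k], of Q "app (z_op p) w"]]
  show "app (z_op p) (app (A (loop Q (- int k))) w) \<in> AN_qW sV \<rho>V" by simp
qed (simp_all add: z_op_S)

text \<open>The case \<open>k = 0\<close> of \<open>z_op_A\<close>: the sum is empty, so the
  commutation holds on \<open>W\<close> and not only modulo \<open>\<qq>W\<close>.\<close>

lemma z_op_sl: "z_op p * A (loop Q 0) = A (loop Q 0) * z_op p"
proof (rule endo_eqI)
  fix w
  have "app (z_op p * A (loop Q (- int 0)) - A (loop Q (- int 0)) * z_op p) w = 0" unfolding z_op_A by simp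
  then show "app (z_op p * A (loop Q 0)) w = app (A (loop Q 0) * z_op p) w" by simp
qed

lemma qW_sl:
  fixes x :: "('n::finite, 'm, 'v) AN"
  assumes "x \<in> AN_qW sV \<rho>V"
  shows "app (A (loop Q 0)) x \<in> AN_qW sV \<rho>V"
  using assms
proof (rule qW_preserve[OF A_S, rotated])
  fix P :: "'m sl" and k :: nat and w :: "('n, 'm, 'v) AN" assume k: "k \<ge> 1"
  have "(A (loop Q 0) * A (loop P (- int k)) :: ('n, 'm, 'v) AN endo) =
     A (loop P (- int k)) * A (loop Q 0) + A (aff_bracket (loop Q 0) (loop P (- int k)))"
    unfolding A_bracket by simp
  also have "aff_bracket (loop Q 0) (loop P (- int k)) = loop (sl_bracket Q P) (- int k)"
    using k by (simp add: aff_bracket_loop zero_prod_def[symmetric])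
  finally have "(A (loop Q 0) * A (loop P (- int k)) :: ('n, 'm, 'v) AN endo) =
     A (loop P (- int k)) * A (loop Q 0) + A (loop (sl_bracket Q P) (- int k))" .
  then have "app (A (loop Q 0) * A (loop P (- int k))) w =
     app (A (loop P (- int k)) * A (loop Q 0) + A (loop (sl_bracket Q P) (- int k))) w"
    by (rule arg_cong)
  then show "app (A (loop Q 0)) (app (A (loop P (- int k))) w) \<in> AN_qW sV \<rho>V"
    using k by (simp add: add_subgroupD[OF qW_subgroup] qW_A loop_neg_q)
qed

end


section \<open>The relations of the Cherednik algebra on W\<close>

text \<open>The relation \<open>[z\<^sub>p, z\<^sub>q] = \<sigma>\<^sub>p\<^sub>q (z\<^sub>p - z\<^sub>q)\<close> is not checked on all of \<open>W\<close>: by the next two lemmas the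
  remaining relations imply that its defect commutes with the variables, so that it suffices to
  know the relation on the constants \<open>1 \<otimes> (\<complex>\<^sup>m)\<^sup>\<otimes>\<^sup>N \<otimes> U\<close>.\<close>

lemma defect_commute_same:
  fixes xp xq zp zq s k t :: "'a::{ring,monoid_mult}"
  assumes "zp * xp = xp * zp + xp * (k + s + t)" "zq * xp = xp * zq - xq * s" "zp * xq = xq * zp - xp * s"
    "s * xp = xq * s" "s * xq = xp * s" "zp * s = s * zq" "zq * s = s * zp" "s * s = 1"
    "zq * k = k * zq" "zq * t = t * zq"
  shows "(zp * zq - zq * zp - s * (zp - zq)) * xp = xp * (zp * zq - zq * zp - s * (zp - zq))"
  using assms(8)
  by (simp add: distrib_left distrib_right left_diff_distrib right_diff_distrib mult.assoc
      assms assms[THEN assoc_rule])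

text \<open>Here \<open>s\<close>, \<open>a\<close>, \<open>b\<close> stand for the transpositions
  of \<open>p, q\<close>, of \<open>p, r\<close> and of \<open>q, r\<close>. The commutator of
  \<open>zp\<close> and \<open>zq\<close> leaves the surplus \<open>xp s b - xq s a\<close> when
  moved past \<open>xr\<close>, and \<open>s (zp - zq)\<close> leaves the same.\<close>

lemma defect_commute_other:
  fixes xp xq xr zp zq s a b :: "'a::{ring,monoid_mult}"
  assumes "zp * xr = xr * zp - xp * a" "zq * xr = xr * zq - xq * b" "zp * b = b * zp" "zq * a = a * zq"
    "s * xr = xr * s" "zp * xq = xq * zp - xp * s" "zq * xp = xp * zq - xq * s"
    "s * xp = xq * s" "s * xq = xp * s" "zp * s = s * zq" "zq * s = s * zp"
  shows "(zp * zq - zq * zp - s * (zp - zq)) * xr = xr * (zp * zq - zq * zp - s * (zp - zq))"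
  by (simp add: distrib_left distrib_right left_diff_distrib right_diff_distrib mult.assoc
      assms assms[THEN assoc_rule])

lemma shift_op_axis_zero: "shift_op (axis p 0) = 1"
proof -
  have "axis p (0 :: int) = 0" by (simp add: axis_def vec_eq_iff)
  then show ?thesis by (simp only: shift_op_zero)
qed

text \<open>Commuting with an invertible element implies commuting with its inverse, and every
  monomial is a product of powers of the variables.\<close>

lemma shift_op_commute_all:
  fixes B :: "('n::finite, 'm, 'v::ab_group_add) AN endo"
  assumes "\<And>p. B * shift_op (axis p 1) = shift_op (axis p 1) * B"
  shows "B * shift_op c = shift_op c * B"
proof -
  have split: "axis p (i + k) = axis p i + axis p k" for p :: 'n and i k :: int
    by (simp add: axis_def vec_eq_iff)
  have inv: "B * shift_op (- d) = shift_op (- d) * B" if "B * shift_op d = shift_op d * B" for d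
  proof -
    have 1: "shift_op (- d) * shift_op d = (1 :: ('n, 'm, 'v) AN endo)" "shift_op d * shift_op (- d) = (1 :: ('n, 'm, 'v) AN endo)"
      by (simp_all add: shift_op_mult shift_op_zero)
    have "B * shift_op (- d) = shift_op (- d) * (shift_op d * B) * shift_op (- d)" by (simp only: mult.assoc[symmetric] 1 mult_1_left)
    also have "\<dots> = shift_op (- d) * B * (shift_op d * shift_op (- d))" by (simp only: that[symmetric] mult.assoc)
    finally show ?thesis by (simp add: 1)
  qed
  have nat: "B * shift_op (axis p (int n)) = shift_op (axis p (int n)) * B" for p n
  proof (induction n)
    case 0
    show ?case by (simp only: of_nat_0 shift_op_axis_zero mult_1_left mult_1_right)
  next
    case (Suc n)
    have "shift_op (axis p (int (Suc n))) = (shift_op (axis p 1) * shift_op (axis p (int n)) :: ('n, 'm, 'v) AN endo)"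
      by (simp add: shift_op_mult split)
    then show ?case using assms[of p] Suc by (simp only:) (rule commute_mult)
  qed
  have axis: "B * shift_op (axis p i) = shift_op (axis p i) * B" for p i
  proof (cases "i \<ge> 0")
    case True
    then show ?thesis using nat[of p "nat i"] by simp
  next
    case False
    have "- axis p (int (nat (- i))) = axis p i" using False by (simp add: axis_def vec_eq_iff)
    then show ?thesis using inv[OF nat[of p "nat (- i)"]] by simp
  qed
  have "B * shift_op (\<Sum>p\<in>P. axis p (c $ p)) = shift_op (\<Sum>p\<in>P. axis p (c $ p)) * B" if "finite P" for P
    using that
  proof (induction P)
    case empty
    then show ?case by (simp add: shift_op_zero)
  next
    case (insert p P)
    then show ?case by (simp add: shift_op_mult[symmetric]) (intro commute_mult axis)
  qed
  moreover have "(\<Sum>p\<in>UNIV. axis p (c $ p)) = c"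
    by (simp add: vec_eq_iff axis_def)
  ultimately show ?thesis by (metis finite)
qed

context par_ind
begin

lemma sym_op_mult: "W.sym_op \<sigma> * W.sym_op \<tau> = W.sym_op (\<sigma> * \<tau>)"
proof -
  have "perm_vars \<sigma> * perm_sites \<sigma> * (perm_vars \<tau> * perm_sites \<tau>) = perm_vars \<sigma> * (perm_sites \<sigma> * perm_vars \<tau>) * perm_sites \<tau>" by (simp only: mult.assoc)
  also have "\<dots> = perm_vars \<sigma> * perm_vars \<tau> * (perm_sites \<sigma> * perm_sites \<tau>)" by (simp only: perm_vars_perm_sites[symmetric] mult.assoc)
  finally show ?thesis by (simp add: W.sym_op_def perm_vars_mult perm_sites_mult)
qed

lemma sym_op_one: "W.sym_op 1 = 1"
  by (simp add: W.sym_op_def perm_vars_one perm_sites_one)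

lemma sym_op_shift_op: "W.sym_op \<sigma> * shift_op c = shift_op (perm_vec \<sigma> c) * W.sym_op \<sigma>"
proof -
  have "perm_vars \<sigma> * perm_sites \<sigma> * shift_op c = perm_vars \<sigma> * shift_op c * perm_sites \<sigma>" by (simp only: mult.assoc perm_sites_shift_op)
  then show ?thesis by (simp only: W.sym_op_def perm_vars_shift_op mult.assoc)
qed

lemma sym_op_S: "W.S c * W.sym_op \<sigma> = W.sym_op \<sigma> * W.S c"
  unfolding W.sym_op_def by (rule commute_mult) (rule W.S_perm_vars, rule W.S_perm_sites)

lemma ddiff_op_perm_sites_shift_op:
  fixes p q r :: "'n::finite"
  assumes "p \<noteq> r"
  shows "W.ddiff_op p r * perm_sites \<langle>p \<leftrightarrow> r\<rangle> * shift_op (axis q 1) = (shift_op (axis q 1) * (W.ddiff_op p r * perm_sites \<langle>p \<leftrightarrow> r\<rangle>) +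
    (if q = p then shift_op (axis p 1) * W.sym_op \<langle>p \<leftrightarrow> r\<rangle> else if q = r then - (shift_op (axis p 1) * W.sym_op \<langle>p \<leftrightarrow> r\<rangle>) else 0)
      :: ('n, 'm, 'v) AN endo)"
proof -
  have "W.ddiff_op p r * perm_sites \<langle>p \<leftrightarrow> r\<rangle> * shift_op (axis q 1) = (W.ddiff_op p r * shift_op (axis q 1) * perm_sites \<langle>p \<leftrightarrow> r\<rangle> :: ('n, 'm, 'v) AN endo)"
    by (simp only: mult.assoc perm_sites_shift_op)
  moreover have "W.ddiff_op p r * shift_op (axis q 1) = (shift_op (axis q 1) * W.ddiff_op p r +
    (if q = p then shift_op (axis p 1) * perm_vars \<langle>p \<leftrightarrow> r\<rangle> else if q = r then - (shift_op (axis p 1) * perm_vars \<langle>p \<leftrightarrow> r\<rangle>) else 0)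
      :: ('n, 'm, 'v) AN endo)"
    using assms by (auto simp: W.ddiff_op_X_left W.ddiff_op_X_right W.ddiff_op_X_other)
  ultimately show ?thesis
    by (simp add: W.sym_op_def distrib_right mult.assoc)
qed

lemma z_term_shift_op: "shift_op c * z_term p i = z_term p i * shift_op c"
  unfolding z_term_def by (rule commute_mult) (rule shift_op_comm, rule casimir_V_shift_op)

lemma z_sum_shift_op: "z_sum p * shift_op c = shift_op c * z_sum p"
  by (rule z_sum_intertwine[symmetric]) (rule z_term_shift_op)

text \<open>The Euler operator yields \<open>\<kappa> x\<^sub>p\<close>, the divided differences
  yield the transpositions by their twisted Leibniz rules, and the infinite sum commutes with the
  variables.\<close>

lemma z_op_X:
  fixes p q :: "'n::finite"
  shows "z_op p * shift_op (axis q 1) = (shift_op (axis q 1) * z_op p +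
    (if q = p then W.S kap * shift_op (axis p 1) + (\<Sum>r\<in>UNIV - {p}. shift_op (axis p 1) * W.sym_op \<langle>p \<leftrightarrow> r\<rangle>)
     else - (shift_op (axis p 1) * W.sym_op \<langle>p \<leftrightarrow> q\<rangle>)) :: ('n, 'm, 'v) AN endo)"
proof -
  let ?x = "shift_op (axis q 1) :: ('n, 'm, 'v) AN endo"
  have 1: "W.S kap * W.euler_op p * ?x = ?x * (W.S kap * W.euler_op p) + (if q = p then W.S kap * ?x else 0)"
  proof -
    have "W.S kap * W.euler_op p * ?x = W.S kap * ?x * (W.euler_op p + W.S (of_int (axis q 1 $ p)))"
      by (simp only: mult.assoc W.euler_op_shift_op)
    also have "\<dots> = ?x * (W.S kap * W.euler_op p) + W.S kap * ?x * W.S (of_int (axis q 1 $ p))"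
      by (simp only: distrib_left W.S_shift_op mult.assoc)
    finally show ?thesis by (auto simp: axis_def W.S_one W.S_zero)
  qed
  have "(\<Sum>r\<in>UNIV - {p}. W.ddiff_op p r * perm_sites \<langle>p \<leftrightarrow> r\<rangle>) * ?x = (\<Sum>r\<in>UNIV - {p}. ?x * (W.ddiff_op p r * perm_sites \<langle>p \<leftrightarrow> r\<rangle>) +
    (if q = p then shift_op (axis p 1) * W.sym_op \<langle>p \<leftrightarrow> r\<rangle> else if r = q then - (shift_op (axis p 1) * W.sym_op \<langle>p \<leftrightarrow> q\<rangle>) else 0))"
    unfolding sum_distrib_right by (rule sum.cong[OF refl]) (auto simp: ddiff_op_perm_sites_shift_op)
  also have "\<dots> = ?x * (\<Sum>r\<in>UNIV - {p}. W.ddiff_op p r * perm_sites \<langle>p \<leftrightarrow> r\<rangle>) +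
    (if q = p then (\<Sum>r\<in>UNIV - {p}. shift_op (axis p 1) * W.sym_op \<langle>p \<leftrightarrow> r\<rangle>) else - (shift_op (axis p 1) * W.sym_op \<langle>p \<leftrightarrow> q\<rangle>))"
    by (simp add: sum.distrib sum_distrib_left sum.delta)
  finally show ?thesis
    by (simp add: z_op_def distrib_left distrib_right 1 z_sum_shift_op)
qed

lemma sym_op_casimir_V: "W.sym_op \<sigma> * casimir_V p i = casimir_V (\<sigma> \<langle>$\<rangle> p) i * W.sym_op \<sigma>"
proof -
  have "perm_vars \<sigma> * perm_sites \<sigma> * casimir_V p i = perm_vars \<sigma> * casimir_V (\<sigma> \<langle>$\<rangle> p) i * perm_sites \<sigma>" by (simp only: mult.assoc casimir_V_perm_sites)
  then show ?thesis by (simp only: W.sym_op_def casimir_V_perm_vars mult.assoc)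
qed

lemma z_op_sym_op:
  fixes p :: "'n::finite"
  shows "W.sym_op \<sigma> * z_op p = (z_op (\<sigma> \<langle>$\<rangle> p) * W.sym_op \<sigma> :: ('n, 'm, 'v) AN endo)"
proof -
  let ?s = "W.sym_op \<sigma> :: ('n, 'm, 'v) AN endo" and ?p = "\<sigma> \<langle>$\<rangle> p"
  have "?s * W.euler_op p = W.euler_op ?p * ?s"
  proof -
    have "?s * W.euler_op p = perm_vars \<sigma> * W.euler_op p * perm_sites \<sigma>" by (simp only: W.sym_op_def mult.assoc W.euler_op_perm_sites)
    then show ?thesis by (simp only: W.sym_op_def W.perm_vars_euler_op mult.assoc)
  qed
  then have 1: "?s * (W.S kap * W.euler_op p) = W.S kap * W.euler_op ?p * ?s"
    by (simp only: mult.assoc[symmetric] sym_op_S[symmetric]) (simp only: mult.assoc)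
  have 2: "?s * (W.ddiff_op p r * perm_sites \<langle>p \<leftrightarrow> r\<rangle>) = W.ddiff_op ?p (\<sigma> \<langle>$\<rangle> r) * perm_sites \<langle>?p \<leftrightarrow> \<sigma> \<langle>$\<rangle> r\<rangle> * ?s" if "p \<noteq> r" for r
  proof -
    have n: "?p \<noteq> \<sigma> \<langle>$\<rangle> r" using that by (simp add: W.apply_eq_iff)
    have "?s * (W.ddiff_op p r * perm_sites \<langle>p \<leftrightarrow> r\<rangle>) = perm_vars \<sigma> * (perm_sites \<sigma> * W.ddiff_op p r) * perm_sites \<langle>p \<leftrightarrow> r\<rangle>" by (simp only: W.sym_op_def mult.assoc)
    also have "\<dots> = perm_vars \<sigma> * W.ddiff_op p r * (perm_sites \<sigma> * perm_sites \<langle>p \<leftrightarrow> r\<rangle>)" by (simp only: W.ddiff_op_perm_sites[OF that, symmetric] mult.assoc)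
    also have "\<dots> = W.ddiff_op ?p (\<sigma> \<langle>$\<rangle> r) * (perm_vars \<sigma> * perm_sites \<langle>?p \<leftrightarrow> \<sigma> \<langle>$\<rangle> r\<rangle>) * perm_sites \<sigma>"
      by (simp only: W.perm_vars_ddiff_op[OF that] perm_sites_mult W.swap_conj) (simp only: perm_sites_mult[symmetric] mult.assoc)
    finally show ?thesis by (simp only: perm_vars_perm_sites W.sym_op_def mult.assoc)
  qed
  have "?s * (\<Sum>r\<in>UNIV - {p}. W.ddiff_op p r * perm_sites \<langle>p \<leftrightarrow> r\<rangle>) = (\<Sum>r\<in>UNIV - {p}. W.ddiff_op ?p (\<sigma> \<langle>$\<rangle> r) * perm_sites \<langle>?p \<leftrightarrow> \<sigma> \<langle>$\<rangle> r\<rangle> * ?s)"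
    unfolding sum_distrib_left by (rule sum.cong[OF refl], rule 2) auto
  also have "\<dots> = (\<Sum>r\<in>UNIV - {?p}. W.ddiff_op ?p r * perm_sites \<langle>?p \<leftrightarrow> r\<rangle> * ?s)"
    by (rule sum.reindex_bij_witness[of _ "\<lambda>r. inverse \<sigma> \<langle>$\<rangle> r" "\<lambda>r. \<sigma> \<langle>$\<rangle> r"]) (auto simp: W.apply_eq_iff)
  finally have 3: "?s * (\<Sum>r\<in>UNIV - {p}. W.ddiff_op p r * perm_sites \<langle>p \<leftrightarrow> r\<rangle>) = (\<Sum>r\<in>UNIV - {?p}. W.ddiff_op ?p r * perm_sites \<langle>?p \<leftrightarrow> r\<rangle>) * ?s"
    by (simp only: sum_distrib_right)
  have 4: "?s * z_sum p = z_sum ?p * ?s"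
  proof (rule z_sum_intertwine)
    fix i
    have "?s * z_term p i = ?s * shift_op (axis p (- int i)) * casimir_V p (int i)" by (simp only: z_term_def mult.assoc)
    also have "\<dots> = shift_op (axis ?p (- int i)) * (?s * casimir_V p (int i))" by (simp only: sym_op_shift_op perm_vec_simps mult.assoc)
    finally show "?s * z_term p i = z_term ?p i * ?s" by (simp only: sym_op_casimir_V z_term_def mult.assoc)
  qed
  show ?thesis unfolding z_op_def distrib_left distrib_right 1 3 4 ..
qed

definition hecke_defect :: "'n \<Rightarrow> 'n \<Rightarrow> ('n::finite, 'm, 'v) AN endo"
  where "hecke_defect p q = z_op p * z_op q - z_op q * z_op p - W.sym_op \<langle>p \<leftrightarrow> q\<rangle> * (z_op p - z_op q)"

lemma swap_square: "\<langle>p \<leftrightarrow> q\<rangle> * \<langle>p \<leftrightarrow> q\<rangle> = (1 :: 'a perm)"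
  by (rule perm_eqI) (metis apply_mult apply_one id_apply inverse_swap perm_inverse_apply(1))

lemma hecke_defect_X_same:
  fixes p q :: "'n::finite"
  assumes "p \<noteq> q"
  shows "hecke_defect p q * shift_op (axis p 1) = (shift_op (axis p 1) * hecke_defect p q :: ('n, 'm, 'v) AN endo)"
  unfolding hecke_defect_def
proof (rule defect_commute_same)
  let ?s = "W.sym_op \<langle>p \<leftrightarrow> q\<rangle> :: ('n, 'm, 'v) AN endo" and ?t = "\<Sum>r\<in>UNIV - {p, q}. W.sym_op \<langle>p \<leftrightarrow> r\<rangle> :: ('n, 'm, 'v) AN endo"
  have "(\<Sum>r\<in>UNIV - {p}. W.sym_op \<langle>p \<leftrightarrow> r\<rangle>) = ?s + ?t"
  proof -
    have "UNIV - {p} = insert q (UNIV - {p, q})" using assms by auto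
    then show ?thesis by simp
  qed
  then show "z_op p * shift_op (axis p 1) = shift_op (axis p 1) * z_op p + shift_op (axis p 1) * (W.S kap + ?s + ?t)"
    by (simp add: z_op_X sum_distrib_left[symmetric] distrib_left W.S_shift_op algebra_simps)
  show "z_op q * shift_op (axis p 1) = shift_op (axis p 1) * z_op q - shift_op (axis q 1) * ?s"
    using assms by (simp add: z_op_X swap_sym[of q p])
  show "z_op p * shift_op (axis q 1) = shift_op (axis q 1) * z_op p - shift_op (axis p 1) * ?s"
    using assms by (simp add: z_op_X)
  show "?s * shift_op (axis p 1) = shift_op (axis q 1) * ?s" "?s * shift_op (axis q 1) = shift_op (axis p 1) * ?s"
    "z_op p * ?s = ?s * z_op q" "z_op q * ?s = ?s * z_op p"
    by (simp_all add: sym_op_shift_op z_op_sym_op)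
  show "?s * ?s = 1" by (simp add: sym_op_mult swap_square sym_op_one)
  show "z_op q * W.S kap = W.S kap * z_op q" by (rule z_op_S[symmetric])
  have "z_op q * W.sym_op \<langle>p \<leftrightarrow> r\<rangle> = (W.sym_op \<langle>p \<leftrightarrow> r\<rangle> * z_op q :: ('n, 'm, 'v) AN endo)" if "r \<noteq> q" for r
    using z_op_sym_op[of "\<langle>p \<leftrightarrow> r\<rangle>" q] assms that by simp
  then show "z_op q * ?t = ?t * z_op q" by (rule_tac commute_sum) auto
qed

lemma hecke_defect_swap: "hecke_defect q p = - hecke_defect p q"
  by (simp add: hecke_defect_def swap_sym[of q p] algebra_simps)

lemma hecke_defect_X:
  fixes p q r :: "'n::finite"
  assumes "p \<noteq> q"
  shows "hecke_defect p q * shift_op (axis r 1) = (shift_op (axis r 1) * hecke_defect p q :: ('n, 'm, 'v) AN endo)"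
proof -
  consider "r = p" | "r = q" | "r \<noteq> p" "r \<noteq> q" by blast
  then show ?thesis
  proof cases
    case 1
    then show ?thesis using hecke_defect_X_same[OF assms] by simp
  next
    case 2
    have "hecke_defect q p * shift_op (axis q 1) = (shift_op (axis q 1) * hecke_defect q p :: ('n, 'm, 'v) AN endo)"
      using assms by (intro hecke_defect_X_same) simp
    then show ?thesis using 2 by (simp add: hecke_defect_swap[of q p])
  next
    case 3
    let ?s = "\<lambda>p q. W.sym_op \<langle>p \<leftrightarrow> q\<rangle> :: ('n, 'm, 'v) AN endo"
    show ?thesis unfolding hecke_defect_def
    proof (rule defect_commute_other)
      show "z_op p * shift_op (axis r 1) = shift_op (axis r 1) * z_op p - shift_op (axis p 1) * ?s p r"
        "z_op q * shift_op (axis r 1) = shift_op (axis r 1) * z_op q - shift_op (axis q 1) * ?s q r"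
        "z_op p * shift_op (axis q 1) = shift_op (axis q 1) * z_op p - shift_op (axis p 1) * ?s p q"
        using assms 3 by (simp_all add: z_op_X)
      show "z_op q * shift_op (axis p 1) = shift_op (axis p 1) * z_op q - shift_op (axis q 1) * ?s p q"
        using assms by (simp add: z_op_X swap_sym[of q p])
      show "z_op p * ?s q r = ?s q r * z_op p" "z_op q * ?s p r = ?s p r * z_op q"
        "?s p q * shift_op (axis r 1) = shift_op (axis r 1) * ?s p q"
        "?s p q * shift_op (axis p 1) = shift_op (axis q 1) * ?s p q" "?s p q * shift_op (axis q 1) = shift_op (axis p 1) * ?s p q"
        "z_op p * ?s p q = ?s p q * z_op q" "z_op q * ?s p q = ?s p q * z_op p"
        using assms 3 by (simp_all add: z_op_sym_op sym_op_shift_op)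
    qed
  qed
qed

lemma hecke_defect_shift_op: "p \<noteq> q \<Longrightarrow> hecke_defect p q * shift_op c = shift_op c * hecke_defect p q"
  by (rule shift_op_commute_all) (rule hecke_defect_X)

text \<open>By \<open>casimir_V_R\<close> in degree 0, the commutator of \<open>sl_unit y x\<close>
  on \<open>V\<close> with the sum at \<open>q\<close> is minus that of the matrix unit at
  \<open>q\<close>. Summed against the matrix units at \<open>p\<close>, these form the flip of
  \<open>p\<close> and \<open>q\<close>.\<close>

lemma casimir_V_hecke:
  fixes p q :: "'n::finite"
  assumes "p \<noteq> q"
  shows "casimir_V p 0 * casimir_V q 0 - casimir_V q 0 * casimir_V p 0 = (perm_sites \<langle>p \<leftrightarrow> q\<rangle> * (casimir_V p 0 - casimir_V q 0) :: ('n, 'm, 'v) AN endo)"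
proof -
  let ?O = "casimir_V q 0 :: ('n, 'm, 'v) AN endo"
  have "R (loop (sl_unit y x) 0) * ?O - ?O * R (loop (sl_unit y x) 0) = ?O * E q y x - E q y x * ?O" for x y
  proof -
    have "R (loop (sl_unit y x) 0) * ?O - ?O * R (loop (sl_unit y x) 0) = G q 0 (sl_unit y x)"
      using casimir_V_R[of q 0 "sl_unit y x" 0] by (simp add: W.S_zero algebra_simps)
    then show ?thesis by (cases "y = x") (simp_all add: G_def M_sl_unit algebra_simps casimir_V_S)
  qed
  moreover have "?O * (E p x y * B) = E p x y * (?O * B)" for x y and B :: "('n, 'm, 'v) AN endo"
  proof -
    have "E p x y * ?O = ?O * E p x y"
      using casimir_V_M[of q p "matrix_unit x y" 0] assms by (simp add: W.M_unit)
    then show ?thesis by (simp only: mult.assoc[symmetric])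
  qed
  ultimately have "E p x y * R (loop (sl_unit y x) 0) * ?O - ?O * (E p x y * R (loop (sl_unit y x) 0)) =
      ?O * (E p x y * E q y x) - E p x y * E q y x * ?O" for x y
    by (simp add: mult.assoc right_diff_distrib[symmetric])
  then have "casimir_V p 0 * ?O - ?O * casimir_V p 0 = ?O * (\<Sum>x\<in>UNIV. \<Sum>y\<in>UNIV. E p x y * E q y x) - (\<Sum>x\<in>UNIV. \<Sum>y\<in>UNIV. E p x y * E q y x) * ?O"
    unfolding casimir_V_eq[of p] by (simp add: sum_distrib_left sum_distrib_right sum_subtractf[symmetric])
  also have "\<dots> = ?O * perm_sites \<langle>p \<leftrightarrow> q\<rangle> - perm_sites \<langle>p \<leftrightarrow> q\<rangle> * ?O" by (simp only: perm_sites_swap[OF assms])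
  also have "?O * perm_sites \<langle>p \<leftrightarrow> q\<rangle> = perm_sites \<langle>p \<leftrightarrow> q\<rangle> * casimir_V p 0" by (simp add: casimir_V_perm_sites)
  finally show ?thesis by (simp add: right_diff_distrib)
qed

definition iota :: "('n::finite, 'm, 'u) FN \<Rightarrow> ('n, 'm, 'v) AN"
  where "iota = pm_ext (\<lambda>e u. tmono 0 e (j u))"

lemma additive_tmono_j: "additive (\<lambda>u. tmono a e (j u))"
  by (rule additive_comp[OF additive_mono additive_linear[OF j_linear]])

lemma additive_iota: "additive iota"
  unfolding iota_def by (rule additive_pm_ext) (rule additive_tmono_j)

lemma iota_single [simp]: "iota (Poly_Mapping.single e u) = tmono 0 e (j u)"
  by (simp add: iota_def additive_tmono_j)

lemma iota_linear: "Vector_Spaces.linear (fscale sU) (fscale (fscale sV)) iota"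
proof (rule linearI'[OF vector_space_fscale[OF vsU] W.vsW additive_iota])
  show "iota (fscale sU c f) = fscale (fscale sV) c (iota f)" for c f
    by (induction f rule: pm_induct)
      (simp_all add: vsU vsV linear_scale'[OF j_linear] additive.add[OF additive_iota]
        additive.add[OF additive_scale[OF vector_space_fscale[OF vsU]]] additive.add[OF additive_scale[OF W.vsW]])
qed

lemma ddiff_op_const: "p \<noteq> r \<Longrightarrow> app (W.ddiff_op p r) (tmono 0 e v) = 0"
proof (rule xdiff_inj)
  assume "p \<noteq> r"
  have "app (xdiff p r * W.ddiff_op p r) (tmono 0 e v) = 0"
    unfolding W.xdiff_ddiff_op[OF \<open>p \<noteq> r\<close>] by simp
  then show "app (xdiff p r) (app (W.ddiff_op p r) (tmono 0 e v)) = 0" by simp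
qed

text \<open>On constants the Euler operator and the divided differences vanish, and loops of
  positive degree annihilate \<open>j u\<close>. Only the summand of degree 0 is left, where the
  \<open>\<F>\<^sub>N\<close> action of \<open>z\<^sub>p\<close> is recovered by
  \<open>iota_Z\<close>.\<close>

lemma z_op_iota: "app (z_op p) (iota f) = app (casimir_V p 0) (iota f)"
proof (induction f rule: pm_induct)
  case (single e u)
  have "app (R (loop P (int i))) (tmono 0 e (j u)) = 0" if "i \<ge> 1" for i P
    using that by (simp add: j_p aff_neg_loop pact_loop linear_zero'[OF j_linear])
  then have "app (z_sum p) (tmono 0 e (j u)) = (\<Sum>i<1. app (z_term p i) (tmono 0 e (j u)))"
    by (intro app_z_sum) blast
  then have "app (z_sum p) (tmono 0 e (j u)) = app (casimir_V p 0) (tmono 0 e (j u))"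
    by (simp add: z_term_def shift_op_axis_zero)
  then show ?case
    by (simp add: z_op_def app_sum_left ddiff_op_const additive.zero[OF additive_scale_left[OF vsV]] additive.zero[OF additive_scale[OF vsV]])
qed (simp_all add: additive.add[OF additive_iota] app_add)

lemma FN_Z_single:
  "tensor_op sU (site_op (matrix_unit x y) p) D (Poly_Mapping.single e u)
    = (if e p = y then Poly_Mapping.single (e(p := x)) (D u) else 0)" if "additive D"
proof -
  have "pure_tensor sU (site_op (matrix_unit x y) p (basis_vec e)) (D u) =
    (\<Sum>z\<in>UNIV. Poly_Mapping.single (e(p := z)) (sU (matrix_unit x y $ z $ e p) (D u)))"
    by (simp add: W.site_op_basis additive.sum[OF additive_pure_tensor_left[OF vsU]] pure_tensor_single vsU)
  also have "\<dots> = (\<Sum>z\<in>UNIV. if z = x then (if e p = y then Poly_Mapping.single (e(p := x)) (D u) else 0) else 0)"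
    by (rule sum.cong) (auto simp: matrix_unit_def additive.zero[OF additive_scale_left[OF vsU]] vector_space.vector_space_assms(4)[OF vsU])
  finally show ?thesis by (simp add: tensor_op_single vsU that)
qed

lemma \<rho>U_add: "additive (\<rho>U P)"
  by (rule additive_linear[OF lie_moduleD(1)[OF modU]])

lemma \<rho>_j: "\<rho>V (loop P 0) (j u) = j (\<rho>U P u)"
  by (simp add: j_p aff_neg_loop pact_loop)

lemma iota_Z: "app (casimir_V p 0) (iota f) = iota (FN_hecke sU \<rho>U (Z p) f)"
proof (rule additive_eqI[where x = f])
  show "additive (\<lambda>f. app (casimir_V p 0) (iota f))" by (rule additive_comp[OF additive_app additive_iota])
  have "additive (FN_hecke sU \<rho>U (Z p))"
    unfolding FN_hecke.simps by (intro additive_sum additive_tensor_op vsU \<rho>U_add)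
  then show "additive (\<lambda>f. iota (FN_hecke sU \<rho>U (Z p) f))" by (rule additive_comp[OF additive_iota])
qed (auto simp: casimir_V_eq app_sum_left app_E \<rho>_j FN_Z_single \<rho>U_add additive.sum[OF additive_iota]
    additive.zero[OF additive_iota] intro!: sum.cong)

lemma iota_Sym: "app (W.sym_op \<sigma>) (iota f) = iota (FN_hecke sU \<rho>U (Sym \<sigma>) f)"
  and iota_perm_sites: "app (perm_sites \<sigma>) (iota f) = iota (FN_hecke sU \<rho>U (Sym \<sigma>) f)"
proof -
  have "additive (FN_hecke sU \<rho>U (Sym \<sigma>))"
    unfolding FN_hecke.simps by (intro additive_tensor_op vsU) simp
  then have 1: "additive (\<lambda>f. iota (FN_hecke sU \<rho>U (Sym \<sigma>) f))" by (rule additive_comp[OF additive_iota])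
  have 2: "FN_hecke sU \<rho>U (Sym \<sigma>) (Poly_Mapping.single e u) = Poly_Mapping.single (perm_idx \<sigma> e) u" for e u
    unfolding FN_hecke.simps tensor_op_single[OF vsU additive_id(1)] by (simp add: perm_tpow_def perm_idx_def vsU)
  show "app (W.sym_op \<sigma>) (iota f) = iota (FN_hecke sU \<rho>U (Sym \<sigma>) f)"
    by (rule additive_eqI[where x = f, OF additive_comp[OF additive_app additive_iota] 1])
      (simp add: 2 W.sym_op_def del: FN_hecke.simps)
  show "app (perm_sites \<sigma>) (iota f) = iota (FN_hecke sU \<rho>U (Sym \<sigma>) f)"
    by (rule additive_eqI[where x = f, OF additive_comp[OF additive_app additive_iota] 1])
      (simp add: 2 del: FN_hecke.simps)
qed

lemma iota_sl:
  fixes f :: "('n::finite, 'm, 'u) FN"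
  shows "app (A (loop P 0)) (iota f) = iota (FN_sl sU \<rho>U P f)"
proof (rule additive_eqI[where x = f])
  show "additive (\<lambda>f. app (A (loop P 0)) (iota f))" by (rule additive_comp[OF additive_app additive_iota])
  have "additive (FN_sl sU \<rho>U P)"
    unfolding FN_sl_def by (intro additive_plus additive_sum additive_tensor_op vsU \<rho>U_add) simp
  then show "additive (\<lambda>f. iota (FN_sl sU \<rho>U P f))" by (rule additive_comp[OF additive_iota])
  fix e :: "'n \<Rightarrow> 'm" and u
  have "tensor_op sU (site_op (mat_of_sl P) q) id (Poly_Mapping.single e u) =
      (\<Sum>z\<in>UNIV. Poly_Mapping.single (e(q := z)) (sU (mat_of_sl P $ z $ e q) u))" for q
    unfolding tensor_op_single[OF vsU additive_id(1)]
    by (simp add: W.site_op_basis additive.sum[OF additive_pure_tensor_left[OF vsU]] pure_tensor_single vsU)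
  moreover have "tensor_op sU id (\<rho>U P) (Poly_Mapping.single e u) = Poly_Mapping.single e (\<rho>U P u)"
    unfolding tensor_op_single[OF vsU \<rho>U_add] by (simp add: vsU)
  ultimately show "app (A (loop P 0)) (iota (Poly_Mapping.single e u)) = iota (FN_sl sU \<rho>U P (Poly_Mapping.single e u))"
    by (simp add: A_loop W.loop_sites_def app_sum_left shift_op_axis_zero W.app_M \<rho>_j FN_sl_def additive.sum[OF additive_iota]
      additive.add[OF additive_iota] linear_scale'[OF j_linear])
qed

text \<open>All operators involved map constants to constants, so products of two
  \<open>z_op\<close> may be replaced by products of Casimir sums of degree 0, and the transposition
  by that of the sites.\<close>

lemma hecke_defect_iota: "p \<noteq> q \<Longrightarrow> app (hecke_defect p q) (iota f) = 0"
proof -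
  assume "p \<noteq> q"
  let ?z = "\<lambda>p. FN_hecke sU \<rho>U (Z p)"
  have 1: "app (z_op p) (app (z_op q) (iota f)) = app (casimir_V p 0) (app (casimir_V q 0) (iota f))" for p q
    by (simp only: z_op_iota iota_Z)
  have 2: "app (W.sym_op \<sigma>) (app (z_op p) (iota f)) = app (perm_sites \<sigma>) (app (casimir_V p 0) (iota f))" for \<sigma> p
    by (simp only: z_op_iota iota_Z iota_Sym iota_perm_sites)
  have "app (hecke_defect p q) (iota f) = app (casimir_V p 0 * casimir_V q 0 - casimir_V q 0 * casimir_V p 0 - perm_sites \<langle>p \<leftrightarrow> q\<rangle> * (casimir_V p 0 - casimir_V q 0)) (iota f)"
    by (simp add: hecke_defect_def 1 2 app_diff)
  then show ?thesis by (simp only: casimir_V_hecke[OF \<open>p \<noteq> q\<close>]) simp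
qed

end


section \<open>Spanning of the induced module by Laurent monomials\<close>

locale cher_ind =
  fixes \<kappa> :: complex and s :: "complex \<Rightarrow> 'f \<Rightarrow> 'f::ab_group_add" and hact :: "'n::finite cher_gen \<Rightarrow> 'f \<Rightarrow> 'f"
  assumes vs: "vector_space s"
begin

abbreviation I :: "'n cher_gen free_alg set"
  where "I \<equiv> two_sided_ideal (cherednik_rels \<kappa>)"

abbreviation rel :: "('n cher_gen free_alg \<times> 'f \<Rightarrow>\<^sub>0 complex) set"
  where "rel \<equiv> induced_rels I hecke_gens s hact"

definition rcong :: "'n cher_gen free_alg \<Rightarrow> 'n cher_gen free_alg \<Rightarrow> bool" (infix "\<simeq>" 50)
  where "a \<simeq> b \<longleftrightarrow> a - b \<in> I"

lemma cgI: "a - b \<in> cherednik_rels \<kappa> \<Longrightarrow> a \<simeq> b"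
  by (simp add: rcong_def two_sided_ideal_base)

lemma rcong_refl [simp]: "a \<simeq> a"
  by (simp add: rcong_def add_subgroupD[OF two_sided_ideal_subgroup])

lemma rcong_sym: "a \<simeq> b \<Longrightarrow> b \<simeq> a"
  unfolding rcong_def using add_subgroupD(3)[OF two_sided_ideal_subgroup, of "a - b"] by simp

lemma rcong_trans [trans]: "a \<simeq> b \<Longrightarrow> b \<simeq> c \<Longrightarrow> a \<simeq> c"
  unfolding rcong_def using add_subgroupD(4)[OF two_sided_ideal_subgroup, of "a - b" _ "b - c"] by simp

lemma rcong_mult: "a \<simeq> a' \<Longrightarrow> b \<simeq> b' \<Longrightarrow> a * b \<simeq> a' * b'"
proof -
  assume "a \<simeq> a'" "b \<simeq> b'"
  then have "(a - a') * b + a' * (b - b') \<in> I"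
    unfolding rcong_def by (intro add_subgroupD(4)[OF two_sided_ideal_subgroup] two_sided_ideal_left two_sided_ideal_right)
  then show ?thesis by (simp add: rcong_def algebra_simps)
qed

lemma rcong_left: "b \<simeq> b' \<Longrightarrow> a * b \<simeq> a * b'" and rcong_right: "a \<simeq> a' \<Longrightarrow> a * b \<simeq> a' * b"
  by (simp_all add: rcong_mult)

lemma X_Xinv: "gen (X p) * gen (Xinv p) \<simeq> 1" and Xinv_X: "gen (Xinv p) * gen (X p) \<simeq> 1"
  and X_comm: "gen (X p) * gen (X q) \<simeq> gen (X q) * gen (X p)"
  by (rule cgI, simp only: cherednik_rels_def laurent_rels_def Un_iff mem_Collect_eq, blast)+

lemma rcong_commute_inv:
  assumes "x * y \<simeq> y * x" "x * x' \<simeq> 1" "x' * x \<simeq> 1"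
  shows "x' * y \<simeq> y * x'"
proof -
  have "x' * y \<simeq> x' * y * (x * x')" using rcong_left[OF rcong_sym[OF assms(2)], of "x' * y"] by simp
  also have "x' * y * (x * x') = x' * (y * x) * x'" by (simp only: mult.assoc)
  also have "x' * (y * x) * x' \<simeq> x' * (x * y) * x'" by (intro rcong_left rcong_right rcong_sym[OF assms(1)])
  also have "x' * (x * y) * x' = x' * x * (y * x')" by (simp only: mult.assoc)
  also have "x' * x * (y * x') \<simeq> y * x'" using rcong_right[OF assms(3), of "y * x'"] by simp
  finally show ?thesis .
qed

lemma Xinv_X_comm: "gen (Xinv p) * gen (X q) \<simeq> gen (X q) * gen (Xinv p)"
  by (rule rcong_commute_inv[OF X_comm X_Xinv Xinv_X])

lemma Xinv_comm: "gen (Xinv p) * gen (Xinv q) \<simeq> gen (Xinv q) * gen (Xinv p)"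
  by (rule rcong_commute_inv[OF rcong_sym[OF Xinv_X_comm] X_Xinv Xinv_X])

lemma rcong_commute_power: "a * b \<simeq> b * a \<Longrightarrow> a * b ^ n \<simeq> b ^ n * a"
proof (induction n)
  case (Suc n)
  have "a * b ^ Suc n = a * b * b ^ n" by (simp add: mult.assoc)
  also have "\<dots> \<simeq> b * a * b ^ n" by (rule rcong_right[OF Suc.prems])
  also have "b * a * b ^ n = b * (a * b ^ n)" by (simp only: mult.assoc)
  also have "\<dots> \<simeq> b * (b ^ n * a)" by (rule rcong_left[OF Suc.IH[OF Suc.prems]])
  finally show ?case by (simp add: mult.assoc)
qed simp

section \<open>Ordered Laurent monomials in the free algebra\<close>

definition x_power :: "'n \<Rightarrow> int \<Rightarrow> 'n cher_gen free_alg"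
  where "x_power p k = (if k \<ge> 0 then gen (X p) ^ nat k else gen (Xinv p) ^ nat (- k))"

lemma X_x_power: "gen (X p) * x_power p k \<simeq> x_power p (k + 1)"
proof (cases "k \<ge> 0")
  case True
  then show ?thesis by (simp add: x_power_def nat_add_distrib)
next
  case False
  define n where "n = nat (- k - 1)"
  have k: "k = - int (Suc n)" using False by (simp add: n_def)
  have "gen (X p) * x_power p k = gen (X p) * gen (Xinv p) * gen (Xinv p) ^ n"
    by (simp add: x_power_def k nat_add_distrib mult.assoc)
  also have "\<dots> \<simeq> 1 * gen (Xinv p) ^ n" by (rule rcong_right[OF X_Xinv])
  also have "1 * gen (Xinv p) ^ n = x_power p (k + 1)" by (simp add: x_power_def k)
  finally show ?thesis .
qed

lemma Xinv_x_power: "gen (Xinv p) * x_power p k \<simeq> x_power p (k - 1)"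
proof (cases "k \<le> 0")
  case True
  define n where "n = nat (- k)"
  have k: "k = - int n" using True by (simp add: n_def)
  show ?thesis by (simp add: x_power_def k nat_add_distrib)
next
  case False
  define n where "n = nat (k - 1)"
  have k: "k = int (Suc n)" using False by (simp add: n_def)
  have "gen (Xinv p) * x_power p k = gen (Xinv p) * gen (X p) * gen (X p) ^ n"
    by (simp add: x_power_def k nat_add_distrib mult.assoc)
  also have "\<dots> \<simeq> 1 * gen (X p) ^ n" by (rule rcong_right[OF Xinv_X])
  also have "1 * gen (X p) ^ n = x_power p (k - 1)" by (simp add: x_power_def k)
  finally show ?thesis .
qed

lemma x_power_comm: "gen (X p) * x_power q k \<simeq> x_power q k * gen (X p)" "gen (Xinv p) * x_power q k \<simeq> x_power q k * gen (Xinv p)"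
  by (auto simp: x_power_def intro: rcong_commute_power X_comm Xinv_comm Xinv_X_comm rcong_sym[OF Xinv_X_comm])

definition x_word_on :: "'n list \<Rightarrow> int^'n \<Rightarrow> 'n cher_gen free_alg"
  where "x_word_on L \<alpha> = prod_list (map (\<lambda>p. x_power p (\<alpha> $ p)) L)"

text \<open>A fixed order of the variables is needed to write a monomial as an element of the free
  algebra, where they do not commute.\<close>

definition sites :: "'n list" where "sites = (SOME L. set L = UNIV \<and> distinct L)"

lemma sites: "set sites = UNIV" "distinct sites"
proof -
  have "\<exists>L :: 'n list. set L = UNIV \<and> distinct L" by (rule finite_distinct_list) simp
  from someI_ex[OF this] show "set sites = UNIV" "distinct sites" by (auto simp: sites_def)
qed

abbreviation x_word :: "int^'n \<Rightarrow> 'n cher_gen free_alg" where "x_word \<equiv> x_word_on sites"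

text \<open>Used with \<open>g\<close> the letter \<open>X p\<close> and \<open>d = 1\<close>, and
  with \<open>Xinv p\<close> and \<open>d = - 1\<close>. The letter passes the other powers until it
  is absorbed by the power of \<open>p\<close>, which occurs once because \<open>L\<close> is
  distinct.\<close>

lemma x_word_on_step:
  assumes "\<And>k. g * x_power p k \<simeq> x_power p (k + d)" "\<And>q k. g * x_power q k \<simeq> x_power q k * g"
  shows "distinct L \<Longrightarrow> p \<in> set L \<Longrightarrow> g * x_word_on L \<alpha> \<simeq> x_word_on L (\<alpha> + axis p d)"
proof (induction L)
  case (Cons q L)
  have out: "x_word_on L' (\<alpha> + axis p d) = x_word_on L' \<alpha>" if "p \<notin> set L'" for L'
    unfolding x_word_on_def using that by (intro arg_cong[where f = prod_list] map_cong) (auto simp: axis_def)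
  show ?case
  proof (cases "q = p")
    case True
    have "g * x_word_on (q # L) \<alpha> = g * x_power p (\<alpha> $ p) * x_word_on L \<alpha>" by (simp add: x_word_on_def True mult.assoc)
    also have "\<dots> \<simeq> x_power p (\<alpha> $ p + d) * x_word_on L \<alpha>" by (rule rcong_right[OF assms(1)])
    also have "\<dots> = x_word_on (q # L) (\<alpha> + axis p d)"
      using Cons.prems True out[of L] by (simp add: x_word_on_def axis_def)
    finally show ?thesis .
  next
    case False
    have "g * x_word_on (q # L) \<alpha> = g * x_power q (\<alpha> $ q) * x_word_on L \<alpha>" by (simp add: x_word_on_def mult.assoc)
    also have "\<dots> \<simeq> x_power q (\<alpha> $ q) * g * x_word_on L \<alpha>" by (rule rcong_right[OF assms(2)])
    also have "\<dots> = x_power q (\<alpha> $ q) * (g * x_word_on L \<alpha>)" by (simp only: mult.assoc)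
    also have "\<dots> \<simeq> x_power q (\<alpha> $ q) * x_word_on L (\<alpha> + axis p d)"
      using Cons False by (intro rcong_left) auto
    also have "\<dots> = x_word_on (q # L) (\<alpha> + axis p d)"
      using False by (simp add: x_word_on_def axis_def)
    finally show ?thesis .
  qed
qed simp

lemma X_x_word: "gen (X p) * x_word \<alpha> \<simeq> x_word (\<alpha> + axis p 1)"
  by (rule x_word_on_step) (simp_all add: X_x_power x_power_comm sites)

lemma Xinv_x_word: "gen (Xinv p) * x_word \<alpha> \<simeq> x_word (\<alpha> + axis p (- 1))"
proof (rule x_word_on_step)
  show "gen (Xinv p) * x_power p k \<simeq> x_power p (k + - 1)" for k using Xinv_x_power[of p k] by simp
qed (simp_all add: x_power_comm sites)

lemma rel_add: "x \<in> rel \<Longrightarrow> y \<in> rel \<Longrightarrow> x + y \<in> rel" and rel_zero: "0 \<in> rel"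
  and rel_minus: "x \<in> rel \<Longrightarrow> - x \<in> rel" and rel_diff: "x \<in> rel \<Longrightarrow> y \<in> rel \<Longrightarrow> x - y \<in> rel"
  by (simp_all add: add_subgroupD[OF induced_rels_subgroup])

lemma left_rel:
  assumes "y \<in> rel" shows "induced_left a y \<in> rel"
  using linear_induced_left[of a] _ induced_rels_subgroup induced_rels_scale assms[unfolded induced_rels_def]
proof (rule linear_on_span)
  note lin = linear_diff'[OF linear_induced_left] linear_scale'[OF linear_induced_left]
  have 1: "basis_vec (a * b, u) - basis_vec (a * b', u) \<in> rel" if "b - b' \<in> I" for b b' u
    using two_sided_ideal_left[OF that, of a] by (intro induced_rels_cong) (simp add: right_diff_distrib)
  have 4: "a * pscale c b = pscale c (a * b)" for c b
    by (rule linear_scale'[OF linear_mult_left])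
  have 6: "basis_vec (a * (b * c), u) - basis_vec (a * b, free_alg_act s hact c u) \<in> rel"
    if "\<forall>w\<in>Poly_Mapping.keys c. set (letters w) \<subseteq> hecke_gens" for b c u
    using induced_rels_act[OF that, of "a * b"] by (simp only: mult.assoc)
  fix b
  assume "b \<in> {basis_vec (a, u) - basis_vec (a', u) |a a' u. a - a' \<in> I} \<union>
     {basis_vec (a + a', u) - basis_vec (a, u) - basis_vec (a', u) |a a' u. True} \<union>
     {basis_vec (a, u + u') - basis_vec (a, u) - basis_vec (a, u') |a u u'. True} \<union>
     {basis_vec (pscale c a, u) - pscale c (basis_vec (a, u)) |c a u. True} \<union>
     {basis_vec (a, s c u) - pscale c (basis_vec (a, u)) |c a u. True} \<union>
     {basis_vec (a * b, u) - basis_vec (a, free_alg_act s hact b u) |a b u.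
        \<forall>w\<in>Poly_Mapping.keys b. set (letters w) \<subseteq> hecke_gens}"
  then show "induced_left a b \<in> rel"
    by (elim UnE CollectE exE conjE)
      (simp_all only: lin induced_left_basis 4 distrib_left 1 6 induced_rels_add_left induced_rels_add_right
        induced_rels_scale_left induced_rels_scale_right)
qed

lemma left_single: "induced_left a (Poly_Mapping.single (b, u) k) = pscale k (basis_vec (a * b, u))"
proof -
  have "Poly_Mapping.single (b, u) k = pscale k (basis_vec (b, u))" by simp
  then show ?thesis by (simp only: linear_scale'[OF linear_induced_left] induced_left_basis)
qed

lemma pscale_minus: "pscale k (x - y) = pscale k x - pscale k y"
  by (rule additive.diff[OF additive_scale]) simp

lemma pscale_plus: "pscale k (x + y) = pscale k x + pscale k y"
  by (rule additive.add[OF additive_scale]) simp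

lemma left_cong: "a \<simeq> b \<Longrightarrow> induced_left a y - induced_left b y \<in> rel"
proof (induction y rule: pm_induct)
  case (single cu k)
  obtain c u where cu: "cu = (c, u)" by (cases cu)
  have "a * c - b * c \<in> I" using rcong_right[OF single, of c] by (simp add: rcong_def)
  then have "pscale k (basis_vec (a * c, u) - basis_vec (b * c, u)) \<in> rel"
    by (intro induced_rels_scale induced_rels_cong)
  then show ?case by (simp only: cu left_single pscale_minus)
next
  case (add f g)
  have "induced_left a (f + g) - induced_left b (f + g)
      = (induced_left a f - induced_left b f) + (induced_left a g - induced_left b g)"
    by (simp add: linear_add'[OF linear_induced_left])
  then show ?case using add rel_add by metis
qed

lemma left_mult: "induced_left (a * b) y = induced_left a (induced_left b y)"
proof (rule linear_eq_on_basis[OF linear_induced_left linear_comp'[OF linear_induced_left linear_induced_left]])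
  show "induced_left (a * b) (basis_vec x) = induced_left a (induced_left b (basis_vec x))" for x
    by (cases x) (simp add: mult.assoc)
qed

lemma left_one: "induced_left 1 y = y"
proof (rule linear_eq_on_basis[OF linear_induced_left linear_ident[OF vs_pscale]])
  show "induced_left 1 (basis_vec x) = basis_vec x" for x
    by (cases x) simp
qed

lemma left_add: "induced_left (a + b) y - (induced_left a y + induced_left b y) \<in> rel"
proof (induction y rule: pm_induct)
  case (single cu k)
  obtain c u where cu: "cu = (c, u)" by (cases cu)
  have "pscale k (basis_vec (a * c + b * c, u) - basis_vec (a * c, u) - basis_vec (b * c, u)) \<in> rel"
    by (intro induced_rels_scale induced_rels_add_left)
  then show ?case by (simp only: cu left_single pscale_minus pscale_plus distrib_right diff_diff_eq)
next
  case (add f g)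
  have "induced_left (a + b) (f + g) - (induced_left a (f + g) + induced_left b (f + g))
      = (induced_left (a + b) f - (induced_left a f + induced_left b f)) +
        (induced_left (a + b) g - (induced_left a g + induced_left b g))"
    by (simp add: linear_add'[OF linear_induced_left])
  then show ?case using add rel_add by metis
qed

lemma left_scale: "induced_left (pscale c a) y - pscale c (induced_left a y) \<in> rel"
proof (induction y rule: pm_induct)
  case (single bu k)
  obtain b u where bu: "bu = (b, u)" by (cases bu)
  have "pscale k (basis_vec (pscale c (a * b), u) - pscale c (basis_vec (a * b, u))) \<in> rel"
    by (intro induced_rels_scale induced_rels_scale_left)
  moreover have "pscale k (pscale c x) = pscale c (pscale k x)" for x :: "'n cher_gen free_alg \<times> 'f \<Rightarrow>\<^sub>0 complex"
    using vector_space.vector_space_assms(3)[OF vs_pscale] by (metis mult.commute)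
  moreover have "pscale c a * b = pscale c (a * b)" by (rule linear_scale'[OF linear_mult_right])
  ultimately show ?case by (simp only: bu left_single pscale_minus)
next
  case (add f g)
  have "induced_left (pscale c a) (f + g) - pscale c (induced_left a (f + g))
      = (induced_left (pscale c a) f - pscale c (induced_left a f)) +
        (induced_left (pscale c a) g - pscale c (induced_left a g))"
    by (simp add: linear_add'[OF linear_induced_left] additive.add[OF additive_scale[OF vs_pscale]])
  then show ?case using add rel_add by metis
qed

text \<open>The normal form attached to a Laurent polynomial with coefficients in \<open>'f\<close>.
  Pairs are formal, so \<open>N\<close> is additive only modulo \<open>rel\<close>.\<close>

definition N :: "(int^'n \<Rightarrow>\<^sub>0 'f) \<Rightarrow> ('n cher_gen free_alg \<times> 'f \<Rightarrow>\<^sub>0 complex)"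
  where "N z = (\<Sum>\<alpha>\<in>Poly_Mapping.keys z. basis_vec (x_word \<alpha>, Poly_Mapping.lookup z \<alpha>))"

definition normal_span :: "('n cher_gen free_alg \<times> 'f \<Rightarrow>\<^sub>0 complex) set"
  where "normal_span = {y. \<exists>z. y - N z \<in> rel}"

lemma basis_zero: "basis_vec (a, 0) \<in> rel"
  using rel_minus[OF induced_rels_add_right[of a 0 0 I hecke_gens s hact]] by simp

lemma rel_sum: "(\<And>i. i \<in> K \<Longrightarrow> f i \<in> rel) \<Longrightarrow> sum f K \<in> rel"
  by (induction K rule: infinite_finite_induct) (auto simp: rel_add rel_zero)

text \<open>Exponents outside the support contribute pairs with second entry 0, which are relations.
  This allows normal forms with different supports to be compared.\<close>

lemma N_superset:
  assumes "finite K" "Poly_Mapping.keys z \<subseteq> K"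
  shows "(\<Sum>\<alpha>\<in>K. basis_vec (x_word \<alpha>, Poly_Mapping.lookup z \<alpha>)) - N z \<in> rel"
proof -
  have "(\<Sum>\<alpha>\<in>K. basis_vec (x_word \<alpha>, Poly_Mapping.lookup z \<alpha>)) - N z
      = (\<Sum>\<alpha>\<in>K - Poly_Mapping.keys z. basis_vec (x_word \<alpha>, Poly_Mapping.lookup z \<alpha>))"
    unfolding N_def using assms by (simp add: sum_diff)
  also have "\<dots> \<in> rel" by (intro rel_sum) (auto simp: in_keys_iff basis_zero)
  finally show ?thesis .
qed

lemma normal_span_cong: "y - y' \<in> rel \<Longrightarrow> y' \<in> normal_span \<Longrightarrow> y \<in> normal_span"
  unfolding normal_span_def using rel_add[of "y - y'"] by fastforce

lemma normal_span_basis: "basis_vec (x_word \<alpha>, f) \<in> normal_span"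
proof -
  have "basis_vec (x_word \<alpha>, f) - N (Poly_Mapping.single \<alpha> f) \<in> rel"
    using N_superset[of "{\<alpha>}" "Poly_Mapping.single \<alpha> f"] by simp
  then show ?thesis unfolding normal_span_def by blast
qed

lemma normal_span_add:
  assumes "y \<in> normal_span" "y' \<in> normal_span" shows "y + y' \<in> normal_span"
proof -
  obtain z z' where z: "y - N z \<in> rel" "y' - N z' \<in> rel" using assms by (auto simp: normal_span_def)
  let ?K = "Poly_Mapping.keys z \<union> Poly_Mapping.keys z'"
  let ?N = "\<lambda>z. \<Sum>\<alpha>\<in>?K. basis_vec (x_word \<alpha>, Poly_Mapping.lookup z \<alpha>)"
  have "?N (z + z') - ?N z - ?N z' \<in> rel"
    unfolding sum_subtractf[symmetric] by (intro rel_sum) (simp only: lookup_add induced_rels_add_right)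
  note m = this
  have n: "?N w - N w \<in> rel" if "w \<in> {z, z', z + z'}" for w
    using that keys_add[of z z'] by (intro N_superset) auto
  have n1: "?N z - N z \<in> rel" and n2: "?N z' - N z' \<in> rel" and n3: "?N (z + z') - N (z + z') \<in> rel"
    by (intro n, simp)+
  have "(y - N z) + (y' - N z') + (?N (z + z') - N (z + z'))
       - (?N (z + z') - ?N z - ?N z') - (?N z - N z) - (?N z' - N z') \<in> rel"
    by (rule rel_diff[OF rel_diff[OF rel_diff[OF rel_add[OF rel_add[OF z] n3] m] n1] n2])
  moreover have "(y - N z) + (y' - N z') + (?N (z + z') - N (z + z'))
       - (?N (z + z') - ?N z - ?N z') - (?N z - N z) - (?N z' - N z') = y + y' - N (z + z')"
    by (simp add: algebra_simps)
  ultimately have "y + y' - N (z + z') \<in> rel" by (simp only:)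
  then show ?thesis unfolding normal_span_def by (intro CollectI exI)
qed

lemma normal_span_scale:
  assumes "y \<in> normal_span" shows "pscale c y \<in> normal_span"
proof -
  obtain z where z: "y - N z \<in> rel" using assms by (auto simp: normal_span_def)
  let ?K = "Poly_Mapping.keys z"
  let ?N = "\<lambda>z. \<Sum>\<alpha>\<in>?K. basis_vec (x_word \<alpha>, Poly_Mapping.lookup z \<alpha>)"
  have "?N (fscale s c z) - pscale c (N z) = (\<Sum>\<alpha>\<in>?K. basis_vec (x_word \<alpha>, s c (Poly_Mapping.lookup z \<alpha>))
      - pscale c (basis_vec (x_word \<alpha>, Poly_Mapping.lookup z \<alpha>)))"
    by (simp only: N_def additive.sum[OF additive_scale[OF vs_pscale]] sum_subtractf lookup_fscale[OF vs])
  also have "\<dots> \<in> rel" by (intro rel_sum induced_rels_scale_right)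
  finally have 1: "?N (fscale s c z) - pscale c (N z) \<in> rel" .
  have 2: "?N (fscale s c z) - N (fscale s c z) \<in> rel"
    by (rule N_superset) (auto simp: in_keys_iff lookup_fscale vs additive.zero[OF additive_scale])
  have 3: "pscale c y - pscale c (N z) \<in> rel"
    using induced_rels_scale[OF z, of c] by (simp only: pscale_minus)
  have "pscale c y - N (fscale s c z) \<in> rel"
    using rel_add[OF rel_diff[OF 3 1] 2] by (simp add: algebra_simps)
  then show ?thesis unfolding normal_span_def by blast
qed

lemma normal_span_zero: "0 \<in> normal_span"
  using normal_span_scale[OF normal_span_basis, of 0] unfolding additive.zero[OF additive_scale_left[OF vs_pscale]] .

lemma normal_span_sum: "(\<And>i. i \<in> K \<Longrightarrow> f i \<in> normal_span) \<Longrightarrow> sum f K \<in> normal_span"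
  by (induction K rule: infinite_finite_induct) (auto simp: normal_span_add normal_span_zero)

lemma normal_span_left:
  assumes "\<And>\<alpha> f. induced_left a (basis_vec (x_word \<alpha>, f)) \<in> normal_span" "y \<in> normal_span"
  shows "induced_left a y \<in> normal_span"
proof -
  obtain z where z: "y - N z \<in> rel" using assms(2) by (auto simp: normal_span_def)
  have "induced_left a (N z) \<in> normal_span"
    unfolding N_def additive.sum[OF additive_linear[OF linear_induced_left]] by (intro normal_span_sum assms(1))
  moreover have "induced_left a y - induced_left a (N z) \<in> rel"
    using left_rel[OF z, of a] by (simp only: linear_diff'[OF linear_induced_left])
  ultimately show ?thesis by (rule normal_span_cong[rotated])
qed

lemma normal_span_X: "y \<in> normal_span \<Longrightarrow> induced_left (gen (X p)) y \<in> normal_span"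
  and normal_span_Xinv: "y \<in> normal_span \<Longrightarrow> induced_left (gen (Xinv p)) y \<in> normal_span"
proof -
  have *: "induced_left a (basis_vec (x_word \<alpha>, f)) \<in> normal_span" if "a * x_word \<alpha> \<simeq> x_word \<beta>" for a \<alpha> \<beta> f
    using normal_span_cong[OF induced_rels_cong normal_span_basis, OF that[unfolded rcong_def]] by (simp only: induced_left_basis)
  show "y \<in> normal_span \<Longrightarrow> induced_left (gen (X p)) y \<in> normal_span" by (rule normal_span_left) (rule *[OF X_x_word])
  show "y \<in> normal_span \<Longrightarrow> induced_left (gen (Xinv p)) y \<in> normal_span" by (rule normal_span_left) (rule *[OF Xinv_x_word])
qed

section \<open>Moving Hecke letters past Laurent monomials\<close>

definition into_span :: "('n cher_gen free_alg \<times> 'f \<Rightarrow>\<^sub>0 complex) \<Rightarrow> 'n cher_gen free_alg set"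
  where "into_span y = {a. induced_left a y \<in> normal_span}"

lemma into_span_cong: "a \<simeq> b \<Longrightarrow> b \<in> into_span y \<Longrightarrow> a \<in> into_span y"
  by (simp add: into_span_def normal_span_cong[OF left_cong])

lemma into_span_add: "a \<in> into_span y \<Longrightarrow> b \<in> into_span y \<Longrightarrow> a + b \<in> into_span y"
  by (simp add: into_span_def normal_span_cong[OF left_add] normal_span_add)

lemma into_span_scale: "a \<in> into_span y \<Longrightarrow> pscale c a \<in> into_span y"
  by (simp add: into_span_def normal_span_cong[OF left_scale] normal_span_scale)

lemma into_span_zero: "0 \<in> into_span y"
proof -
  have "pscale 0 0 = (0 :: 'n cher_gen free_alg)" by (rule additive.zero[OF additive_scale[OF vs_pscale]])
  moreover have "induced_left (pscale 0 0) y - pscale 0 (induced_left 0 y) \<in> rel" by (rule left_scale)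
  moreover have "pscale 0 (induced_left 0 y) = 0" by (rule additive.zero[OF additive_scale_left[OF vs_pscale]])
  ultimately show ?thesis using normal_span_cong[of _ 0] normal_span_zero by (simp add: into_span_def)
qed

lemma into_span_diff: "a \<in> into_span y \<Longrightarrow> b \<in> into_span y \<Longrightarrow> a - b \<in> into_span y"
  using into_span_add[of a y "pscale (- 1) b"] into_span_scale[of b y "- 1"]
  by (simp add: module.scale_minus_left[OF vector_space_module[OF vs_pscale]]
    vector_space.vector_space_assms(4)[OF vs_pscale])

lemma into_span_sum: "(\<And>i. i \<in> K \<Longrightarrow> f i \<in> into_span y) \<Longrightarrow> sum f K \<in> into_span y"
  by (induction K rule: infinite_finite_induct) (auto simp: into_span_add into_span_zero)

lemma into_span_X: "a \<in> into_span y \<Longrightarrow> gen (X p) * a \<in> into_span y" and into_span_Xinv: "a \<in> into_span y \<Longrightarrow> gen (Xinv p) * a \<in> into_span y"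
  by (simp_all add: into_span_def left_mult normal_span_X normal_span_Xinv)

lemma into_span_X_cancel: "gen (X p) * a \<in> into_span y \<Longrightarrow> a \<in> into_span y"
proof -
  assume "gen (X p) * a \<in> into_span y"
  then have "gen (Xinv p) * (gen (X p) * a) \<in> into_span y" by (rule into_span_Xinv)
  moreover have "a \<simeq> gen (Xinv p) * (gen (X p) * a)"
    using rcong_sym[OF rcong_right[OF Xinv_X, of p a]] by (simp add: mult.assoc)
  ultimately show ?thesis by (rule into_span_cong[rotated])
qed

lemma Sym_Xp: "gen (Sym \<sigma>) * gen (X p) \<simeq> gen (X (\<sigma> \<langle>$\<rangle> p)) * gen (Sym \<sigma>)"
proof -
  let ?s = "gen (Sym \<sigma>)" and ?i = "gen (Sym (inverse \<sigma>))"
  have one: "gen (Sym 1) \<simeq> 1"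
    by (rule cgI, simp only: cherednik_rels_def hecke_rels_def Un_iff insert_iff, blast)
  have "gen (Sym (inverse \<sigma> * \<sigma>)) \<simeq> ?i * ?s"
    by (rule cgI, simp only: cherednik_rels_def hecke_rels_def Un_iff mem_Collect_eq, blast)
  moreover have "inverse \<sigma> * \<sigma> = 1" by (rule perm_eqI) (simp add: apply_mult)
  ultimately have inv: "?i * ?s \<simeq> 1" using one rcong_sym rcong_trans by metis
  have rel: "?s * gen (X p) * ?i \<simeq> gen (X (\<sigma> \<langle>$\<rangle> p))"
    by (rule cgI, simp only: cherednik_rels_def Un_iff mem_Collect_eq, blast)
  have "?s * gen (X p) \<simeq> ?s * gen (X p) * (?i * ?s)"
    using rcong_left[OF rcong_sym[OF inv], of "?s * gen (X p)"] by simp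
  also have "\<dots> = ?s * gen (X p) * ?i * ?s" by (simp only: mult.assoc)
  also have "\<dots> \<simeq> gen (X (\<sigma> \<langle>$\<rangle> p)) * ?s" by (rule rcong_right[OF rel])
  finally show ?thesis .
qed

lemma Z_X_other:
  "q \<noteq> p \<Longrightarrow> gen (Z p) * gen (X q) \<simeq> gen (X q) * gen (Z p) - gen (X p) * gen (Sym \<langle>p \<leftrightarrow> q\<rangle>)"
proof (rule cgI)
  assume "q \<noteq> p"
  moreover have "gen (Z p) * gen (X q) - (gen (X q) * gen (Z p) - gen (X p) * gen (Sym \<langle>p \<leftrightarrow> q\<rangle>)) =
     gen (Z p) * gen (X q) - gen (X q) * gen (Z p) + gen (X p) * gen (Sym \<langle>p \<leftrightarrow> q\<rangle>)" by simp
  ultimately show "gen (Z p) * gen (X q) - (gen (X q) * gen (Z p) - gen (X p) * gen (Sym \<langle>p \<leftrightarrow> q\<rangle>)) \<in> cherednik_rels \<kappa>"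
    by (simp only: cherednik_rels_def Un_iff mem_Collect_eq) blast
qed

lemma Z_X_same:
  "gen (Z p) * gen (X p) \<simeq> gen (X p) * gen (Z p) + pscale \<kappa> (gen (X p))
     + (\<Sum>r\<in>UNIV - {p}. gen (X p) * gen (Sym \<langle>p \<leftrightarrow> r\<rangle>))"
proof (rule cgI)
  have "gen (Z p) * gen (X p) - (gen (X p) * gen (Z p) + pscale \<kappa> (gen (X p))
     + (\<Sum>r\<in>UNIV - {p}. gen (X p) * gen (Sym \<langle>p \<leftrightarrow> r\<rangle>))) =
     gen (Z p) * gen (X p) - gen (X p) * gen (Z p) - pscale \<kappa> (gen (X p))
     - (\<Sum>r\<in>UNIV - {p}. gen (X p) * gen (Sym \<langle>p \<leftrightarrow> r\<rangle>))" by (simp only: diff_diff_eq)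
  then show "gen (Z p) * gen (X p) - (gen (X p) * gen (Z p) + pscale \<kappa> (gen (X p))
     + (\<Sum>r\<in>UNIV - {p}. gen (X p) * gen (Sym \<langle>p \<leftrightarrow> r\<rangle>))) \<in> cherednik_rels \<kappa>"
    unfolding cherednik_rels_def by (simp only:) (rule UnI2, rule CollectI, rule exI[of _ p], intro conjI refl TrueI)
qed

text \<open>The invariant for the induction along a monomial. All Hecke letters are treated
  together, because moving \<open>Z p\<close> past a variable creates permutations.\<close>

definition S0 :: "('n cher_gen free_alg \<times> 'f \<Rightarrow>\<^sub>0 complex) set"
  where "S0 = {y. 1 \<in> into_span y \<and> (\<forall>g\<in>hecke_gens. gen g \<in> into_span y)}"

lemma into_span_left: "a \<in> into_span (induced_left b y) \<longleftrightarrow> a * b \<in> into_span y"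
  by (simp add: into_span_def left_mult)

lemma S0_gens: "y \<in> S0 \<Longrightarrow> 1 \<in> into_span y" "y \<in> S0 \<Longrightarrow> gen (Sym \<sigma>) \<in> into_span y" "y \<in> S0 \<Longrightarrow> gen (Z p) \<in> into_span y"
  by (auto simp: S0_def hecke_gens_def)

lemma S0I:
  assumes "b \<in> into_span y" "\<And>\<sigma>. gen (Sym \<sigma>) * b \<in> into_span y" "\<And>p. gen (Z p) * b \<in> into_span y"
  shows "induced_left b y \<in> S0"
  using assms by (auto simp: S0_def hecke_gens_def into_span_left)

lemma S0_X:
  assumes "y \<in> S0" shows "induced_left (gen (X q)) y \<in> S0"
proof (rule S0I)
  note g = S0_gens[OF assms]
  show "gen (X q) \<in> into_span y" using into_span_X[OF g(1), of q] by simp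
  show "gen (Sym \<sigma>) * gen (X q) \<in> into_span y" for \<sigma>
    by (rule into_span_cong[OF Sym_Xp into_span_X[OF g(2)]])
  show "gen (Z p) * gen (X q) \<in> into_span y" for p
  proof (cases "q = p")
    case True
    have "gen (X p) \<in> into_span y" using into_span_X[OF g(1), of p] by simp
    then show ?thesis unfolding True
      by (intro into_span_cong[OF Z_X_same] into_span_add into_span_sum into_span_X into_span_scale g) auto
  next
    case False
    then show ?thesis by (intro into_span_cong[OF Z_X_other] into_span_diff into_span_X g)
  qed
qed

text \<open>The relations describe Hecke letters only against \<open>X\<close>. Multiplying by the
  appropriate \<open>X\<close> from the left reduces the claim to these relations, and
  \<open>X\<close> can be cancelled since \<open>Xinv\<close> preserves the span.\<close>

lemma S0_Xinv:
  assumes "y \<in> S0" shows "induced_left (gen (Xinv q)) y \<in> S0"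
proof (rule S0I)
  note g = S0_gens[OF assms]
  have inv: "a * (gen (X q) * gen (Xinv q)) \<simeq> a" for a
    using rcong_left[OF X_Xinv, of a q] by simp
  show 1: "gen (Xinv q) \<in> into_span y" using into_span_Xinv[OF g(1), of q] by simp
  show 2: "gen (Sym \<sigma>) * gen (Xinv q) \<in> into_span y" for \<sigma>
  proof (rule into_span_X_cancel[of "\<sigma> \<langle>$\<rangle> q"])
    have "gen (X (\<sigma> \<langle>$\<rangle> q)) * (gen (Sym \<sigma>) * gen (Xinv q)) \<simeq> gen (Sym \<sigma>) * (gen (X q) * gen (Xinv q))"
      using rcong_right[OF rcong_sym[OF Sym_Xp], of \<sigma> q "gen (Xinv q)"] by (simp only: mult.assoc)
    also have "\<dots> \<simeq> gen (Sym \<sigma>)" by (rule inv)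
    finally show "gen (X (\<sigma> \<langle>$\<rangle> q)) * (gen (Sym \<sigma>) * gen (Xinv q)) \<in> into_span y" by (rule into_span_cong) (rule g(2))
  qed
  show "gen (Z p) * gen (Xinv q) \<in> into_span y" for p
  \<comment> \<open>With \<open>?E\<close> the commutator of \<open>Z p\<close> and
    \<open>X q\<close>, the product \<open>X q Z p Xinv q\<close> equals
    \<open>Z p X q Xinv q - ?E Xinv q\<close>. The first term reduces to \<open>Z p\<close>; the
    second only involves \<open>Xinv q\<close> and permutations times \<open>Xinv q\<close>, treated
    before.\<close>
  proof (rule into_span_X_cancel[of q])
    let ?E = "gen (Z p) * gen (X q) - gen (X q) * gen (Z p)"
    have "gen (Z p) * (gen (X q) * gen (Xinv q)) \<in> into_span y" by (rule into_span_cong[OF inv g(3)])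
    moreover have "?E * gen (Xinv q) \<in> into_span y"
    proof (cases "q = p")
      case True
      let ?D = "pscale \<kappa> (gen (X p)) + (\<Sum>r\<in>UNIV - {p}. gen (X p) * gen (Sym \<langle>p \<leftrightarrow> r\<rangle>))"
      have "?E \<simeq> ?D" using Z_X_same[of p] by (simp add: rcong_def True algebra_simps)
      then have c: "?E * gen (Xinv q) \<simeq> ?D * gen (Xinv q)" by (rule rcong_right)
      have "?D * gen (Xinv q) = pscale \<kappa> (gen (X p) * gen (Xinv q)) +
          (\<Sum>r\<in>UNIV - {p}. gen (X p) * (gen (Sym \<langle>p \<leftrightarrow> r\<rangle>) * gen (Xinv q)))"
        by (simp only: distrib_right sum_distrib_right linear_scale'[OF linear_mult_right] mult.assoc)
      also have "\<dots> \<in> into_span y" by (intro into_span_add into_span_scale into_span_sum into_span_X 1 2)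
      finally show ?thesis by (rule into_span_cong[OF c])
    next
      case False
      have "?E \<simeq> 0 - gen (X p) * gen (Sym \<langle>p \<leftrightarrow> q\<rangle>)" using Z_X_other[OF False] by (simp add: rcong_def algebra_simps)
      then have c: "?E * gen (Xinv q) \<simeq> (0 - gen (X p) * gen (Sym \<langle>p \<leftrightarrow> q\<rangle>)) * gen (Xinv q)" by (rule rcong_right)
      have "(0 - gen (X p) * gen (Sym \<langle>p \<leftrightarrow> q\<rangle>)) * gen (Xinv q) = 0 - gen (X p) * (gen (Sym \<langle>p \<leftrightarrow> q\<rangle>) * gen (Xinv q))"
        by (simp add: mult.assoc)
      also have "\<dots> \<in> into_span y" by (intro into_span_diff into_span_zero into_span_X 2)
      finally show ?thesis by (rule into_span_cong[OF c])
    qed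
    ultimately have "gen (Z p) * (gen (X q) * gen (Xinv q)) - ?E * gen (Xinv q) \<in> into_span y" by (rule into_span_diff)
    then show "gen (X q) * (gen (Z p) * gen (Xinv q)) \<in> into_span y" by (simp add: left_diff_distrib mult.assoc)
  qed
qed

lemma x_word_zero: "x_word 0 = 1"
proof -
  have "map (\<lambda>p. x_power p ((0 :: int^'n) $ p)) L = replicate (length L) 1" for L
    by (induction L) (simp_all add: x_power_def)
  then have "x_word_on L 0 = prod_list (replicate (length L) 1)" for L unfolding x_word_on_def by (rule arg_cong)
  moreover have "prod_list (replicate n 1) = (1 :: 'n cher_gen free_alg)" for n by (induction n) simp_all
  ultimately show ?thesis by simp
qed

lemma S0_one: "basis_vec (1, f) \<in> S0"
proof -
  have one: "basis_vec (1, f) \<in> normal_span" for f using normal_span_basis[of 0 f] by (simp only: x_word_zero)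
  have "induced_left (gen g) (basis_vec (1, f)) \<in> normal_span" if "g \<in> hecke_gens" for g
  proof -
    have "basis_vec (1 * gen g, f) - basis_vec (1, free_alg_act s hact (gen g) f) \<in> rel"
      using that by (intro induced_rels_act) simp
    then show ?thesis using normal_span_cong[OF _ one] by simp
  qed
  then show ?thesis using one by (simp add: S0_def into_span_def left_one)
qed

lemma S0_x_word: "basis_vec (x_word \<alpha>, f) \<in> S0"
proof -
  have pow: "induced_left (a ^ n) y \<in> S0" if "\<And>y. y \<in> S0 \<Longrightarrow> induced_left a y \<in> S0" "y \<in> S0" for a n y
    using that by (induction n) (simp_all add: left_one left_mult)
  have x_power: "induced_left (x_power p k) y \<in> S0" if "y \<in> S0" for p k y
    using that pow[of "gen (X p)"] pow[of "gen (Xinv p)"] by (simp add: x_power_def S0_X S0_Xinv)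
  have "induced_left (x_word_on L \<alpha>) (basis_vec (1, f)) \<in> S0" for L
    by (induction L) (simp_all add: x_word_on_def left_one S0_one left_mult x_power del: induced_left_basis)
  from this[of sites] show ?thesis by simp
qed

lemma normal_span_gen: "y \<in> normal_span \<Longrightarrow> induced_left (gen g) y \<in> normal_span"
proof (cases g)
  case (Sym \<sigma>)
  show "y \<in> normal_span \<Longrightarrow> ?thesis" unfolding Sym by (rule normal_span_left) (use S0_gens(2)[OF S0_x_word] in \<open>simp only: into_span_def mem_Collect_eq\<close>)
next
  case (Z p)
  show "y \<in> normal_span \<Longrightarrow> ?thesis" unfolding Z by (rule normal_span_left) (use S0_gens(3)[OF S0_x_word] in \<open>simp only: into_span_def mem_Collect_eq\<close>)
qed (simp_all add: normal_span_X normal_span_Xinv)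

text \<open>The span of the monomials times vectors contains every pair \<open>(1, f)\<close>, by
  the exponent 0, and is stable under all letters, so it is everything modulo the relations.\<close>

lemma spanning: "\<exists>z. y - N z \<in> rel"
proof -
  have word: "basis_vec (basis_vec (Word gs), f) \<in> normal_span" for gs f
  proof (induction gs)
    case Nil
    show ?case using normal_span_basis[of 0 f] by (simp only: x_word_zero basis_vec_one)
  next
    case (Cons g gs)
    have "basis_vec (Word (g # gs)) = gen g * (basis_vec (Word gs) :: 'n cher_gen free_alg)"
      by (simp add: mult_single word_plus)
    then show ?case using normal_span_gen[OF Cons, of g] by simp
  qed
  have basis: "basis_vec (a, f) \<in> normal_span" for a f
  proof (induction a rule: pm_induct)
    case (single w c)
    have "basis_vec (pscale c (basis_vec w), f) - pscale c (basis_vec (basis_vec w, f)) \<in> rel"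
      by (rule induced_rels_scale_left)
    then have "basis_vec (pscale c (basis_vec w), f) \<in> normal_span"
      using normal_span_cong normal_span_scale word[of "letters w"] by (metis word.collapse)
    then show ?case by simp
  next
    case (add a b)
    have "basis_vec (a + b, f) - (basis_vec (a, f) + basis_vec (b, f)) \<in> rel"
      using induced_rels_add_left[of a b f] by (simp only: diff_diff_eq)
    then show ?case using normal_span_cong normal_span_add add by metis
  qed
  have "y \<in> normal_span"
  proof (induction y rule: pm_induct)
    case (single af c)
    then show ?case using normal_span_scale[OF basis, of c "fst af" "snd af"] by simp
  qed (rule normal_span_add)
  then show ?thesis by (simp add: normal_span_def)
qed

end


section \<open>The isomorphism\<close>

context par_ind
begin

section \<open>The action of the Cherednik algebra on the coinvariants\<close>

abbreviation qW :: "('n::finite, 'm, 'v) AN set"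
  where "qW \<equiv> AN_qW sV \<rho>V"

abbreviation sW :: "complex \<Rightarrow> ('n::finite, 'm, 'v) AN \<Rightarrow> ('n, 'm, 'v) AN"
  where "sW \<equiv> fscale (fscale sV)"

definition gen_op :: "'n cher_gen \<Rightarrow> ('n::finite, 'm, 'v) AN endo"
  where "gen_op g = (case g of Sym \<sigma> \<Rightarrow> W.sym_op \<sigma> | cher_gen.Z p \<Rightarrow> z_op p | X p \<Rightarrow> shift_op (axis p 1) | Xinv p \<Rightarrow> shift_op (axis p (- 1)))"

lemma gen_op_simps [simp]: "gen_op (Sym \<sigma>) = W.sym_op \<sigma>" "gen_op (cher_gen.Z p) = z_op p" "gen_op (X p) = shift_op (axis p 1)"
  "gen_op (Xinv p) = shift_op (axis p (- 1))"
  by (simp_all add: gen_op_def)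

lemma AN_gen_op: "AN_cherednik kap sV \<rho>V g = app (gen_op g)"
proof
  show "AN_cherednik kap sV \<rho>V g w = app (gen_op g) w" for w
    by (cases g) (simp_all only: W.AN_Sym AN_Z W.AN_X W.Xop_def gen_op_simps)
qed

lemma gen_op_S: "W.S c * gen_op g = gen_op g * W.S c"
  by (cases g) (simp_all add: sym_op_S z_op_S W.S_shift_op)

lemma gen_op_sl: "gen_op g * A (loop P 0) = A (loop P 0) * gen_op g"
  by (cases g) (simp_all add: A_sym_op z_op_sl A_shift_op)

lemma gen_op_qW:
  assumes "x \<in> qW" shows "app (gen_op g) x \<in> qW"
proof (cases g)
  case (Z p)
  then show ?thesis using qW_z_op[OF assms] by simp
next
  case (Sym \<sigma>)
  have "app (W.sym_op \<sigma>) x \<in> qW" by (rule qW_commute[OF sym_op_S A_sym_op assms])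
  then show ?thesis using Sym by simp
next
  case (X p)
  have "app (shift_op (axis p 1)) x \<in> qW" by (rule qW_commute[OF W.S_shift_op A_shift_op assms])
  then show ?thesis using X by simp
next
  case (Xinv p)
  have "app (shift_op (axis p (- 1))) x \<in> qW" by (rule qW_commute[OF W.S_shift_op A_shift_op assms])
  then show ?thesis using Xinv by simp
qed

lemma AN_free: "free_action sW (AN_cherednik kap sV \<rho>V)"
  by (rule free_action.intro) (simp only: AN_gen_op, rule app_linear[OF gen_op_S])

abbreviation act :: "'n cher_gen free_alg \<Rightarrow> ('n::finite, 'm, 'v) AN \<Rightarrow> ('n, 'm, 'v) AN"
  where "act \<equiv> free_alg_act sW (AN_cherednik kap sV \<rho>V)"

lemmas act_linear_left = linear_free_alg_act_left[OF W.vsW, where act = "AN_cherednik kap sV \<rho>V"]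
lemmas act_linear = free_action.linear_free_alg_act[OF AN_free]
lemmas act_mult = free_action.free_alg_act_mult[OF AN_free]

lemma act_gen: "act (gen g) w = app (gen_op g) w"
  by (simp add: AN_gen_op vsV)

lemma act_one: "act 1 w = w"
  by (simp add: vsV)

lemmas act_diff = linear_diff'[OF act_linear_left] and act_add = linear_add'[OF act_linear_left]
  and act_scale = linear_scale'[OF act_linear_left] and act_sum = additive.sum[OF additive_linear[OF act_linear_left]]

text \<open>A monomial tensored with \<open>\<xi> v\<close>, \<open>\<xi> \<in> \<qq>\<close>, is an
  element of \<open>\<qq>W\<close> minus a combination of monomials tensored with multiples of
  \<open>v\<close>. So the letters from \<open>\<qq>\<close> can be stripped off until a vector
  \<open>j u\<close> is left.\<close>

lemma W_span:
  fixes w :: "('n::finite, 'm, 'v) AN"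
  assumes S: "add_subgroup S" "\<And>c x. x \<in> S \<Longrightarrow> sW c x \<in> S" "qW \<subseteq> S" "\<And>c f. app (shift_op c) (iota f) \<in> S"
  shows "w \<in> S"
proof -
  have sum: "sum f K \<in> S" if "\<And>i. i \<in> K \<Longrightarrow> f i \<in> S" for f :: "_ \<Rightarrow> ('n, 'm, 'v) AN" and K
    using that by (induction K rule: infinite_finite_induct) (auto simp: add_subgroupD[OF S(1)])
  have loop_act: "app (W.loop_act \<xi>) (tmono a e v) \<in> S" if "\<And>a e. tmono a e v \<in> S" for \<xi> a e v
  proof (induction \<xi> rule: aff_induct)
    case (loop P i)
    have "tmono a' e' (sV c v) \<in> S" for a' e' c using S(2)[OF that[of a' e'], of c] by (simp add: vsV)
    then show ?case by (simp add: W.loop_act_loop W.loop_sites_def app_sum_left W.app_M app_sum) (intro sum)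
  qed (simp_all add: W.loop_act_add add_subgroupD[OF S(1)])
  \<comment> \<open>Exponent and index are quantified inside the induction on \<open>v\<close>,
    because the action on variables and sites changes both.\<close>
  have mon: "\<forall>a e. tmono a e v \<in> S" for v
  proof (induction v rule: V_induct_q)
    case (j u)
    have "app (shift_op a) (iota (Poly_Mapping.single e u)) \<in> S" for a and e :: "'n \<Rightarrow> 'm" by (rule S(4))
    then show ?case by simp
  next
    case (act \<xi> v)
    have "tmono a e (\<rho>V \<xi> v) \<in> S" for a e
    proof -
      have "app (A \<xi>) (tmono a e v) \<in> S" using qW_A[OF act(1)] S(3) by blast
      from add_subgroupD(2)[OF S(1) this loop_act[of v \<xi> a e]] act(2) show ?thesis by (simp add: A_def)
    qed
    then show ?case by blast
  qed (simp add: single_add add_subgroupD[OF S(1)])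
  show ?thesis by (induction w rule: mono_induct) (simp_all add: mon add_subgroupD[OF S(1)])
qed

lemma hecke_defect_S: "W.S c * hecke_defect p q = hecke_defect p q * W.S c"
proof -
  have z: "W.S c * (z_op p * z_op q) = z_op p * z_op q * W.S c" for p q
    by (rule commute_mult) (rule z_op_S)+
  have s: "W.S c * (W.sym_op \<sigma> * (z_op p - z_op q)) = W.sym_op \<sigma> * (z_op p - z_op q) * W.S c" for \<sigma>
    by (rule commute_mult) (simp_all add: sym_op_S right_diff_distrib left_diff_distrib z_op_S)
  show ?thesis by (simp only: hecke_defect_def right_diff_distrib[of "W.S c"] left_diff_distrib[of _ _ "W.S c"] z s)
qed

text \<open>The vectors that the defect sends into \<open>\<qq>W\<close> form a subspace. It
  contains \<open>\<qq>W\<close>, which all operators preserve, and the multiples of constants by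
  monomials, since the defect commutes with monomials and kills constants.\<close>

lemma hecke_defect_qW:
  fixes w :: "('n::finite, 'm, 'v) AN"
  assumes "p \<noteq> q" shows "app (hecke_defect p q) w \<in> qW"
proof -
  note q = add_subgroupD[OF qW_subgroup]
  note lin = app_linear[OF hecke_defect_S]
  have "w \<in> {w. app (hecke_defect p q) w \<in> qW}"
  proof (rule W_span)
    show "add_subgroup {w. app (hecke_defect p q) w \<in> qW}"
      by (simp add: add_subgroup_def app_diff q)
    show "sW c x \<in> {w. app (hecke_defect p q) w \<in> qW}" if "x \<in> {w. app (hecke_defect p q) w \<in> qW}" for c and x :: "('n, 'm, 'v) AN"
      using that by (simp add: linear_scale'[OF lin] qW_scale)
    show "qW \<subseteq> {w. app (hecke_defect p q) w \<in> qW}"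
      using gen_op_qW[of _ "Sym _"] by (auto simp: hecke_defect_def app_diff intro!: q qW_z_op)
    have "app (hecke_defect p q * shift_op c) (iota f) = 0" for c and f :: "('n, 'm, 'u) FN"
      unfolding hecke_defect_shift_op[OF assms] by (simp add: hecke_defect_iota[OF assms])
    then show "app (shift_op c) (iota f) \<in> {w. app (hecke_defect p q) w \<in> qW}" for c and f :: "('n, 'm, 'u) FN"
      by (simp add: q)
  qed
  then show ?thesis by simp
qed

lemma sym_op_inverse:
  fixes w :: "('n::finite, 'm, 'v) AN"
  shows "app (W.sym_op \<sigma>) (app (W.sym_op (inverse \<sigma>)) w) = w"
proof -
  have "\<sigma> * inverse \<sigma> = 1" by (rule perm_eqI) (simp add: apply_mult)
  then have "W.sym_op \<sigma> * W.sym_op (inverse \<sigma>) = (1 :: ('n, 'm, 'v) AN endo)" by (simp add: sym_op_mult sym_op_one)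
  then have "app (W.sym_op \<sigma> * W.sym_op (inverse \<sigma>)) w = app 1 w" by (rule arg_cong)
  then show ?thesis by simp
qed

text \<open>Every relation other than the one for \<open>[z\<^sub>p, z\<^sub>q]\<close> is shown to
  act by zero on \<open>W\<close> itself; for that one the action is \<open>hecke_defect\<close>,
  which is controlled modulo \<open>\<qq>W\<close>.\<close>

lemma act_rels:
  fixes w :: "('n::finite, 'm, 'v) AN"
  assumes "r \<in> cherednik_rels kap" shows "act r w \<in> qW"
proof -
  note acts = act_diff act_add act_mult act_gen act_one act_scale act_sum gen_op_simps
  have eq: "app B w = app C w" if "B = C" for B C :: "('n, 'm, 'v) AN endo" and w using that by simp
  have conj: "app (W.sym_op \<sigma>) (app B (app (W.sym_op (inverse \<sigma>)) w)) = app C w"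
    if "W.sym_op \<sigma> * B = C * W.sym_op \<sigma>" for \<sigma> and B C :: "('n, 'm, 'v) AN endo"
    using eq[OF that, of "app (W.sym_op (inverse \<sigma>)) w"] by (simp add: sym_op_inverse)
  have inv: "shift_op (axis p 1) * shift_op (axis p (- 1)) = (1 :: ('n, 'm, 'v) AN endo)"
    "shift_op (axis p (- 1)) * shift_op (axis p 1) = (1 :: ('n, 'm, 'v) AN endo)" for p
    by (simp_all only: shift_op_mult W.axis_split[symmetric]) (simp_all add: shift_op_axis_zero)
  have zero: "r = r' \<Longrightarrow> act r' w = 0 \<Longrightarrow> act r w \<in> qW" for r'
    by (simp add: add_subgroupD[OF qW_subgroup])
  from assms show ?thesis
    unfolding cherednik_rels_def hecke_rels_def laurent_rels_def
  proof (elim UnE CollectE exE conjE)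
    assume "r \<in> {gen (Sym 1) - 1}"
    then show ?thesis by (intro zero) (auto simp: acts sym_op_one)
  next
    fix \<sigma> \<tau> assume "r = gen (Sym (\<sigma> * \<tau>)) - gen (Sym \<sigma>) * gen (Sym \<tau>)"
    then show ?thesis
      by (rule zero) (simp only: acts app_simps(6)[symmetric] sym_op_mult diff_self)
  next
    fix \<sigma> p assume "r = gen (Sym \<sigma>) * gen (cher_gen.Z p) * gen (Sym (inverse \<sigma>)) - gen (cher_gen.Z (\<sigma> \<langle>$\<rangle> p))"
    then show ?thesis by (rule zero) (simp only: acts conj[OF z_op_sym_op] diff_self)
  next
    fix p q :: 'n
    assume r: "r = gen (cher_gen.Z p) * gen (cher_gen.Z q) - gen (cher_gen.Z q) * gen (cher_gen.Z p)
       - gen (Sym \<langle>p \<leftrightarrow> q\<rangle>) * (gen (cher_gen.Z p) - gen (cher_gen.Z q))" and "p \<noteq> q"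
    have "act r w = app (hecke_defect p q) w" unfolding r by (simp only: acts hecke_defect_def app_simps)
    then show ?thesis using hecke_defect_qW[OF \<open>p \<noteq> q\<close>] by simp
  next
    fix p assume "r = gen (X p) * gen (Xinv p) - 1"
    then show ?thesis by (rule zero) (simp only: acts app_simps(6)[symmetric] inv app_simps(2) diff_self)
  next
    fix p assume "r = gen (Xinv p) * gen (X p) - 1"
    then show ?thesis by (rule zero) (simp only: acts app_simps(6)[symmetric] inv app_simps(2) diff_self)
  next
    fix p q assume "r = gen (X p) * gen (X q) - gen (X q) * gen (X p)"
    then show ?thesis
      by (rule zero) (simp only: acts right_minus_eq app_simps(6)[symmetric], rule eq[OF shift_op_comm])
  next
    fix \<sigma> p assume "r = gen (Sym \<sigma>) * gen (X p) * gen (Sym (inverse \<sigma>)) - gen (X (\<sigma> \<langle>$\<rangle> p))"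
    then show ?thesis
      by (rule zero) (simp only: acts conj[OF sym_op_shift_op] perm_vec_simps diff_self)
  next
    fix p q assume r: "r = gen (cher_gen.Z p) * gen (X q) - gen (X q) * gen (cher_gen.Z p) + gen (X p) * gen (Sym \<langle>p \<leftrightarrow> q\<rangle>)" and "q \<noteq> p"
    have "app (z_op p * shift_op (axis q 1)) w = app (shift_op (axis q 1) * z_op p - shift_op (axis p 1) * W.sym_op \<langle>p \<leftrightarrow> q\<rangle>) w"
      unfolding z_op_X using \<open>q \<noteq> p\<close> by simp
    then show ?thesis by (intro zero[OF r]) (simp add: acts)
  next
    fix p assume r: "r = gen (cher_gen.Z p) * gen (X p) - gen (X p) * gen (cher_gen.Z p) - pscale kap (gen (X p))
       - (\<Sum>r\<in>UNIV - {p}. gen (X p) * gen (Sym \<langle>p \<leftrightarrow> r\<rangle>))"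
    have "app (z_op p * shift_op (axis p 1)) w = app (shift_op (axis p 1) * z_op p + (W.S kap * shift_op (axis p 1)
       + (\<Sum>r\<in>UNIV - {p}. shift_op (axis p 1) * W.sym_op \<langle>p \<leftrightarrow> r\<rangle>))) w"
      unfolding z_op_X by simp
    moreover have "act r w = app (z_op p * shift_op (axis p 1)) w - app (shift_op (axis p 1) * z_op p) w - app (W.S kap * shift_op (axis p 1)) w
       - (\<Sum>r\<in>UNIV - {p}. app (shift_op (axis p 1) * W.sym_op \<langle>p \<leftrightarrow> r\<rangle>) w)"
      unfolding r by (simp only: acts W.S_scale app_simps(6))
    ultimately have "act r w = 0" by (simp add: app_sum_left)
    then show ?thesis by (simp add: add_subgroupD[OF qW_subgroup])
  qed
qed

lemma AN_qW:
  assumes "y \<in> qW" shows "AN_cherednik kap sV \<rho>V g y \<in> qW"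
  using gen_op_qW[OF assms] by (simp only: AN_gen_op)

lemma act_ideal:
  assumes "a \<in> two_sided_ideal (cherednik_rels kap)" shows "act a w \<in> qW"
  by (rule free_action.free_alg_act_ideal[OF AN_free qW_subgroup _ _ act_rels assms])
    (rule qW_scale, assumption, rule AN_qW, assumption)

lemma act_qW:
  assumes "x \<in> qW" shows "act a x \<in> qW"
  by (rule free_action.free_alg_act_invariant[OF AN_free qW_subgroup _ _ assms])
    (rule qW_scale, assumption, rule AN_qW, assumption)

lemma act_iota:
  assumes "\<forall>w\<in>Poly_Mapping.keys b. set (letters w) \<subseteq> hecke_gens"
  shows "act b (iota f) = iota (free_alg_act (fscale sU) (FN_hecke sU \<rho>U) b f)"
proof (rule free_action.free_alg_act_intertwine[OF AN_free vector_space_fscale[OF vsU] iota_linear _ assms])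
  fix g :: "'a cher_gen" and f :: "('a, 'm, 'u) FN" assume "g \<in> hecke_gens"
  then show "AN_cherednik kap sV \<rho>V g (iota f) = iota (FN_hecke sU \<rho>U g f)"
    unfolding hecke_gens_def AN_gen_op
    by (elim UnE rangeE) (simp_all only: gen_op_simps iota_Sym z_op_iota iota_Z)
qed

section \<open>The map from the induced module\<close>

abbreviation relC :: "('n::finite cher_gen free_alg \<times> ('n, 'm, 'u) FN \<Rightarrow>\<^sub>0 complex) set"
  where "relC \<equiv> induced_rels (two_sided_ideal (cherednik_rels kap)) hecke_gens (fscale sU) (FN_hecke sU \<rho>U)"

definition Theta :: "('n::finite cher_gen free_alg \<times> ('n, 'm, 'u) FN \<Rightarrow>\<^sub>0 complex) \<Rightarrow> ('n, 'm, 'v) AN"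
  where "Theta = lin_ext sW (\<lambda>(a, f). act a (iota f))"

lemma Theta_linear: "Vector_Spaces.linear pscale sW Theta"
  unfolding Theta_def by (rule linear_lin_ext[OF W.vsW])

lemma Theta_basis: "Theta (basis_vec (a, f)) = act a (iota f)"
  by (simp add: Theta_def vsV)

lemma Theta_left: "Theta (induced_left a y) = act a (Theta y)"
proof (rule linear_eq_on_basis[OF linear_comp'[OF linear_induced_left Theta_linear] linear_comp'[OF Theta_linear act_linear]])
  show "Theta (induced_left a (basis_vec x)) = act a (Theta (basis_vec x))" for x
    by (cases x) (simp add: Theta_basis act_mult)
qed

lemma act_sl:
  fixes w :: "('n::finite, 'm, 'v) AN"
  shows "act a (app (A (loop P 0)) w) = app (A (loop P 0)) (act a w)"
proof (rule free_action.free_alg_act_intertwine[OF AN_free W.vsW app_linear[OF A_S], where G = UNIV])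
  fix g :: "'n cher_gen" and u :: "('n, 'm, 'v) AN"
  have "app (gen_op g * A (loop P 0)) u = app (A (loop P 0) * gen_op g) u" by (simp only: gen_op_sl)
  then show "AN_cherednik kap sV \<rho>V g (app (A (loop P 0)) u) = app (A (loop P 0)) (AN_cherednik kap sV \<rho>V g u)"
    by (simp only: AN_gen_op app_simps(6))
qed simp

lemma Theta_right: "Theta (induced_right (FN_sl sU \<rho>U P) y) = app (A (loop P 0)) (Theta y)"
proof (rule linear_eq_on_basis[OF linear_comp'[OF linear_induced_right Theta_linear] linear_comp'[OF Theta_linear app_linear[OF A_S]]])
  show "Theta (induced_right (FN_sl sU \<rho>U P) (basis_vec x)) = app (A (loop P 0)) (Theta (basis_vec x))" for x
    by (cases x) (simp add: Theta_basis iota_sl[symmetric] act_sl)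
qed

lemma Theta_rels:
  fixes y :: "('n::finite cher_gen free_alg \<times> ('n, 'm, 'u) FN \<Rightarrow>\<^sub>0 complex)"
  assumes "y \<in> relC" shows "Theta y \<in> qW"
  using Theta_linear _ qW_subgroup qW_scale assms[unfolded induced_rels_def]
proof (rule linear_on_span)
  note T = linear_diff'[OF Theta_linear] linear_scale'[OF Theta_linear] Theta_basis
  have z: "x = 0 \<Longrightarrow> x \<in> qW" for x :: "('n, 'm, 'v) AN" by (simp add: add_subgroupD[OF qW_subgroup])
  fix b :: "('n cher_gen free_alg \<times> ('n, 'm, 'u) FN \<Rightarrow>\<^sub>0 complex)"
  assume "b \<in> {basis_vec (a, u) - basis_vec (a', u) |a a' u. a - a' \<in> two_sided_ideal (cherednik_rels kap)} \<union>
     {basis_vec (a + a', u) - basis_vec (a, u) - basis_vec (a', u) |a a' u. True} \<union>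
     {basis_vec (a, u + u') - basis_vec (a, u) - basis_vec (a, u') |a u u'. True} \<union>
     {basis_vec (pscale c a, u) - pscale c (basis_vec (a, u)) |c a u. True} \<union>
     {basis_vec (a, fscale sU c u) - pscale c (basis_vec (a, u)) |c a u. True} \<union>
     {basis_vec (a * b, u) - basis_vec (a, free_alg_act (fscale sU) (FN_hecke sU \<rho>U) b u) |a b u.
        \<forall>w\<in>Poly_Mapping.keys b. set (letters w) \<subseteq> hecke_gens}"
  then show "Theta b \<in> qW"
  proof (elim UnE CollectE exE conjE)
    fix a a' u assume b: "b = basis_vec (a, u) - basis_vec (a', u)" and a: "a - a' \<in> two_sided_ideal (cherednik_rels kap)"
    show ?thesis using act_ideal[OF a, of "iota u"] by (simp only: b T act_diff)
  next
    fix a a' u assume b: "b = basis_vec (a + a', u) - basis_vec (a, u) - basis_vec (a', u)"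
    show ?thesis by (rule z) (simp only: b T act_add, simp)
  next
    fix a u u' assume b: "b = basis_vec (a, u + u') - basis_vec (a, u) - basis_vec (a, u')"
    show ?thesis by (rule z) (simp only: b T additive.add[OF additive_iota] linear_add'[OF act_linear], simp)
  next
    fix c a u assume b: "b = basis_vec (pscale c a, u) - pscale c (basis_vec (a, u))"
    show ?thesis by (rule z) (simp only: b T act_scale diff_self)
  next
    fix c a u assume b: "b = basis_vec (a, fscale sU c u) - pscale c (basis_vec (a, u))"
    show ?thesis by (rule z) (simp only: b T linear_scale'[OF iota_linear] linear_scale'[OF act_linear] diff_self)
  next
    fix a d u assume b: "b = basis_vec (a * d, u) - basis_vec (a, free_alg_act (fscale sU) (FN_hecke sU \<rho>U) d u)"
      and d: "\<forall>w\<in>Poly_Mapping.keys d. set (letters w) \<subseteq> hecke_gens"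
    show ?thesis by (rule z) (simp only: b T act_mult act_iota[OF d] diff_self)
  qed
qed

section \<open>Injectivity and surjectivity\<close>

lemma linear_tmono: "Vector_Spaces.linear sU (fscale (fscale sU)) (tmono a e)"
  using vsU by (intro linearI' additive_mono) simp_all

text \<open>\<open>\<qq>W\<close> is killed because of a cancellation: the part of
  \<open>A \<xi>\<close> on variables and sites becomes \<open>loop_act \<xi>\<close> on the target,
  and by \<open>functional\<close> the part on \<open>V\<close> becomes its negative.\<close>

lemma projection:
  obtains proj :: "('n::finite, 'm, 'v) AN \<Rightarrow> ('n, 'm, 'u) AN" where "additive proj"
    "\<And>w. w \<in> qW \<Longrightarrow> proj w = 0" "\<And>\<alpha> f. proj (app (shift_op \<alpha>) (iota f)) = Poly_Mapping.single \<alpha> f"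
proof -
  let ?sZ = "fscale (fscale sU) :: complex \<Rightarrow> ('n, 'm, 'u) AN \<Rightarrow> ('n, 'm, 'u) AN"
  show ?thesis
  proof (rule functional[OF Z.lie_module_loop_act])
    fix \<Psi> :: "('u \<Rightarrow> ('n, 'm, 'u) AN) \<Rightarrow> 'v \<Rightarrow> ('n, 'm, 'u) AN"
    assume lin: "\<And>h. Vector_Spaces.linear sU ?sZ h \<Longrightarrow> Vector_Spaces.linear sV ?sZ (\<Psi> h)" and
      \<Psi>_j: "\<And>h u. Vector_Spaces.linear sU ?sZ h \<Longrightarrow> \<Psi> h (j u) = h u" and
      \<Psi>_q: "\<And>h \<xi> v. Vector_Spaces.linear sU ?sZ h \<Longrightarrow> \<xi> \<in> aff_q \<Longrightarrow>
          \<Psi> h (\<rho>V \<xi> v) = \<Psi> (\<lambda>u. - app (Z.loop_act \<xi>) (h u)) v" and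
      \<Psi>_add: "\<And>h h' v. \<Psi> (\<lambda>u. h u + h' u) v = \<Psi> h v + \<Psi> h' v" and
      \<Psi>_scale: "\<And>h c v. \<Psi> (\<lambda>u. ?sZ c (h u)) v = ?sZ c (\<Psi> h v)"
    have \<Psi>_zero: "\<Psi> (\<lambda>u. 0) v = 0" for v
      using \<Psi>_add[of "\<lambda>u. 0" "\<lambda>u. 0" v] by simp
    have \<Psi>_sum: "\<Psi> (\<lambda>u. \<Sum>i\<in>K. h i u) v = (\<Sum>i\<in>K. \<Psi> (h i) v)" if "finite K"
      for K :: "'c set" and h :: "'c \<Rightarrow> 'u \<Rightarrow> ('n, 'm, 'u) AN" and v
      using that by (induction K) (simp_all add: \<Psi>_zero \<Psi>_add)
    \<comment> \<open>For fixed \<open>a\<close> and \<open>e\<close>, \<open>tmono a e\<close>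
      embeds \<open>U\<close> into the target, and \<open>\<Psi>\<close> extends this embedding to
      \<open>V\<close>.\<close>
    define proj where "proj = pm_ext (\<lambda>a. pm_ext (\<lambda>e. \<Psi> (tmono a e)))"
    have addt: "additive (\<Psi> (tmono a e))" for a e by (rule additive_linear[OF lin[OF linear_tmono]])
    have add: "additive proj" unfolding proj_def by (rule additive_pm_ext) (rule additive_pm_ext, rule addt)
    have proj_tmono [simp]: "proj (tmono a e v) = \<Psi> (tmono a e) v" for a e v
      unfolding proj_def
      by (subst pm_ext_single, rule additive_pm_ext, rule addt) (rule pm_ext_single, rule addt)
    have proj_scale: "proj (sW c w) = ?sZ c (proj w)" for c w
      by (rule additive_mono_eqI[where w = w, OF additive_comp[OF add additive_scale[OF W.vsW]]
          additive_comp[OF additive_scale[OF Z.vsW] add]])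
        (simp add: vsV linear_scale'[OF lin[OF linear_tmono]])
    have proj_linear: "Vector_Spaces.linear sW ?sZ proj"
      by (rule linearI'[OF W.vsW Z.vsW add]) (rule proj_scale)
    \<comment> \<open>The coefficients of the loop action do not depend on the vector in
      \<open>V\<close>. Hence the action can be applied to the embedding of \<open>U\<close> first,
      and linearity of \<open>\<Psi>\<close> in its first argument carries the finite sums
      through.\<close>
    have proj_loop_act: "proj (app (W.loop_act \<xi>) (tmono a e v)) = \<Psi> (\<lambda>u. app (Z.loop_act \<xi>) (tmono a e u)) v" for \<xi> a e v
    proof (induction \<xi> rule: aff_induct)
      case (loop P i)
      let ?t = "\<lambda>q x. tmono (a + axis q i) (e(q := x))" and ?c = "\<lambda>q x. mat_of_sl P $ x $ e q"
      have "proj (app (W.loop_act (loop P i)) (tmono a e v)) = (\<Sum>q\<in>UNIV. \<Sum>x\<in>UNIV. ?sZ (?c q x) (\<Psi> (?t q x) v))"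
        by (simp add: W.loop_act_loop W.loop_sites_def app_sum_left W.app_M app_sum additive.sum[OF add]
            linear_scale'[OF lin[OF linear_tmono]])
      moreover have "app (Z.loop_act (loop P i)) (tmono a e u) = (\<Sum>q\<in>UNIV. \<Sum>x\<in>UNIV. ?sZ (?c q x) (?t q x u))" for u
        by (simp add: Z.loop_act_loop Z.loop_sites_def app_sum_left Z.app_M app_sum vsU)
      ultimately show ?case by (simp only: \<Psi>_sum[OF finite] \<Psi>_scale)
    next
      case (central c)
      then show ?case by (simp add: \<Psi>_zero additive.zero[OF add])
    next
      case (add \<xi> \<eta>)
      then show ?case by (simp add: W.loop_act_add Z.loop_act_add \<Psi>_add additive.add[OF \<open>additive proj\<close>])
    qed
    have proj_A: "proj (app (A \<xi>) w) = 0" if "\<xi> \<in> aff_q" for \<xi> w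
    proof (induction w rule: mono_induct)
      case (mono a e v)
      have "proj (app (A \<xi>) (tmono a e v)) = \<Psi> (\<lambda>u. app (Z.loop_act \<xi>) (tmono a e u)) v + \<Psi> (\<lambda>u. - app (Z.loop_act \<xi>) (tmono a e u)) v"
        by (simp add: A_def additive.add[OF add] proj_loop_act \<Psi>_q[OF linear_tmono that])
      then show ?case by (simp add: \<Psi>_add[symmetric] \<Psi>_zero)
    qed (simp add: app_add additive.add[OF add])
    have proj_qW: "proj w = 0" if "w \<in> qW" for w
      by (rule linear_span_zero[OF proj_linear _ that[unfolded AN_qW_def]]) (auto simp: AN_aff_A proj_A)
    have "proj (app (shift_op \<alpha>) (iota f)) = Poly_Mapping.single \<alpha> f" for \<alpha> f
      by (rule additive_eqI[where x = f, OF additive_comp[OF add additive_comp[OF additive_app additive_iota]] additive_single])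
        (simp add: \<Psi>_j[OF linear_tmono])
    with add proj_qW show ?thesis by (rule that)
  qed
qed

text \<open>Modulo the relations \<open>y\<close> is a normal form \<open>N z\<close> by
  \<open>spanning\<close>. Since \<open>proj\<close> recovers \<open>z\<close> from
  \<open>Theta (N z)\<close>, which lies in \<open>\<qq>W\<close>, it follows that
  \<open>z = 0\<close>.\<close>

lemma Theta_kernel:
  fixes y :: "('n::finite cher_gen free_alg \<times> ('n, 'm, 'u) FN \<Rightarrow>\<^sub>0 complex)"
  assumes "Theta y \<in> qW" shows "y \<in> relC"
proof -
  interpret C: cher_ind kap "fscale sU" "FN_hecke sU \<rho>U :: 'n cher_gen \<Rightarrow> ('n, 'm, 'u) FN \<Rightarrow> ('n, 'm, 'u) FN"
    by (rule cher_ind.intro[OF vector_space_fscale[OF vsU]])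
  have pow: "act (gen g ^ n) w = ((app (gen_op g)) ^^ n) w" for g n and w :: "('n, 'm, 'v) AN"
    by (induction n arbitrary: w) (simp_all add: act_one act_mult act_gen funpow_swap1)
  have shift_op_pow: "((app (shift_op (axis p d))) ^^ n) w = app (shift_op (axis p (int n * d))) w" for p :: 'n and d n and w :: "('n, 'm, 'v) AN"
  proof (induction n)
    case (Suc n)
    have "app (shift_op (axis p (int (Suc n) * d))) w = app (shift_op (axis p d) * shift_op (axis p (int n * d))) w"
      by (simp only: shift_op_mult W.axis_split[symmetric]) (simp add: algebra_simps)
    then show ?case using Suc by simp
  qed (simp add: shift_op_axis_zero)
  have x_power: "act (C.x_power p k) w = app (shift_op (axis p k)) w" for p k and w :: "('n, 'm, 'v) AN"
    by (cases "k \<ge> 0") (simp_all add: C.x_power_def pow shift_op_pow)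
  have x_word_on: "act (C.x_word_on L \<alpha>) w = app (shift_op (\<Sum>p\<leftarrow>L. axis p (\<alpha> $ p))) w" for L \<alpha> and w :: "('n, 'm, 'v) AN"
    by (induction L) (simp_all add: C.x_word_on_def act_one shift_op_zero act_mult x_power shift_op_mult[symmetric])
  have "(\<Sum>p\<leftarrow>C.sites. axis p (\<alpha> $ p)) = \<alpha>" for \<alpha> :: "int^'n"
    by (simp add: sum_list_distinct_conv_sum_set C.sites vec_eq_iff axis_def)
  then have x_word: "act (C.x_word \<alpha>) w = app (shift_op \<alpha>) w" for \<alpha> and w :: "('n, 'm, 'v) AN"
    by (simp add: x_word_on)
  obtain z where z: "y - C.N z \<in> relC" using C.spanning by blast
  obtain proj :: "('n, 'm, 'v) AN \<Rightarrow> ('n, 'm, 'u) AN" where proj: "additive proj"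
    "\<And>w. w \<in> qW \<Longrightarrow> proj w = 0" "\<And>\<alpha> f. proj (app (shift_op \<alpha>) (iota f)) = Poly_Mapping.single \<alpha> f"
    using projection by blast
  have "Theta y - Theta (y - C.N z) \<in> qW"
    by (rule add_subgroupD(2)[OF qW_subgroup assms Theta_rels[OF z]])
  then have "proj (Theta (C.N z)) = 0" by (simp add: linear_diff'[OF Theta_linear] proj(2))
  moreover have "proj (Theta (C.N z)) = pm_ext Poly_Mapping.single z"
    by (simp add: C.N_def additive.sum[OF additive_linear[OF Theta_linear]] Theta_basis x_word additive.sum[OF proj(1)] proj(3) pm_ext_def)
  ultimately have "z = 0" by (simp add: pm_ext_single_id)
  then show ?thesis using z by (simp add: C.N_def)
qed

text \<open>The image of \<open>Theta\<close> enlarged by \<open>\<qq>W\<close> is stable under the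
  variables and their inverses and contains the constants, so \<open>W_span\<close> applies to
  it.\<close>

lemma Theta_surj:
  fixes w :: "('n::finite, 'm, 'v) AN"
  shows "\<exists>y. w - Theta y \<in> qW"
proof -
  note q = add_subgroupD[OF qW_subgroup]
  let ?S = "{w :: ('n, 'm, 'v) AN. \<exists>y. w - Theta y \<in> qW}"
  have gens: "app (gen_op g) w \<in> ?S" if w: "w \<in> ?S" for g w
  proof -
    obtain y where "w - Theta y \<in> qW" using w by blast
    then have "app (gen_op g) w - Theta (induced_left (gen g) y) \<in> qW"
      using gen_op_qW[of "w - Theta y" g] by (simp only: Theta_left act_gen app_diff)
    then show ?thesis by blast
  qed
  have "w \<in> ?S"
  proof (rule W_span)
    have "x - x' - Theta (y - y') \<in> qW" if "x - Theta y \<in> qW" "x' - Theta y' \<in> qW" for x x' :: "('n, 'm, 'v) AN" and y y'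
      using q(2)[OF that] by (simp add: linear_diff'[OF Theta_linear] algebra_simps)
    moreover have "0 - Theta 0 \<in> qW" using q(1) by (simp add: linear_zero'[OF Theta_linear])
    ultimately show "add_subgroup ?S" unfolding add_subgroup_def by blast
    show "sW c x \<in> ?S" if x: "x \<in> ?S" for c x
    proof -
      obtain y where "x - Theta y \<in> qW" using x by blast
      from qW_scale[OF this, of c] have "sW c x - Theta (pscale c y) \<in> qW"
        by (simp only: linear_scale'[OF Theta_linear] additive.diff[OF additive_scale[OF W.vsW]])
      then show ?thesis by blast
    qed
    show "qW \<subseteq> ?S"
    proof
      fix x :: "('n, 'm, 'v) AN" assume "x \<in> qW"
      then have "x - Theta 0 \<in> qW" by (simp add: linear_zero'[OF Theta_linear])
      then show "x \<in> ?S" by blast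
    qed
    fix c :: "int^'n" and f :: "('n, 'm, 'u) FN"
    have ax: "app (shift_op (axis p (int n))) w \<in> ?S \<and> app (shift_op (axis p (- int n))) w \<in> ?S" if "w \<in> ?S" for p n w
    proof (induction n)
      case 0
      then show ?case using that by (simp only: of_nat_0 minus_zero shift_op_axis_zero app_simps(2))
    next
      case (Suc n)
      have "shift_op (axis p (int (Suc n))) = gen_op (X p) * (shift_op (axis p (int n)) :: ('n, 'm, 'v) AN endo)"
        "shift_op (axis p (- int (Suc n))) = gen_op (Xinv p) * (shift_op (axis p (- int n)) :: ('n, 'm, 'v) AN endo)"
        by (simp_all only: gen_op_simps shift_op_mult W.axis_split[symmetric]) simp_all
      then show ?case using Suc gens by (simp only: app_simps(6))
    qed
    have axis: "app (shift_op (axis p k)) w \<in> ?S" if "w \<in> ?S" for p k w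
      using ax[OF that, of p "nat k"] ax[OF that, of p "nat (- k)"] by (cases "k \<ge> 0") simp_all
    have fin: "app (shift_op (\<Sum>p\<in>P. axis p (c $ p))) (iota f) \<in> ?S" if "finite P" for P
      using that
    proof (induction P)
      case empty
      have "iota f - Theta (basis_vec (1, f)) \<in> qW" by (simp add: Theta_basis act_one q)
      then have "iota f \<in> ?S" by blast
      then show ?case by (simp only: sum.empty shift_op_zero app_simps(2))
    next
      case (insert p P)
      then show ?case using axis[OF insert.IH] by (simp only: sum.insert[OF insert.hyps] shift_op_mult[symmetric] app_simps(6))
    qed
    have "(\<Sum>p\<in>UNIV. axis p (c $ p)) = c"
      by (simp add: vec_eq_iff axis_def)
    then show "app (shift_op c) (iota f) \<in> ?S" using fin[OF finite[of UNIV]] by (simp only:)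
  qed
  then show ?thesis by simp
qed

end

theorem theorem2p5:
  fixes \<kappa> :: complex
    and sU :: "complex \<Rightarrow> 'u::ab_group_add \<Rightarrow> 'u"
    and \<rho>U :: "'m::finite sl \<Rightarrow> 'u \<Rightarrow> 'u"
    and sV :: "complex \<Rightarrow> 'v::ab_group_add \<Rightarrow> 'v"
    and \<rho>V :: "'m aff \<Rightarrow> 'v \<Rightarrow> 'v"
  assumes "vector_space sU"
    and "lie_module sl_scale sl_bracket sU \<rho>U"
    and "vector_space sV"
    and "parabolically_induced sU \<rho>U (\<kappa> - of_nat CARD('m)) sV \<rho>V"
  shows "quotient_iso
    (fscale (fscale sV))
    (AN_qW sV \<rho>V :: ('n::finite, 'm, 'v) AN set)
    pscale
    (induced_rels (two_sided_ideal (cherednik_rels \<kappa>)) hecke_gens (fscale sU) (FN_hecke sU \<rho>U)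
      :: ('n cher_gen free_alg \<times> ('n, 'm, 'u) FN \<Rightarrow>\<^sub>0 complex) set)
    ({(AN_aff sV \<rho>V (loop P 0), induced_right (FN_sl sU \<rho>U P)) |P. True} \<union>
     {(free_alg_act (fscale (fscale sV)) (AN_cherednik \<kappa> sV \<rho>V) a, induced_left a) |a. True})"
proof -
  obtain \<psi> where "par_ind sU \<rho>U (\<kappa> - of_nat CARD('m)) sV \<rho>V \<psi>"
    using par_indI[OF assms] .
  then interpret par_ind sU \<rho>U "\<kappa> - of_nat CARD('m)" sV \<rho>V \<psi> .
  \<comment> \<open>At the level \<open>\<kappa> - m\<close> the parameter attached to the locale is
    the given \<open>\<kappa>\<close>.\<close>
  have kap: "kap = \<kappa>" by (simp add: kap_def)
  have AN_aff: "AN_aff sV \<rho>V (loop P 0) = app (A (loop P 0))" for P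
    by (rule ext) (rule AN_aff_A)
  have "quotient_iso sW (qW :: ('n, 'm, 'v) AN set) pscale relC
    ({(AN_aff sV \<rho>V (loop P 0), induced_right (FN_sl sU \<rho>U P)) |P. True} \<union>
     {(act a, induced_left a) |a. True})"
  proof (rule quotient_isoI[OF Theta_linear qW_subgroup qW_scale])
    show "Theta y \<in> qW \<longleftrightarrow> y \<in> relC" for y :: "('n cher_gen free_alg \<times> ('n, 'm, 'u) FN \<Rightarrow>\<^sub>0 complex)"
      using Theta_kernel Theta_rels by blast
    show "\<exists>y. x - Theta y \<in> qW" for x :: "('n, 'm, 'v) AN" by (rule Theta_surj)
    fix B :: "('n, 'm, 'v) AN \<Rightarrow> ('n, 'm, 'v) AN"
      and C :: "('n cher_gen free_alg \<times> ('n, 'm, 'u) FN \<Rightarrow>\<^sub>0 complex) \<Rightarrow> ('n cher_gen free_alg \<times> ('n, 'm, 'u) FN \<Rightarrow>\<^sub>0 complex)"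
    assume "(B, C) \<in> {(AN_aff sV \<rho>V (loop P 0), induced_right (FN_sl sU \<rho>U P)) |P. True} \<union>
      {(act a, induced_left a) |a. True}"
    then consider P where "B = app (A (loop P 0))" "C = induced_right (FN_sl sU \<rho>U P)"
      | a where "B = act a" "C = induced_left a"
      unfolding AN_aff by blast
    note cases = this
    show "additive B" using cases by cases (auto intro: additive_linear[OF act_linear])
    show "B x \<in> qW" if "x \<in> qW" for x :: "('n, 'm, 'v) AN"
      using cases by cases (use that in \<open>simp_all add: qW_sl act_qW\<close>)
    show "B (Theta y) - Theta (C y) \<in> qW" for y :: "('n cher_gen free_alg \<times> ('n, 'm, 'u) FN \<Rightarrow>\<^sub>0 complex)"
      using cases by cases (simp_all add: Theta_right Theta_left add_subgroupD[OF qW_subgroup])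
  qed
  then show ?thesis by (simp only: kap)
qed

end
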